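(* Let $L$ be a flag complex on $m$ vertices $v_1,\dots,v_m$ and suppose $\langle v_1,\dots,v_k\rangle=F_k<A_L$ is a free subgroup (freely generated by $v_1,\dots,v_k$). Let $X$ be a proper $\mathrm{CAT}(0)$ space and assume $H<\mathrm{Isom}(X)$ acts cocompactly and minimally. The following conclusions hold: (1) Let $\Gamma$ be a group acting on $\mathcal{T}_{2k}$ by label-preserving isometries. Then the action of $\Gamma$ on $\mathcal{T}_{2k}$ extends to an action of $\widetilde\Gamma$ on $\widetilde{S}_L$ by isometries. (2) If $\Gamma$ is a uniform lattice in $H\times T_{2k}$, then $\widetilde\Gamma$ is a uniform lattice in $H\times\mathrm{Aut}(\widetilde{S}_L)$. (3) If in addition $X$ is a $\mathrm{CAT}(0)$ polyhedral complex and $\Gamma$ is an $(H\times T_{2k})$-lattice, then $\widetilde\Gamma$ is an $(H\times\mathrm{Aut}(\widetilde{S}_L))$-lattice. (4) If the projection of $\Gamma$ to $H$ (resp. $T_{2k}$) is non-discrete, then so is the projection of $\widetilde\Gamma$ to $H$ (resp. $\mathrm{Aut}(\widetilde{S}_L)$). Here in (2)--(4) $\Gamma$ is assumed to act on $\mathcal{T}_{2k}$, via its projection to $T_{2k}$, by label-preserving isometries as in (1).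
   Context: Standing assumptions: all $\mathrm{CAT}(0)$ spaces have finite-dimensional Tits boundary; actions on graphs and polyhedral complexes are admissible (each element fixes pointwise every cell it stabilises). A $G$-lattice is a discrete subgroup of finite covolume in the locally compact group $G$; it is uniform if cocompact. $H$ acts minimally on $X$ if there is no non-empty $H$-invariant closed convex proper subset. $A_L$ is the right-angled Artin group generated by the vertices of $L$, two generators commuting exactly when joined by an edge. The Salvetti complex of $L$ is the cube complex with one vertex, an oriented loop for each vertex of $L$, and an $r$-torus for each set of $r\geq2$ vertices spanning a simplex of $L$, with faces the tori already attached; its fundamental group is $A_L$. $\widetilde{S}_L$ denotes its universal cover, with edges labelled by vertices of $L$ and oriented. $\mathcal{T}_{2k}$ is the $2k$-regular tree, $T_{2k}=\mathrm{Aut}(\mathcal{T}_{2k})$; $\mathcal{T}_{2k}$ is identified with the Cayley tree of $F_k=\langle v_1,\dots,v_k\rangle$, each edge labelled by the corresponding generator, and an isometry is label-preserving if it sends each edge to an edge with the same label. Definition of $\widetilde\Gamma$. Let $\phi:A_L\twoheadrightarrow F_k$ send $v_i\mapsto v_i$ for $i\le k$ and the other generators to $1$, and let $\pi:\widetilde{S}_L\to\overline{X}$ be the covering with $\overline{X}=\widetilde{S}_L/\mathrm{Ker}(\phi)$. The $1$-skeleton of $\overline{X}$ is $\mathcal{T}_{2k}$ with an oriented loop labelled $v$ attached at each vertex for each vertex $v\in\{v_{k+1},\dots,v_m\}$ of $L$. A label-preserving action of $\Gamma$ on $\mathcal{T}_{2k}$ extends, preserving labels and the orientations of these loops, to the $1$-skeleton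 and hence to $\overline{X}$. $\widetilde\Gamma$ is the group of all lifts to $\widetilde{S}_L$ of the automorphisms of $\overline{X}$ given by elements of $\Gamma$ (pairs consisting of an element of $\Gamma$ and a lift), so there is a short exact sequence $1\to\mathrm{Aut}(\pi)\to\widetilde\Gamma\to\Gamma\to1$ with $\mathrm{Aut}(\pi)$ the deck group of $\pi$. $\widetilde\Gamma$ acts on $\widetilde{S}_L$ by lifts and maps to $H$ via $\widetilde\Gamma\to\Gamma\to H$; the lattice statements are about the resulting map $\widetilde\Gamma\to H\times\mathrm{Aut}(\widetilde{S}_L)$. *)

theory Defs
  imports "HOL-Analysis.Analysis" "HOL-Algebra.Bij" "HOL-Algebra.Coset"
begin

section \<open>Metric geometry: geodesics, CAT(0) spaces, Tits boundary\<close>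

text \<open>The abstract metric type demands a total symmetric non-negative distance function, so a
  distance is cut off to 0 outside its carrier.\<close>

definition mk_metric :: "'a set \<Rightarrow> ('a \<Rightarrow> 'a \<Rightarrow> real) \<Rightarrow> 'a metric" where
  "mk_metric M d = metric (M, \<lambda>x y. if x \<in> M \<and> y \<in> M then d x y else 0)"

definition geodesic_on :: "'a metric \<Rightarrow> real set \<Rightarrow> (real \<Rightarrow> 'a) \<Rightarrow> bool" where
  "geodesic_on X I c \<longleftrightarrow>
     c ` I \<subseteq> mspace X \<and> (\<forall>s\<in>I. \<forall>t\<in>I. mdist X (c s) (c t) = \<bar>s - t\<bar>)"

definition geodesic_between :: "'a metric \<Rightarrow> (real \<Rightarrow> 'a) \<Rightarrow> 'a \<Rightarrow> 'a \<Rightarrow> bool" where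
  "geodesic_between X c x y \<longleftrightarrow>
     geodesic_on X {0..mdist X x y} c \<and> c 0 = x \<and> c (mdist X x y) = y"

text \<open>The CAT(0) inequality compares two points of a geodesic triangle with vertices
  \<open>p, q, r\<close> with their comparison points in the Euclidean plane (here \<open>complex\<close>).  Any two
  sides share a vertex, so up to renaming the vertices the two points lie on the sides
  issuing from \<open>p\<close>.\<close>

definition CAT0_space :: "'a metric \<Rightarrow> bool" where
  "CAT0_space X \<longleftrightarrow>
     mspace X \<noteq> {} \<and>
     (\<forall>x\<in>mspace X. \<forall>y\<in>mspace X. \<exists>c. geodesic_between X c x y) \<and>
     (\<forall>p\<in>mspace X. \<forall>q\<in>mspace X. \<forall>r\<in>mspace X. \<forall>c1 c2 c3.
        geodesic_between X c1 p q \<longrightarrow> geodesic_between X c2 p r \<longrightarrow> geodesic_between X c3 q r \<longrightarrow>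
        (\<forall>p' q' r' :: complex.
           dist p' q' = mdist X p q \<longrightarrow> dist p' r' = mdist X p r \<longrightarrow> dist q' r' = mdist X q r \<longrightarrow>
           (\<forall>s\<in>{0..mdist X p q}. \<forall>t\<in>{0..mdist X p r}.
              \<forall>x'\<in>closed_segment p' q'. \<forall>y'\<in>closed_segment p' r'.
                dist p' x' = s \<longrightarrow> dist p' y' = t \<longrightarrow> mdist X (c1 s) (c2 t) \<le> dist x' y')))"

definition proper_metric :: "'a metric \<Rightarrow> bool" where
  "proper_metric X \<longleftrightarrow> (\<forall>x\<in>mspace X. \<forall>r. compactin (mtopology_of X) (mcball_of X x r))"

definition geodesically_convex :: "'a metric \<Rightarrow> 'a set \<Rightarrow> bool" where
  "geodesically_convex X C \<longleftrightarrow>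
     C \<subseteq> mspace X \<and>
     (\<forall>x\<in>C. \<forall>y\<in>C. (\<exists>c. geodesic_between X c x y) \<and>
        (\<forall>c. geodesic_between X c x y \<longrightarrow> c ` {0..mdist X x y} \<subseteq> C))"

definition geodesic_rays :: "'a metric \<Rightarrow> (real \<Rightarrow> 'a) set" where
  "geodesic_rays X = {c. geodesic_on X {0..} c}"

definition asymptotic :: "'a metric \<Rightarrow> ((real \<Rightarrow> 'a) \<times> (real \<Rightarrow> 'a)) set" where
  "asymptotic X = {(c, c'). c \<in> geodesic_rays X \<and> c' \<in> geodesic_rays X \<and>
                            (\<exists>K. \<forall>t\<ge>0. mdist X (c t) (c' t) \<le> K)}"

definition boundary_at_infinity :: "'a metric \<Rightarrow> (real \<Rightarrow> 'a) set set" where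
  "boundary_at_infinity X = geodesic_rays X // asymptotic X"

text \<open>The Alexandrov angle is the limit superior, as \<open>s, t\<close> tend to 0, of the comparison angles
  of the triangles with vertices \<open>c 0 = c' 0\<close>, \<open>c s\<close>, \<open>c' t\<close>.\<close>

definition alexandrov_angle :: "'a metric \<Rightarrow> (real \<Rightarrow> 'a) \<Rightarrow> (real \<Rightarrow> 'a) \<Rightarrow> real" where
  "alexandrov_angle X c c' =
     (INF e\<in>{0<..}. SUP (s, t)\<in>{0<..<e} \<times> {0<..<e}.
        arccos ((s\<^sup>2 + t\<^sup>2 - (mdist X (c s) (c' t))\<^sup>2) / (2 * s * t)))"

definition angular_metric :: "'a metric \<Rightarrow> (real \<Rightarrow> 'a) set \<Rightarrow> (real \<Rightarrow> 'a) set \<Rightarrow> real" where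
  "angular_metric X \<xi> \<eta> = Sup {alexandrov_angle X c c' | c c'. c \<in> \<xi> \<and> c' \<in> \<eta> \<and> c 0 = c' 0}"

text \<open>The Tits metric is the length metric of the angular metric.  For a proper CAT(0) space the
  two agree wherever the angular metric is less than \<open>\<pi>\<close>, so they define the same topology.
  The dimension of the Tits boundary is the supremum of the dimensions of its compact subsets;
  on these (compact metrizable) sets the inductive dimension is the covering dimension.\<close>

definition tits_topology :: "'a metric \<Rightarrow> (real \<Rightarrow> 'a) set topology" where
  "tits_topology X = Metric_space.mtopology (boundary_at_infinity X) (angular_metric X)"

definition finite_dim_tits_boundary :: "'a metric \<Rightarrow> bool" where
  "finite_dim_tits_boundary X \<longleftrightarrow>
     (\<exists>n. \<forall>K. compactin (tits_topology X) K \<longrightarrow> subtopology (tits_topology X) K dim_le n)"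

text \<open>Lengths of strings: chains of points in which consecutive points \<open>y, z\<close> lie in a common
  cell, at distance \<open>b\<close> inside that cell (\<open>D y z b\<close>).  The intrinsic metric of a complex is the
  infimum of these lengths.\<close>

inductive string_length :: "('a \<Rightarrow> 'a \<Rightarrow> real \<Rightarrow> bool) \<Rightarrow> 'a \<Rightarrow> 'a \<Rightarrow> real \<Rightarrow> bool" for D where
  "string_length D x x 0"
| "string_length D x y a \<Longrightarrow> D y z b \<Longrightarrow> string_length D x z (a + b)"

section \<open>Polyhedral complexes\<close>

text \<open>The model space \<open>M\<^sub>\<kappa>\<close> of dimension \<open>n\<close> and curvature \<open>\<kappa>\<close>: Euclidean space, a rescaled
  round sphere, or a rescaled hyperboloid model of hyperbolic space.\<close>

definition lorentz_form :: "nat \<Rightarrow> (nat \<Rightarrow> real) \<Rightarrow> (nat \<Rightarrow> real) \<Rightarrow> real" where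
  "lorentz_form n x y = (\<Sum>i=1..n. x i * y i) - x 0 * y 0"

definition model_space :: "real \<Rightarrow> nat \<Rightarrow> (nat \<Rightarrow> real) metric" where
  "model_space \<kappa> n =
     (if \<kappa> = 0 then
        mk_metric (extensional {..<n}) (\<lambda>x y. sqrt (\<Sum>i<n. (x i - y i)\<^sup>2))
      else if \<kappa> > 0 then
        mk_metric {x \<in> extensional {..n}. (\<Sum>i\<le>n. (x i)\<^sup>2) = 1}
          (\<lambda>x y. arccos (\<Sum>i\<le>n. x i * y i) / sqrt \<kappa>)
      else
        mk_metric {x \<in> extensional {..n}. lorentz_form n x x = -1 \<and> x 0 > 0}
          (\<lambda>x y. arcosh (- lorentz_form n x y) / sqrt (- \<kappa>)))"

definition geodesic_hull :: "'a metric \<Rightarrow> 'a set \<Rightarrow> 'a set" where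
  "geodesic_hull X S = \<Inter>{C. geodesically_convex X C \<and> S \<subseteq> C}"

definition convex_polyhedral_cell :: "real \<Rightarrow> nat \<Rightarrow> (nat \<Rightarrow> real) set \<Rightarrow> bool" where
  "convex_polyhedral_cell \<kappa> n P \<longleftrightarrow>
     (\<exists>S. finite S \<and> S \<noteq> {} \<and> S \<subseteq> mspace (model_space \<kappa> n) \<and>
          P = geodesic_hull (model_space \<kappa> n) S) \<and>
     (\<kappa> > 0 \<longrightarrow> (\<exists>x\<in>mspace (model_space \<kappa> n).
                    P \<subseteq> mball_of (model_space \<kappa> n) x (pi / (2 * sqrt \<kappa>))))"

text \<open>Faces are the non-empty convex extreme subsets, as in \<open>face_of\<close>.\<close>

definition geodesic_face :: "'a metric \<Rightarrow> 'a set \<Rightarrow> 'a set \<Rightarrow> bool" where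
  "geodesic_face X F C \<longleftrightarrow>
     F \<noteq> {} \<and> F \<subseteq> C \<and> geodesically_convex X F \<and>
     (\<forall>x\<in>C. \<forall>y\<in>C. \<forall>c. geodesic_between X c x y \<longrightarrow>
        (\<exists>t\<in>{0<..<mdist X x y}. c t \<in> F) \<longrightarrow> x \<in> F \<and> y \<in> F)"

text \<open>\<open>\<C>\<close> is the set of closed cells of an \<open>M\<^sub>\<kappa>\<close>-polyhedral structure on \<open>X\<close>.  In a CAT(0)
  polyhedral complex the closed cells are convex, hence isometrically embedded, and a convex
  union of faces of a cell is a face; so nothing is lost by asking that two cells which meet do so
  in a common face.\<close>

definition polyhedral_structure :: "real \<Rightarrow> 'a metric \<Rightarrow> 'a set set \<Rightarrow> bool" where
  "polyhedral_structure \<kappa> X \<C> \<longleftrightarrow>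
     \<Union>\<C> = mspace X \<and>
     (\<forall>C\<in>\<C>. \<exists>n P f. convex_polyhedral_cell \<kappa> n P \<and> bij_betw f P C \<and>
        (\<forall>x\<in>P. \<forall>y\<in>P. mdist X (f x) (f y) = mdist (model_space \<kappa> n) x y)) \<and>
     (\<forall>C\<in>\<C>. \<forall>F. geodesic_face X F C \<longrightarrow> F \<in> \<C>) \<and>
     (\<forall>C\<in>\<C>. \<forall>D\<in>\<C>. C \<inter> D \<noteq> {} \<longrightarrow> geodesic_face X (C \<inter> D) C \<and> geodesic_face X (C \<inter> D) D) \<and>
     (\<forall>x\<in>mspace X. \<forall>y\<in>mspace X.
        (let S = {l. string_length (\<lambda>y z b. (\<exists>C\<in>\<C>. y \<in> C \<and> z \<in> C) \<and> b = mdist X y z) x y l}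
         in S \<noteq> {} \<and> mdist X x y = Inf S))"

text \<open>An admissible action by cellular maps: an element stabilising a cell fixes it pointwise.\<close>

definition admissible_on :: "('a \<Rightarrow> 'a) set \<Rightarrow> 'a set set \<Rightarrow> bool" where
  "admissible_on H \<C> \<longleftrightarrow>
     (\<forall>h\<in>H. \<forall>C\<in>\<C>. h ` C \<in> \<C> \<and> (h ` C = C \<longrightarrow> (\<forall>x\<in>C. h x = x)))"

section \<open>Topological groups, isometry groups and lattices\<close>

definition topological_group :: "'a monoid \<Rightarrow> 'a topology \<Rightarrow> bool" where
  "topological_group G T \<longleftrightarrow>
     group G \<and> topspace T = carrier G \<and>
     continuous_map (prod_topology T T) T (\<lambda>(x, y). x \<otimes>\<^bsub>G\<^esub> y) \<and>
     continuous_map T T (\<lambda>x. inv\<^bsub>G\<^esub> x)"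

definition locally_compact_group :: "'a monoid \<Rightarrow> 'a topology \<Rightarrow> bool" where
  "locally_compact_group G T \<longleftrightarrow>
     topological_group G T \<and> Hausdorff_space T \<and> locally_compact_space T"

definition discrete_in :: "'a topology \<Rightarrow> 'a set \<Rightarrow> bool" where
  "discrete_in T S \<longleftrightarrow> S \<subseteq> topspace T \<and> subtopology T S = discrete_topology S"

definition coset_topology :: "'a monoid \<Rightarrow> 'a topology \<Rightarrow> 'a set \<Rightarrow> 'a set topology" where
  "coset_topology G T \<Gamma> = topology (\<lambda>U. U \<subseteq> rcosets\<^bsub>G\<^esub> \<Gamma> \<and> openin T (\<Union>U))"

text \<open>Finite covolume: the space of cosets carries a non-zero finite \<open>G\<close>-invariant Borel measure.
  (All groups below are second countable, so that such a measure is automatically regular.)\<close>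

definition finite_covolume :: "'a monoid \<Rightarrow> 'a topology \<Rightarrow> 'a set \<Rightarrow> bool" where
  "finite_covolume G T \<Gamma> \<longleftrightarrow>
     (\<exists>\<mu> :: 'a set measure.
        space \<mu> = rcosets\<^bsub>G\<^esub> \<Gamma> \<and>
        sets \<mu> = sigma_sets (rcosets\<^bsub>G\<^esub> \<Gamma>) {U. openin (coset_topology G T \<Gamma>) U} \<and>
        0 < emeasure \<mu> (space \<mu>) \<and> emeasure \<mu> (space \<mu>) < \<infinity> \<and>
        (\<forall>g\<in>carrier G. \<forall>A\<in>sets \<mu>. emeasure \<mu> ((\<lambda>C. C #>\<^bsub>G\<^esub> g) ` A) = emeasure \<mu> A))"

definition lattice_in :: "'a monoid \<Rightarrow> 'a topology \<Rightarrow> 'a set \<Rightarrow> bool" where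
  "lattice_in G T \<Gamma> \<longleftrightarrow>
     locally_compact_group G T \<and> subgroup \<Gamma> G \<and> discrete_in T \<Gamma> \<and> finite_covolume G T \<Gamma>"

definition uniform_lattice_in :: "'a monoid \<Rightarrow> 'a topology \<Rightarrow> 'a set \<Rightarrow> bool" where
  "uniform_lattice_in G T \<Gamma> \<longleftrightarrow> lattice_in G T \<Gamma> \<and> compact_space (coset_topology G T \<Gamma>)"

definition isom_group :: "'a metric \<Rightarrow> ('a \<Rightarrow> 'a) monoid" where
  "isom_group X = (BijGroup (mspace X))
     \<lparr>carrier := {f \<in> Bij (mspace X). \<forall>x\<in>mspace X. \<forall>y\<in>mspace X. mdist X (f x) (f y) = mdist X x y}\<rparr>"

text \<open>Pointwise convergence; on isometry groups this is the compact-open topology.\<close>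

definition isom_topology :: "'a metric \<Rightarrow> ('a \<Rightarrow> 'a) topology" where
  "isom_topology X =
     subtopology (product_topology (\<lambda>_. mtopology_of X) (mspace X)) (carrier (isom_group X))"

definition acts_cocompactly :: "('a \<Rightarrow> 'a) set \<Rightarrow> 'a metric \<Rightarrow> bool" where
  "acts_cocompactly H X \<longleftrightarrow>
     (\<exists>K. compactin (mtopology_of X) K \<and> (\<Union>h\<in>H. h ` K) = mspace X)"

definition acts_minimally :: "('a \<Rightarrow> 'a) set \<Rightarrow> 'a metric \<Rightarrow> bool" where
  "acts_minimally H X \<longleftrightarrow>
     \<not> (\<exists>C. C \<noteq> {} \<and> C \<subset> mspace X \<and> closedin (mtopology_of X) C \<and>
            geodesically_convex X C \<and> (\<forall>h\<in>H. h ` C \<subseteq> C))"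

section \<open>Group presentations, free groups and right-angled Artin groups\<close>

text \<open>A letter \<open>(x, True)\<close> stands for the generator \<open>x\<close> and \<open>(x, False)\<close> for its inverse.\<close>

type_synonym 'v word = "('v \<times> bool) list"

inductive word_equiv :: "'v set \<Rightarrow> 'v word set \<Rightarrow> 'v word \<Rightarrow> 'v word \<Rightarrow> bool" for S R where
  refl: "w \<in> lists (S \<times> UNIV) \<Longrightarrow> word_equiv S R w w"
| sym: "word_equiv S R u w \<Longrightarrow> word_equiv S R w u"
| trans: "word_equiv S R u w \<Longrightarrow> word_equiv S R w z \<Longrightarrow> word_equiv S R u z"
| cancel: "u \<in> lists (S \<times> UNIV) \<Longrightarrow> w \<in> lists (S \<times> UNIV) \<Longrightarrow> x \<in> S \<Longrightarrow>
     word_equiv S R (u @ [(x, e), (x, \<not> e)] @ w) (u @ w)"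
| relator: "u \<in> lists (S \<times> UNIV) \<Longrightarrow> w \<in> lists (S \<times> UNIV) \<Longrightarrow> r \<in> R \<Longrightarrow> r \<in> lists (S \<times> UNIV) \<Longrightarrow>
     word_equiv S R (u @ r @ w) (u @ w)"

definition word_rel :: "'v set \<Rightarrow> 'v word set \<Rightarrow> ('v word \<times> 'v word) set" where
  "word_rel S R = {(u, w). word_equiv S R u w}"

definition presented_group :: "'v set \<Rightarrow> 'v word set \<Rightarrow> 'v word set monoid" where
  "presented_group S R =
     \<lparr>carrier = lists (S \<times> UNIV) // word_rel S R,
      mult = (\<lambda>a b. word_rel S R `` {u @ w | u w. u \<in> a \<and> w \<in> b}),
      one = word_rel S R `` {[]}\<rparr>"

definition word_value :: "'g monoid \<Rightarrow> ('v \<Rightarrow> 'g) \<Rightarrow> 'v word \<Rightarrow> 'g" where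
  "word_value G f w =
     foldr (\<lambda>(x, e) a. (if e then f x else inv\<^bsub>G\<^esub> (f x)) \<otimes>\<^bsub>G\<^esub> a) w \<one>\<^bsub>G\<^esub>"

text \<open>The homomorphism from a presented group to \<open>G\<close> with \<open>x \<mapsto> f x\<close> on generators.\<close>

definition induced_hom :: "'g monoid \<Rightarrow> ('v \<Rightarrow> 'g) \<Rightarrow> 'v word set \<Rightarrow> 'g" where
  "induced_hom G f a = the_elem (word_value G f ` a)"

definition free_group_on :: "'v set \<Rightarrow> 'v word set monoid" where
  "free_group_on B = presented_group B {}"

definition free_gen :: "'v set \<Rightarrow> 'v \<Rightarrow> 'v word set" where
  "free_gen B x = word_rel B {} `` {[(x, True)]}"

text \<open>A finite flag complex with vertex set \<open>V\<close>, as its set of simplices, the empty one included.\<close>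

definition flag_complex :: "'v set \<Rightarrow> 'v set set \<Rightarrow> bool" where
  "flag_complex V L \<longleftrightarrow>
     finite V \<and> L \<subseteq> Pow V \<and> (\<forall>x\<in>V. {x} \<in> L) \<and>
     (\<forall>\<sigma>\<in>L. \<forall>\<tau>. \<tau> \<subseteq> \<sigma> \<longrightarrow> \<tau> \<in> L) \<and>
     (\<forall>\<sigma>. \<sigma> \<subseteq> V \<longrightarrow> (\<forall>x\<in>\<sigma>. \<forall>y\<in>\<sigma>. {x, y} \<in> L) \<longrightarrow> \<sigma> \<in> L)"

definition raag_relators :: "'v set set \<Rightarrow> 'v word set" where
  "raag_relators L =
     {[(x, True), (y, True), (x, False), (y, False)] | x y. x \<noteq> y \<and> {x, y} \<in> L}"

definition raag :: "'v set set \<Rightarrow> 'v word set monoid" where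
  "raag L = presented_group (\<Union>L) (raag_relators L)"

definition raag_gen :: "'v set set \<Rightarrow> 'v \<Rightarrow> 'v word set" where
  "raag_gen L x = word_rel (\<Union>L) (raag_relators L) `` {[(x, True)]}"

definition freely_generates :: "'v set set \<Rightarrow> 'v set \<Rightarrow> bool" where
  "freely_generates L B \<longleftrightarrow> inj_on (induced_hom (raag L) (raag_gen L)) (carrier (free_group_on B))"

definition raag_to_free :: "'v set set \<Rightarrow> 'v set \<Rightarrow> 'v word set \<Rightarrow> 'v word set" where
  "raag_to_free L B =
     induced_hom (free_group_on B) (\<lambda>x. if x \<in> B then free_gen B x else \<one>\<^bsub>free_group_on B\<^esub>)"

section \<open>The Cayley tree of a free group\<close>

text \<open>\<open>x\<close> and \<open>y\<close> span an (unoriented) edge labelled \<open>b\<close>.\<close>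

definition tree_edge :: "'v set \<Rightarrow> 'v \<Rightarrow> 'v word set \<Rightarrow> 'v word set \<Rightarrow> bool" where
  "tree_edge B b x y \<longleftrightarrow>
     b \<in> B \<and> x \<in> carrier (free_group_on B) \<and> y \<in> carrier (free_group_on B) \<and>
     (y = x \<otimes>\<^bsub>free_group_on B\<^esub> free_gen B b \<or> x = y \<otimes>\<^bsub>free_group_on B\<^esub> free_gen B b)"

definition tree_aut :: "'v set \<Rightarrow> ('v word set \<Rightarrow> 'v word set) monoid" where
  "tree_aut B = (BijGroup (carrier (free_group_on B)))
     \<lparr>carrier := {f \<in> Bij (carrier (free_group_on B)).
        \<forall>x\<in>carrier (free_group_on B). \<forall>y\<in>carrier (free_group_on B).
          (\<exists>b. tree_edge B b (f x) (f y)) \<longleftrightarrow> (\<exists>b. tree_edge B b x y)}\<rparr>"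

definition tree_aut_topology :: "'v set \<Rightarrow> ('v word set \<Rightarrow> 'v word set) topology" where
  "tree_aut_topology B =
     subtopology (product_topology (\<lambda>_. discrete_topology (carrier (free_group_on B)))
                                   (carrier (free_group_on B)))
                 (carrier (tree_aut B))"

definition label_preserving :: "'v set \<Rightarrow> ('v word set \<Rightarrow> 'v word set) \<Rightarrow> bool" where
  "label_preserving B f \<longleftrightarrow> (\<forall>b x y. tree_edge B b x y \<longrightarrow> tree_edge B b (f x) (f y))"

definition no_inversion :: "'v set \<Rightarrow> ('v word set \<Rightarrow> 'v word set) \<Rightarrow> bool" where
  "no_inversion B f \<longleftrightarrow> (\<forall>b x y. tree_edge B b x y \<longrightarrow> \<not> (f x = y \<and> f y = x))"

text \<open>A homomorphism \<open>\<rho>\<close> to \<open>tree_aut B\<close> that is an admissible action by label-preserving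
  isometries.\<close>

definition label_preserving_action ::
    "'v set \<Rightarrow> 'g monoid \<Rightarrow> ('g \<Rightarrow> 'v word set \<Rightarrow> 'v word set) \<Rightarrow> bool" where
  "label_preserving_action B \<Gamma> \<rho> \<longleftrightarrow>
     group \<Gamma> \<and> \<rho> \<in> hom \<Gamma> (tree_aut B) \<and>
     (\<forall>\<gamma>\<in>carrier \<Gamma>. label_preserving B (\<rho> \<gamma>) \<and> no_inversion B (\<rho> \<gamma>))"

section \<open>The universal cover of the Salvetti complex\<close>

text \<open>The Salvetti complex is the subcomplex of the torus with one circle factor per vertex of
  \<open>L\<close> formed by the coordinate subtori of the simplices of \<open>L\<close>.  With circle coordinates in
  \<open>[0, 1)\<close> its points are the \<open>t\<close> whose support is a simplex.

  Its edge paths are the words in the letters \<open>x\<close>, \<open>x\<inverse>\<close>, and edge homotopy of paths is exactly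
  \<open>word_equiv\<close> for the commutator relators, since the 2-cells are the tori of the edges of \<open>L\<close>.
  So the vertices of the universal cover, homotopy classes of edge paths starting at the vertex,
  are the elements of \<open>raag L\<close>, and the open cubes are indexed by their initial vertex and a
  simplex.  A point of the universal cover is therefore a pair \<open>(g, t)\<close>: the point with torus
  coordinates \<open>t\<close> in the open cube with initial vertex \<open>g\<close> given by the support of \<open>t\<close>.  The
  universal covering map is \<open>(g, t) \<mapsto> t\<close>, and \<open>raag L\<close> is the deck group, acting by left
  multiplication on \<open>g\<close>.\<close>

definition salvetti_points :: "'v set set \<Rightarrow> ('v \<Rightarrow> real) set" where
  "salvetti_points L = {t. (\<forall>x. 0 \<le> t x \<and> t x < 1) \<and> {x. t x \<noteq> 0} \<in> L}"

type_synonym 'v cover_point = "'v word set \<times> ('v \<Rightarrow> real)"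

definition cover_points :: "'v set set \<Rightarrow> 'v cover_point set" where
  "cover_points L = carrier (raag L) \<times> salvetti_points L"

definition unit_cube :: "'v set \<Rightarrow> ('v \<Rightarrow> real) set" where
  "unit_cube \<sigma> = {s. (\<forall>x. 0 \<le> s x \<and> s x \<le> 1) \<and> (\<forall>x. x \<notin> \<sigma> \<longrightarrow> s x = 0)}"

definition cube_dist :: "'v set set \<Rightarrow> ('v \<Rightarrow> real) \<Rightarrow> ('v \<Rightarrow> real) \<Rightarrow> real" where
  "cube_dist L s t = sqrt (\<Sum>x\<in>\<Union>L. (s x - t x)\<^sup>2)"

text \<open>The product of the generators in a simplex \<open>\<tau>\<close>; these commute, so every ordering of the
  factors gives the same class.\<close>

definition simplex_product :: "'v set set \<Rightarrow> 'v set \<Rightarrow> 'v word set" where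
  "simplex_product L \<tau> =
     word_rel (\<Union>L) (raag_relators L) `` {map (\<lambda>x. (x, True)) xs | xs. distinct xs \<and> set xs = \<tau>}"

text \<open>\<open>char_map L g\<close> restricted to \<open>unit_cube \<sigma>\<close> is the characteristic map of the closed
  \<open>\<sigma>\<close>-cube with initial vertex \<open>g\<close>: the coordinates equal to 1 move the initial vertex.\<close>

definition char_map :: "'v set set \<Rightarrow> 'v word set \<Rightarrow> ('v \<Rightarrow> real) \<Rightarrow> 'v cover_point" where
  "char_map L g s = (g \<otimes>\<^bsub>raag L\<^esub> simplex_product L {x. s x = 1}, \<lambda>x. if s x = 1 then 0 else s x)"

definition cover_cubes :: "'v set set \<Rightarrow> 'v cover_point set set" where
  "cover_cubes L = {char_map L g ` unit_cube \<sigma> | g \<sigma>. g \<in> carrier (raag L) \<and> \<sigma> \<in> L}"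

definition salvetti_cover :: "'v set set \<Rightarrow> 'v cover_point metric" where
  "salvetti_cover L = mk_metric (cover_points L) (\<lambda>x y. Inf {l. string_length
     (\<lambda>p q b. \<exists>g\<in>carrier (raag L). \<exists>\<sigma>\<in>L. \<exists>s\<in>unit_cube \<sigma>. \<exists>t\<in>unit_cube \<sigma>.
        p = char_map L g s \<and> q = char_map L g t \<and> b = cube_dist L s t) x y l})"

definition cover_aut :: "'v set set \<Rightarrow> ('v cover_point \<Rightarrow> 'v cover_point) monoid" where
  "cover_aut L = (isom_group (salvetti_cover L))
     \<lparr>carrier := {f \<in> carrier (isom_group (salvetti_cover L)).
                   (\<lambda>C. f ` C) ` cover_cubes L = cover_cubes L}\<rparr>"

definition cover_aut_topology :: "'v set set \<Rightarrow> ('v cover_point \<Rightarrow> 'v cover_point) topology" where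
  "cover_aut_topology L = subtopology (isom_topology (salvetti_cover L)) (carrier (cover_aut L))"

section \<open>The intermediate cover and the group of lifts\<close>

text \<open>The covering map \<open>\<pi>\<close> onto the quotient by the kernel of \<open>raag_to_free\<close>: a point is sent to
  its orbit.\<close>

definition cover_proj :: "'v set set \<Rightarrow> 'v set \<Rightarrow> 'v cover_point \<Rightarrow> 'v cover_point set" where
  "cover_proj L B = (\<lambda>(g, t).
     {(n \<otimes>\<^bsub>raag L\<^esub> g, t) | n. n \<in> kernel (raag L) (free_group_on B) (raag_to_free L B)})"

definition intermediate_cover :: "'v set set \<Rightarrow> 'v set \<Rightarrow> 'v cover_point set set" where
  "intermediate_cover L B = cover_proj L B ` cover_points L"

definition edge_point :: "'v \<Rightarrow> real \<Rightarrow> 'v \<Rightarrow> real" where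
  "edge_point x r = (\<lambda>y. if y = x then r else 0)"

text \<open>\<open>\<Phi>\<close> is the automorphism of the intermediate cover extending a label-preserving isometry
  \<open>a\<close> of the tree.  The vertex of the tree \<open>raag_to_free L B g\<close> is the image under \<open>\<pi>\<close> of the
  vertex \<open>g\<close>.  The clauses say: \<open>\<Phi>\<close> is \<open>a\<close> on vertices; it is \<open>a\<close> on an edge of the tree with
  label \<open>b\<close>, whose orientation \<open>a\<close> either preserves or reverses; it preserves labels and
  orientations of the loops; and it maps every cube isometrically onto a cube.\<close>

definition extends_to_intermediate ::
    "'v set set \<Rightarrow> 'v set \<Rightarrow> ('v word set \<Rightarrow> 'v word set) \<Rightarrow>
     ('v cover_point set \<Rightarrow> 'v cover_point set) \<Rightarrow> bool" where
  "extends_to_intermediate L B a \<Phi> \<longleftrightarrow>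
     (let A = raag L; F = free_group_on B; \<phi> = raag_to_free L B; \<pi> = cover_proj L B in
      bij_betw \<Phi> (intermediate_cover L B) (intermediate_cover L B) \<and>
      (\<forall>g\<in>carrier A. \<forall>g'\<in>carrier A. \<phi> g' = a (\<phi> g) \<longrightarrow>
         \<Phi> (\<pi> (g, \<lambda>_. 0)) = \<pi> (g', \<lambda>_. 0)) \<and>
      (\<forall>g\<in>carrier A. \<forall>g'\<in>carrier A. \<forall>b\<in>B. \<forall>r\<in>{0..1}.
         (\<phi> g' = a (\<phi> g) \<and> a (\<phi> g \<otimes>\<^bsub>F\<^esub> free_gen B b) = \<phi> g' \<otimes>\<^bsub>F\<^esub> free_gen B b \<longrightarrow>
            \<Phi> (\<pi> (char_map L g (edge_point b r))) = \<pi> (char_map L g' (edge_point b r))) \<and>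
         (\<phi> g' = a (\<phi> g \<otimes>\<^bsub>F\<^esub> free_gen B b) \<and> a (\<phi> g) = \<phi> g' \<otimes>\<^bsub>F\<^esub> free_gen B b \<longrightarrow>
            \<Phi> (\<pi> (char_map L g (edge_point b r))) = \<pi> (char_map L g' (edge_point b (1 - r))))) \<and>
      (\<forall>g\<in>carrier A. \<forall>g'\<in>carrier A. \<forall>x\<in>\<Union>L - B. \<forall>r\<in>{0..1}. \<phi> g' = a (\<phi> g) \<longrightarrow>
         \<Phi> (\<pi> (char_map L g (edge_point x r))) = \<pi> (char_map L g' (edge_point x r))) \<and>
      (\<forall>g\<in>carrier A. \<forall>\<sigma>\<in>L. \<exists>g'\<in>carrier A. \<exists>\<sigma>'\<in>L. \<exists>\<theta>.
         bij_betw \<theta> (unit_cube \<sigma>) (unit_cube \<sigma>') \<and>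
         (\<forall>s\<in>unit_cube \<sigma>. \<forall>t\<in>unit_cube \<sigma>. cube_dist L (\<theta> s) (\<theta> t) = cube_dist L s t) \<and>
         (\<forall>s\<in>unit_cube \<sigma>. \<Phi> (\<pi> (char_map L g s)) = \<pi> (char_map L g' (\<theta> s)))))"

definition cover_homeos :: "'v set set \<Rightarrow> ('v cover_point \<Rightarrow> 'v cover_point) set" where
  "cover_homeos L = {f \<in> Bij (cover_points L).
     homeomorphic_map (mtopology_of (salvetti_cover L)) (mtopology_of (salvetti_cover L)) f}"

definition deck_group :: "'v set set \<Rightarrow> 'v set \<Rightarrow> ('v cover_point \<Rightarrow> 'v cover_point) set" where
  "deck_group L B =
     {f \<in> cover_homeos L. \<forall>x\<in>cover_points L. cover_proj L B (f x) = cover_proj L B x}"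

definition lift_group ::
    "'v set set \<Rightarrow> 'v set \<Rightarrow> 'g monoid \<Rightarrow> ('g \<Rightarrow> 'v word set \<Rightarrow> 'v word set) \<Rightarrow>
     ('g \<times> ('v cover_point \<Rightarrow> 'v cover_point)) monoid" where
  "lift_group L B \<Gamma> \<rho> = (\<Gamma> \<times>\<times> BijGroup (cover_points L))
     \<lparr>carrier := {(\<gamma>, f). \<gamma> \<in> carrier \<Gamma> \<and> f \<in> cover_homeos L \<and>
        (\<exists>\<Phi>. extends_to_intermediate L B (\<rho> \<gamma>) \<Phi> \<and>
             (\<forall>x\<in>cover_points L. cover_proj L B (f x) = \<Phi> (cover_proj L B x)))}\<rparr>"

section \<open>The two product groups\<close>

definition subgroup_with_tree :: "('x \<Rightarrow> 'x) set \<Rightarrow> 'x metric \<Rightarrow> 'v set \<Rightarrow>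
    (('x \<Rightarrow> 'x) \<times> ('v word set \<Rightarrow> 'v word set)) monoid" where
  "subgroup_with_tree H X B = (isom_group X)\<lparr>carrier := H\<rparr> \<times>\<times> tree_aut B"

definition subgroup_with_tree_topology :: "('x \<Rightarrow> 'x) set \<Rightarrow> 'x metric \<Rightarrow> 'v set \<Rightarrow>
    (('x \<Rightarrow> 'x) \<times> ('v word set \<Rightarrow> 'v word set)) topology" where
  "subgroup_with_tree_topology H X B =
     prod_topology (subtopology (isom_topology X) H) (tree_aut_topology B)"

definition subgroup_with_cover :: "('x \<Rightarrow> 'x) set \<Rightarrow> 'x metric \<Rightarrow> 'v set set \<Rightarrow>
    (('x \<Rightarrow> 'x) \<times> ('v cover_point \<Rightarrow> 'v cover_point)) monoid" where
  "subgroup_with_cover H X L = (isom_group X)\<lparr>carrier := H\<rparr> \<times>\<times> cover_aut L"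

definition subgroup_with_cover_topology :: "('x \<Rightarrow> 'x) set \<Rightarrow> 'x metric \<Rightarrow> 'v set set \<Rightarrow>
    (('x \<Rightarrow> 'x) \<times> ('v cover_point \<Rightarrow> 'v cover_point)) topology" where
  "subgroup_with_cover_topology H X L =
     prod_topology (subtopology (isom_topology X) H) (cover_aut_topology L)"

text \<open>For a subgroup \<open>\<Gamma>\<close> of \<open>H \<times> T\<close>, acting on the tree through its second projection.\<close>

definition lattice_lift_group :: "('x \<Rightarrow> 'x) set \<Rightarrow> 'x metric \<Rightarrow> 'v set set \<Rightarrow> 'v set \<Rightarrow>
    (('x \<Rightarrow> 'x) \<times> ('v word set \<Rightarrow> 'v word set)) set \<Rightarrow>
    ((('x \<Rightarrow> 'x) \<times> ('v word set \<Rightarrow> 'v word set)) \<times> ('v cover_point \<Rightarrow> 'v cover_point)) monoid" where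
  "lattice_lift_group H X L B \<Gamma> = lift_group L B ((subgroup_with_tree H X B)\<lparr>carrier := \<Gamma>\<rparr>) snd"

definition lift_group_map :: "(('h \<times> 't) \<times> 'f) \<Rightarrow> 'h \<times> 'f" where
  "lift_group_map = (\<lambda>((h, \<tau>), f). (h, f))"

end

theory Submission
  imports Defs "HOL-Probability.Infinite_Product_Measure" "HOL-Probability.Giry_Monad"
begin

text \<open>A label-preserving tree automorphism \<open>a\<close> acts on words by flipping the exponents of the
  letters whose edges it reverses.  This gives the lifts of \<open>a\<close> to the vertices of the universal
  cover, and each lift extends over the cubes by reflecting the reversed coordinates.  Any two
  lifts differ by an element of the kernel of \<open>A\<^sub>L \<rightarrow> F\<^sub>k\<close>, which acts with uniformly discrete
  orbits.

  For the lattices, \<open>Aut\<close> of the cover is viewed as a closed permutation group of the vertex set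
  containing \<open>A\<^sub>L\<close> as a regular subgroup.  It carries an explicit bi-invariant measure, built from
  the profinite vertex stabiliser.  A finite invariant measure for \<open>\<Gamma>\<close> is pushed to one for
  the group of lifts by integrating, over a coset \<open>\<Gamma>(h, t)\<close>, the Haar measure on the fibre of
  automorphisms taking the base vertex to a vertex over \<open>t\<close> of the base vertex of the tree.
  Invariance under all of \<open>Aut\<close> is a mass transport argument that uses only the translations by
  \<open>F\<^sub>k\<close> in the automorphism group of the tree.\<close>

section \<open>Presented groups\<close>

text \<open>Freeness of the chosen generators enters the lifting argument in one form: no two of
  them are adjacent in \<open>L\<close>. A commutator relator then contains at most one letter that
  the tree sees, so reversing tree edges respects the relators, and the set of reversed coordinates
  is the same at all corners of a cube. The obstacle for the lattices is that an automorphism of the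
  cover need not preserve the fibres of the map from the Artin group to the free group. So there is
  no homomorphism from the automorphisms of the cover to those of the tree along which a measure or
  a fundamental domain could be pulled back. What the two groups share is that each acts on a
  countable set containing a regular group of translations, and that the base vertex of the cover
  lies over that of the tree. All comparisons therefore go through values at base vertices, fibre by
  fibre, and the group of lifts is needed only through four properties: each lift covers an element,
  lifts exist through any compatible pair of vertices, kernel translations are lifts, and a lift of
  the identity that fixes the base vertex is trivial.\<close>

abbreviation pclass :: "'v set \<Rightarrow> 'v word set \<Rightarrow> 'v word \<Rightarrow> 'v word set" where
  "pclass S R w \<equiv> word_rel S R `` {w}"

lemma word_equiv_lists:
  assumes "word_equiv S R u w" shows "u \<in> lists (S \<times> UNIV) \<and> w \<in> lists (S \<times> UNIV)"
  using assms by induction auto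

lemma equiv_word_rel: "equiv (lists (S \<times> UNIV)) (word_rel S R)"
proof (rule equivI)
  show "word_rel S R \<subseteq> lists (S \<times> UNIV) \<times> lists (S \<times> UNIV)"
    using word_equiv_lists by (fastforce simp: word_rel_def)
  show "refl_on (lists (S \<times> UNIV)) (word_rel S R)"
    by (auto intro!: refl_onI simp: word_rel_def intro: word_equiv.refl)
  show "Relation.sym (word_rel S R)"
    by (rule symI) (auto simp: word_rel_def intro: word_equiv.sym)
  show "Relation.trans (word_rel S R)"
    by (rule transI) (auto simp: word_rel_def intro: word_equiv.trans)
qed

lemma word_equiv_append_left:
  assumes "word_equiv S R u w" "p \<in> lists (S \<times> UNIV)" shows "word_equiv S R (p @ u) (p @ w)"
  using assms
proof induction
  case (cancel u w x e)
  have "word_equiv S R ((p @ u) @ [(x, e), (x, \<not> e)] @ w) ((p @ u) @ w)"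
    by (rule word_equiv.cancel) (use cancel in auto)
  then show ?case by simp
next
  case (relator u w r)
  have "word_equiv S R ((p @ u) @ r @ w) ((p @ u) @ w)"
    by (rule word_equiv.relator) (use relator in auto)
  then show ?case by simp
next
  case (refl w)
  then show ?case by (intro word_equiv.refl) auto
qed (auto intro: word_equiv.intros)

lemma word_equiv_append_right:
  assumes "word_equiv S R u w" "p \<in> lists (S \<times> UNIV)" shows "word_equiv S R (u @ p) (w @ p)"
  using assms
proof induction
  case (cancel u w x e)
  have "word_equiv S R (u @ [(x, e), (x, \<not> e)] @ (w @ p)) (u @ (w @ p))"
    by (rule word_equiv.cancel) (use cancel in auto)
  then show ?case by simp
next
  case (relator u w r)
  have "word_equiv S R (u @ r @ (w @ p)) (u @ (w @ p))"
    by (rule word_equiv.relator) (use relator in auto)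
  then show ?case by simp
next
  case (refl w)
  then show ?case by (intro word_equiv.refl) auto
qed (auto intro: word_equiv.intros)

lemma word_equiv_append:
  "word_equiv S R u u' \<Longrightarrow> word_equiv S R w w' \<Longrightarrow> word_equiv S R (u @ w) (u' @ w')"
  by (meson word_equiv.trans word_equiv_append_left word_equiv_append_right word_equiv_lists)

lemma pclass_eq_iff:
  "u \<in> lists (S \<times> UNIV) \<Longrightarrow> w \<in> lists (S \<times> UNIV) \<Longrightarrow>
   pclass S R u = pclass S R w \<longleftrightarrow> word_equiv S R u w"
  using eq_equiv_class_iff[OF equiv_word_rel, of u S w R] by (simp add: word_rel_def)

lemma pclass_self: "w \<in> lists (S \<times> UNIV) \<Longrightarrow> w \<in> pclass S R w"
  by (simp add: word_rel_def word_equiv.refl)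

lemma mem_pclass: "u \<in> pclass S R w \<longleftrightarrow> word_equiv S R w u"
  by (simp add: word_rel_def)

lemma presented_group_carrierE:
  assumes "a \<in> carrier (presented_group S R)"
  obtains w where "w \<in> lists (S \<times> UNIV)" "a = pclass S R w"
  using assms by (auto simp: presented_group_def quotient_def)

lemma pclass_in_carrier [intro]: "w \<in> lists (S \<times> UNIV) \<Longrightarrow> pclass S R w \<in> carrier (presented_group S R)"
  by (auto simp: presented_group_def quotient_def)

lemma mult_pclass:
  assumes "u \<in> lists (S \<times> UNIV)" "w \<in> lists (S \<times> UNIV)"
  shows "pclass S R u \<otimes>\<^bsub>presented_group S R\<^esub> pclass S R w = pclass S R (u @ w)"
proof -
  have "word_rel S R `` {a @ b | a b. a \<in> pclass S R u \<and> b \<in> pclass S R w} = pclass S R (u @ w)"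
  proof (intro equalityI subsetI)
    fix z assume "z \<in> word_rel S R `` {a @ b | a b. a \<in> pclass S R u \<and> b \<in> pclass S R w}"
    then obtain a b where "word_equiv S R u a" "word_equiv S R w b" "word_equiv S R (a @ b) z"
      by (auto simp: word_rel_def)
    then show "z \<in> pclass S R (u @ w)"
      unfolding mem_pclass by (meson word_equiv.trans word_equiv_append)
  next
    fix z assume "z \<in> pclass S R (u @ w)"
    with assms show "z \<in> word_rel S R `` {a @ b | a b. a \<in> pclass S R u \<and> b \<in> pclass S R w}"
      using pclass_self[of u S R] pclass_self[of w S R] by blast
  qed
  then show ?thesis by (simp add: presented_group_def)
qed

lemma one_pclass: "\<one>\<^bsub>presented_group S R\<^esub> = pclass S R []"
  by (simp add: presented_group_def)

definition inv_word :: "'v word \<Rightarrow> 'v word" where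
  "inv_word w = rev (map (\<lambda>(x, e). (x, \<not> e)) w)"

lemma inv_word_lists: "w \<in> lists (S \<times> UNIV) \<Longrightarrow> inv_word w \<in> lists (S \<times> UNIV)"
  by (auto simp: inv_word_def)

lemma inv_word_cancel: "w \<in> lists (S \<times> UNIV) \<Longrightarrow> word_equiv S R (inv_word w @ w) []"
proof (induction w)
  case (Cons p w)
  obtain x e where p: "p = (x, e)" by (cases p)
  have "word_equiv S R (inv_word w @ [(x, \<not> e), (x, \<not> \<not> e)] @ w) (inv_word w @ w)"
    by (rule word_equiv.cancel) (use Cons.prems p inv_word_lists in auto)
  then show ?case using Cons by (auto simp: inv_word_def p intro: word_equiv.trans)
qed (auto simp: inv_word_def intro: word_equiv.refl)

lemma group_presented_group: "group (presented_group S R)"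
proof (rule groupI)
  fix x y z
  assume x: "x \<in> carrier (presented_group S R)" and y: "y \<in> carrier (presented_group S R)"
  obtain u where u: "u \<in> lists (S \<times> UNIV)" "x = pclass S R u"
    using x by (rule presented_group_carrierE)
  obtain w where w: "w \<in> lists (S \<times> UNIV)" "y = pclass S R w"
    using y by (rule presented_group_carrierE)
  show "x \<otimes>\<^bsub>presented_group S R\<^esub> y \<in> carrier (presented_group S R)"
    unfolding u w mult_pclass[OF u(1) w(1)] using u w by (intro pclass_in_carrier) auto
  assume z: "z \<in> carrier (presented_group S R)"
  obtain t where t: "t \<in> lists (S \<times> UNIV)" "z = pclass S R t"
    using z by (elim presented_group_carrierE)
  have "u @ w \<in> lists (S \<times> UNIV)" "w @ t \<in> lists (S \<times> UNIV)" using u w t by auto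
  then show "x \<otimes>\<^bsub>presented_group S R\<^esub> y \<otimes>\<^bsub>presented_group S R\<^esub> z = x \<otimes>\<^bsub>presented_group S R\<^esub> (y \<otimes>\<^bsub>presented_group S R\<^esub> z)"
    unfolding u w t using u w t by (simp only: mult_pclass append_assoc)
next
  show "\<one>\<^bsub>presented_group S R\<^esub> \<in> carrier (presented_group S R)" by (auto simp: one_pclass)
next
  fix x assume "x \<in> carrier (presented_group S R)"
  then obtain u where u: "u \<in> lists (S \<times> UNIV)" "x = pclass S R u"
    by (elim presented_group_carrierE)
  show "\<one>\<^bsub>presented_group S R\<^esub> \<otimes>\<^bsub>presented_group S R\<^esub> x = x"
    using u mult_pclass[of "[]" S u R] by (simp add: one_pclass)
  show "\<exists>y\<in>carrier (presented_group S R). y \<otimes>\<^bsub>presented_group S R\<^esub> x = \<one>\<^bsub>presented_group S R\<^esub>"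
  proof
    show "pclass S R (inv_word u) \<otimes>\<^bsub>presented_group S R\<^esub> x = \<one>\<^bsub>presented_group S R\<^esub>"
      using inv_word_cancel[OF u(1), of R] pclass_eq_iff[of "inv_word u @ u" S "[]" R] u inv_word_lists[OF u(1)]
      by (simp add: mult_pclass one_pclass)
  qed (use u inv_word_lists in blast)
qed

lemma inv_pclass:
  assumes "w \<in> lists (S \<times> UNIV)"
  shows "inv\<^bsub>presented_group S R\<^esub> pclass S R w = pclass S R (inv_word w)"
proof -
  interpret group "presented_group S R" by (rule group_presented_group)
  have "pclass S R (inv_word w) \<otimes>\<^bsub>presented_group S R\<^esub> pclass S R w = \<one>\<^bsub>presented_group S R\<^esub>"
    using inv_word_cancel[OF assms, of R] pclass_eq_iff[of "inv_word w @ w" S "[]" R] assms inv_word_lists[OF assms]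
    by (simp add: mult_pclass one_pclass)
  then show ?thesis
    by (rule inv_equality) (use assms inv_word_lists in blast)+
qed

definition pgen :: "'v set \<Rightarrow> 'v word set \<Rightarrow> 'v \<Rightarrow> 'v word set" where
  "pgen S R x = pclass S R [(x, True)]"

lemma pgen_carrier [simp, intro]: "x \<in> S \<Longrightarrow> pgen S R x \<in> carrier (presented_group S R)"
  unfolding pgen_def by (rule pclass_in_carrier) simp

lemma pgen_inv: "x \<in> S \<Longrightarrow> inv\<^bsub>presented_group S R\<^esub> pgen S R x = pclass S R [(x, False)]"
  by (simp add: pgen_def inv_pclass inv_word_def)

lemma pclass_snoc:
  assumes "w \<in> lists (S \<times> UNIV)" "x \<in> S"
  shows "pclass S R (w @ [(x, e)]) = pclass S R w \<otimes>\<^bsub>presented_group S R\<^esub>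
    (if e then pgen S R x else inv\<^bsub>presented_group S R\<^esub> pgen S R x)"
proof -
  have "[(x, e)] \<in> lists (S \<times> UNIV)" using assms by simp
  from mult_pclass[OF assms(1) this, of R] show ?thesis
    unfolding pgen_inv[OF assms(2)] by (cases e) (simp_all add: pgen_def)
qed

lemma pclass_Cons:
  assumes "w \<in> lists (S \<times> UNIV)" "x \<in> S"
  shows "pclass S R ((x, e) # w) =
    (if e then pgen S R x else inv\<^bsub>presented_group S R\<^esub> pgen S R x) \<otimes>\<^bsub>presented_group S R\<^esub> pclass S R w"
proof -
  have "[(x, e)] \<in> lists (S \<times> UNIV)" using assms by simp
  from mult_pclass[OF this assms(1), of R] show ?thesis
    unfolding pgen_inv[OF assms(2)] by (cases e) (simp_all add: pgen_def)
qed

text \<open>Right multiplication by a generator is a step along an edge of the Cayley graph, so this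
  rule propagates a property from the base vertex along edge paths. Connectedness of the cover and
  uniqueness of lifts are proved in this way.\<close>

lemma presented_group_induct [consumes 1, case_names one mult inv_mult]:
  assumes "g \<in> carrier (presented_group S R)"
    and "P \<one>\<^bsub>presented_group S R\<^esub>"
    and "\<And>g x. g \<in> carrier (presented_group S R) \<Longrightarrow> x \<in> S \<Longrightarrow> P g \<Longrightarrow> P (g \<otimes>\<^bsub>presented_group S R\<^esub> pgen S R x)"
    and "\<And>g x. g \<in> carrier (presented_group S R) \<Longrightarrow> x \<in> S \<Longrightarrow> P g \<Longrightarrow>
      P (g \<otimes>\<^bsub>presented_group S R\<^esub> inv\<^bsub>presented_group S R\<^esub> pgen S R x)"
  shows "P g"
proof -
  obtain w where w: "w \<in> lists (S \<times> UNIV)" "g = pclass S R w"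
    using assms(1) by (rule presented_group_carrierE)
  have "P (pclass S R w)"
    using w(1)
  proof (induction w rule: rev_induct)
    case Nil
    then show ?case using assms(2) by (simp add: one_pclass)
  next
    case (snoc p w)
    obtain x e where p: "p = (x, e)" by (cases p)
    from snoc have "w \<in> lists (S \<times> UNIV)" "x \<in> S" "P (pclass S R w)" by (auto simp: p)
    then show ?case
      unfolding p pclass_snoc[OF \<open>w \<in> _\<close> \<open>x \<in> S\<close>] using assms(3,4)[OF pclass_in_carrier] \<open>w \<in> _\<close> \<open>P (pclass S R w)\<close> \<open>x \<in> S\<close>
      by (cases e) simp_all
  qed
  then show ?thesis by (simp add: w)
qed

lemma countable_presented_group:
  assumes "countable S" shows "countable (carrier (presented_group S R))"
proof -
  have "carrier (presented_group S R) = pclass S R ` lists (S \<times> UNIV)"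
    by (auto simp: presented_group_def quotient_def)
  then show ?thesis using assms by auto
qed

section \<open>The universal property of a presentation\<close>

lemma word_value_Nil [simp]: "word_value G f [] = \<one>\<^bsub>G\<^esub>"
  and word_value_Cons [simp]: "word_value G f ((x, e) # w) =
    (if e then f x else inv\<^bsub>G\<^esub> (f x)) \<otimes>\<^bsub>G\<^esub> word_value G f w"
  by (simp_all add: word_value_def)

text \<open>The relator condition concerns only relators spelled in letters of \<open>S\<close>,
  because \<open>word_equiv\<close> applies no others; one set of relators can thus be paired with
  any alphabet.\<close>

locale presented_map = group G for G :: "'g monoid" (structure) +
  fixes S :: "'v set" and R :: "'v word set" and f :: "'v \<Rightarrow> 'g"
  assumes f_closed: "x \<in> S \<Longrightarrow> f x \<in> carrier G"
    and relators: "r \<in> R \<Longrightarrow> r \<in> lists (S \<times> UNIV) \<Longrightarrow> word_value G f r = \<one>"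
begin

lemma word_value_closed: "w \<in> lists (S \<times> UNIV) \<Longrightarrow> word_value G f w \<in> carrier G"
  by (induction w) (auto simp: f_closed)

lemma word_value_append:
  "u \<in> lists (S \<times> UNIV) \<Longrightarrow> w \<in> lists (S \<times> UNIV) \<Longrightarrow>
    word_value G f (u @ w) = word_value G f u \<otimes> word_value G f w"
proof (induction u)
  case (Cons p u)
  obtain x e where p: "p = (x, e)" by (cases p)
  have "word_value G f u \<in> carrier G" "word_value G f w \<in> carrier G" "f x \<in> carrier G"
    using Cons.prems by (auto simp: p f_closed intro!: word_value_closed)
  moreover have "word_value G f (u @ w) = word_value G f u \<otimes> word_value G f w"
    using Cons by auto
  ultimately show ?case by (simp add: p m_assoc)
qed (simp add: word_value_closed)

lemma word_value_equiv: "word_equiv S R u w \<Longrightarrow> word_value G f u = word_value G f w"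
proof (induction rule: word_equiv.induct)
  case (cancel u w x e)
  have "[(x, e), (x, \<not> e)] \<in> lists (S \<times> UNIV)" "[(x, e), (x, \<not> e)] @ w \<in> lists (S \<times> UNIV)"
    using cancel by auto
  moreover have "word_value G f [(x, e), (x, \<not> e)] = \<one>"
    using cancel f_closed[of x] by (cases e) auto
  ultimately show ?case using cancel
    by (simp only: word_value_append) (simp add: word_value_closed)
next
  case (relator u w r)
  have "r @ w \<in> lists (S \<times> UNIV)" using relator by auto
  then show ?case using relator by (simp add: word_value_append word_value_closed relators del: append_in_lists_conv)
qed auto

text \<open>All words of a class have the same value, so the image that \<open>the_elem\<close>
  inspects is a singleton.\<close>

lemma induced_hom_pclass:
  assumes "w \<in> lists (S \<times> UNIV)" shows "induced_hom G f (pclass S R w) = word_value G f w"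
proof -
  have "word_value G f ` pclass S R w = {word_value G f w}"
  proof (intro equalityI subsetI)
    fix z assume "z \<in> word_value G f ` pclass S R w"
    then obtain u where "word_equiv S R w u" "z = word_value G f u" unfolding word_rel_def by blast
    with word_value_equiv[of w u] show "z \<in> {word_value G f w}" by simp
  qed (use pclass_self[OF assms, of R] in blast)
  then show ?thesis by (simp add: induced_hom_def)
qed

lemma induced_hom_hom: "induced_hom G f \<in> hom (presented_group S R) G"
proof (rule homI)
  fix x y assume x: "x \<in> carrier (presented_group S R)"
  then obtain u where u: "u \<in> lists (S \<times> UNIV)" "x = pclass S R u" by (elim presented_group_carrierE)
  then show "induced_hom G f x \<in> carrier G" by (simp add: induced_hom_pclass word_value_closed del: in_listsI)
  assume y: "y \<in> carrier (presented_group S R)"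
  then obtain w where w: "w \<in> lists (S \<times> UNIV)" "y = pclass S R w" by (elim presented_group_carrierE)
  have "u @ w \<in> lists (S \<times> UNIV)" using u w by simp
  then show "induced_hom G f (x \<otimes>\<^bsub>presented_group S R\<^esub> y) = induced_hom G f x \<otimes> induced_hom G f y"
    unfolding u w using u w
    by (simp only: mult_pclass induced_hom_pclass word_value_append)
qed

lemma induced_hom_gen: "x \<in> S \<Longrightarrow> induced_hom G f (pgen S R x) = f x"
  unfolding pgen_def by (subst induced_hom_pclass) (auto simp: f_closed)

end

section \<open>Right-angled Artin groups and free groups\<close>

definition fun_group :: "('v \<Rightarrow> int) monoid" where
  "fun_group = \<lparr>carrier = UNIV, mult = (\<lambda>f g x. f x + g x), one = (\<lambda>_. 0)\<rparr>"

lemma group_fun_group: "group fun_group"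
proof (rule groupI)
  fix f :: "'v \<Rightarrow> int"
  show "\<exists>y\<in>carrier fun_group. y \<otimes>\<^bsub>fun_group\<^esub> f = \<one>\<^bsub>fun_group\<^esub>"
    by (rule bexI[of _ "\<lambda>x. - f x"]) (auto simp: fun_group_def)
qed (auto simp: fun_group_def fun_eq_iff)

lemma inv_fun_group: "inv\<^bsub>fun_group\<^esub> f = (\<lambda>x. - f x)"
  by (rule group.inv_equality[OF group_fun_group]) (auto simp: fun_group_def)

definition unit_fun :: "'v \<Rightarrow> 'v \<Rightarrow> int" where
  "unit_fun x = (\<lambda>y. if y = x then 1 else 0)"

text \<open>Coordinates in the abelianisation. A class is a set of words and
  \<open>induced_hom\<close> reads only that set, so one constant serves the Artin group and the
  free group.\<close>

definition expo :: "'v word set \<Rightarrow> 'v \<Rightarrow> int" where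
  "expo = induced_hom fun_group unit_fun"

lemma presented_map_fun_group_raag: "presented_map fun_group S (raag_relators L) unit_fun"
proof -
  interpret group fun_group by (rule group_fun_group)
  show ?thesis
    by unfold_locales
      (auto simp: raag_relators_def inv_fun_group, auto simp: fun_group_def fun_eq_iff)
qed

lemma presented_map_fun_group_free: "presented_map fun_group S {} unit_fun"
proof -
  interpret group fun_group by (rule group_fun_group)
  show ?thesis by unfold_locales (auto simp: fun_group_def)
qed

lemma group_free_group: "group (free_group_on B)"
  unfolding free_group_on_def by (rule group_presented_group)

lemma group_raag: "group (raag L)"
  unfolding raag_def by (rule group_presented_group)

lemma free_gen_eq: "free_gen B x = pgen B {} x"
  by (simp add: free_gen_def pgen_def)

lemma raag_gen_eq: "raag_gen L x = pgen (\<Union>L) (raag_relators L) x"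
  by (simp add: raag_gen_def pgen_def)

lemma free_gen_carrier [simp, intro]: "x \<in> B \<Longrightarrow> free_gen B x \<in> carrier (free_group_on B)"
  by (auto simp: free_gen_eq free_group_on_def)

lemma raag_gen_carrier [simp, intro]: "x \<in> \<Union>L \<Longrightarrow> raag_gen L x \<in> carrier (raag L)"
  unfolding raag_gen_eq raag_def by (rule pgen_carrier)

lemma expo_mult_raag:
  "g \<in> carrier (raag L) \<Longrightarrow> h \<in> carrier (raag L) \<Longrightarrow> expo (g \<otimes>\<^bsub>raag L\<^esub> h) = (\<lambda>x. expo g x + expo h x)"
  using hom_mult[OF presented_map.induced_hom_hom[OF presented_map_fun_group_raag]]
  unfolding expo_def raag_def by (fastforce simp: fun_group_def)

lemma expo_raag_gen: "x \<in> \<Union>L \<Longrightarrow> expo (raag_gen L x) = unit_fun x"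
  unfolding expo_def raag_gen_eq
  by (rule presented_map.induced_hom_gen[OF presented_map_fun_group_raag])

lemma expo_one_raag: "expo \<one>\<^bsub>raag L\<^esub> = (\<lambda>_. 0)"
  using presented_map.induced_hom_pclass[OF presented_map_fun_group_raag, of "[]" "\<Union>L" L]
  by (simp add: expo_def raag_def one_pclass fun_group_def)

lemma expo_inv_raag: "g \<in> carrier (raag L) \<Longrightarrow> expo (inv\<^bsub>raag L\<^esub> g) = (\<lambda>x. - expo g x)"
  using expo_mult_raag[of "inv\<^bsub>raag L\<^esub> g" L g] expo_one_raag[of L] group_raag[of L]
  by (simp add: fun_eq_iff group.l_inv)
     (metis add.right_inverse add_left_cancel add.commute)

lemma expo_mult_free:
  "g \<in> carrier (free_group_on B) \<Longrightarrow> h \<in> carrier (free_group_on B) \<Longrightarrow>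
    expo (g \<otimes>\<^bsub>free_group_on B\<^esub> h) = (\<lambda>x. expo g x + expo h x)"
  using hom_mult[OF presented_map.induced_hom_hom[OF presented_map_fun_group_free]]
  unfolding expo_def free_group_on_def by (fastforce simp: fun_group_def)

lemma expo_free_gen: "x \<in> B \<Longrightarrow> expo (free_gen B x) = unit_fun x"
  unfolding expo_def free_gen_eq
  by (rule presented_map.induced_hom_gen[OF presented_map_fun_group_free])

lemma expo_one_free: "expo \<one>\<^bsub>free_group_on B\<^esub> = (\<lambda>_. 0)"
  using presented_map.induced_hom_pclass[OF presented_map_fun_group_free, of "[]" B]
  by (simp add: expo_def free_group_on_def one_pclass fun_group_def)

lemma expo_inv_free: "g \<in> carrier (free_group_on B) \<Longrightarrow> expo (inv\<^bsub>free_group_on B\<^esub> g) = (\<lambda>x. - expo g x)"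
  using expo_mult_free[of "inv\<^bsub>free_group_on B\<^esub> g" B g] expo_one_free[of B] group_free_group[of B]
  by (simp add: fun_eq_iff group.l_inv)
     (metis add.right_inverse add_left_cancel add.commute)

section \<open>Commuting generators, and the map from the Artin group to the free group\<close>

lemma raag_induct [consumes 1, case_names one mult inv_mult]:
  assumes "g \<in> carrier (raag L)"
    and "P \<one>\<^bsub>raag L\<^esub>"
    and "\<And>g x. g \<in> carrier (raag L) \<Longrightarrow> x \<in> \<Union>L \<Longrightarrow> P g \<Longrightarrow> P (g \<otimes>\<^bsub>raag L\<^esub> raag_gen L x)"
    and "\<And>g x. g \<in> carrier (raag L) \<Longrightarrow> x \<in> \<Union>L \<Longrightarrow> P g \<Longrightarrow> P (g \<otimes>\<^bsub>raag L\<^esub> inv\<^bsub>raag L\<^esub> raag_gen L x)"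
  shows "P g"
  using assms presented_group_induct[of g "\<Union>L" "raag_relators L" P]
  unfolding raag_def raag_gen_eq by blast

lemma raag_gen_commute:
  assumes "{x, y} \<in> L"
  shows "raag_gen L x \<otimes>\<^bsub>raag L\<^esub> raag_gen L y = raag_gen L y \<otimes>\<^bsub>raag L\<^esub> raag_gen L x"
proof (cases "x = y")
  case False
  let ?S = "\<Union>L" and ?R = "raag_relators L"
  interpret group "raag L" by (rule group_raag)
  have xy: "x \<in> ?S" "y \<in> ?S" using assms by auto
  let ?r = "[(x, True), (y, True), (x, False), (y, False)]"
  have "?r \<in> ?R" using False assms by (auto simp: raag_relators_def)
  then have "word_equiv ?S ?R ([] @ ?r @ []) ([] @ [])"
    by (rule word_equiv.relator[rotated 2]) (use xy in auto)
  then have "pclass ?S ?R ?r = \<one>\<^bsub>raag L\<^esub>"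
    using xy by (simp add: raag_def one_pclass pclass_eq_iff)
  moreover have "pclass ?S ?R ?r = raag_gen L x \<otimes>\<^bsub>raag L\<^esub> (raag_gen L y \<otimes>\<^bsub>raag L\<^esub>
     (inv\<^bsub>raag L\<^esub> raag_gen L x \<otimes>\<^bsub>raag L\<^esub> (inv\<^bsub>raag L\<^esub> raag_gen L y \<otimes>\<^bsub>raag L\<^esub> \<one>\<^bsub>raag L\<^esub>)))"
    using xy by (simp add: pclass_Cons raag_gen_eq raag_def one_pclass)
  ultimately have "raag_gen L x \<otimes>\<^bsub>raag L\<^esub> raag_gen L y \<otimes>\<^bsub>raag L\<^esub>
     inv\<^bsub>raag L\<^esub> (raag_gen L y \<otimes>\<^bsub>raag L\<^esub> raag_gen L x) = \<one>\<^bsub>raag L\<^esub>"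
    using xy by (simp add: inv_mult_group m_assoc)
  then show ?thesis
    using xy by (metis inv_equality inv_inv inv_closed m_closed raag_gen_carrier)
qed simp

lemma free_group_not_commute:
  assumes "x \<in> B" "y \<in> B" "x \<noteq> y"
  shows "free_gen B x \<otimes>\<^bsub>free_group_on B\<^esub> free_gen B y \<noteq> free_gen B y \<otimes>\<^bsub>free_group_on B\<^esub> free_gen B x"
proof
  \<comment> \<open>\<open>x\<close> goes to the transposition of 0 and 1, every other generator to
    the transposition of 1 and 2; the two products already differ at 0.\<close>
  define s where "s = (\<lambda>z. if z = x then Transposition.transpose 0 (1::nat) else Transposition.transpose 1 2)"
  let ?G = "BijGroup (UNIV :: nat set)"
  interpret G: group ?G by (rule group_BijGroup)
  have bij: "s z \<in> Bij UNIV" for z by (simp add: s_def Bij_def)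
  interpret presented_map ?G B "{}" s
    by unfold_locales (auto simp: BijGroup_def bij)
  assume eq: "free_gen B x \<otimes>\<^bsub>free_group_on B\<^esub> free_gen B y = free_gen B y \<otimes>\<^bsub>free_group_on B\<^esub> free_gen B x"
  have "induced_hom ?G s (free_gen B x \<otimes>\<^bsub>free_group_on B\<^esub> free_gen B y) = s x \<otimes>\<^bsub>?G\<^esub> s y"
    using assms hom_mult[OF induced_hom_hom] by (simp add: free_gen_eq free_group_on_def induced_hom_gen)
  moreover have "induced_hom ?G s (free_gen B y \<otimes>\<^bsub>free_group_on B\<^esub> free_gen B x) = s y \<otimes>\<^bsub>?G\<^esub> s x"
    using assms hom_mult[OF induced_hom_hom] by (simp add: free_gen_eq free_group_on_def induced_hom_gen)
  ultimately have "(s x \<otimes>\<^bsub>?G\<^esub> s y) 0 = (s y \<otimes>\<^bsub>?G\<^esub> s x) 0"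
    using eq by simp
  then show False
    using assms bij by (simp add: BijGroup_def compose_def) (simp add: s_def Transposition.transpose_def)
qed

text \<open>Adjacent generators commute in the Artin group; by injectivity the corresponding free
  generators would commute as well, which distinct ones do not.\<close>

lemma freely_generates_not_adjacent:
  assumes "freely_generates L B" "B \<subseteq> \<Union>L" "x \<in> B" "y \<in> B" "{x, y} \<in> L"
  shows "x = y"
proof (rule ccontr)
  assume "x \<noteq> y"
  interpret group "raag L" by (rule group_raag)
  interpret presented_map "raag L" B "{}" "raag_gen L"
    by unfold_locales (use assms in auto)
  interpret F: group "free_group_on B" by (rule group_free_group)
  have "induced_hom (raag L) (raag_gen L) (free_gen B x \<otimes>\<^bsub>free_group_on B\<^esub> free_gen B y) =
        induced_hom (raag L) (raag_gen L) (free_gen B y \<otimes>\<^bsub>free_group_on B\<^esub> free_gen B x)"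
    using assms hom_mult[OF induced_hom_hom] raag_gen_commute[OF assms(5)]
    by (simp add: free_gen_eq free_group_on_def induced_hom_gen)
  moreover have "free_gen B x \<in> carrier (free_group_on B)" "free_gen B y \<in> carrier (free_group_on B)"
    using assms by auto
  ultimately have "free_gen B x \<otimes>\<^bsub>free_group_on B\<^esub> free_gen B y = free_gen B y \<otimes>\<^bsub>free_group_on B\<^esub> free_gen B x"
    using assms(1) unfolding freely_generates_def inj_on_def by (meson F.m_closed)
  with free_group_not_commute \<open>x \<noteq> y\<close> assms show False by metis
qed

text \<open>A relator is a commutator of two distinct adjacent letters. One of them lies outside
  \<open>B\<close> and is sent to the identity, and the commutator collapses.\<close>

lemma presented_map_raag_to_free:
  assumes "\<And>x y. x \<in> B \<Longrightarrow> y \<in> B \<Longrightarrow> {x, y} \<in> L \<Longrightarrow> x = y"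
  shows "presented_map (free_group_on B) S (raag_relators L)
    (\<lambda>x. if x \<in> B then free_gen B x else \<one>\<^bsub>free_group_on B\<^esub>)"
proof -
  interpret F: group "free_group_on B" by (rule group_free_group)
  show ?thesis
  proof
    fix r assume "r \<in> raag_relators L"
    then obtain x y where r: "r = [(x, True), (y, True), (x, False), (y, False)]" "x \<noteq> y" "{x, y} \<in> L"
      unfolding raag_relators_def by blast
    then have "x \<notin> B \<or> y \<notin> B" using assms by blast
    then show "word_value (free_group_on B) (\<lambda>x. if x \<in> B then free_gen B x else \<one>\<^bsub>free_group_on B\<^esub>) r
      = \<one>\<^bsub>free_group_on B\<^esub>"
      unfolding r by (cases "x \<in> B"; cases "y \<in> B") simp_all
  qed simp
qed

section \<open>The geometry of the universal cover\<close>

locale flag =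
  fixes L :: "'v set set" and V :: "'v set"
  assumes flag: "flag_complex V L"
begin

lemma Union_L: "\<Union>L = V"
  using flag by (auto simp: flag_complex_def)

lemma finite_V: "finite V" and finite_L: "finite L"
  using flag finite_subset[of L "Pow V"] by (auto simp: flag_complex_def)

lemma simplex_subset: "\<sigma> \<in> L \<Longrightarrow> \<tau> \<subseteq> \<sigma> \<Longrightarrow> \<tau> \<in> L"
  using flag by (auto simp: flag_complex_def)

lemma simplex_subset_V: "\<sigma> \<in> L \<Longrightarrow> \<sigma> \<subseteq> V"
  using flag by (auto simp: flag_complex_def)

lemma finite_simplex: "\<sigma> \<in> L \<Longrightarrow> finite \<sigma>"
  using finite_V finite_subset simplex_subset_V by blast

lemma empty_simplex [simp]: "{} \<in> L"
  using flag by (auto simp: flag_complex_def)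

lemma vertex_simplex: "x \<in> V \<Longrightarrow> {x} \<in> L"
  using flag by (auto simp: flag_complex_def)

lemma edge_simplex: "\<sigma> \<in> L \<Longrightarrow> x \<in> \<sigma> \<Longrightarrow> y \<in> \<sigma> \<Longrightarrow> {x, y} \<in> L"
  by (rule simplex_subset) auto

sublocale A: group "raag L" by (rule group_raag)

abbreviation sp :: "'v set \<Rightarrow> 'v word set" where "sp \<equiv> simplex_product L"
abbreviation gen :: "'v \<Rightarrow> 'v word set" where "gen \<equiv> raag_gen L"
abbreviation AL :: "'v word set set" where "AL \<equiv> carrier (raag L)"
abbreviation amult :: "'v word set \<Rightarrow> 'v word set \<Rightarrow> 'v word set" (infixl \<open>\<cdot>\<close> 70) where
  "a \<cdot> b \<equiv> a \<otimes>\<^bsub>raag L\<^esub> b"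
abbreviation ainv :: "'v word set \<Rightarrow> 'v word set" where
  "ainv a \<equiv> inv\<^bsub>raag L\<^esub> a"
abbreviation aone :: "'v word set" (\<open>\<one>\<^sub>L\<close>) where "aone \<equiv> \<one>\<^bsub>raag L\<^esub>"

lemma gen_closed [simp]: "x \<in> V \<Longrightarrow> gen x \<in> AL"
  using Union_L by auto

section \<open>Products over simplices\<close>

definition gprod :: "'v list \<Rightarrow> 'v word set" where
  "gprod xs = foldr (\<lambda>x a. gen x \<cdot> a) xs \<one>\<^sub>L"

lemma gprod_Nil [simp]: "gprod [] = \<one>\<^sub>L"
  and gprod_Cons [simp]: "gprod (x # xs) = gen x \<cdot> gprod xs"
  by (simp_all add: gprod_def)

lemma gprod_closed [simp]: "set xs \<subseteq> V \<Longrightarrow> gprod xs \<in> AL"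
  by (induction xs) auto

lemma gprod_append: "set xs \<subseteq> V \<Longrightarrow> set ys \<subseteq> V \<Longrightarrow> gprod (xs @ ys) = gprod xs \<cdot> gprod ys"
  by (induction xs) (simp_all add: A.m_assoc)

lemma pclass_gprod: "set xs \<subseteq> V \<Longrightarrow> pclass (\<Union>L) (raag_relators L) (map (\<lambda>x. (x, True)) xs) = gprod xs"
proof (induction xs)
  case (Cons x xs)
  have "map (\<lambda>x. (x, True)) xs \<in> lists (\<Union>L \<times> UNIV)" "x \<in> \<Union>L"
    using Cons.prems Union_L by auto
  from pclass_Cons[OF this, of "raag_relators L" True] Cons show ?case
    by (simp add: raag_def raag_gen_eq)
qed (simp add: raag_def one_pclass)

lemma gprod_commute_gen:
  assumes "x \<in> V" "set xs \<subseteq> V" "\<And>y. y \<in> set xs \<Longrightarrow> {x, y} \<in> L"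
  shows "gen x \<cdot> gprod xs = gprod xs \<cdot> gen x"
  using assms(2,3)
proof (induction xs)
  case (Cons y xs)
  have y: "y \<in> V" "set xs \<subseteq> V" "gen x \<cdot> gprod xs = gprod xs \<cdot> gen x" "gen x \<cdot> gen y = gen y \<cdot> gen x"
    using Cons raag_gen_commute[of x y L] by auto
  have "gen x \<cdot> gprod (y # xs) = gen x \<cdot> gen y \<cdot> gprod xs"
    using y(1,2) assms(1) by (simp add: A.m_assoc)
  also have "\<dots> = gen y \<cdot> (gen x \<cdot> gprod xs)"
    unfolding y(4) by (rule A.m_assoc) (use y(1,2) assms(1) in simp_all)
  also have "\<dots> = gprod (y # xs) \<cdot> gen x"
    unfolding y(3) using y(1,2) assms(1) by (simp add: A.m_assoc)
  finally show ?case .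
qed (use assms in simp)

text \<open>Induction on the first list: its head occurs somewhere in the second and can be moved to
  the front, since it commutes with all other members of the simplex.\<close>

lemma gprod_perm:
  assumes "distinct xs" "distinct ys" "set xs = set ys" "set xs \<in> L"
  shows "gprod xs = gprod ys"
  using assms
proof (induction xs arbitrary: ys)
  case (Cons x xs)
  then have "x \<in> set ys" by auto
  then obtain y1 y2 where ys: "ys = y1 @ x # y2" by (meson split_list)
  have sV: "set (x # xs) \<subseteq> V" by (rule simplex_subset_V) (rule Cons.prems(4))
  have inV: "x \<in> V" "set y1 \<subseteq> V" "set y2 \<subseteq> V" using sV Cons.prems(3) ys by auto
  have comm: "gen x \<cdot> gprod y1 = gprod y1 \<cdot> gen x"
  proof (rule gprod_commute_gen)
    fix y assume "y \<in> set y1"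
    then show "{x, y} \<in> L" using edge_simplex[OF Cons.prems(4)] Cons.prems(3) ys by auto
  qed (use inV in auto)
  have "gprod xs = gprod (y1 @ y2)"
  proof (rule Cons.IH)
    show "set xs = set (y1 @ y2)" using Cons.prems ys by (auto simp: insert_eq_iff)
    show "set xs \<in> L" using Cons.prems(4) by (rule simplex_subset) auto
  qed (use Cons.prems ys in auto)
  then show ?case
    using inV comm by (simp add: ys gprod_append flip: A.m_assoc)
qed simp

text \<open>\<open>simplex_product\<close> is a union of classes, one for each ordering of the
  simplex. These classes coincide, so the union is a single class, and \<open>xs\<close> shows that
  there is at least one ordering.\<close>

lemma sp_gprod:
  assumes "distinct xs" "set xs = \<tau>" "\<tau> \<in> L" shows "sp \<tau> = gprod xs"
proof -
  have "word_rel (\<Union>L) (raag_relators L) `` {map (\<lambda>x. (x, True)) xs | xs. distinct xs \<and> set xs = \<tau>} =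
    (\<Union>ys \<in> {ys. distinct ys \<and> set ys = \<tau>}. pclass (\<Union>L) (raag_relators L) (map (\<lambda>x. (x, True)) ys))"
    by auto
  also have "\<dots> = (\<Union>ys \<in> {ys. distinct ys \<and> set ys = \<tau>}. gprod xs)"
  proof (rule SUP_cong[OF HOL.refl])
    fix ys assume "ys \<in> {ys. distinct ys \<and> set ys = \<tau>}"
    then show "pclass (\<Union>L) (raag_relators L) (map (\<lambda>x. (x, True)) ys) = gprod xs"
      using pclass_gprod[of ys] gprod_perm[of ys xs] assms simplex_subset_V by auto
  qed
  also have "\<dots> = gprod xs" using assms by auto
  finally show ?thesis by (simp add: simplex_product_def)
qed

lemma simplex_list:
  assumes "\<tau> \<in> L" obtains xs where "distinct xs" "set xs = \<tau>" "set xs \<subseteq> V" "sp \<tau> = gprod xs"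
  using finite_distinct_list[OF finite_simplex[OF assms]] sp_gprod assms simplex_subset_V by metis

lemma sp_closed [simp]: "\<tau> \<in> L \<Longrightarrow> sp \<tau> \<in> AL"
  by (metis simplex_list gprod_closed)

lemma sp_empty [simp]: "sp {} = \<one>\<^sub>L"
  using sp_gprod[of "[]" "{}"] by simp

lemma sp_single [simp]: "x \<in> V \<Longrightarrow> sp {x} = gen x"
  using sp_gprod[of "[x]" "{x}"] vertex_simplex by simp

lemma sp_Un:
  assumes "\<sigma> \<union> \<tau> \<in> L" "\<sigma> \<inter> \<tau> = {}" shows "sp (\<sigma> \<union> \<tau>) = sp \<sigma> \<cdot> sp \<tau>"
proof -
  have L: "\<sigma> \<in> L" "\<tau> \<in> L" using assms(1) by (auto elim: simplex_subset)
  obtain xs where xs: "distinct xs" "set xs = \<sigma>" "set xs \<subseteq> V" "sp \<sigma> = gprod xs" using L simplex_list by blast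
  obtain ys where ys: "distinct ys" "set ys = \<tau>" "set ys \<subseteq> V" "sp \<tau> = gprod ys" using L simplex_list by blast
  have "sp (\<sigma> \<union> \<tau>) = gprod (xs @ ys)"
    by (rule sp_gprod) (use xs ys assms in auto)
  with xs ys show ?thesis by (simp add: gprod_append)
qed

lemma sp_partition:
  assumes "\<rho> \<in> L" "\<rho> = \<sigma> \<union> \<tau>" "\<sigma> \<inter> \<tau> = {}" shows "sp \<rho> = sp \<sigma> \<cdot> sp \<tau>"
  using assms sp_Un by simp

lemma expo_sp:
  assumes "\<tau> \<in> L" shows "expo (sp \<tau>) = (\<lambda>x. if x \<in> \<tau> then 1 else 0)"
  using finite_simplex[OF assms] assms
proof (induction \<tau> rule: finite_induct)
  case empty
  then show ?case by (simp add: expo_one_raag)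
next
  case (insert x \<tau>)
  have "\<tau> \<in> L" using insert.prems by (rule simplex_subset) auto
  moreover have "sp (insert x \<tau>) = sp {x} \<cdot> sp \<tau>"
    by (rule sp_partition) (use insert in auto)
  moreover have "x \<in> V" using insert.prems simplex_subset_V by auto
  ultimately show ?case
    using insert Union_L by (auto simp: expo_mult_raag expo_raag_gen unit_fun_def)
qed

section \<open>Characteristic maps and global coordinates\<close>

abbreviation CP :: "'v cover_point set" where "CP \<equiv> cover_points L"
abbreviation cm :: "'v word set \<Rightarrow> ('v \<Rightarrow> real) \<Rightarrow> 'v cover_point" where "cm \<equiv> char_map L"

definition ones :: "('v \<Rightarrow> real) \<Rightarrow> 'v set" where "ones s = {x. s x = 1}"
definition supp :: "('v \<Rightarrow> real) \<Rightarrow> 'v set" where "supp s = {x. s x \<noteq> 0}"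

lemma cm_def: "cm g s = (g \<cdot> sp (ones s), \<lambda>x. if s x = 1 then 0 else s x)"
  by (simp add: char_map_def ones_def)

lemma unit_cubeD: "s \<in> unit_cube \<sigma> \<Longrightarrow> 0 \<le> s x" "s \<in> unit_cube \<sigma> \<Longrightarrow> s x \<le> 1"
    "s \<in> unit_cube \<sigma> \<Longrightarrow> x \<notin> \<sigma> \<Longrightarrow> s x = 0"
  by (auto simp: unit_cube_def)

lemma ones_subset: "s \<in> unit_cube \<sigma> \<Longrightarrow> ones s \<subseteq> \<sigma>"
  by (auto simp: ones_def dest: unit_cubeD(3)[of s \<sigma>])

lemma ones_simplex: "s \<in> unit_cube \<sigma> \<Longrightarrow> \<sigma> \<in> L \<Longrightarrow> ones s \<in> L"
  using ones_subset simplex_subset by blast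

lemma mem_CP: "(g, t) \<in> CP \<longleftrightarrow> g \<in> AL \<and> (\<forall>x. 0 \<le> t x \<and> t x < 1) \<and> supp t \<in> L"
  by (auto simp: cover_points_def salvetti_points_def supp_def)

lemma cm_in_CP: "g \<in> AL \<Longrightarrow> \<sigma> \<in> L \<Longrightarrow> s \<in> unit_cube \<sigma> \<Longrightarrow> cm g s \<in> CP"
  unfolding cm_def mem_CP
proof (intro conjI allI)
  assume *: "g \<in> AL" "\<sigma> \<in> L" "s \<in> unit_cube \<sigma>"
  then show "g \<cdot> sp (ones s) \<in> AL" by (simp add: ones_simplex)
  show "supp (\<lambda>x. if s x = 1 then 0 else s x) \<in> L"
    using *(2) by (rule simplex_subset) (use *(3) in \<open>auto simp: supp_def dest: unit_cubeD(3)\<close>)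
  show "0 \<le> (if s x = 1 then 0 else s x)" "(if s x = 1 then 0 else s x) < 1" for x
    using unit_cubeD(1,2)[OF *(3), of x] by auto
qed

lemma point_in_cube: "(g, t) \<in> CP \<Longrightarrow> t \<in> unit_cube (supp t)" "(g, t) \<in> CP \<Longrightarrow> supp t \<in> L"
    "(g, t) \<in> CP \<Longrightarrow> cm g t = (g, t)"
proof -
  assume *: "(g, t) \<in> CP"
  show "t \<in> unit_cube (supp t)" using * by (fastforce simp: mem_CP unit_cube_def supp_def less_imp_le)
  show "supp t \<in> L" using * by (simp add: mem_CP)
  have "t x \<noteq> 1" for x using * by (metis mem_CP less_irrefl)
  then show "cm g t = (g, t)" using * by (simp add: cm_def ones_def mem_CP)
qed

text \<open>The developing map to Euclidean space: torus coordinates lifted by exponent sums. It is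
  isometric on every closed cube, so it does not increase lengths of chains and gives lower bounds
  on distances.\<close>

definition coord :: "'v cover_point \<Rightarrow> 'v \<Rightarrow> real" where
  "coord p = (\<lambda>x. of_int (expo (fst p) x) + snd p x)"

lemma coord_cm: "g \<in> AL \<Longrightarrow> \<sigma> \<in> L \<Longrightarrow> s \<in> unit_cube \<sigma> \<Longrightarrow> coord (cm g s) = (\<lambda>x. of_int (expo g x) + s x)"
  by (auto simp: coord_def cm_def expo_mult_raag expo_sp ones_simplex fun_eq_iff) (simp_all add: ones_def)

lemma cube_dist_L2: "cube_dist L s t = L2_set (\<lambda>x. s x - t x) V"
  by (simp add: cube_dist_def L2_set_def Union_L)

lemma cube_dist_nonneg [simp]: "0 \<le> cube_dist L s t"
  by (simp add: cube_dist_L2 L2_set_nonneg)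

lemma cube_dist_sym: "cube_dist L s t = cube_dist L t s"
  by (simp add: cube_dist_def power2_commute)

lemma cube_dist_triangle: "cube_dist L s u \<le> cube_dist L s t + cube_dist L t u"
  using L2_set_triangle_ineq[of "\<lambda>x. s x - t x" "\<lambda>x. t x - u x" V] by (simp add: cube_dist_L2)

lemma cube_dist_component: "x \<in> V \<Longrightarrow> \<bar>s x - t x\<bar> \<le> cube_dist L s t"
  unfolding cube_dist_L2 using member_le_L2_set[OF finite_V, of x "\<lambda>x. \<bar>s x - t x\<bar>"]
  by (simp add: L2_set_def)

lemma cube_dist_refl [simp]: "cube_dist L s s = 0"
  by (simp add: cube_dist_def)

lemma cube_dist_translate: "cube_dist L (\<lambda>x. c x + s x) (\<lambda>x. c x + t x) = cube_dist L s t"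
  by (simp add: cube_dist_def)

section \<open>Chains of points in common cubes\<close>

definition step :: "'v cover_point \<Rightarrow> 'v cover_point \<Rightarrow> real \<Rightarrow> bool" where
  "step = (\<lambda>p q b. \<exists>g\<in>AL. \<exists>\<sigma>\<in>L. \<exists>s\<in>unit_cube \<sigma>. \<exists>t\<in>unit_cube \<sigma>.
     p = cm g s \<and> q = cm g t \<and> b = cube_dist L s t)"

abbreviation chain :: "'v cover_point \<Rightarrow> 'v cover_point \<Rightarrow> real \<Rightarrow> bool" where
  "chain \<equiv> string_length step"

lemma step_sym: "step p q b \<Longrightarrow> step q p b"
  unfolding step_def using cube_dist_sym by metis

lemma step_nonneg: "step p q b \<Longrightarrow> 0 \<le> b"
  unfolding step_def by auto

lemma chain_nonneg: "chain p q l \<Longrightarrow> 0 \<le> l"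
  by (induction rule: string_length.induct) (auto dest: step_nonneg)

lemma chain_append: "chain q r m \<Longrightarrow> chain p q l \<Longrightarrow> chain p r (l + m)"
proof (induction rule: string_length.induct)
  case (2 x y a z b)
  from string_length.intros(2)[OF 2(3)[OF 2(4)] 2(2)] show ?case by (simp add: add.assoc)
qed simp

lemma chain_step: "step p q b \<Longrightarrow> chain p q b"
  using string_length.intros(2)[OF string_length.intros(1), of step p q b] by simp

lemma chain_sym: "chain p q l \<Longrightarrow> chain q p l"
proof (induction rule: string_length.induct)
  case (2 x y a z b)
  from chain_append[OF 2(3) chain_step[OF step_sym[OF 2(2)]]] show ?case by (simp add: add.commute)
qed (rule string_length.intros)

lemma chain_coord: "chain p q l \<Longrightarrow> cube_dist L (coord p) (coord q) \<le> l"
proof (induction rule: string_length.induct)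
  case (2 x y a z b)
  from 2(2) obtain g \<sigma> s t where *: "g \<in> AL" "\<sigma> \<in> L" "s \<in> unit_cube \<sigma>" "t \<in> unit_cube \<sigma>"
     "y = cm g s" "z = cm g t" "b = cube_dist L s t" unfolding step_def by blast
  then have "cube_dist L (coord y) (coord z) = b"
    by (simp add: coord_cm[OF *(1-3)] coord_cm[OF *(1,2,4)] cube_dist_translate)
  with 2(3) cube_dist_triangle[of "coord x" "coord z" "coord y"] show ?case by simp
qed simp

lemma chain_to_vertex: assumes "(g, t) \<in> CP" shows "\<exists>l. chain (g, \<lambda>_. 0) (g, t) l"
proof -
  have z: "(\<lambda>_. 0) \<in> unit_cube \<sigma>" for \<sigma> :: "'v set" by (simp add: unit_cube_def)
  have g: "g \<in> AL" using assms by (simp add: mem_CP)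
  have "cm g (\<lambda>_. 0) = (g, \<lambda>_. 0)" using g by (simp add: cm_def ones_def)
  then have "step (g, \<lambda>_. 0) (g, t) (cube_dist L (\<lambda>_. 0) t)"
    unfolding step_def using g z point_in_cube[OF assms] by metis
  then show ?thesis using chain_step by blast
qed

lemma cm_edge: assumes "g \<in> AL" "x \<in> V"
  shows "edge_point x r \<in> unit_cube {x} \<longleftrightarrow> 0 \<le> r \<and> r \<le> 1"
    "cm g (edge_point x 0) = (g, \<lambda>_. 0)" "cm g (edge_point x 1) = (g \<cdot> gen x, \<lambda>_. 0)"
proof -
  show "edge_point x r \<in> unit_cube {x} \<longleftrightarrow> 0 \<le> r \<and> r \<le> 1"
    by (auto simp: unit_cube_def edge_point_def)
  have "ones (edge_point x 0) = {}" "ones (edge_point x 1) = {x}"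
    by (auto simp: ones_def edge_point_def)
  then show "cm g (edge_point x 0) = (g, \<lambda>_. 0)" "cm g (edge_point x 1) = (g \<cdot> gen x, \<lambda>_. 0)"
    using assms by (auto simp: cm_def) (auto simp: edge_point_def)
qed

lemma chain_edge: assumes "g \<in> AL" "x \<in> V" shows "\<exists>l. chain (g, \<lambda>_. 0) (g \<cdot> gen x, \<lambda>_. 0) l"
proof -
  have "step (cm g (edge_point x 0)) (cm g (edge_point x 1)) (cube_dist L (edge_point x 0) (edge_point x 1))"
    unfolding step_def using assms vertex_simplex[OF assms(2)] cm_edge(1)[OF assms] by fastforce
  from chain_step[OF this] show ?thesis unfolding cm_edge(2,3)[OF assms] by blast
qed

lemma chain_from_one: "g \<in> AL \<Longrightarrow> \<exists>l. chain (\<one>\<^sub>L, \<lambda>_. 0) (g, \<lambda>_. 0) l"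
proof (induction g rule: raag_induct)
  case one
  show ?case by (rule exI, rule string_length.intros(1))
next
  case (mult g x)
  then show ?case using chain_edge[of g x] chain_append Union_L by blast
next
  case (inv_mult g x)
  then have *: "x \<in> V" "g \<in> AL" "g \<cdot> ainv (gen x) \<in> AL" using Union_L by auto
  then have "g \<cdot> ainv (gen x) \<cdot> gen x = g" by (simp add: A.m_assoc)
  with chain_edge[OF *(3,1)] obtain l where "chain (g \<cdot> ainv (gen x), \<lambda>_. 0) (g, \<lambda>_. 0) l" by auto
  then show ?case using inv_mult chain_append chain_sym by blast
qed

lemma chain_exists: assumes "p \<in> CP" "q \<in> CP" shows "\<exists>l. chain p q l"
proof -
  have "\<exists>l. chain (\<one>\<^sub>L, \<lambda>_. 0) r l" if "r \<in> CP" for r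
  proof -
    have r: "(fst r, snd r) \<in> CP" using that by simp
    then have "fst r \<in> AL" unfolding mem_CP by simp
    from chain_from_one[OF this] obtain l where l: "chain (\<one>\<^sub>L, \<lambda>_. 0) (fst r, \<lambda>_. 0) l" ..
    from chain_to_vertex[OF r] obtain m where "chain (fst r, \<lambda>_. 0) (fst r, snd r) m" ..
    from chain_append[OF this l] show ?thesis by auto
  qed
  then obtain l m where "chain (\<one>\<^sub>L, \<lambda>_. 0) p l" "chain (\<one>\<^sub>L, \<lambda>_. 0) q m" using assms by meson
  from chain_append[OF this(2) chain_sym[OF this(1)]] show ?thesis ..
qed

text \<open>The open star of the vertex \<open>h\<close>: the point with signed displacement \<open>w\<close> from \<open>h\<close>.\<close>

definition star :: "'v word set \<Rightarrow> ('v \<Rightarrow> real) \<Rightarrow> 'v cover_point" where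
  "star h w = (h \<cdot> ainv (sp {x. w x < 0}), \<lambda>x. if w x < 0 then w x + 1 else w x)"

text \<open>Moving by \<open>t - s\<close> inside one cube changes the displacement from
  \<open>h\<close> by the same vector, as long as no entry reaches absolute value 1, that is, as
  long as the point stays in the open star of \<open>h\<close>.\<close>

lemma star_step:
  assumes h: "h \<in> AL" and w: "supp w \<in> L" "\<And>x. \<bar>w x\<bar> < 1"
    and g: "g \<in> AL" and \<sigma>: "\<sigma> \<in> L" and s: "s \<in> unit_cube \<sigma>" and t: "t \<in> unit_cube \<sigma>"
    and eq: "star h w = cm g s" and w': "\<And>x. \<bar>w x + (t x - s x)\<bar> < 1"
  shows "star h (\<lambda>x. w x + (t x - s x)) = cm g t" "supp (\<lambda>x. w x + (t x - s x)) \<in> L"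
proof -
  \<comment> \<open>\<open>s - w\<close> is the position of \<open>h\<close> in the coordinates of
    the cube, so its entries are 0 or 1 and \<open>h\<close> is the corner
    \<open>g \<cdot> sp C\<close>. Splitting \<open>C\<close> once by \<open>s\<close> and
    \<open>w\<close> and once by \<open>t\<close> and \<open>w1\<close> gives two expressions for
    the same corner.\<close>
  define C where "C = {x. s x - w x = 1}"
  define w1 where "w1 = (\<lambda>x. w x + (t x - s x))"
  have tor: "(if s x = 1 then 0 else s x) = (if w x < 0 then w x + 1 else w x)" for x
    using eq by (auto simp: star_def cm_def fun_eq_iff)
  have c: "s x - w x = 1 \<or> s x - w x = 0" for x
    using tor[of x] unit_cubeD(1,2)[OF s, of x] w(2)[of x] by (auto split: if_splits)
  have C1: "C = ones s \<union> {x. w x < 0}" "ones s \<inter> {x. w x < 0} = {}"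
  proof -
    have "x \<in> C \<longleftrightarrow> s x = 1 \<or> w x < 0" for x
      unfolding C_def using tor[of x] unit_cubeD(1,2)[OF s, of x] w(2)[of x] by (auto split: if_splits)
    moreover have "\<not> (s x = 1 \<and> w x < 0)" for x
      using tor[of x] unit_cubeD(1,2)[OF s, of x] w(2)[of x] by (auto split: if_splits)
    ultimately show "C = ones s \<union> {x. w x < 0}" "ones s \<inter> {x. w x < 0} = {}"
      by (auto simp: ones_def)
  qed
  have C2: "C = ones t \<union> {x. w1 x < 0}" "ones t \<inter> {x. w1 x < 0} = {}"
  proof -
    have "x \<in> C \<longleftrightarrow> t x = 1 \<or> w1 x < 0" for x
      unfolding C_def w1_def using c[of x] w'[of x] unit_cubeD(1,2)[OF t, of x] by auto
    moreover have "\<not> (t x = 1 \<and> w1 x < 0)" for x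
      unfolding w1_def using c[of x] w'[of x] unit_cubeD(1,2)[OF t, of x] by auto
    ultimately show "C = ones t \<union> {x. w1 x < 0}" "ones t \<inter> {x. w1 x < 0} = {}"
      by (auto simp: ones_def)
  qed
  have "{x. w x < 0} \<subseteq> \<sigma>"
  proof
    fix x assume "x \<in> {x. w x < 0}"
    then show "x \<in> \<sigma>" using tor[of x] unit_cubeD(3)[OF s, of x] w(2)[of x] by (auto split: if_splits)
  qed
  then have "C \<subseteq> \<sigma>" using C1(1) ones_subset[OF s] by blast
  then have CL: "C \<in> L" using \<sigma> simplex_subset by blast
  have negL: "{x. w x < 0} \<in> L" "{x. w1 x < 0} \<in> L" "ones s \<in> L" "ones t \<in> L"
    using C1 C2 CL by (auto intro: simplex_subset)
  have "h \<cdot> ainv (sp {x. w x < 0}) = g \<cdot> sp (ones s)"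
    using eq by (simp add: star_def cm_def)
  then have "h = g \<cdot> sp (ones s) \<cdot> sp {x. w x < 0}"
    by (metis A.inv_solve_right' A.m_closed g h negL(1) negL(3) sp_closed)
  also have "\<dots> = g \<cdot> sp C"
    using sp_partition[OF CL C1] g negL by (simp add: A.m_assoc)
  also have "\<dots> = g \<cdot> sp (ones t) \<cdot> sp {x. w1 x < 0}"
    using sp_partition[OF CL C2] g negL by (simp add: A.m_assoc)
  finally have "h \<cdot> ainv (sp {x. w1 x < 0}) = g \<cdot> sp (ones t)"
    using g negL by (simp add: A.m_assoc)
  moreover have "(if w1 x < 0 then w1 x + 1 else w1 x) = (if t x = 1 then 0 else t x)" for x
    unfolding w1_def using c[of x] w'[of x] unit_cubeD(1,2)[OF t, of x] by auto
  ultimately show "star h (\<lambda>x. w x + (t x - s x)) = cm g t"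
    unfolding w1_def[symmetric] by (simp add: star_def cm_def)
  have "w1 x = 0" if "x \<notin> \<sigma>" for x
    using that tor[of x] w(2)[of x] unit_cubeD(3)[OF s, of x] unit_cubeD(3)[OF t, of x]
    by (auto simp: w1_def split: if_splits)
  then have "supp w1 \<subseteq> \<sigma>" by (auto simp: supp_def)
  then show "supp (\<lambda>x. w x + (t x - s x)) \<in> L"
    using simplex_subset[OF \<sigma>] by (simp add: w1_def)
qed

text \<open>Rounding each torus coordinate to the nearest integer selects the vertex; coordinates
  above 1/2 are counted back from the far end of their edge.\<close>

lemma star_exists:
  assumes "p \<in> CP"
  obtains h w where "h \<in> AL" "supp w \<in> L" "\<And>x. \<bar>w x\<bar> \<le> 1 / 2" "p = star h w"
proof -
  obtain g t where p: "p = (g, t)" by (cases p)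
  define T where "T = {x. t x > 1/2}"
  define w where "w = (\<lambda>x. if t x > 1/2 then t x - 1 else t x)"
  have t: "g \<in> AL" "\<And>x. 0 \<le> t x" "\<And>x. t x < 1" "supp t \<in> L" using assms by (auto simp: p mem_CP)
  have TL: "T \<in> L" using t(4) by (rule simplex_subset) (auto simp: T_def supp_def)
  have "w x < 0 \<longleftrightarrow> t x > 1/2" for x using t(2,3)[of x] by (auto simp: w_def)
  then have neg: "{x. w x < 0} = T" by (simp add: T_def)
  show ?thesis
  proof
    show "g \<cdot> sp T \<in> AL" using t TL by simp
    show "supp w \<in> L" using t(4) by (rule simplex_subset) (auto simp: w_def supp_def split: if_splits)
    show "\<bar>w x\<bar> \<le> 1/2" for x using t(2,3)[of x] by (auto simp: w_def)
    have "(if w x < 0 then w x + 1 else w x) = t x" for x using t(2,3)[of x] by (auto simp: w_def)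
    then show "p = star (g \<cdot> sp T) w"
      using t TL by (simp add: p star_def neg A.m_assoc)
  qed
qed

text \<open>The bound 1/2 is spent twice: the start is displaced by at most 1/2 and the chain is
  shorter than 1/2, so every intermediate displacement stays below 1 and \<open>star_step\<close>
  applies throughout.\<close>

lemma chain_star:
  assumes "chain p q l" "l < 1 / 2" "p = star h w" "h \<in> AL" "supp w \<in> L" "\<And>x. \<bar>w x\<bar> \<le> 1 / 2"
  shows "\<exists>w'. q = star h w' \<and> supp w' \<in> L \<and> (\<forall>x. \<bar>w' x - w x\<bar> \<le> l)"
  using assms
proof (induction rule: string_length.induct)
  case (1 x)
  then show ?case by (intro exI[of _ w]) simp
next
  case (2 x y a z b)
  from 2(2) obtain g \<sigma> s t where *: "g \<in> AL" "\<sigma> \<in> L" "s \<in> unit_cube \<sigma>" "t \<in> unit_cube \<sigma>"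
     "y = cm g s" "z = cm g t" "b = cube_dist L s t" unfolding step_def by blast
  have b: "0 \<le> b" using * by simp
  with 2 obtain w1 where w1: "y = star h w1" "supp w1 \<in> L" "\<And>x. \<bar>w1 x - w x\<bar> \<le> a"
    by fastforce
  have st: "\<bar>t x - s x\<bar> \<le> b" for x
  proof (cases "x \<in> V")
    case True
    then show ?thesis using cube_dist_component[of x s t] * by (simp add: abs_minus_commute)
  next
    case False
    then have "x \<notin> \<sigma>" using *(2) simplex_subset_V by blast
    then have "s x = 0" "t x = 0" using *(3,4) by (simp_all add: unit_cubeD(3))
    then show ?thesis using b by simp
  qed
  have w1': "\<bar>w1 x\<bar> < 1" for x
    using w1(3)[of x] \<open>\<And>x. \<bar>w x\<bar> \<le> 1/2\<close>[of x] \<open>a + b < 1/2\<close> b by linarith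
  have w2': "\<bar>w1 x + (t x - s x)\<bar> < 1" for x
    using w1(3)[of x] \<open>\<And>x. \<bar>w x\<bar> \<le> 1/2\<close>[of x] \<open>a + b < 1/2\<close> st[of x] by linarith
  note ss = star_step[OF \<open>h \<in> AL\<close> w1(2) w1' *(1-4) _ w2']
  have "star h w1 = cm g s" using w1 * by simp
  note ss = ss[OF this]
  show ?case
  proof (intro exI conjI allI)
    show "z = star h (\<lambda>x. w1 x + (t x - s x))" using ss(1) * by simp
    show "supp (\<lambda>x. w1 x + (t x - s x)) \<in> L" by (rule ss(2))
    show "\<bar>w1 x + (t x - s x) - w x\<bar> \<le> a + b" for x
      using w1(3)[of x] st[of x] by linarith
  qed
qed

lemma coord_star:
  assumes "h \<in> AL" "supp w \<in> L" shows "coord (star h w) = (\<lambda>x. of_int (expo h x) + w x)"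
proof -
  have "{x. w x < 0} \<in> L" using assms(2) by (rule simplex_subset) (auto simp: supp_def)
  then show ?thesis
    using assms(1) by (auto simp: coord_def star_def expo_mult_raag expo_inv_raag expo_sp fun_eq_iff)
qed

text \<open>A short chain stays in the open star of one vertex, where a point is determined by its
  coordinates.\<close>

lemma short_chain_eq:
  assumes "chain p q l" "l < 1 / 2" "p \<in> CP" "\<And>x. x \<in> V \<Longrightarrow> coord p x = coord q x"
  shows "p = q"
proof -
  obtain h w where hw: "h \<in> AL" "supp w \<in> L" "\<And>x. \<bar>w x\<bar> \<le> 1 / 2" "p = star h w"
    using assms(3) by (rule star_exists) blast
  obtain w' where w': "q = star h w'" "supp w' \<in> L"
    using chain_star[OF assms(1,2) hw(4,1,2,3)] by blast
  have "w x = w' x" for x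
  proof (cases "x \<in> V")
    case True
    then show ?thesis using assms(4)[OF True] hw w' by (simp add: coord_star)
  next
    case False
    then have "x \<notin> supp w" "x \<notin> supp w'" using hw w' simplex_subset_V by blast+
    then show ?thesis by (simp add: supp_def)
  qed
  then have "w = w'" by blast
  then show ?thesis using hw w' by simp
qed

section \<open>The length metric\<close>

definition cdist :: "'v cover_point \<Rightarrow> 'v cover_point \<Rightarrow> real" where
  "cdist p q = Inf {l. chain p q l}"

lemma cdist_le: "chain p q l \<Longrightarrow> cdist p q \<le> l"
  unfolding cdist_def by (rule cInf_lower) (auto intro!: bdd_belowI[of _ 0] chain_nonneg)

lemma cdist_less: assumes "p \<in> CP" "q \<in> CP" "cdist p q < e" shows "\<exists>l<e. chain p q l"
  using assms cInf_lessD[of "{l. chain p q l}" e] chain_exists[OF assms(1,2)]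
  by (auto simp: cdist_def)

lemma cdist_sym: "cdist p q = cdist q p"
proof -
  have "{l. chain p q l} = {l. chain q p l}" using chain_sym by blast
  then show ?thesis by (simp add: cdist_def)
qed

lemma cdist_nonneg: "p \<in> CP \<Longrightarrow> q \<in> CP \<Longrightarrow> 0 \<le> cdist p q"
  unfolding cdist_def using chain_exists by (intro cInf_greatest) (auto dest: chain_nonneg)

lemma cdist_coord: "p \<in> CP \<Longrightarrow> q \<in> CP \<Longrightarrow> cube_dist L (coord p) (coord q) \<le> cdist p q"
  unfolding cdist_def using chain_exists by (intro cInf_greatest) (auto dest: chain_coord)

lemma cdist_triangle: assumes "p \<in> CP" "q \<in> CP" "r \<in> CP" shows "cdist p r \<le> cdist p q + cdist q r"
proof (rule field_le_epsilon)
  fix e :: real assume "0 < e"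
  then obtain l m where "chain p q l" "l < cdist p q + e/2" "chain q r m" "m < cdist q r + e/2"
    using cdist_less[OF assms(1,2), of "cdist p q + e/2"] cdist_less[OF assms(2,3), of "cdist q r + e/2"] by auto
  then show "cdist p r \<le> cdist p q + cdist q r + e"
    using cdist_le[OF chain_append, of q r m p l] by simp
qed

lemma cdist_refl [simp]: "p \<in> CP \<Longrightarrow> cdist p p = 0"
  using cdist_le[of p p 0] cdist_nonneg[of p p] string_length.intros(1)[of step p] by force

lemma cdist_short_eq:
  assumes "p \<in> CP" "q \<in> CP" "cdist p q < 1 / 2" "\<And>x. x \<in> V \<Longrightarrow> coord p x = coord q x"
  shows "p = q"
  using cdist_less[OF assms(1-3)] short_chain_eq[OF _ _ assms(1,4)] by blast

lemma cdist_eq_0: assumes "p \<in> CP" "q \<in> CP" "cdist p q = 0" shows "p = q"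
proof (rule cdist_short_eq[OF assms(1,2)])
  show "coord p x = coord q x" if "x \<in> V" for x
    using cube_dist_component[OF that, of "coord p" "coord q"] cdist_coord[OF assms(1,2)] assms(3) by simp
qed (use assms in simp)

abbreviation SC :: "'v cover_point metric" where "SC \<equiv> salvetti_cover L"

lemma metric_cdist: "Metric_space CP (\<lambda>x y. if x \<in> CP \<and> y \<in> CP then cdist x y else 0)"
proof
  show "0 \<le> (if x \<in> CP \<and> y \<in> CP then cdist x y else 0)" for x y by (simp add: cdist_nonneg)
  show "(if x \<in> CP \<and> y \<in> CP then cdist x y else 0) = (if y \<in> CP \<and> x \<in> CP then cdist y x else 0)" for x y
    by (simp add: cdist_sym conj_commute)
  show "((if x \<in> CP \<and> y \<in> CP then cdist x y else 0) = 0) = (x = y)" if "x \<in> CP" "y \<in> CP" for x y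
    using that cdist_eq_0[OF that] by (metis cdist_refl)
  show "(if x \<in> CP \<and> z \<in> CP then cdist x z else 0) \<le> (if x \<in> CP \<and> y \<in> CP then cdist x y else 0) +
    (if y \<in> CP \<and> z \<in> CP then cdist y z else 0)" if "x \<in> CP" "y \<in> CP" "z \<in> CP" for x y z
    using that cdist_triangle by simp
qed

lemma SC_def: "SC = metric (CP, \<lambda>x y. if x \<in> CP \<and> y \<in> CP then cdist x y else 0)"
  unfolding salvetti_cover_def mk_metric_def cdist_def step_def ..

lemma mspace_SC [simp]: "mspace SC = CP"
  unfolding SC_def by (rule Metric_space.mspace_metric[OF metric_cdist])

lemma mdist_SC: "p \<in> CP \<Longrightarrow> q \<in> CP \<Longrightarrow> mdist SC p q = cdist p q"
  unfolding SC_def by (simp add: Metric_space.mdist_metric[OF metric_cdist])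

text \<open>Upper bound: a chain with one step. Lower bound: \<open>coord\<close> is isometric on
  the cube.\<close>

lemma cdist_cube:
  assumes "g \<in> AL" "\<sigma> \<in> L" "s \<in> unit_cube \<sigma>" "t \<in> unit_cube \<sigma>"
  shows "cdist (cm g s) (cm g t) = cube_dist L s t"
proof (rule antisym)
  have "step (cm g s) (cm g t) (cube_dist L s t)" unfolding step_def using assms by blast
  then show "cdist (cm g s) (cm g t) \<le> cube_dist L s t" using chain_step cdist_le by blast
  show "cube_dist L s t \<le> cdist (cm g s) (cm g t)"
    using cdist_coord[OF cm_in_CP[OF assms(1-3)] cm_in_CP[OF assms(1,2,4)]]
    by (simp add: coord_cm[OF assms(1-3)] coord_cm[OF assms(1,2,4)] cube_dist_translate)
qed

lemma vertex_in_CP [simp]: "(g, \<lambda>_. 0) \<in> CP \<longleftrightarrow> g \<in> AL"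
  by (simp add: mem_CP supp_def)

text \<open>Vertices have integral coordinates. Below distance 1/2 the coordinates agree, and a
  short chain can join only equal points with equal coordinates.\<close>

lemma vertices_separated:
  assumes "g \<in> AL" "h \<in> AL" "cdist (g, \<lambda>_. 0) (h, \<lambda>_. 0) < 1 / 2" shows "g = h"
proof -
  have "(g, (\<lambda>_. 0) :: 'v \<Rightarrow> real) = (h, \<lambda>_. 0)"
  proof (rule cdist_short_eq)
    fix x assume "x \<in> V"
    then have "\<bar>coord (g, \<lambda>_. 0) x - coord (h, \<lambda>_. 0) x\<bar> < 1 / 2"
      using cube_dist_component[of x "coord (g, \<lambda>_. 0)" "coord (h, \<lambda>_. 0)"]
        cdist_coord[of "(g, \<lambda>_. 0)" "(h, \<lambda>_. 0)"] assms by simp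
    then have "\<bar>real_of_int (expo g x - expo h x)\<bar> < 1 / 2" by (simp add: coord_def)
    then have "expo g x = expo h x" by linarith
    then show "coord (g, \<lambda>_. 0) x = coord (h, \<lambda>_. 0) x" by (simp add: coord_def)
  qed (use assms in auto)
  then show ?thesis by simp
qed

section \<open>Translations by the Artin group\<close>

definition trans :: "'v word set \<Rightarrow> 'v cover_point \<Rightarrow> 'v cover_point" where
  "trans n p = (n \<cdot> fst p, snd p)"

lemma trans_CP [simp]: "n \<in> AL \<Longrightarrow> p \<in> CP \<Longrightarrow> trans n p \<in> CP"
  by (cases p) (simp add: trans_def mem_CP)

lemma trans_cm: "n \<in> AL \<Longrightarrow> g \<in> AL \<Longrightarrow> \<sigma> \<in> L \<Longrightarrow> s \<in> unit_cube \<sigma> \<Longrightarrow> trans n (cm g s) = cm (n \<cdot> g) s"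
  by (simp add: trans_def cm_def A.m_assoc ones_simplex)

lemma trans_trans: "n \<in> AL \<Longrightarrow> m \<in> AL \<Longrightarrow> p \<in> CP \<Longrightarrow> trans n (trans m p) = trans (n \<cdot> m) p"
  by (cases p) (simp add: trans_def A.m_assoc mem_CP)

lemma trans_one [simp]: "p \<in> CP \<Longrightarrow> trans \<one>\<^sub>L p = p"
  by (cases p) (simp add: trans_def mem_CP)

lemma chain_map:
  assumes "\<And>p q b. step p q b \<Longrightarrow> step (f p) (f q) b" "chain p q l" shows "chain (f p) (f q) l"
  using assms(2) by induction (auto intro: string_length.intros assms(1))

lemma step_trans: "n \<in> AL \<Longrightarrow> step p q b \<Longrightarrow> step (trans n p) (trans n q) b"
  unfolding step_def using trans_cm A.m_closed by metis

lemma cdist_map_le: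
  assumes "\<And>p q b. step p q b \<Longrightarrow> step (f p) (f q) b" "p \<in> CP" "q \<in> CP"
  shows "cdist (f p) (f q) \<le> cdist p q"
proof (rule field_le_epsilon)
  fix e :: real assume "0 < e"
  then obtain l where "l < cdist p q + e" "chain p q l" using cdist_less[OF assms(2,3), of "cdist p q + e"] by auto
  then show "cdist (f p) (f q) \<le> cdist p q + e" using cdist_le chain_map[of f, OF assms(1)] by fastforce
qed

lemma cdist_trans:
  assumes n: "n \<in> AL" and p: "p \<in> CP" and q: "q \<in> CP" shows "cdist (trans n p) (trans n q) = cdist p q"
proof (rule antisym)
  show "cdist (trans n p) (trans n q) \<le> cdist p q"
    by (rule cdist_map_le[OF step_trans[OF n] p q])
  have "cdist (trans (ainv n) (trans n p)) (trans (ainv n) (trans n q)) \<le> cdist (trans n p) (trans n q)"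
    by (rule cdist_map_le[OF step_trans]) (use assms in auto)
  then show "cdist p q \<le> cdist (trans n p) (trans n q)"
    using assms by (simp add: trans_trans)
qed

text \<open>A translation shifts each coordinate by the integer \<open>expo n x\<close>; a shift
  below 1/2 vanishes, and then the point is fixed. The constant is the same for all points, which is
  what makes the comparison of two lifts uniform.\<close>

lemma trans_separated:
  assumes "n \<in> AL" "p \<in> CP" "cdist p (trans n p) < 1 / 2" shows "n = \<one>\<^sub>L"
proof -
  have pA: "fst p \<in> AL" using assms(2) by (cases p) (simp add: mem_CP)
  have "p = trans n p"
  proof (rule cdist_short_eq)
    fix x assume "x \<in> V"
    then have "\<bar>coord p x - coord (trans n p) x\<bar> < 1 / 2"
      using cube_dist_component[of x "coord p" "coord (trans n p)"]
        cdist_coord[of p "trans n p"] assms by simp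
    then have "\<bar>real_of_int (expo n x)\<bar> < 1 / 2" using assms pA by (simp add: coord_def trans_def expo_mult_raag)
    then have "expo n x = 0" by linarith
    then show "coord p x = coord (trans n p) x" using assms pA by (simp add: coord_def trans_def expo_mult_raag)
  qed (use assms in auto)
  then have "n \<cdot> fst p = \<one>\<^sub>L \<cdot> fst p" using pA by (cases p) (simp add: trans_def)
  then show ?thesis using assms(1) pA by (metis A.one_closed A.right_cancel)
qed

end

section \<open>Groups of bijections\<close>

lemma BijGroup_simps [simp]:
  "carrier (BijGroup S) = Bij S"
  "f \<in> Bij S \<Longrightarrow> g \<in> Bij S \<Longrightarrow> f \<otimes>\<^bsub>BijGroup S\<^esub> g = compose S f g"
  "\<one>\<^bsub>BijGroup S\<^esub> = (\<lambda>x\<in>S. x)"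
  by (simp_all add: BijGroup_def)

lemma BijGroup_inv:
  assumes f: "f \<in> Bij S" shows "inv\<^bsub>BijGroup S\<^esub> f = restrict (inv_into S f) S"
proof (rule group.inv_equality[OF group_BijGroup])
  note r = restrict_inv_into_Bij[OF f]
  show "restrict (inv_into S f) S \<otimes>\<^bsub>BijGroup S\<^esub> f = \<one>\<^bsub>BijGroup S\<^esub>"
    unfolding BijGroup_simps(2)[OF r f] BijGroup_simps(3) by (rule Bij_compose_restrict_eq[OF f])
  show "f \<in> carrier (BijGroup S)" "restrict (inv_into S f) S \<in> carrier (BijGroup S)"
    using f r by simp_all
qed

lemma Bij_mem: "f \<in> Bij S \<Longrightarrow> x \<in> S \<Longrightarrow> f x \<in> S"
  by (rule funcset_mem[OF Bij_imp_funcset])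

lemma Bij_surj: assumes "f \<in> Bij S" "y \<in> S" obtains x where "x \<in> S" "f x = y"
proof -
  have "y \<in> f ` S" using assms by (simp add: Bij_def bij_betw_def)
  then show ?thesis using that by blast
qed

lemma Bij_inj: "f \<in> Bij S \<Longrightarrow> x \<in> S \<Longrightarrow> y \<in> S \<Longrightarrow> f x = f y \<longleftrightarrow> x = y"
  by (auto simp: Bij_def bij_betw_def dest: inj_onD)

lemma Bij_eqI: "f \<in> Bij S \<Longrightarrow> g \<in> Bij S \<Longrightarrow> (\<And>x. x \<in> S \<Longrightarrow> f x = g x) \<Longrightarrow> f = g"
  by (auto simp: Bij_def intro: extensionalityI)

lemma BijI:
  assumes "f \<in> extensional S" "\<And>x. x \<in> S \<Longrightarrow> f x \<in> S" "\<And>x. x \<in> S \<Longrightarrow> g x \<in> S"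
    "\<And>x. x \<in> S \<Longrightarrow> f (g x) = x" "\<And>x. x \<in> S \<Longrightarrow> g (f x) = x"
  shows "f \<in> Bij S"
  unfolding Bij_def using assms by (auto intro!: bij_betwI[where g = g])

lemma subgroup_BijGroupI:
  assumes "C \<subseteq> Bij S" "(\<lambda>x\<in>S. x) \<in> C" "\<And>f g. f \<in> C \<Longrightarrow> g \<in> C \<Longrightarrow> compose S f g \<in> C"
    "\<And>f. f \<in> C \<Longrightarrow> restrict (inv_into S f) S \<in> C"
  shows "subgroup C (BijGroup S)"
proof (rule group.subgroupI[OF group_BijGroup])
  show "inv\<^bsub>BijGroup S\<^esub> f \<in> C" if "f \<in> C" for f
    using assms that by (auto simp: BijGroup_inv subset_iff)
  show "f \<otimes>\<^bsub>BijGroup S\<^esub> g \<in> C" if "f \<in> C" "g \<in> C" for f g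
    using assms that by (auto simp: subset_iff)
qed (use assms in auto)

lemma inv_into_Bij: "f \<in> Bij S \<Longrightarrow> y \<in> S \<Longrightarrow> inv_into S f y \<in> S \<and> f (inv_into S f y) = y"
  by (simp add: Bij_def bij_betw_def f_inv_into_f inv_into_into)

lemma Bij_inv_left: "f \<in> Bij S \<Longrightarrow> x \<in> S \<Longrightarrow> restrict (inv_into S f) S (f x) = x"
  using Bij_mem[of f S x] by (simp add: Bij_def bij_betw_def)

definition isometries :: "'a metric \<Rightarrow> ('a \<Rightarrow> 'a) set" where
  "isometries X = {f \<in> Bij (mspace X). \<forall>x\<in>mspace X. \<forall>y\<in>mspace X. mdist X (f x) (f y) = mdist X x y}"

lemma carrier_isom_group [simp]: "carrier (isom_group X) = isometries X"
  by (simp add: isom_group_def isometries_def)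

lemma isom_group_eq: "isom_group X = (BijGroup (mspace X))\<lparr>carrier := isometries X\<rparr>"
  by (simp add: isom_group_def isometries_def)

lemma subgroup_isometries: "subgroup (isometries X) (BijGroup (mspace X))"
proof (rule subgroup_BijGroupI)
  fix f assume f: "f \<in> isometries X"
  then have fB: "f \<in> Bij (mspace X)" by (simp add: isometries_def)
  have "mdist X (inv_into (mspace X) f x) (inv_into (mspace X) f y) = mdist X x y"
    if "x \<in> mspace X" "y \<in> mspace X" for x y
    using inv_into_Bij[OF fB that(1)] inv_into_Bij[OF fB that(2)] f unfolding isometries_def by force
  then show "restrict (inv_into (mspace X) f) (mspace X) \<in> isometries X"
    using restrict_inv_into_Bij[OF fB] by (simp add: isometries_def)
qed (auto simp: isometries_def id_Bij compose_Bij compose_eq Bij_mem)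

lemma group_isom_group: "group (isom_group X)"
  unfolding isom_group_eq by (rule subgroup.subgroup_is_group[OF subgroup_isometries group_BijGroup])

section \<open>Automorphisms of the universal cover\<close>

context flag
begin

section \<open>Closed cubes and isometries between them\<close>

definition cube :: "'v word set \<Rightarrow> 'v set \<Rightarrow> 'v cover_point set" where
  "cube g \<sigma> = cm g ` unit_cube \<sigma>"

lemma cover_cubes_eq: "cover_cubes L = {cube g \<sigma> | g \<sigma>. g \<in> AL \<and> \<sigma> \<in> L}"
  by (simp add: cover_cubes_def cube_def)

lemma zero_unit_cube [simp]: "(\<lambda>_. 0) \<in> unit_cube \<sigma>"
  by (simp add: unit_cube_def)

lemma cm_zero [simp]: "g \<in> AL \<Longrightarrow> cm g (\<lambda>_. 0) = (g, \<lambda>_. 0)"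
  by (simp add: cm_def ones_def)

definition indic :: "'v set \<Rightarrow> 'v \<Rightarrow> real" where
  "indic \<tau> = (\<lambda>x. if x \<in> \<tau> then 1 else 0)"

lemma indic_unit_cube: "\<tau> \<subseteq> \<sigma> \<Longrightarrow> indic \<tau> \<in> unit_cube \<sigma>"
  by (auto simp: unit_cube_def indic_def)

lemma cm_indic: "cm g (indic \<tau>) = (g \<cdot> sp \<tau>, \<lambda>_. 0)"
  by (auto simp: cm_def ones_def indic_def)

lemma cube_empty: "g \<in> AL \<Longrightarrow> cube g {} = {(g, \<lambda>_. 0)}"
proof -
  assume "g \<in> AL"
  have "unit_cube {} = {(\<lambda>_. 0) :: 'v \<Rightarrow> real}" by (auto simp: unit_cube_def)
  then show ?thesis using \<open>g \<in> AL\<close> by (simp add: cube_def)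
qed

lemma point_in_some_cube:
  assumes "p \<in> CP" obtains g \<sigma> s where "g \<in> AL" "\<sigma> \<in> L" "s \<in> unit_cube \<sigma>" "p = cm g s"
proof -
  obtain g t where p: "p = (g, t)" by (cases p)
  with assms point_in_cube[of g t] have "t \<in> unit_cube (supp t)" "supp t \<in> L" "p = cm g t" "g \<in> AL"
    by (auto simp: mem_CP)
  then show ?thesis using that by blast
qed

text \<open>An isometry is recognised by the corner \<open>c\<close> to which it sends the origin
  and by where it sends one point on each axis: it reflects the coordinates of
  \<open>\<sigma>\<close> at which \<open>c\<close> is 1. The distance \<open>r\<close> of these
  points is left open because inside the cover the far ends of edges suffice, while modulo the
  kernel only interior points show the direction of an edge.\<close>

lemma isometry_unit_cube:
  assumes \<sigma>: "\<sigma> \<in> L" "\<sigma>' \<in> L" and maps: "\<And>s. s \<in> unit_cube \<sigma> \<Longrightarrow> \<theta> s \<in> unit_cube \<sigma>'"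
    and iso: "\<And>s t. s \<in> unit_cube \<sigma> \<Longrightarrow> t \<in> unit_cube \<sigma> \<Longrightarrow> cube_dist L (\<theta> s) (\<theta> t) = cube_dist L s t"
    and c: "\<theta> (\<lambda>_. 0) = c" "\<And>y. c y = 0 \<or> c y = 1"
    and r: "0 < r" "r \<le> 1" and dir: "\<And>x y. x \<in> \<sigma> \<Longrightarrow> y \<noteq> x \<Longrightarrow> \<theta> (edge_point x r) y = c y"
    and s: "s \<in> unit_cube \<sigma>"
  shows "\<theta> s = (\<lambda>y. if y \<in> \<sigma> then (if c y = 1 then 1 - s y else s y) else c y)"
proof -
  have sq: "(\<Sum>y\<in>V. (\<theta> s y - \<theta> t y)\<^sup>2) = (\<Sum>y\<in>V. (s y - t y)\<^sup>2)" if "s \<in> unit_cube \<sigma>" "t \<in> unit_cube \<sigma>" for s t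
    using iso[OF that] by (simp add: cube_dist_def Union_L)
  have ep: "edge_point x r \<in> unit_cube \<sigma>" if "x \<in> \<sigma>" for x
    using that r by (auto simp: unit_cube_def edge_point_def)
  have sV: "\<sigma> \<subseteq> V" "\<sigma>' \<subseteq> V" using \<sigma> simplex_subset_V by auto
  have dirx: "\<theta> (edge_point x r) x - c x = (if c x = 1 then - r else r)" if x: "x \<in> \<sigma>" for x
  proof -
    have "(\<Sum>y\<in>V. (\<theta> (edge_point x r) y - c y)\<^sup>2) = (\<Sum>y\<in>V. if y = x then (\<theta> (edge_point x r) x - c x)\<^sup>2 else 0)"
      using dir[OF x] by (intro sum.cong) auto
    moreover have "(\<Sum>y\<in>V. (edge_point x r y - 0)\<^sup>2) = (\<Sum>y\<in>V. if y = x then r\<^sup>2 else 0)"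
      by (intro sum.cong) (auto simp: edge_point_def)
    ultimately have "(\<theta> (edge_point x r) x - c x)\<^sup>2 = r\<^sup>2"
      using sq[OF ep[OF x] zero_unit_cube] x sV finite_V by (auto simp: c(1))
    then have "\<theta> (edge_point x r) x - c x = r \<or> \<theta> (edge_point x r) x - c x = - r"
      by (simp add: power2_eq_iff)
    then show ?thesis
      using unit_cubeD(1,2)[OF maps[OF ep[OF x]], of x] c(2)[of x] r by auto
  qed
  \<comment> \<open>Polarisation: the squared distances from \<open>\<theta> s\<close> to the images
    of the origin and of \<open>edge_point x r\<close> differ by a term that is linear in coordinate
    \<open>x\<close>.\<close>
  have main: "\<theta> s x - c x = (if c x = 1 then - s x else s x)" if x: "x \<in> \<sigma>" for x
  proof -
    define d where "d = (if c x = 1 then - r else r)"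
    have d2: "d * d = r * r" "d \<noteq> 0" using r by (auto simp: d_def)
    have "(\<Sum>y\<in>V. (\<theta> s y - \<theta> (edge_point x r) y)\<^sup>2) =
       (\<Sum>y\<in>V. (\<theta> s y - c y)\<^sup>2 + (if y = x then d * d - 2 * d * (\<theta> s x - c x) else 0))"
    proof (intro sum.cong)
      fix y assume "y \<in> V"
      show "(\<theta> s y - \<theta> (edge_point x r) y)\<^sup>2 = (\<theta> s y - c y)\<^sup>2 + (if y = x then d * d - 2 * d * (\<theta> s x - c x) else 0)"
      proof (cases "y = x")
        case True
        have "\<theta> (edge_point x r) x = c x + d" using dirx[OF x] by (simp add: d_def)
        then show ?thesis using True by (simp add: power2_eq_square algebra_simps)
      qed (use dir[OF x] in simp)
    qed simp
    also have "\<dots> = (\<Sum>y\<in>V. (\<theta> s y - c y)\<^sup>2) + (d * d - 2 * d * (\<theta> s x - c x))"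
      using x sV finite_V by (auto simp: sum.distrib)
    also have "(\<Sum>y\<in>V. (\<theta> s y - c y)\<^sup>2) = (\<Sum>y\<in>V. (s y - 0)\<^sup>2)"
      using sq[OF s zero_unit_cube] by (simp add: c(1))
    also have "(\<Sum>y\<in>V. (\<theta> s y - \<theta> (edge_point x r) y)\<^sup>2) = (\<Sum>y\<in>V. (s y - edge_point x r y)\<^sup>2)"
      by (rule sq[OF s ep[OF x]])
    also have "\<dots> = (\<Sum>y\<in>V. (s y - 0)\<^sup>2 + (if y = x then r * r - 2 * r * s x else 0))"
      by (intro sum.cong) (auto simp: edge_point_def power2_eq_square algebra_simps)
    also have "\<dots> = (\<Sum>y\<in>V. (s y - 0)\<^sup>2) + (r * r - 2 * r * s x)"
      using x sV finite_V by (auto simp: sum.distrib)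
    finally have "d * (\<theta> s x - c x) = r * s x" using d2 by simp
    then have "r * (\<theta> s x - c x) = r * (if c x = 1 then - s x else s x)"
      by (auto simp: d_def algebra_simps split: if_splits)
    then show ?thesis using r by simp
  qed
  \<comment> \<open>The coordinates in \<open>\<sigma>\<close> already account for the whole squared
    distance, so nothing is left for the others.\<close>
  have "(\<Sum>y\<in>V. (\<theta> s y - c y)\<^sup>2) = (\<Sum>y\<in>V. (s y)\<^sup>2)"
    using sq[OF s zero_unit_cube] by (simp add: c(1))
  moreover have "(\<Sum>y\<in>\<sigma>. (\<theta> s y - c y)\<^sup>2) = (\<Sum>y\<in>\<sigma>. (s y)\<^sup>2)"
    by (intro sum.cong) (auto simp: main)
  moreover have "(\<Sum>y\<in>V - \<sigma>. (s y)\<^sup>2) = 0" using unit_cubeD(3)[OF s] by (intro sum.neutral) auto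
  ultimately have "(\<Sum>y\<in>V - \<sigma>. (\<theta> s y - c y)\<^sup>2) = 0"
    using sum.subset_diff[OF sV(1) finite_V, of "\<lambda>y. (\<theta> s y - c y)\<^sup>2"] sum.subset_diff[OF sV(1) finite_V, of "\<lambda>y. (s y)\<^sup>2"]
    by simp
  then have outV: "\<theta> s y = c y" if "y \<in> V - \<sigma>" for y
    using that finite_V by (subst (asm) sum_nonneg_eq_0_iff) auto
  have "\<theta> s y = c y" if "y \<notin> V" for y
  proof -
    have "y \<notin> \<sigma>'" using that sV by auto
    then show ?thesis using unit_cubeD(3)[OF maps[OF s]] unit_cubeD(3)[OF maps[OF zero_unit_cube]] c(1) by metis
  qed
  then have out: "\<theta> s y = c y" if "y \<notin> \<sigma>" for y
    using outV that by blast
  show ?thesis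
  proof
    fix y show "\<theta> s y = (if y \<in> \<sigma> then (if c y = 1 then 1 - s y else s y) else c y)"
      using main[of y] out[of y] c(2)[of y] by (cases "y \<in> \<sigma>") auto
  qed
qed

text \<open>Cubes go isometrically into cubes; neither bijectivity nor a matching of corners is
  asked. So the notion is closed under composition and under limits that are eventually constant on
  every cube, and it suffices for maps that do not increase distance.\<close>

definition cubical :: "('v cover_point \<Rightarrow> 'v cover_point) \<Rightarrow> bool" where
  "cubical G \<longleftrightarrow> (\<forall>g\<in>AL. \<forall>\<sigma>\<in>L. \<exists>g'\<in>AL. \<exists>\<sigma>'\<in>L. \<exists>\<theta>.
     (\<forall>s\<in>unit_cube \<sigma>. \<theta> s \<in> unit_cube \<sigma>') \<and>
     (\<forall>s\<in>unit_cube \<sigma>. \<forall>t\<in>unit_cube \<sigma>. cube_dist L (\<theta> s) (\<theta> t) = cube_dist L s t) \<and>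
     (\<forall>s\<in>unit_cube \<sigma>. G (cm g s) = cm g' (\<theta> s)))"

lemma cubicalE:
  assumes "cubical G" "g \<in> AL" "\<sigma> \<in> L"
  obtains g' \<sigma>' \<theta> where "g' \<in> AL" "\<sigma>' \<in> L" "\<And>s. s \<in> unit_cube \<sigma> \<Longrightarrow> \<theta> s \<in> unit_cube \<sigma>'"
    "\<And>s t. s \<in> unit_cube \<sigma> \<Longrightarrow> t \<in> unit_cube \<sigma> \<Longrightarrow> cube_dist L (\<theta> s) (\<theta> t) = cube_dist L s t"
    "\<And>s. s \<in> unit_cube \<sigma> \<Longrightarrow> G (cm g s) = cm g' (\<theta> s)"
proof -
  from assms have "\<exists>g'\<in>AL. \<exists>\<sigma>'\<in>L. \<exists>\<theta>.
     (\<forall>s\<in>unit_cube \<sigma>. \<theta> s \<in> unit_cube \<sigma>') \<and>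
     (\<forall>s\<in>unit_cube \<sigma>. \<forall>t\<in>unit_cube \<sigma>. cube_dist L (\<theta> s) (\<theta> t) = cube_dist L s t) \<and>
     (\<forall>s\<in>unit_cube \<sigma>. G (cm g s) = cm g' (\<theta> s))"
    unfolding cubical_def by simp
  then obtain g' \<sigma>' \<theta> where "g' \<in> AL" "\<sigma>' \<in> L" "\<forall>s\<in>unit_cube \<sigma>. \<theta> s \<in> unit_cube \<sigma>'"
     "\<forall>s\<in>unit_cube \<sigma>. \<forall>t\<in>unit_cube \<sigma>. cube_dist L (\<theta> s) (\<theta> t) = cube_dist L s t"
     "\<forall>s\<in>unit_cube \<sigma>. G (cm g s) = cm g' (\<theta> s)" by (elim bexE exE conjE)
  then show ?thesis by (intro that[of g' \<sigma>' \<theta>]) simp_all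
qed

lemma cubical_CP: assumes "cubical G" "p \<in> CP" shows "G p \<in> CP"
proof -
  obtain g \<sigma> s where *: "g \<in> AL" "\<sigma> \<in> L" "s \<in> unit_cube \<sigma>" "p = cm g s" using point_in_some_cube[OF assms(2)] .
  obtain g' \<sigma>' \<theta> where **: "g' \<in> AL" "\<sigma>' \<in> L" "\<And>s. s \<in> unit_cube \<sigma> \<Longrightarrow> \<theta> s \<in> unit_cube \<sigma>'"
    "\<And>s. s \<in> unit_cube \<sigma> \<Longrightarrow> G (cm g s) = cm g' (\<theta> s)"
    by (rule cubicalE[OF assms(1) *(1,2)]) blast
  show ?thesis unfolding * **(4)[OF *(3)] by (rule cm_in_CP[OF **(1,2) **(3)[OF *(3)]])
qed

lemma cubical_step: assumes "cubical G" "step p q b" shows "step (G p) (G q) b"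
proof -
  obtain g \<sigma> s t where *: "g \<in> AL" "\<sigma> \<in> L" "s \<in> unit_cube \<sigma>" "t \<in> unit_cube \<sigma>"
     "p = cm g s" "q = cm g t" "b = cube_dist L s t" using assms(2) unfolding step_def by blast
  obtain g' \<sigma>' \<theta> where **: "g' \<in> AL" "\<sigma>' \<in> L" "\<And>s. s \<in> unit_cube \<sigma> \<Longrightarrow> \<theta> s \<in> unit_cube \<sigma>'"
    "\<And>s t. s \<in> unit_cube \<sigma> \<Longrightarrow> t \<in> unit_cube \<sigma> \<Longrightarrow> cube_dist L (\<theta> s) (\<theta> t) = cube_dist L s t"
    "\<And>s. s \<in> unit_cube \<sigma> \<Longrightarrow> G (cm g s) = cm g' (\<theta> s)"
    by (rule cubicalE[OF assms(1) *(1,2)]) blast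
  have "G p = cm g' (\<theta> s)" "G q = cm g' (\<theta> t)" "b = cube_dist L (\<theta> s) (\<theta> t)"
    "\<theta> s \<in> unit_cube \<sigma>'" "\<theta> t \<in> unit_cube \<sigma>'" using * ** by auto
  with **(1,2) show ?thesis unfolding step_def by blast
qed

lemma cubical_comp:
  assumes "cubical G" "cubical H" shows "cubical (\<lambda>p. G (H p))"
  unfolding cubical_def
proof (intro ballI)
  fix g \<sigma> assume *: "g \<in> AL" "\<sigma> \<in> L"
  obtain g' \<sigma>' \<theta> where 1: "g' \<in> AL" "\<sigma>' \<in> L" "\<And>s. s \<in> unit_cube \<sigma> \<Longrightarrow> \<theta> s \<in> unit_cube \<sigma>'"
    "\<And>s t. s \<in> unit_cube \<sigma> \<Longrightarrow> t \<in> unit_cube \<sigma> \<Longrightarrow> cube_dist L (\<theta> s) (\<theta> t) = cube_dist L s t"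
    "\<And>s. s \<in> unit_cube \<sigma> \<Longrightarrow> H (cm g s) = cm g' (\<theta> s)"
    by (rule cubicalE[OF assms(2) *]) blast
  obtain g'' \<sigma>'' \<theta>' where 2: "g'' \<in> AL" "\<sigma>'' \<in> L" "\<And>s. s \<in> unit_cube \<sigma>' \<Longrightarrow> \<theta>' s \<in> unit_cube \<sigma>''"
    "\<And>s t. s \<in> unit_cube \<sigma>' \<Longrightarrow> t \<in> unit_cube \<sigma>' \<Longrightarrow> cube_dist L (\<theta>' s) (\<theta>' t) = cube_dist L s t"
    "\<And>s. s \<in> unit_cube \<sigma>' \<Longrightarrow> G (cm g' s) = cm g'' (\<theta>' s)"
    by (rule cubicalE[OF assms(1) 1(1,2)]) blast
  show "\<exists>g'\<in>AL. \<exists>\<sigma>'\<in>L. \<exists>\<theta>.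
     (\<forall>s\<in>unit_cube \<sigma>. \<theta> s \<in> unit_cube \<sigma>') \<and>
     (\<forall>s\<in>unit_cube \<sigma>. \<forall>t\<in>unit_cube \<sigma>. cube_dist L (\<theta> s) (\<theta> t) = cube_dist L s t) \<and>
     (\<forall>s\<in>unit_cube \<sigma>. G (H (cm g s)) = cm g' (\<theta> s))"
    by (rule bexI[OF _ 2(1)], rule bexI[OF _ 2(2)], rule exI[of _ "\<lambda>s. \<theta>' (\<theta> s)"])
      (simp add: 1(3-5) 2(3-5))
qed

text \<open>The developing map recovers the image of each corner as \<open>c\<close> shifted by
  \<open>indic \<tau>\<close>. A coordinate in \<open>\<sigma>\<close> that started at 1 would leave
  the cube, so \<open>c\<close> vanishes on \<open>\<sigma>\<close> and no reflection occurs; the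
  remaining ones of \<open>c\<close> only rename the initial vertex.\<close>

lemma cubical_fix_vertices:
  assumes G: "cubical G" and g: "g \<in> AL" and \<sigma>: "\<sigma> \<in> L"
    and fx: "\<And>\<tau>. \<tau> \<subseteq> \<sigma> \<Longrightarrow> G (g \<cdot> sp \<tau>, \<lambda>_. 0) = (g \<cdot> sp \<tau>, \<lambda>_. 0)" and s: "s \<in> unit_cube \<sigma>"
  shows "G (cm g s) = cm g s"
proof -
  obtain g' \<sigma>' \<theta> where 1: "g' \<in> AL" "\<sigma>' \<in> L" "\<And>s. s \<in> unit_cube \<sigma> \<Longrightarrow> \<theta> s \<in> unit_cube \<sigma>'"
    "\<And>s t. s \<in> unit_cube \<sigma> \<Longrightarrow> t \<in> unit_cube \<sigma> \<Longrightarrow> cube_dist L (\<theta> s) (\<theta> t) = cube_dist L s t"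
    "\<And>s. s \<in> unit_cube \<sigma> \<Longrightarrow> G (cm g s) = cm g' (\<theta> s)"
    by (rule cubicalE[OF G g \<sigma>]) blast
  define c where "c = \<theta> (\<lambda>_. 0)"
  have cU: "c \<in> unit_cube \<sigma>'" using 1(3) by (simp add: c_def)
  have vert: "cm g' (\<theta> (indic \<tau>)) = (g \<cdot> sp \<tau>, \<lambda>_. 0)" if "\<tau> \<subseteq> \<sigma>" for \<tau>
    using fx[OF that] 1(5)[OF indic_unit_cube[OF that]] by (simp add: cm_indic)
  have v0: "cm g' c = (g, \<lambda>_. 0)"
    using vert[of "{}"] g by (simp add: c_def indic_def)
  have c01: "c y = 0 \<or> c y = 1" for y using v0 by (auto simp: cm_def fun_eq_iff split: if_splits)
  have co: "\<theta> (indic \<tau>) y = c y + indic \<tau> y" if "\<tau> \<subseteq> \<sigma>" for \<tau> y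
  proof -
    have "\<tau> \<in> L" using that \<sigma> simplex_subset by blast
    then have "coord (cm g' (\<theta> (indic \<tau>))) y - coord (cm g' c) y = indic \<tau> y"
      unfolding vert[OF that] v0 using g by (simp add: coord_def expo_mult_raag expo_sp indic_def)
    then show ?thesis
      unfolding coord_cm[OF 1(1,2) cU] coord_cm[OF 1(1,2) 1(3)[OF indic_unit_cube[OF that]]] by simp
  qed
  have ei: "edge_point x 1 = indic {x}" for x by (auto simp: edge_point_def indic_def)
  have dir: "\<theta> (edge_point x 1) y = c y" if "x \<in> \<sigma>" "y \<noteq> x" for x y
    unfolding ei using co[of "{x}" y] that by (simp add: fun_cong[OF indic_def])
  have c0: "c x = 0" if "x \<in> \<sigma>" for x
    using co[of "{x}" x] unit_cubeD(2)[OF 1(3)[OF indic_unit_cube, of "{x}"], of x] unit_cubeD(1)[OF cU, of x] that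
    by (simp add: indic_def)
  have "\<theta> s = (\<lambda>y. if y \<in> \<sigma> then (if c y = 1 then 1 - s y else s y) else c y)"
    by (rule isometry_unit_cube[where r = 1, OF \<sigma> 1(2,3,4) c_def[symmetric] c01])
      (use s dir in auto)
  then have th: "\<theta> s = (\<lambda>y. if y \<in> \<sigma> then s y else c y)" using c0 by auto
  have "ones (\<theta> s) = ones c \<union> ones s"
    using c0 unit_cubeD(3)[OF s] by (auto simp: th ones_def)
  moreover have "ones c \<inter> ones s = {}" using c0 ones_subset[OF s] by (auto simp: ones_def)
  moreover have "ones (\<theta> s) \<in> L" using ones_simplex[OF 1(3)[OF s] 1(2)] .
  ultimately have "sp (ones (\<theta> s)) = sp (ones c) \<cdot> sp (ones s)" by (metis sp_partition)
  moreover have "g' \<cdot> sp (ones c) = g" using v0 by (simp add: cm_def)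
  ultimately have "g' \<cdot> sp (ones (\<theta> s)) = g \<cdot> sp (ones s)"
    using A.m_assoc[OF 1(1) sp_closed[OF ones_simplex[OF cU 1(2)]] sp_closed[OF ones_simplex[OF s \<sigma>]]] by simp
  moreover have "(if \<theta> s y = 1 then 0 else \<theta> s y) = (if s y = 1 then 0 else s y)" for y
    using c01[of y] unit_cubeD(3)[OF s, of y] by (auto simp: th)
  ultimately have "cm g' (\<theta> s) = cm g s" by (simp add: cm_def)
  then show ?thesis using 1(5)[OF s] by simp
qed

text \<open>Rigidity: being the identity is tested on vertices alone. That the extensions of a lift
  and of its inverse are mutually inverse is checked in this way.\<close>

lemma cubical_identity:
  assumes "cubical G" "\<And>g. g \<in> AL \<Longrightarrow> G (g, \<lambda>_. 0) = (g, \<lambda>_. 0)" "p \<in> CP" shows "G p = p"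
proof -
  obtain g \<sigma> s where *: "g \<in> AL" "\<sigma> \<in> L" "s \<in> unit_cube \<sigma>" "p = cm g s" using point_in_some_cube[OF assms(3)] .
  show ?thesis unfolding *(4)
    by (rule cubical_fix_vertices[OF assms(1) *(1,2) _ *(3)]) (use assms(2) * simplex_subset in auto)
qed

lemma cubical_cdist_le: "cubical G \<Longrightarrow> p \<in> CP \<Longrightarrow> q \<in> CP \<Longrightarrow> cdist (G p) (G q) \<le> cdist p q"
  by (rule cdist_map_le[OF cubical_step])

section \<open>The automorphism group and its action on vertices\<close>

abbreviation CA :: "('v cover_point \<Rightarrow> 'v cover_point) monoid" where "CA \<equiv> cover_aut L"

definition cauts :: "('v cover_point \<Rightarrow> 'v cover_point) set" where
  "cauts = {f \<in> isometries SC. (\<lambda>C. f ` C) ` cover_cubes L = cover_cubes L}"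

lemma carrier_CA [simp]: "carrier CA = cauts"
  by (simp add: cover_aut_def cauts_def)

lemma CA_eq: "CA = (BijGroup CP)\<lparr>carrier := cauts\<rparr>"
  by (simp add: cover_aut_def cauts_def isom_group_eq)

lemma cauts_Bij: "f \<in> cauts \<Longrightarrow> f \<in> Bij CP"
  by (simp add: cauts_def isometries_def)

lemma cubes_subset: "C \<in> cover_cubes L \<Longrightarrow> C \<subseteq> CP"
proof
  fix p assume C: "C \<in> cover_cubes L" and p: "p \<in> C"
  from C obtain g \<sigma> where "g \<in> AL" "\<sigma> \<in> L" "C = cm g ` unit_cube \<sigma>"
    unfolding cover_cubes_eq cube_def by blast
  with p show "p \<in> CP" using cm_in_CP by blast
qed

lemma subgroup_cauts: "subgroup cauts (BijGroup CP)"
proof (rule subgroup_BijGroupI)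
  have img: "compose CP f g ` C = f ` g ` C" if "C \<in> cover_cubes L" for f g C
  proof -
    have "compose CP f g ` C = (\<lambda>x. f (g x)) ` C"
      by (rule image_cong) (use cubes_subset[OF that] in \<open>auto simp: compose_def\<close>)
    then show ?thesis by (simp add: image_image)
  qed
  fix f assume f: "f \<in> cauts"
  then have fB: "f \<in> Bij CP" by (rule cauts_Bij)
  let ?h = "restrict (inv_into CP f) CP"
  have "?h \<in> isometries SC"
    using subgroup.m_inv_closed[OF subgroup_isometries[of SC], of f] f fB by (simp add: cauts_def BijGroup_inv)
  moreover have "?h ` f ` C = C" if "C \<in> cover_cubes L" for C
  proof -
    have "?h (f x) = x" if "x \<in> C" for x
      using Bij_inv_left[OF fB] cubes_subset[OF \<open>C \<in> _\<close>] that by blast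
    then have "(\<lambda>x. ?h (f x)) ` C = (\<lambda>x. x) ` C" by (rule image_cong[OF HOL.refl])
    then show ?thesis by (simp only: image_image image_ident)
  qed
  then have "(\<lambda>C. ?h ` C) ` (\<lambda>C. f ` C) ` cover_cubes L = cover_cubes L"
    by (simp add: image_image)
  ultimately show "?h \<in> cauts" using f by (simp add: cauts_def)
  fix g assume g: "g \<in> cauts"
  have "compose CP f g \<in> isometries SC"
    using subgroup.m_closed[OF subgroup_isometries[of SC], of f g] f g cauts_Bij by (simp add: cauts_def)
  moreover have "(\<lambda>C. compose CP f g ` C) ` cover_cubes L = (\<lambda>C. f ` C) ` (\<lambda>C. g ` C) ` cover_cubes L"
    unfolding image_image[of "\<lambda>C. f ` C"] by (rule image_cong) (auto simp: img)
  ultimately show "compose CP f g \<in> cauts" using f g by (simp add: cauts_def)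
next
  have "(\<lambda>C. (\<lambda>x\<in>CP. x) ` C) ` cover_cubes L = (\<lambda>C. C) ` cover_cubes L"
    by (rule image_cong) (use cubes_subset in \<open>force+\<close>)
  then show "(\<lambda>x\<in>CP. x) \<in> cauts"
    using subgroup.one_closed[OF subgroup_isometries[of SC]] by (simp add: cauts_def)
qed (simp add: cauts_Bij subsetI)

lemma group_CA: "group CA"
  unfolding CA_eq by (rule subgroup.subgroup_is_group[OF subgroup_cauts group_BijGroup])

lemma CA_mult: "f \<in> cauts \<Longrightarrow> g \<in> cauts \<Longrightarrow> f \<otimes>\<^bsub>CA\<^esub> g = compose CP f g"
  by (simp add: CA_eq cauts_Bij)

lemma CA_one: "\<one>\<^bsub>CA\<^esub> = (\<lambda>x\<in>CP. x)"
  by (simp add: CA_eq)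

lemma cauts_cubical: assumes f: "f \<in> cauts" shows "cubical f"
  unfolding cubical_def
proof (intro ballI)
  fix g \<sigma> assume *: "g \<in> AL" "\<sigma> \<in> L"
  then have "cube g \<sigma> \<in> cover_cubes L" by (auto simp: cover_cubes_eq)
  then have "f ` cube g \<sigma> \<in> cover_cubes L" using f by (auto simp: cauts_def)
  then obtain g' \<sigma>' where **: "g' \<in> AL" "\<sigma>' \<in> L" "f ` cube g \<sigma> = cube g' \<sigma>'" by (auto simp: cover_cubes_eq)
  have "\<forall>s\<in>unit_cube \<sigma>. \<exists>t. t \<in> unit_cube \<sigma>' \<and> f (cm g s) = cm g' t"
    using **(3) by (auto simp: cube_def)
  then obtain \<theta> where \<theta>: "\<And>s. s \<in> unit_cube \<sigma> \<Longrightarrow> \<theta> s \<in> unit_cube \<sigma>' \<and> f (cm g s) = cm g' (\<theta> s)"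
    by metis
  have "cube_dist L (\<theta> s) (\<theta> t) = cube_dist L s t" if st: "s \<in> unit_cube \<sigma>" "t \<in> unit_cube \<sigma>" for s t
  proof -
    have C: "cm g s \<in> CP" "cm g t \<in> CP" using st * cm_in_CP by auto
    have "cdist (f (cm g s)) (f (cm g t)) = cdist (cm g s) (cm g t)"
      using f C Bij_mem[OF cauts_Bij[OF f]] by (simp add: cauts_def isometries_def mdist_SC)
    then show ?thesis
      using \<theta>[OF st(1)] \<theta>[OF st(2)] cdist_cube[OF * st] cdist_cube[OF **(1,2), of "\<theta> s" "\<theta> t"] by simp
  qed
  then show "\<exists>g'\<in>AL. \<exists>\<sigma>'\<in>L. \<exists>\<theta>.
     (\<forall>s\<in>unit_cube \<sigma>. \<theta> s \<in> unit_cube \<sigma>') \<and>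
     (\<forall>s\<in>unit_cube \<sigma>. \<forall>t\<in>unit_cube \<sigma>. cube_dist L (\<theta> s) (\<theta> t) = cube_dist L s t) \<and>
     (\<forall>s\<in>unit_cube \<sigma>. f (cm g s) = cm g' (\<theta> s))"
  proof (intro bexI exI conjI ballI)
    show "\<sigma>' \<in> L" "g' \<in> AL" by fact+
  qed (use \<theta> in auto)
qed

definition act :: "('v cover_point \<Rightarrow> 'v cover_point) \<Rightarrow> 'v word set \<Rightarrow> 'v word set" where
  "act f g = fst (f (g, \<lambda>_. 0))"

text \<open>A vertex is a 0-cube. Its image is a cube with a single point, and that point must be
  the initial vertex of the cube.\<close>

lemma cauts_vertex: assumes f: "f \<in> cauts" and g: "g \<in> AL"
  shows "f (g, \<lambda>_. 0) = (act f g, \<lambda>_. 0)" "act f g \<in> AL"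
proof -
  have "cube g {} \<in> cover_cubes L" unfolding cover_cubes_eq using g empty_simplex by blast
  then have "f ` cube g {} \<in> cover_cubes L" using f by (auto simp: cauts_def)
  then obtain g' \<sigma>' where **: "g' \<in> AL" "\<sigma>' \<in> L" "f ` cube g {} = cube g' \<sigma>'" by (auto simp: cover_cubes_eq)
  then have eq: "cube g' \<sigma>' = {f (g, \<lambda>_. 0)}" using g by (simp add: cube_empty)
  have "(g', \<lambda>_. 0) \<in> cube g' \<sigma>'" unfolding cube_def by (rule image_eqI[OF _ zero_unit_cube]) (simp add: **(1))
  with eq have "f (g, \<lambda>_. 0) = (g', \<lambda>_. 0)" by simp
  then show "f (g, \<lambda>_. 0) = (act f g, \<lambda>_. 0)" "act f g \<in> AL" using ** by (simp_all add: act_def)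
qed

lemma cauts_eqI:
  assumes f: "f \<in> cauts" and h: "h \<in> cauts" and eq: "\<And>g. g \<in> AL \<Longrightarrow> act f g = act h g"
  shows "f = h"
proof (rule Bij_eqI[OF cauts_Bij[OF f] cauts_Bij[OF h]])
  fix p assume p: "p \<in> CP"
  let ?i = "restrict (inv_into CP h) CP"
  have i: "?i \<in> cauts"
    using subgroup.m_inv_closed[OF subgroup_cauts h] by (simp add: BijGroup_inv cauts_Bij h)
  have ih: "?i (h q) = q" if "q \<in> CP" for q
    by (rule Bij_inv_left[OF cauts_Bij[OF h] that])
  have "?i (f p) = p"
  proof (rule cubical_identity[OF cubical_comp[OF cauts_cubical[OF i] cauts_cubical[OF f]] _ p])
    fix g assume g: "g \<in> AL"
    then show "?i (f (g, \<lambda>_. 0)) = (g, \<lambda>_. 0)"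
      using ih[of "(g, \<lambda>_. 0)"] cauts_vertex[OF f g] cauts_vertex[OF h g] eq by simp
  qed
  then have "?i (f p) = ?i (h p)" unfolding ih[OF p] .
  then show "f p = h p"
    by (rule iffD1[OF Bij_inj[OF cauts_Bij[OF i] Bij_mem[OF cauts_Bij[OF f] p] Bij_mem[OF cauts_Bij[OF h] p]]])
qed

lemma act_compose: "f \<in> cauts \<Longrightarrow> h \<in> cauts \<Longrightarrow> g \<in> AL \<Longrightarrow> act (compose CP f h) g = act f (act h g)"
proof -
  assume "h \<in> cauts" "g \<in> AL"
  then have "act (compose CP f h) g = fst (f (act h g, \<lambda>_. 0))"
    by (simp add: act_def[of "compose CP f h"] compose_eq cauts_vertex(1))
  then show ?thesis by (simp add: act_def[of f])
qed

lemma act_one: "g \<in> AL \<Longrightarrow> act (\<lambda>x\<in>CP. x) g = g"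
  by (simp add: act_def)

text \<open>A cubical map does not increase distances; applied to the map and to its inverse, this
  gives an isometry.\<close>

lemma cautsI:
  assumes f: "f \<in> extensional CP" and h: "\<And>p. p \<in> CP \<Longrightarrow> f (h p) = p" "\<And>p. p \<in> CP \<Longrightarrow> h (f p) = p"
    and cub: "cubical f" "cubical h"
    and cubes: "\<And>C. C \<in> cover_cubes L \<Longrightarrow> f ` C \<in> cover_cubes L" "\<And>C. C \<in> cover_cubes L \<Longrightarrow> h ` C \<in> cover_cubes L"
  shows "f \<in> cauts"
proof -
  have fB: "f \<in> Bij CP"
    by (rule BijI[OF f cubical_CP[OF cub(1)] cubical_CP[OF cub(2)] h])
  have "cdist (f p) (f q) = cdist p q" if "p \<in> CP" "q \<in> CP" for p q
    using cubical_cdist_le[OF cub(1) that] cubical_cdist_le[OF cub(2), of "f p" "f q"] that h(2) cubical_CP[OF cub(1)]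
    by (metis antisym)
  then have "f \<in> isometries SC" using fB cubical_CP[OF cub(1)] by (simp add: isometries_def mdist_SC)
  moreover have fh: "f ` h ` C = C" if "C \<in> cover_cubes L" for C
  proof -
    have "(\<lambda>x. f (h x)) ` C = (\<lambda>x. x) ` C"
      by (rule image_cong) (use cubes_subset[OF that] h(1) in auto)
    then show ?thesis by (simp add: image_image)
  qed
  have "cover_cubes L \<subseteq> (\<lambda>C. f ` C) ` cover_cubes L"
  proof
    fix C assume C: "C \<in> cover_cubes L"
    show "C \<in> (\<lambda>C. f ` C) ` cover_cubes L"
      by (rule image_eqI[OF _ cubes(2)[OF C]]) (simp add: fh[OF C])
  qed
  moreover have "(\<lambda>C. f ` C) ` cover_cubes L \<subseteq> cover_cubes L" using cubes(1) by blast
  ultimately show ?thesis by (simp add: cauts_def)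
qed

end

section \<open>Lifting label-preserving tree automorphisms\<close>

locale flag_free = flag L V for L :: "'v set set" and V :: "'v set" +
  fixes B :: "'v set"
  assumes B_subset: "B \<subseteq> V" and free: "freely_generates L B"
begin

sublocale F: group "free_group_on B" by (rule group_free_group)

abbreviation FB :: "'v word set set" where "FB \<equiv> carrier (free_group_on B)"
abbreviation fmult :: "'v word set \<Rightarrow> 'v word set \<Rightarrow> 'v word set" (infixl \<open>\<bullet>\<close> 70) where
  "a \<bullet> b \<equiv> a \<otimes>\<^bsub>free_group_on B\<^esub> b"
abbreviation fone :: "'v word set" (\<open>\<one>\<^sub>F\<close>) where "fone \<equiv> \<one>\<^bsub>free_group_on B\<^esub>"
abbreviation fgen :: "'v \<Rightarrow> 'v word set" where "fgen \<equiv> free_gen B"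
abbreviation \<phi> :: "'v word set \<Rightarrow> 'v word set" where "\<phi> \<equiv> raag_to_free L B"
abbreviation N :: "'v word set set" where "N \<equiv> kernel (raag L) (free_group_on B) \<phi>"
abbreviation \<pi> :: "'v cover_point \<Rightarrow> 'v cover_point set" where "\<pi> \<equiv> cover_proj L B"

lemma B_not_adjacent: "x \<in> B \<Longrightarrow> y \<in> B \<Longrightarrow> {x, y} \<in> L \<Longrightarrow> x = y"
  using freely_generates_not_adjacent[OF free] B_subset Union_L by blast

sublocale phi: presented_map "free_group_on B" V "raag_relators L"
    "\<lambda>x. if x \<in> B then fgen x else \<one>\<^sub>F"
  by (rule presented_map_raag_to_free[OF B_not_adjacent])

lemma phi_hom: "\<phi> \<in> hom (raag L) (free_group_on B)"
  using phi.induced_hom_hom by (simp add: raag_to_free_def raag_def Union_L)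

lemma phi_closed [simp]: "g \<in> AL \<Longrightarrow> \<phi> g \<in> FB"
  using phi_hom by (rule hom_in_carrier)

lemma phi_mult: "g \<in> AL \<Longrightarrow> h \<in> AL \<Longrightarrow> \<phi> (g \<cdot> h) = \<phi> g \<bullet> \<phi> h"
  using phi_hom by (rule hom_mult)

lemma phi_one [simp]: "\<phi> \<one>\<^sub>L = \<one>\<^sub>F"
  using hom_one[OF phi_hom A.group_axioms F.group_axioms] .

lemma phi_inv: "g \<in> AL \<Longrightarrow> \<phi> (ainv g) = inv\<^bsub>free_group_on B\<^esub> \<phi> g"
  using group_hom.hom_inv[of "raag L" "free_group_on B" \<phi> g] phi_hom
  by (simp add: group_hom_def group_hom_axioms_def A.group_axioms F.group_axioms)

lemma phi_gen: "x \<in> V \<Longrightarrow> \<phi> (gen x) = (if x \<in> B then fgen x else \<one>\<^sub>F)"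
  using phi.induced_hom_gen[of x] by (simp add: raag_to_free_def raag_gen_eq Union_L)

lemma phi_surj: assumes "u \<in> FB" obtains g where "g \<in> AL" "\<phi> g = u"
proof -
  have "\<exists>g\<in>AL. \<phi> g = u"
    using assms unfolding free_group_on_def
  proof (induction rule: presented_group_induct)
    case one
    then show ?case using phi_one A.one_closed unfolding free_group_on_def by blast
  next
    case (mult u x)
    then obtain g where "g \<in> AL" "\<phi> g = u" by blast
    then have "\<phi> (g \<cdot> gen x) = u \<otimes>\<^bsub>presented_group B {}\<^esub> pgen B {} x" "g \<cdot> gen x \<in> AL"
      using mult(2) B_subset by (auto simp: phi_mult phi_gen subset_iff) (simp_all add: free_gen_eq free_group_on_def)
    then show ?case by blast
  next
    case (inv_mult u x)
    then obtain g where "g \<in> AL" "\<phi> g = u" by blast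
    then have "\<phi> (g \<cdot> ainv (gen x)) = u \<otimes>\<^bsub>presented_group B {}\<^esub> inv\<^bsub>presented_group B {}\<^esub> pgen B {} x"
        "g \<cdot> ainv (gen x) \<in> AL"
      using inv_mult(2) B_subset by (auto simp: phi_mult phi_inv phi_gen subset_iff) (simp_all add: free_gen_eq free_group_on_def)
    then show ?case by blast
  qed
  then show ?thesis using that by blast
qed

lemma N_iff: "n \<in> N \<longleftrightarrow> n \<in> AL \<and> \<phi> n = \<one>\<^sub>F"
  by (simp add: kernel_def)

lemma same_phi: assumes "g \<in> AL" "h \<in> AL" "\<phi> g = \<phi> h" obtains n where "n \<in> N" "h = n \<cdot> g"
proof
  show "h \<cdot> ainv g \<in> N" using assms by (simp add: N_iff phi_mult phi_inv)
  show "h = h \<cdot> ainv g \<cdot> g" using assms by (simp add: A.m_assoc)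
qed

section \<open>Signs of tree edges under a label-preserving automorphism\<close>

definition fpow :: "'v \<Rightarrow> bool \<Rightarrow> 'v word set" where
  "fpow x e = (if x \<in> B then (if e then fgen x else inv\<^bsub>free_group_on B\<^esub> fgen x) else \<one>\<^sub>F)"

definition apow :: "'v \<Rightarrow> bool \<Rightarrow> 'v word set" where
  "apow x e = (if e then gen x else ainv (gen x))"

lemma fpow_closed [simp]: "fpow x e \<in> FB"
  by (simp add: fpow_def)

lemma apow_closed [simp]: "x \<in> V \<Longrightarrow> apow x e \<in> AL"
  by (simp add: apow_def)

lemma phi_apow: "x \<in> V \<Longrightarrow> \<phi> (apow x e) = fpow x e"
  by (simp add: apow_def fpow_def phi_gen phi_inv)

lemma fpow_cancel [simp]: "u \<in> FB \<Longrightarrow> u \<bullet> fpow x e \<bullet> fpow x (\<not> e) = u"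
    "u \<in> FB \<Longrightarrow> u \<bullet> fpow x (\<not> e) \<bullet> fpow x e = u"
  by (simp_all add: fpow_def F.m_assoc)

lemma apow_cancel [simp]: "g \<in> AL \<Longrightarrow> x \<in> V \<Longrightarrow> g \<cdot> apow x e \<cdot> apow x (\<not> e) = g"
    "g \<in> AL \<Longrightarrow> x \<in> V \<Longrightarrow> g \<cdot> apow x (\<not> e) \<cdot> apow x e = g"
  by (simp_all add: apow_def A.m_assoc)

lemma expo_fpow: "x \<in> B \<Longrightarrow> expo (fpow x e) = (\<lambda>y. if y = x then (if e then 1 else -1) else 0)"
  by (auto simp: fpow_def expo_free_gen expo_inv_free unit_fun_def)

lemma fpow_inj: "x \<in> B \<Longrightarrow> u \<in> FB \<Longrightarrow> u \<bullet> fpow x e = u \<bullet> fpow x e' \<longleftrightarrow> e = e'"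
proof -
  assume *: "x \<in> B" "u \<in> FB"
  have "fpow x e = fpow x e' \<longleftrightarrow> e = e'"
    using expo_fpow[OF *(1), of e] expo_fpow[OF *(1), of e'] by (metis (full_types) one_neq_neg_one)
  then show ?thesis using * by (metis F.inv_closed F.l_inv F.l_one F.m_assoc fpow_closed)
qed

definition lpa :: "('v word set \<Rightarrow> 'v word set) \<Rightarrow> bool" where
  "lpa a \<longleftrightarrow> a \<in> carrier (tree_aut B) \<and> label_preserving B a"

text \<open>The sign of the edge labelled \<open>x\<close> at \<open>u\<close>: true when
  \<open>a\<close> keeps its orientation. Letters outside \<open>B\<close> label loops, whose
  orientation is always kept, hence the value \<open>True\<close> there.\<close>

definition eps :: "('v word set \<Rightarrow> 'v word set) \<Rightarrow> 'v word set \<Rightarrow> 'v \<Rightarrow> bool" where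
  "eps a u x \<longleftrightarrow> (x \<in> B \<longrightarrow> a (u \<bullet> fgen x) = a u \<bullet> fgen x)"

lemma lpa_Bij: "lpa a \<Longrightarrow> a \<in> Bij FB"
  by (simp add: lpa_def tree_aut_def)

lemma lpa_closed [simp]: "lpa a \<Longrightarrow> u \<in> FB \<Longrightarrow> a u \<in> FB"
  using Bij_mem[OF lpa_Bij] .

lemma eps_not_B: "x \<notin> B \<Longrightarrow> eps a u x"
  by (simp add: eps_def)

lemma lpa_step1:
  assumes a: "lpa a" and u: "u \<in> FB" and x: "x \<in> B"
  shows "a (u \<bullet> fgen x) = a u \<bullet> fpow x (eps a u x)"
proof -
  have "tree_edge B x u (u \<bullet> fgen x)" using u x by (simp add: tree_edge_def)
  then have "tree_edge B x (a u) (a (u \<bullet> fgen x))" using a by (simp add: lpa_def label_preserving_def)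
  then have "a (u \<bullet> fgen x) = a u \<bullet> fgen x \<or> a u = a (u \<bullet> fgen x) \<bullet> fgen x"
    by (simp add: tree_edge_def)
  then show ?thesis
  proof
    assume "a (u \<bullet> fgen x) = a u \<bullet> fgen x"
    then show ?thesis using x by (simp add: eps_def fpow_def)
  next
    assume *: "a u = a (u \<bullet> fgen x) \<bullet> fgen x"
    have auc: "a (u \<bullet> fgen x) \<in> FB" using a u x by simp
    then have eq: "a (u \<bullet> fgen x) = a u \<bullet> fpow x False"
      unfolding * using x by (simp add: fpow_def F.m_assoc)
    moreover have "\<not> eps a u x"
    proof
      assume "eps a u x"
      then have "a u \<bullet> fpow x False = a u \<bullet> fpow x True" using eq x by (simp add: eps_def) (simp add: fpow_def)
      then show False using fpow_inj[OF x] a u by simp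
    qed
    ultimately show ?thesis by simp
  qed
qed

text \<open>If the sign changed between two consecutive edges labelled \<open>x\<close>, the image
  path would turn back and \<open>a\<close> would identify \<open>u\<close> with
  \<open>u \<bullet> fgen x \<bullet> fgen x\<close>, although their exponents at \<open>x\<close>
  differ by 2.\<close>

lemma eps_step1:
  assumes a: "lpa a" and u: "u \<in> FB" and x: "x \<in> B"
  shows "eps a (u \<bullet> fgen x) x = eps a u x"
proof (rule ccontr)
  let ?v = "u \<bullet> fgen x"
  assume ne: "eps a ?v x \<noteq> eps a u x"
  have v: "?v \<in> FB" using u x by simp
  have "a (?v \<bullet> fgen x) = a u \<bullet> fpow x (eps a u x) \<bullet> fpow x (eps a ?v x)"
    using lpa_step1[OF a v x] lpa_step1[OF a u x] by simp
  also have "eps a ?v x = (\<not> eps a u x)" using ne by simp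
  also have "a u \<bullet> fpow x (eps a u x) \<bullet> fpow x (\<not> eps a u x) = a u" using a u by simp
  finally have "?v \<bullet> fgen x = u" using Bij_inj[OF lpa_Bij[OF a]] u v x by simp
  then have "expo (?v \<bullet> fgen x) x = expo u x" by simp
  then show False using u v x by (simp add: expo_mult_free expo_free_gen unit_fun_def)
qed

lemma lpa_step:
  assumes a: "lpa a" and u: "u \<in> FB"
  shows "a (u \<bullet> fpow x e) = a u \<bullet> fpow x (e = eps a u x)" "eps a (u \<bullet> fpow x e) x = eps a u x"
proof -
  have "a (u \<bullet> fpow x e) = a u \<bullet> fpow x (e = eps a u x) \<and> eps a (u \<bullet> fpow x e) x = eps a u x"
  proof (cases "x \<in> B")
    case False
    then show ?thesis using a u by (simp add: fpow_def eps_def)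
  next
    case x: True
    show ?thesis
    proof (cases e)
      case True
      then show ?thesis using lpa_step1[OF a u x] eps_step1[OF a u x] x by (simp add: fpow_def[of x True])
    next
      case False
      let ?v = "u \<bullet> fpow x False"
      have v: "?v \<in> FB" "?v \<bullet> fgen x = u" using u x by (simp_all add: fpow_def F.m_assoc)
      have 1: "eps a ?v x = eps a u x" using eps_step1[OF a v(1) x] v by simp
      have "a u = a ?v \<bullet> fpow x (eps a u x)" using lpa_step1[OF a v(1) x] v 1 by simp
      then have "a u \<bullet> fpow x (\<not> eps a u x) = a ?v" using a v by simp
      then show ?thesis using 1 False by simp
    qed
  qed
  then show "a (u \<bullet> fpow x e) = a u \<bullet> fpow x (e = eps a u x)" "eps a (u \<bullet> fpow x e) x = eps a u x" by auto
qed

text \<open>For \<open>y\<close> outside \<open>B\<close> the tree vertex does not move. For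
  \<open>y\<close> in \<open>B\<close>, adjacency forces \<open>x\<close> to lie outside
  \<open>B\<close>, where all signs are positive, or to equal \<open>y\<close>, where consecutive
  edges have equal signs.\<close>

lemma eps_adjacent:
  assumes "{x, y} \<in> L" "u \<in> FB" "lpa a" shows "eps a (u \<bullet> fpow y e) x = eps a u x"
proof (cases "x \<in> B \<and> y \<in> B")
  case True
  then show ?thesis using B_not_adjacent assms lpa_step(2) by blast
next
  case False
  then show ?thesis using assms(2) by (auto simp: eps_not_B fpow_def)
qed

text \<open>Spells the image path: each letter receives the sign of \<open>a\<close> at the tree
  vertex reached so far, and that vertex is tracked through the letters of the original
  word.\<close>

fun tword :: "('v word set \<Rightarrow> 'v word set) \<Rightarrow> 'v word set \<Rightarrow> 'v word \<Rightarrow> 'v word" where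
  "tword a u [] = []"
| "tword a u ((x, e) # w) = (x, e = eps a u x) # tword a (u \<bullet> fpow x e) w"

fun wval :: "'v word \<Rightarrow> 'v word set" where
  "wval [] = \<one>\<^sub>F"
| "wval ((x, e) # w) = fpow x e \<bullet> wval w"

lemma wval_closed [simp]: "wval w \<in> FB"
  by (induction w rule: wval.induct) auto

lemma tword_append: "u \<in> FB \<Longrightarrow> tword a u (p @ q) = tword a u p @ tword a (u \<bullet> wval p) q"
  by (induction a u p rule: tword.induct) (simp_all add: F.m_assoc)

lemma tword_lists: "w \<in> lists (S \<times> UNIV) \<Longrightarrow> tword a u w \<in> lists (S \<times> UNIV)"
  by (induction a u w rule: tword.induct) auto

lemma word_equiv_cls: "u \<in> lists (V \<times> UNIV) \<Longrightarrow> w \<in> lists (V \<times> UNIV) \<Longrightarrow>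
   word_equiv V (raag_relators L) u w \<longleftrightarrow> pclass V (raag_relators L) u = pclass V (raag_relators L) w"
  by (simp add: pclass_eq_iff)

abbreviation cls :: "'v word \<Rightarrow> 'v word set" where "cls \<equiv> pclass V (raag_relators L)"

lemma cls_Cons: "w \<in> lists (V \<times> UNIV) \<Longrightarrow> x \<in> V \<Longrightarrow> cls ((x, e) # w) = apow x e \<cdot> cls w"
  using pclass_Cons[of w V x "raag_relators L" e] by (simp add: apow_def raag_def raag_gen_eq Union_L)

lemma cls_snoc: "w \<in> lists (V \<times> UNIV) \<Longrightarrow> x \<in> V \<Longrightarrow> cls (w @ [(x, e)]) = cls w \<cdot> apow x e"
  using pclass_snoc[of w V x "raag_relators L" e] by (simp add: apow_def raag_def raag_gen_eq Union_L)

lemma cls_append: "u \<in> lists (V \<times> UNIV) \<Longrightarrow> w \<in> lists (V \<times> UNIV) \<Longrightarrow> cls (u @ w) = cls u \<cdot> cls w"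
  using mult_pclass[of u V w "raag_relators L"] by (simp add: raag_def Union_L)

lemma cls_Nil: "cls [] = \<one>\<^sub>L"
  by (simp add: raag_def one_pclass Union_L)

lemma cls_closed: "w \<in> lists (V \<times> UNIV) \<Longrightarrow> cls w \<in> AL"
  by (simp add: raag_def Union_L pclass_in_carrier del: in_listsI)

lemma AL_cls: assumes "g \<in> AL" obtains w where "w \<in> lists (V \<times> UNIV)" "g = cls w"
  using assms presented_group_carrierE[of g V "raag_relators L"] by (auto simp: raag_def Union_L)

lemma phi_cls: "w \<in> lists (V \<times> UNIV) \<Longrightarrow> \<phi> (cls w) = wval w"
proof (induction w rule: wval.induct)
  case (2 x e w)
  then have "w \<in> lists (V \<times> UNIV)" "x \<in> V" by auto
  with 2 show ?case by (simp only: cls_Cons phi_mult apow_closed cls_closed phi_apow wval.simps)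
qed (simp add: cls_Nil)

lemma apow_commute:
  assumes "{x, y} \<in> L" shows "apow x e \<cdot> apow y e' = apow y e' \<cdot> apow x e"
proof -
  have xy: "x \<in> V" "y \<in> V" using assms simplex_subset_V by auto
  have c: "gen x \<cdot> gen y = gen y \<cdot> gen x" using raag_gen_commute[OF assms] .
  have inv1: "ainv a \<cdot> b = b \<cdot> ainv a" if "a \<in> AL" "b \<in> AL" "a \<cdot> b = b \<cdot> a" for a b
    by (metis A.inv_closed A.inv_solve_left A.inv_solve_right A.m_assoc A.m_closed that)
  show ?thesis
    using c inv1[of "gen x" "gen y"] inv1[of "gen y" "gen x"] inv1[of "gen x" "ainv (gen y)"] xy
    by (auto simp: apow_def)
qed

text \<open>Both moves of \<open>word_equiv\<close> are carried to valid moves. The two letters of a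
  cancelling pair have the same sign, so they still cancel; around a relator the sign of each of its
  two letters is constant, so the relator becomes a commutator of generators or their
  inverses.\<close>

lemma tword_equiv:
  assumes "word_equiv V (raag_relators L) p q" "lpa a" "u \<in> FB"
  shows "cls (tword a u p) = cls (tword a u q) \<and> wval p = wval q"
  using assms
proof (induction arbitrary: u rule: word_equiv.induct)
  case (cancel p w x e)
  let ?v = "u \<bullet> wval p"
  let ?d = "e = eps a ?v x"
  have v: "?v \<in> FB" using cancel by simp
  have lsts: "tword a u p \<in> lists (V \<times> UNIV)" "tword a ?v w \<in> lists (V \<times> UNIV)"
    using cancel tword_lists by blast+
  have sg: "((\<not> e) = eps a (?v \<bullet> fpow x e) x) = (\<not> ?d)" using lpa_step(2)[OF cancel(4) v, of x e] by auto
  have "tword a u (p @ [(x, e), (x, \<not> e)] @ w) = tword a u p @ (x, ?d) # (x, \<not> ?d) # tword a ?v w"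
    using cancel.prems v by (simp only: tword_append append_Cons append_Nil tword.simps sg fpow_cancel)
  moreover have "cls ((x, ?d) # (x, \<not> ?d) # tword a ?v w) = cls (tword a ?v w)"
  proof -
    have "(x, \<not> ?d) # tword a ?v w \<in> lists (V \<times> UNIV)" using lsts cancel by auto
    then have "cls ((x, ?d) # (x, \<not> ?d) # tword a ?v w) = apow x ?d \<cdot> (apow x (\<not> ?d) \<cdot> cls (tword a ?v w))"
      using lsts cancel by (simp only: cls_Cons)
    then show ?thesis
      using apow_cancel[of "\<one>\<^sub>L" x ?d] cancel cls_closed[OF lsts(2)] by (simp flip: A.m_assoc)
  qed
  moreover have "(x, ?d) # (x, \<not> ?d) # tword a ?v w \<in> lists (V \<times> UNIV)" using lsts cancel by auto
  ultimately have "cls (tword a u (p @ [(x, e), (x, \<not> e)] @ w)) = cls (tword a u (p @ w))"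
    using lsts cancel.prems by (simp only: tword_append cls_append)
  moreover have "wval (p' @ q') = wval p' \<bullet> wval q'" for p' q'
    by (induction p' rule: wval.induct) (simp_all add: F.m_assoc)
  then have "wval (p @ [(x, e), (x, \<not> e)] @ w) = wval (p @ w)"
    using fpow_cancel[of "\<one>\<^sub>F" x e] by (simp flip: F.m_assoc)
  ultimately show ?case by simp
next
  case (relator p w r)
  obtain x y where r: "r = [(x, True), (y, True), (x, False), (y, False)]" "x \<noteq> y" "{x, y} \<in> L"
    using relator(3) unfolding raag_relators_def by blast
  have xy: "x \<in> V" "y \<in> V" "{y, x} \<in> L" using r simplex_subset_V by (auto simp: insert_commute)
  let ?v = "u \<bullet> wval p"
  let ?d = "eps a ?v x" and ?e = "eps a ?v y"
  have v: "?v \<in> FB" using relator by simp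
  have lsts: "tword a u p \<in> lists (V \<times> UNIV)" "tword a ?v w \<in> lists (V \<times> UNIV)"
    using relator tword_lists by blast+
  have comm: "fpow x e \<bullet> fpow y e' = fpow y e' \<bullet> fpow x e" for e e'
    using phi_mult[of "apow x e" "apow y e'"] phi_mult[of "apow y e'" "apow x e"] apow_commute[OF r(3)] xy
    by (simp add: phi_apow)
  \<comment> \<open>The relator also closes up in the tree, so the tail \<open>w\<close> is
    transported from the same vertex on both sides.\<close>
  have vv: "?v \<bullet> fpow x True \<bullet> fpow y True \<bullet> fpow x False \<bullet> fpow y False = ?v"
  proof -
    have "?v \<bullet> fpow x True \<bullet> fpow y True = ?v \<bullet> fpow y True \<bullet> fpow x True"
      using v by (simp add: F.m_assoc comm)
    then show ?thesis using v fpow_cancel(1)[of "?v \<bullet> fpow y True" x True] fpow_cancel(1)[of ?v y True] by simp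
  qed
  have e1: "eps a (?v \<bullet> fpow x True) y = ?e" using eps_adjacent[OF xy(3) v relator(5)] .
  have e2: "eps a (?v \<bullet> fpow x True \<bullet> fpow y True) x = ?d"
    using eps_adjacent[OF r(3) _ relator(5), of "?v \<bullet> fpow x True" True] lpa_step(2)[OF relator(5) v] v by simp
  have e3: "eps a (?v \<bullet> fpow x True \<bullet> fpow y True \<bullet> fpow x False) y = ?e"
    using eps_adjacent[OF xy(3) _ relator(5), of "?v \<bullet> fpow x True \<bullet> fpow y True" False]
      lpa_step(2)[OF relator(5), of "?v \<bullet> fpow x True" y True] v e1 by simp
  let ?t = "[(x, ?d), (y, ?e), (x, \<not> ?d), (y, \<not> ?e)]"
  have "tword a ?v (r @ w) = ?t @ tword a ?v w"
    using v by (simp add: r e1 e2 e3 vv)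
  then have "tword a u (p @ r @ w) = tword a u p @ ?t @ tword a ?v w"
    using relator.prems by (simp only: tword_append)
  moreover have "cls ?t = \<one>\<^sub>L"
  proof -
    have "cls ?t = apow x ?d \<cdot> (apow y ?e \<cdot> (apow x (\<not> ?d) \<cdot> (apow y (\<not> ?e) \<cdot> \<one>\<^sub>L)))"
      using xy by (simp add: cls_Cons cls_Nil)
    also have "\<dots> = apow x ?d \<cdot> (apow y ?e \<cdot> apow x (\<not> ?d)) \<cdot> apow y (\<not> ?e)"
      using xy by (simp add: A.m_assoc)
    also have "\<dots> = \<one>\<^sub>L \<cdot> apow x ?d \<cdot> apow x (\<not> ?d) \<cdot> apow y ?e \<cdot> apow y (\<not> ?e)"
      using xy by (simp add: A.m_assoc apow_commute[OF r(3)])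
    also have "\<dots> = \<one>\<^sub>L"
      unfolding apow_cancel(1)[OF A.one_closed xy(1)] by (rule apow_cancel(1)[OF A.one_closed xy(2)])
    finally show ?thesis .
  qed
  moreover have "?t \<in> lists (V \<times> UNIV)" "?t @ tword a ?v w \<in> lists (V \<times> UNIV)" using xy lsts by auto
  ultimately have "cls (tword a u (p @ r @ w)) = cls (tword a u (p @ w))"
    using lsts relator.prems cls_closed[OF lsts(2)] by (simp only: tword_append cls_append A.l_one)
  moreover have app: "wval (p' @ q') = wval p' \<bullet> wval q'" for p' q'
    by (induction p' rule: wval.induct) (simp_all add: F.m_assoc)
  have "wval r = \<one>\<^sub>F"
    using phi_cls[OF relator(4)] phi.relators[OF relator(3,4)] phi.induced_hom_pclass[OF relator(4)]
    unfolding raag_to_free_def by simp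
  then have "wval (p @ r @ w) = wval (p @ w)" by (simp add: app)
  ultimately show ?case by simp
qed auto

section \<open>Automorphisms of the tree\<close>

definition edge :: "'v word set \<Rightarrow> 'v word set \<Rightarrow> bool" where
  "edge x y \<longleftrightarrow> (\<exists>b. tree_edge B b x y)"

definition tauts :: "('v word set \<Rightarrow> 'v word set) set" where
  "tauts = {f \<in> Bij FB. \<forall>x\<in>FB. \<forall>y\<in>FB. edge (f x) (f y) \<longleftrightarrow> edge x y}"

lemma carrier_tree_aut [simp]: "carrier (tree_aut B) = tauts"
  by (simp add: tree_aut_def tauts_def edge_def)

lemma tree_aut_eq: "tree_aut B = (BijGroup FB)\<lparr>carrier := tauts\<rparr>"
  by (simp add: tree_aut_def tauts_def edge_def)

lemma subgroup_tauts: "subgroup tauts (BijGroup FB)"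
proof (rule subgroup_BijGroupI)
  fix f assume f: "f \<in> tauts"
  then have fB: "f \<in> Bij FB" by (simp add: tauts_def)
  have "edge (inv_into FB f x) (inv_into FB f y) \<longleftrightarrow> edge x y" if "x \<in> FB" "y \<in> FB" for x y
    using inv_into_Bij[OF fB that(1)] inv_into_Bij[OF fB that(2)] f unfolding tauts_def
    by (metis (mono_tags, lifting) mem_Collect_eq)
  then show "restrict (inv_into FB f) FB \<in> tauts"
    using restrict_inv_into_Bij[OF fB] by (simp add: tauts_def)
qed (auto simp: tauts_def id_Bij compose_Bij compose_eq Bij_mem)

lemma group_tree_aut: "group (tree_aut B)"
  unfolding tree_aut_eq by (rule subgroup.subgroup_is_group[OF subgroup_tauts group_BijGroup])

lemma tauts_Bij: "f \<in> tauts \<Longrightarrow> f \<in> Bij FB"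
  by (simp add: tauts_def)

lemma tree_aut_mult: "f \<in> tauts \<Longrightarrow> g \<in> tauts \<Longrightarrow> f \<otimes>\<^bsub>tree_aut B\<^esub> g = compose FB f g"
  by (simp add: tree_aut_eq tauts_Bij)

lemma tree_aut_one: "\<one>\<^bsub>tree_aut B\<^esub> = (\<lambda>x\<in>FB. x)"
  by (simp add: tree_aut_eq)

lemma lpa_tauts: "lpa a \<Longrightarrow> a \<in> tauts"
  by (simp add: lpa_def)

lemma tree_edge_carrier: "tree_edge B b x y \<Longrightarrow> x \<in> FB \<and> y \<in> FB"
  by (simp add: tree_edge_def)

lemma tree_edge_iff: "tree_edge B b x y \<longleftrightarrow> b \<in> B \<and> x \<in> FB \<and> (\<exists>e. y = x \<bullet> fpow b e)"
proof
  assume *: "tree_edge B b x y"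
  then have "y = x \<bullet> fpow b True \<or> y = x \<bullet> fpow b False"
    by (auto simp: tree_edge_def fpow_def F.m_assoc)
  then show "b \<in> B \<and> x \<in> FB \<and> (\<exists>e. y = x \<bullet> fpow b e)" using * by (auto simp: tree_edge_def)
next
  assume "b \<in> B \<and> x \<in> FB \<and> (\<exists>e. y = x \<bullet> fpow b e)"
  then obtain e where *: "b \<in> B" "x \<in> FB" "y = x \<bullet> fpow b e" by blast
  show "tree_edge B b x y"
  proof (cases e)
    case True
    then show ?thesis using * by (simp add: tree_edge_def fpow_def)
  next
    case False
    then show ?thesis using * by (simp add: tree_edge_def fpow_def F.m_assoc)
  qed
qed

lemma lpa_id: "lpa (\<lambda>x\<in>FB. x)"
  using subgroup.one_closed[OF subgroup_tauts] tree_edge_carrier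
  by (auto simp: lpa_def label_preserving_def)

lemma lpa_inverse: assumes a: "lpa a" shows "lpa (restrict (inv_into FB a) FB)"
proof -
  let ?i = "restrict (inv_into FB a) FB"
  note aB = lpa_Bij[OF a]
  have "tree_edge B b (?i x) (?i y)" if xy: "tree_edge B b x y" for b x y
  proof -
    obtain e where e: "b \<in> B" "x \<in> FB" "y = x \<bullet> fpow b e" using xy tree_edge_iff by blast
    obtain u where u: "u \<in> FB" "x = a u" using Bij_surj[OF aB e(2)] by metis
    have "y = a (u \<bullet> fpow b (e = eps a u b))"
      using lpa_step(1)[OF a u(1), of b "e = eps a u b"] e u by (cases e; cases "eps a u b") simp_all
    then have "?i y = u \<bullet> fpow b (e = eps a u b)" "?i x = u"
      using Bij_inv_left[OF aB] u by (simp_all only: F.m_closed fpow_closed)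
    then show ?thesis unfolding tree_edge_iff using u e by blast
  qed
  moreover have "?i \<in> tauts"
    using subgroup.m_inv_closed[OF subgroup_tauts lpa_tauts[OF a]] BijGroup_inv[OF aB] by simp
  ultimately show ?thesis by (simp add: lpa_def label_preserving_def)
qed

lemma wval_tword: "lpa a \<Longrightarrow> u \<in> FB \<Longrightarrow> a u \<bullet> wval (tword a u w) = a (u \<bullet> wval w)"
  by (induction a u w rule: tword.induct) (simp_all add: lpa_step(1) flip: F.m_assoc)

text \<open>A label-preserving automorphism may reverse edges of the tree; \<open>eps\<close> records which, and a
  lift traverses the corresponding edges of the cover backwards.\<close>

definition vlift :: "('v word set \<Rightarrow> 'v word set) \<Rightarrow> ('v word set \<Rightarrow> 'v word set) \<Rightarrow> bool" where
  "vlift a f \<longleftrightarrow> (\<forall>g\<in>AL. f g \<in> AL \<and> \<phi> (f g) = a (\<phi> g)) \<and>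
     (\<forall>g\<in>AL. \<forall>x\<in>V. f (g \<cdot> gen x) = f g \<cdot> apow x (eps a (\<phi> g) x))"

lemma vliftD: "vlift a f \<Longrightarrow> g \<in> AL \<Longrightarrow> f g \<in> AL" "vlift a f \<Longrightarrow> g \<in> AL \<Longrightarrow> \<phi> (f g) = a (\<phi> g)"
  by (auto simp: vlift_def)

lemma vlift_apow:
  assumes a: "lpa a" and f: "vlift a f" and g: "g \<in> AL" and x: "x \<in> V"
  shows "f (g \<cdot> apow x e) = f g \<cdot> apow x (e = eps a (\<phi> g) x)"
proof (cases e)
  case True
  then show ?thesis using f g x by (simp add: vlift_def apow_def[of x True])
next
  case False
  let ?h = "g \<cdot> apow x False"
  have h: "?h \<in> AL" "?h \<cdot> gen x = g" using g x by (simp_all add: apow_def A.m_assoc)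
  have "eps a (\<phi> ?h) x = eps a (\<phi> g) x" using lpa_step(2)[OF a, of "\<phi> g" x False] g x by (simp add: phi_mult phi_apow)
  moreover have "f (?h \<cdot> gen x) = f ?h \<cdot> apow x (eps a (\<phi> ?h) x)" using f h(1) x unfolding vlift_def by blast
  ultimately have "f g = f ?h \<cdot> apow x (eps a (\<phi> g) x)" using h(2) by simp
  then show ?thesis using False vliftD(1)[OF f h(1)] x by simp
qed

text \<open>Transport a word for \<open>g\<close> from the base vertex of the tree and multiply by
  \<open>g0\<close> on the left; by \<open>tword_equiv\<close> the choice of the word does not
  matter.\<close>

lemma vlift_exists:
  assumes a: "lpa a" and g0: "g0 \<in> AL" "\<phi> g0 = a \<one>\<^sub>F"
  obtains f where "vlift a f" "f \<one>\<^sub>L = g0"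
proof -
  define f where "f g = g0 \<cdot> cls (tword a \<one>\<^sub>F (SOME w. w \<in> lists (V \<times> UNIV) \<and> g = cls w))" for g
  have f: "f (cls w) = g0 \<cdot> cls (tword a \<one>\<^sub>F w)" if w: "w \<in> lists (V \<times> UNIV)" for w
  proof -
    define w' where "w' = (SOME w'. w' \<in> lists (V \<times> UNIV) \<and> cls w = cls w')"
    have w': "w' \<in> lists (V \<times> UNIV) \<and> cls w = cls w'"
      unfolding w'_def by (rule someI[of _ w]) (use w in blast)
    then have "word_equiv V (raag_relators L) w w'" using word_equiv_cls[of w w'] w by blast
    then have "cls (tword a \<one>\<^sub>F w) = cls (tword a \<one>\<^sub>F w')" using tword_equiv[OF _ a, of w w' "\<one>\<^sub>F"] by simp
    then show ?thesis by (simp add: f_def flip: w'_def)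
  qed
  have "vlift a f"
    unfolding vlift_def
  proof (intro conjI ballI)
    fix g assume "g \<in> AL"
    then obtain w where w: "w \<in> lists (V \<times> UNIV)" "g = cls w" by (rule AL_cls)
    have tw: "tword a \<one>\<^sub>F w \<in> lists (V \<times> UNIV)" using w(1) by (rule tword_lists)
    show "f g \<in> AL" using f[OF w(1)] g0 cls_closed[OF tw] by (simp add: w(2))
    show "\<phi> (f g) = a (\<phi> g)"
      using f[OF w(1)] g0 cls_closed[OF tw] phi_cls[OF tw] phi_cls[OF w(1)] wval_tword[OF a, of "\<one>\<^sub>F" w]
      by (simp add: w(2) phi_mult)
    fix x assume x: "x \<in> V"
    have wx: "w @ [(x, True)] \<in> lists (V \<times> UNIV)" using w x by simp
    have "g \<cdot> gen x = cls (w @ [(x, True)])" unfolding cls_snoc[OF w(1) x] w(2) by (simp add: apow_def)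
    then have "f (g \<cdot> gen x) = g0 \<cdot> cls (tword a \<one>\<^sub>F w @ [(x, eps a (wval w) x)])"
      using f[OF wx] by (simp add: tword_append)
    also have "\<dots> = f g \<cdot> apow x (eps a (\<phi> g) x)"
      unfolding cls_snoc[OF tw x] w(2) phi_cls[OF w(1)] f[OF w(1)]
      using g0 cls_closed[OF tw] x by (simp add: A.m_assoc)
    finally show "f (g \<cdot> gen x) = f g \<cdot> apow x (eps a (\<phi> g) x)" .
  qed
  moreover have "f \<one>\<^sub>L = g0" using f[of "[]"] g0 by (simp add: cls_Nil)
  ultimately show ?thesis using that by blast
qed

lemma vlift_unique:
  assumes a: "lpa a" and f: "vlift a f" and f': "vlift a f'" and 1: "f \<one>\<^sub>L = f' \<one>\<^sub>L" and g: "g \<in> AL"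
  shows "f g = f' g"
  using g
proof (induction rule: raag_induct)
  case (mult g x)
  then show ?case using f f' Union_L unfolding vlift_def by metis
next
  case (inv_mult g x)
  then show ?case using vlift_apow[OF a f, of g x False] vlift_apow[OF a f', of g x False] Union_L by (simp add: apow_def[of x False])
qed (rule 1)

lemma vlift_N:
  assumes "vlift a f" "n \<in> N" shows "vlift a (\<lambda>g. n \<cdot> f g)"
  unfolding vlift_def
proof (intro conjI ballI)
  have n: "n \<in> AL" "\<phi> n = \<one>\<^sub>F" using assms(2) by (auto simp: N_iff)
  fix g assume g: "g \<in> AL"
  note fg = vliftD[OF assms(1) g]
  show "n \<cdot> f g \<in> AL" using n fg by simp
  have "\<phi> (n \<cdot> f g) = \<phi> (f g)" using n fg(1) phi_closed[OF fg(1)] by (simp only: phi_mult F.l_one)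
  then show "\<phi> (n \<cdot> f g) = a (\<phi> g)" using fg(2) by simp
  fix x assume x: "x \<in> V"
  have "f (g \<cdot> gen x) = f g \<cdot> apow x (eps a (\<phi> g) x)" using assms(1) g x unfolding vlift_def by blast
  then show "n \<cdot> f (g \<cdot> gen x) = n \<cdot> f g \<cdot> apow x (eps a (\<phi> g) x)"
    using n fg(1) x by (simp add: A.m_assoc)
qed

text \<open>The values at the base vertex lie over one tree vertex, so they differ by an element of
  the kernel. Left multiplication by it turns lifts into lifts, and a lift is determined by its
  value at the base vertex.\<close>

lemma vlift_same:
  assumes a: "lpa a" and f: "vlift a f" and f': "vlift a f'"
  obtains n where "n \<in> N" "\<And>g. g \<in> AL \<Longrightarrow> f' g = n \<cdot> f g"
proof -
  obtain n where n: "n \<in> N" "f' \<one>\<^sub>L = n \<cdot> f \<one>\<^sub>L"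
    using same_phi[of "f \<one>\<^sub>L" "f' \<one>\<^sub>L"] vliftD[OF f, of "\<one>\<^sub>L"] vliftD[OF f', of "\<one>\<^sub>L"] by auto
  show ?thesis
    using vlift_unique[OF a f' vlift_N[OF f n(1)] n(2)] n(1) that by blast
qed

text \<open>Signs multiply along a composition; on truth values the product of two signs is their
  equality.\<close>

lemma eps_compose:
  assumes "lpa a" "lpa b" "u \<in> FB"
  shows "eps (compose FB a b) u x \<longleftrightarrow> (eps b u x = eps a (b u) x)"
proof (cases "x \<in> B")
  case True
  have "compose FB a b (u \<bullet> fgen x) = a (b u) \<bullet> fpow x (eps b u x = eps a (b u) x)"
    using assms True lpa_step1[OF assms(2,3) True] lpa_step(1)[OF assms(1), of "b u" x] by (simp add: compose_eq)
  moreover have "compose FB a b u \<bullet> fgen x = a (b u) \<bullet> fpow x True"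
    using assms True by (simp add: compose_eq fpow_def)
  ultimately show ?thesis
    using fpow_inj[OF True, of "a (b u)"] assms True by (simp add: eps_def[of "compose FB a b"])
qed (simp add: eps_not_B)

lemma vlift_compose:
  assumes a: "lpa a" and b: "lpa b" and f: "vlift a f" and h: "vlift b h"
  shows "vlift (compose FB a b) (\<lambda>g. f (h g))"
  unfolding vlift_def
proof (intro conjI ballI)
  fix g assume g: "g \<in> AL"
  show "f (h g) \<in> AL" "\<phi> (f (h g)) = compose FB a b (\<phi> g)"
    using g vliftD[OF f] vliftD[OF h] by (simp_all add: compose_eq)
  fix x assume x: "x \<in> V"
  have "h (g \<cdot> gen x) = h g \<cdot> apow x (eps b (\<phi> g) x)" using h g x unfolding vlift_def by blast
  then have "f (h (g \<cdot> gen x)) = f (h g) \<cdot> apow x (eps b (\<phi> g) x = eps a (\<phi> (h g)) x)"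
    using vlift_apow[OF a f vliftD(1)[OF h g] x] by simp
  then show "f (h (g \<cdot> gen x)) = f (h g) \<cdot> apow x (eps (compose FB a b) (\<phi> g) x)"
    using vliftD(2)[OF h g] eps_compose[OF a b phi_closed[OF g]] by simp
qed

lemma eps_id: "u \<in> FB \<Longrightarrow> eps (\<lambda>x\<in>FB. x) u x"
  by (simp add: eps_def)

lemma vlift_trans: assumes "n \<in> N" shows "vlift (\<lambda>x\<in>FB. x) (\<lambda>g. n \<cdot> g)"
  using assms by (auto simp: vlift_def N_iff phi_mult eps_id apow_def A.m_assoc)

lemma vlift_idD:
  assumes "vlift (\<lambda>x\<in>FB. x) f" obtains n where "n \<in> N" "\<And>g. g \<in> AL \<Longrightarrow> f g = n \<cdot> g"
proof -
  have "\<one>\<^sub>L \<in> N" by (simp add: N_iff)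
  from vlift_same[OF lpa_id vlift_trans[OF this] assms] obtain n where
    "n \<in> N" "\<And>g. g \<in> AL \<Longrightarrow> f g = n \<cdot> (\<one>\<^sub>L \<cdot> g)" by blast
  then show ?thesis using that[of n] by simp
qed

lemma vlift_inverse:
  assumes a: "lpa a" and f: "vlift a f"
  obtains f' where "vlift (restrict (inv_into FB a) FB) f'"
    "\<And>g. g \<in> AL \<Longrightarrow> f' (f g) = g" "\<And>g. g \<in> AL \<Longrightarrow> f (f' g) = g"
proof -
  let ?i = "restrict (inv_into FB a) FB"
  note i = lpa_inverse[OF a] and aB = lpa_Bij[OF a]
  have ci: "compose FB ?i a = (\<lambda>x\<in>FB. x)" by (rule Bij_compose_restrict_eq[OF aB])
  have ic: "compose FB a ?i = (\<lambda>x\<in>FB. x)"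
    using inv_into_Bij[OF aB] by (auto simp: compose_def restrict_def fun_eq_iff)
  obtain h where h: "h \<in> AL" "\<phi> h = ?i \<one>\<^sub>F" using phi_surj[OF lpa_closed[OF i F.one_closed]] by blast
  obtain k where k: "vlift ?i k" "k \<one>\<^sub>L = h" using vlift_exists[OF i h] by blast
  obtain n where n: "n \<in> N" "\<And>g. g \<in> AL \<Longrightarrow> k (f g) = n \<cdot> g"
    using vlift_idD vlift_compose[OF i a k(1) f] unfolding ci by blast
  have nA: "n \<in> AL" "ainv n \<in> N" using n(1) by (auto simp: N_iff phi_inv)
  \<comment> \<open>A lift \<open>k\<close> of the inverse automorphism may miss the inverse of
    \<open>f\<close> by a kernel element; dividing by that element makes it a left inverse.\<close>
  let ?k = "\<lambda>g. ainv n \<cdot> k g"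
  have k': "vlift ?i ?k" by (rule vlift_N[OF k(1) nA(2)])
  have l: "?k (f g) = g" if "g \<in> AL" for g using n(2)[OF that] nA that by (simp flip: A.m_assoc)
  obtain m where m: "m \<in> N" "\<And>g. g \<in> AL \<Longrightarrow> f (?k g) = m \<cdot> g"
    using vlift_idD vlift_compose[OF a i f k'] unfolding ic by blast
  have f1: "f \<one>\<^sub>L \<in> AL" using vliftD(1)[OF f] by simp
  \<comment> \<open>The other composite is translation by some \<open>m\<close>. It fixes the vertex
    \<open>f \<one>\<^sub>L\<close>, and translations act freely, so \<open>m\<close> is
    trivial.\<close>
  have "f (?k (f \<one>\<^sub>L)) = f \<one>\<^sub>L" using l[OF A.one_closed] by simp
  then have "m \<cdot> f \<one>\<^sub>L = f \<one>\<^sub>L" using m(2)[OF f1] by simp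
  then have "m = \<one>\<^sub>L" using m(1) f1 A.right_cancel[of m "\<one>\<^sub>L" "f \<one>\<^sub>L"] by (simp add: N_iff)
  then show ?thesis using that[OF k' l] m(2) by simp
qed

section \<open>Extending a lift to the cubes\<close>

lemma sp_insert: "insert x \<tau> \<in> L \<Longrightarrow> x \<notin> \<tau> \<Longrightarrow> sp (insert x \<tau>) = sp \<tau> \<cdot> gen x"
proof -
  assume *: "insert x \<tau> \<in> L" "x \<notin> \<tau>"
  then have "x \<in> V" using simplex_subset_V by blast
  moreover have "sp (insert x \<tau>) = sp \<tau> \<cdot> sp {x}" by (rule sp_partition[OF *(1)]) (use * in auto)
  ultimately show ?thesis by simp
qed

lemma sp_commute:
  assumes "\<sigma> \<in> L" "\<tau> \<subseteq> \<sigma>" "\<rho> \<subseteq> \<sigma>" "\<tau> \<inter> \<rho> = {}" shows "sp \<tau> \<cdot> sp \<rho> = sp \<rho> \<cdot> sp \<tau>"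
proof -
  have "\<tau> \<union> \<rho> \<in> L" using assms(1) by (rule simplex_subset) (use assms in auto)
  then show ?thesis using sp_Un[of \<tau> \<rho>] sp_Un[of \<rho> \<tau>] assms(4) by (simp add: Un_commute Int_commute)
qed

text \<open>Passing from one corner of a cube to another crosses only edges whose labels equal
  \<open>x\<close> or are adjacent to it, and these keep the sign of \<open>x\<close>. So a single
  reflection serves the whole cube.\<close>

lemma eps_sp:
  assumes a: "lpa a" and g: "g \<in> AL" and \<sigma>: "\<sigma> \<in> L" and \<tau>: "\<tau> \<subseteq> \<sigma>" and x: "x \<in> \<sigma>"
  shows "eps a (\<phi> (g \<cdot> sp \<tau>)) x = eps a (\<phi> g) x"
proof -
  have "finite \<tau>" using \<sigma> \<tau> finite_simplex finite_subset by blast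
  then show ?thesis using \<tau>
  proof (induction \<tau> rule: finite_induct)
    case (insert y \<tau>)
    have L: "insert y \<tau> \<in> L" "\<tau> \<in> L" using insert.prems \<sigma> simplex_subset by (meson subset_insertI2 subset_trans subset_insertI)+
    have "y \<in> V" using L simplex_subset_V by auto
    have "{x, y} \<in> L" using \<sigma> x insert.prems by (auto intro: simplex_subset)
    have "\<phi> (g \<cdot> sp (insert y \<tau>)) = \<phi> (g \<cdot> sp \<tau>) \<bullet> fpow y True"
      using g L \<open>y \<in> V\<close> insert.hyps by (simp add: sp_insert phi_mult phi_gen fpow_def F.m_assoc)
    then show ?case using eps_adjacent[OF \<open>{x, y} \<in> L\<close> _ a, of "\<phi> (g \<cdot> sp \<tau>)" True] insert g L by simp
  qed (use g in simp)
qed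

lemma commute_inv:
  assumes "x \<in> AL" "y \<in> AL" "x \<cdot> y = y \<cdot> x" shows "ainv x \<cdot> y = y \<cdot> ainv x"
  using assms by (metis A.inv_closed A.inv_solve_left A.inv_solve_right A.m_assoc A.m_closed)

lemma vlift_sp:
  assumes a: "lpa a" and f: "vlift a f" and g: "g \<in> AL" and \<tau>: "\<tau> \<in> L"
  shows "f (g \<cdot> sp \<tau>) = f g \<cdot> sp {x \<in> \<tau>. eps a (\<phi> g) x} \<cdot> ainv (sp {x \<in> \<tau>. \<not> eps a (\<phi> g) x})"
  using finite_simplex[OF \<tau>] \<tau>
proof (induction \<tau> rule: finite_induct)
  case (insert x \<tau>)
  let ?E = "\<lambda>\<tau>. {x \<in> \<tau>. eps a (\<phi> g) x}" and ?D = "\<lambda>\<tau>. {x \<in> \<tau>. \<not> eps a (\<phi> g) x}"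
  have L: "\<tau> \<in> L" "?E \<tau> \<in> L" "?D \<tau> \<in> L" "x \<in> V"
    using insert.prems simplex_subset_V by (auto intro: simplex_subset)
  have fg: "f g \<in> AL" using vliftD[OF f g] by simp
  have e: "eps a (\<phi> (g \<cdot> sp \<tau>)) x = eps a (\<phi> g) x" by (rule eps_sp[OF a g insert.prems]) auto
  have "f (g \<cdot> sp (insert x \<tau>)) = f (g \<cdot> sp \<tau> \<cdot> apow x True)"
    using g L insert by (simp add: sp_insert A.m_assoc apow_def)
  also have "\<dots> = f (g \<cdot> sp \<tau>) \<cdot> apow x (eps a (\<phi> g) x)"
    using vlift_apow[OF a f, of "g \<cdot> sp \<tau>" x True] g L e by simp
  also have "\<dots> = f g \<cdot> sp (?E \<tau>) \<cdot> ainv (sp (?D \<tau>)) \<cdot> apow x (eps a (\<phi> g) x)"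
    using insert.IH L by simp
  also have "\<dots> = f g \<cdot> sp (?E (insert x \<tau>)) \<cdot> ainv (sp (?D (insert x \<tau>)))"
  proof (cases "eps a (\<phi> g) x")
    case True
    then have sets: "?E (insert x \<tau>) = insert x (?E \<tau>)" "?D (insert x \<tau>) = ?D \<tau>" by auto
    have iL: "insert x (?E \<tau>) \<in> L" using insert.prems by (rule simplex_subset) auto
    have "sp (?D \<tau>) \<cdot> sp {x} = sp {x} \<cdot> sp (?D \<tau>)"
      by (rule sp_commute[OF insert.prems]) (use insert.hyps in auto)
    then have "ainv (sp (?D \<tau>)) \<cdot> gen x = gen x \<cdot> ainv (sp (?D \<tau>))"
      using commute_inv[of "sp (?D \<tau>)" "gen x"] L by simp
    then show ?thesis
      unfolding sets using True fg L insert.hyps iL by (simp add: apow_def sp_insert A.m_assoc)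
  next
    case False
    then have sets: "?D (insert x \<tau>) = insert x (?D \<tau>)" "?E (insert x \<tau>) = ?E \<tau>" by auto
    have iL: "insert x (?D \<tau>) \<in> L" using insert.prems by (rule simplex_subset) auto
    have "sp (?D \<tau>) \<cdot> sp {x} = sp {x} \<cdot> sp (?D \<tau>)"
      by (rule sp_commute[OF insert.prems]) (use insert.hyps in auto)
    then have "sp (insert x (?D \<tau>)) = gen x \<cdot> sp (?D \<tau>)"
      using L iL insert.hyps by (simp add: sp_insert)
    then show ?thesis
      unfolding sets using False fg L by (simp add: apow_def A.m_assoc A.inv_mult_group)
  qed
  finally show ?case .
qed (use vliftD(1)[OF f g] g in simp)

definition flip :: "'v set \<Rightarrow> ('v \<Rightarrow> real) \<Rightarrow> 'v \<Rightarrow> real" where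
  "flip D s = (\<lambda>x. if x \<in> D then 1 - s x else s x)"

definition flips :: "('v word set \<Rightarrow> 'v word set) \<Rightarrow> 'v word set \<Rightarrow> 'v set \<Rightarrow> 'v set" where
  "flips a g \<sigma> = {x \<in> \<sigma>. \<not> eps a (\<phi> g) x}"

text \<open>The image of a cube runs backwards from the image of its initial vertex in the
  directions of \<open>D\<close>; the initial vertex of the image cube is therefore reached by the
  factor \<open>ainv (sp D)\<close>, and the coordinates in \<open>D\<close> are reflected.\<close>

definition ext :: "('v word set \<Rightarrow> 'v word set) \<Rightarrow> ('v word set \<Rightarrow> 'v word set) \<Rightarrow> 'v cover_point \<Rightarrow> 'v cover_point" where
  "ext a f = (\<lambda>p\<in>CP. let D = flips a (fst p) (supp (snd p)) in cm (f (fst p) \<cdot> ainv (sp D)) (flip D (snd p)))"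

lemma flip_unit_cube: "D \<subseteq> \<sigma> \<Longrightarrow> s \<in> unit_cube \<sigma> \<Longrightarrow> flip D s \<in> unit_cube \<sigma>"
  by (auto simp: unit_cube_def flip_def)

lemma flip_flip [simp]: "flip D (flip D s) = s"
  by (auto simp: flip_def)

lemma cube_dist_flip: "cube_dist L (flip D s) (flip D t) = cube_dist L s t"
  unfolding cube_dist_def by (intro arg_cong[where f = sqrt] sum.cong) (auto simp: flip_def power2_commute)

lemma flips_simplex: "\<sigma> \<in> L \<Longrightarrow> flips a g \<sigma> \<in> L" "flips a g \<sigma> \<subseteq> \<sigma>"
  by (auto simp: flips_def intro: simplex_subset)

text \<open>Bookkeeping for \<open>ext_cm\<close>: there \<open>m\<close> is the product over the
  kept coordinates at 1, and \<open>p\<close>, \<open>q\<close>, \<open>z\<close> are the products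
  over the reversed coordinates at 1, in the interior and at 0.\<close>

lemma commuting_identity:
  assumes c: "m \<in> AL" "p \<in> AL" "q \<in> AL" "z \<in> AL"
    and mp: "p \<cdot> m = m \<cdot> p" and mq: "q \<cdot> m = m \<cdot> q" and pq: "p \<cdot> q = q \<cdot> p"
  shows "m \<cdot> ainv p \<cdot> ainv q = ainv (z \<cdot> (p \<cdot> q)) \<cdot> (z \<cdot> m)"
proof -
  have "ainv (z \<cdot> (p \<cdot> q)) \<cdot> (z \<cdot> m) = ainv (q \<cdot> p) \<cdot> (ainv z \<cdot> z) \<cdot> m"
    using c by (simp only: pq A.inv_mult_group A.m_assoc A.m_closed A.inv_closed)
  also have "\<dots> = ainv p \<cdot> (ainv q \<cdot> m)" using c by (simp add: A.inv_mult_group A.m_assoc)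
  also have "\<dots> = ainv p \<cdot> m \<cdot> ainv q" using c commute_inv[OF c(3,1) mq] by (simp add: A.m_assoc)
  also have "\<dots> = m \<cdot> ainv p \<cdot> ainv q" using commute_inv[OF c(2,1) mp] by simp
  finally show ?thesis by simp
qed

text \<open>\<open>ext\<close> is defined through the open cube containing the point. On the
  boundary of a closed cube this is a smaller cube, possibly with another initial vertex; the
  content is that the reflection of the large cube restricts to that of the small one.\<close>

lemma ext_cm:
  assumes a: "lpa a" and f: "vlift a f" and g: "g \<in> AL" and \<sigma>: "\<sigma> \<in> L" and s: "s \<in> unit_cube \<sigma>"
  shows "ext a f (cm g s) = cm (f g \<cdot> ainv (sp (flips a g \<sigma>))) (flip (flips a g \<sigma>) s)"
proof -
  define t where "t = (\<lambda>x. if s x = 1 then 0 else s x)"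
  let ?O = "ones s" and ?I = "supp t" and ?D = "flips a g \<sigma>"
  \<comment> \<open>The reversed coordinates are split by position: at 0 in \<open>?Z\<close>, at 1
    in \<open>?P\<close>, in the interior in \<open>?Q\<close>. The coordinates at 1 that are kept
    form \<open>?M\<close>. After the reflection exactly \<open>?Z\<close> and \<open>?M\<close> are
    at 1.\<close>
  let ?Z = "{x \<in> ?D. s x = 0}" and ?P = "flips a g ?O" and ?Q = "flips a g ?I" and ?M = "{x \<in> ?O. eps a (\<phi> g) x}"
  have sub: "?O \<subseteq> \<sigma>" "?I \<subseteq> \<sigma>" "?D \<subseteq> \<sigma>"
    using ones_subset[OF s] unit_cubeD(3)[OF s] by (auto simp: supp_def t_def flips_def)
  have L: "?O \<in> L" "?I \<in> L" "?D \<in> L" "?Z \<in> L" "?P \<in> L" "?Q \<in> L" "?M \<in> L" "?P \<union> ?Q \<in> L" "?Z \<union> ?M \<in> L"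
    using sub by (auto intro!: simplex_subset[OF \<sigma>] simp: flips_def)
  have fg: "f g \<in> AL" using vliftD[OF f g] by simp
  have "cm g s = (g \<cdot> sp ?O, t)" by (simp add: cm_def t_def)
  moreover have D': "flips a (g \<cdot> sp ?O) ?I = ?Q"
    using eps_sp[OF a g \<sigma> sub(1)] sub(2) by (auto simp: flips_def)
  ultimately have "ext a f (cm g s) = cm (f (g \<cdot> sp ?O) \<cdot> ainv (sp ?Q)) (flip ?Q t)"
    using cm_in_CP[OF g \<sigma> s] by (simp add: ext_def Let_def)
  also have "\<dots> = (f (g \<cdot> sp ?O) \<cdot> ainv (sp ?Q), flip ?Q t)"
  proof -
    have "flip ?Q t x \<noteq> 1" for x by (auto simp: flip_def flips_def supp_def t_def)
    then show ?thesis using vliftD(1)[OF f, of "g \<cdot> sp ?O"] g L by (simp add: cm_def ones_def)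
  qed
  also have "f (g \<cdot> sp ?O) = f g \<cdot> sp ?M \<cdot> ainv (sp ?P)"
    using vlift_sp[OF a f g L(1)] by (simp add: flips_def)
  also have "f g \<cdot> sp ?M \<cdot> ainv (sp ?P) \<cdot> ainv (sp ?Q) = f g \<cdot> ainv (sp ?D) \<cdot> sp (ones (flip ?D s))"
  proof -
    have 1: "ones (flip ?D s) = ?Z \<union> ?M" "?Z \<inter> ?M = {}"
      using sub by (auto simp: ones_def flip_def flips_def)
    have 2: "?D = ?Z \<union> (?P \<union> ?Q)" "?Z \<inter> (?P \<union> ?Q) = {}" "?P \<inter> ?Q = {}"
      using sub by (auto simp: ones_def flips_def supp_def t_def)
    have "sp ?D = sp ?Z \<cdot> (sp ?P \<cdot> sp ?Q)"
      using sp_partition[OF L(3) 2(1,2)] sp_partition[OF L(8) HOL.refl 2(3)] by simp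
    moreover have "sp (ones (flip ?D s)) = sp ?Z \<cdot> sp ?M"
      unfolding 1(1) by (rule sp_partition[OF L(9) HOL.refl 1(2)])
    moreover have "sp ?M \<cdot> ainv (sp ?P) \<cdot> ainv (sp ?Q) = ainv (sp ?Z \<cdot> (sp ?P \<cdot> sp ?Q)) \<cdot> (sp ?Z \<cdot> sp ?M)"
    proof (rule commuting_identity)
      have PQM: "?P \<subseteq> \<sigma>" "?Q \<subseteq> \<sigma>" "?M \<subseteq> \<sigma>" "?P \<inter> ?M = {}" "?Q \<inter> ?M = {}"
        using sub by (auto simp: flips_def supp_def t_def ones_def)
      show "sp ?P \<cdot> sp ?M = sp ?M \<cdot> sp ?P" by (rule sp_commute[OF \<sigma> PQM(1,3,4)])
      show "sp ?Q \<cdot> sp ?M = sp ?M \<cdot> sp ?Q" by (rule sp_commute[OF \<sigma> PQM(2,3,5)])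
      show "sp ?P \<cdot> sp ?Q = sp ?Q \<cdot> sp ?P" by (rule sp_commute[OF \<sigma> PQM(1,2) 2(3)])
    qed (use L in simp_all)
    ultimately show ?thesis using fg L by (simp add: A.m_assoc)
  qed
  also have "flip ?Q t = (\<lambda>x. if flip ?D s x = 1 then 0 else flip ?D s x)"
  proof
    fix x show "flip ?Q t x = (if flip ?D s x = 1 then 0 else flip ?D s x)"
      using unit_cubeD(3)[OF s, of x] by (cases "x \<in> \<sigma>") (auto simp: flip_def flips_def supp_def t_def)
  qed
  finally show ?thesis by (simp add: cm_def)
qed

lemma ext_vertex:
  assumes "vlift a f" "g \<in> AL" shows "ext a f (g, \<lambda>_. 0) = (f g, \<lambda>_. 0)"
  using vliftD(1)[OF assms] assms(2) by (simp add: ext_def supp_def flips_def flip_def)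

lemma ext_base: assumes "lpa a" "vlift a f" "g \<in> AL" "\<sigma> \<in> L" shows "f g \<cdot> ainv (sp (flips a g \<sigma>)) \<in> AL"
  using vliftD(1)[OF assms(2,3)] flips_simplex(1)[OF assms(4)] by simp

lemma cubical_ext: assumes "lpa a" "vlift a f" shows "cubical (ext a f)"
  unfolding cubical_def
proof (intro ballI)
  fix g \<sigma> assume *: "g \<in> AL" "\<sigma> \<in> L"
  show "\<exists>g'\<in>AL. \<exists>\<sigma>'\<in>L. \<exists>\<theta>. (\<forall>s\<in>unit_cube \<sigma>. \<theta> s \<in> unit_cube \<sigma>') \<and>
     (\<forall>s\<in>unit_cube \<sigma>. \<forall>t\<in>unit_cube \<sigma>. cube_dist L (\<theta> s) (\<theta> t) = cube_dist L s t) \<and>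
     (\<forall>s\<in>unit_cube \<sigma>. ext a f (cm g s) = cm g' (\<theta> s))"
    by (rule bexI[OF _ ext_base[OF assms *]], rule bexI[OF _ *(2)], rule exI[of _ "flip (flips a g \<sigma>)"])
      (simp add: cube_dist_flip flip_unit_cube flips_simplex(2) ext_cm[OF assms *])
qed

lemma flip_image: "D \<subseteq> \<sigma> \<Longrightarrow> flip D ` unit_cube \<sigma> = unit_cube \<sigma>"
  by (metis (no_types, lifting) flip_flip flip_unit_cube image_eqI image_subsetI subsetI subset_antisym)

lemma ext_cube:
  assumes "lpa a" "vlift a f" "g \<in> AL" "\<sigma> \<in> L"
  shows "ext a f ` cube g \<sigma> = cube (f g \<cdot> ainv (sp (flips a g \<sigma>))) \<sigma>"
proof -
  have "ext a f ` cube g \<sigma> = (\<lambda>s. cm (f g \<cdot> ainv (sp (flips a g \<sigma>))) (flip (flips a g \<sigma>) s)) ` unit_cube \<sigma>"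
    unfolding cube_def image_image by (rule image_cong) (auto simp: ext_cm[OF assms])
  also have "\<dots> = cm (f g \<cdot> ainv (sp (flips a g \<sigma>))) ` (flip (flips a g \<sigma>) ` unit_cube \<sigma>)"
    by (simp add: image_image)
  finally show ?thesis by (simp add: flip_image flips_simplex(2) cube_def)
qed

lemma ext_cauts: assumes a: "lpa a" and f: "vlift a f" shows "ext a f \<in> cauts"
proof -
  let ?i = "restrict (inv_into FB a) FB"
  note i = lpa_inverse[OF a]
  obtain f' where f': "vlift ?i f'" "\<And>g. g \<in> AL \<Longrightarrow> f' (f g) = g" "\<And>g. g \<in> AL \<Longrightarrow> f (f' g) = g"
    by (rule vlift_inverse[OF a f]) blast
  have cubes: "ext b h ` C \<in> cover_cubes L" if bh: "lpa b" "vlift b h" and C: "C \<in> cover_cubes L" for b h C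
  proof -
    obtain g \<sigma> where "g \<in> AL" "\<sigma> \<in> L" "C = cube g \<sigma>" using C unfolding cover_cubes_eq by blast
    then show ?thesis using ext_cube[OF bh] ext_base[OF bh] unfolding cover_cubes_eq by blast
  qed
  show ?thesis
  proof (rule cautsI[where h = "ext ?i f'"])
    show "ext a f \<in> extensional CP" by (simp add: ext_def)
    show "ext a f (ext ?i f' p) = p" if "p \<in> CP" for p
      by (rule cubical_identity[OF cubical_comp[OF cubical_ext[OF a f] cubical_ext[OF i f'(1)]] _ that])
        (use f' ext_vertex[OF f] ext_vertex[OF f'(1)] vliftD(1)[OF f'(1)] in simp)
    show "ext ?i f' (ext a f p) = p" if "p \<in> CP" for p
      by (rule cubical_identity[OF cubical_comp[OF cubical_ext[OF i f'(1)] cubical_ext[OF a f]] _ that])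
        (use f' ext_vertex[OF f] ext_vertex[OF f'(1)] vliftD(1)[OF f] in simp)
    show "cubical (ext a f)" "cubical (ext ?i f')" using cubical_ext a f i f'(1) by auto
  qed (use cubes a f i f'(1) in auto)
qed

lemma act_ext: "vlift a f \<Longrightarrow> g \<in> AL \<Longrightarrow> act (ext a f) g = f g"
  by (simp add: act_def ext_vertex)

lemma vlift_cong: "(\<And>g. g \<in> AL \<Longrightarrow> f g = f' g) \<Longrightarrow> vlift a f \<Longrightarrow> vlift a f'"
  by (simp add: vlift_def)

lemma cauts_ext: "lpa a \<Longrightarrow> h \<in> cauts \<Longrightarrow> vlift a (act h) \<Longrightarrow> h = ext a (act h)"
  by (rule cauts_eqI) (simp_all add: ext_cauts act_ext)

text \<open>The reversed coordinates of a cube lie in \<open>B\<close> and are pairwise adjacent, so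
  there is at most one of them. If the cube is stabilised and a coordinate \<open>b\<close> is
  reversed, then \<open>a\<close> exchanges the ends of a tree edge labelled
  \<open>b\<close>.\<close>

lemma ext_admissible:
  assumes a: "lpa a" and ni: "no_inversion B a" and f: "vlift a f" and C: "C \<in> cover_cubes L"
    and stab: "ext a f ` C = C" and p: "p \<in> C"
  shows "ext a f p = p"
proof -
  obtain g \<sigma> where g: "g \<in> AL" "\<sigma> \<in> L" "C = cube g \<sigma>" using C unfolding cover_cubes_eq by blast
  let ?D = "flips a g \<sigma>"
  let ?g = "f g \<cdot> ainv (sp ?D)"
  have DL: "?D \<in> L" and gA: "?g \<in> AL" and fg: "f g \<in> AL"
    using flips_simplex(1)[OF g(2)] ext_base[OF a f g(1,2)] vliftD(1)[OF f g(1)] by auto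
  \<comment> \<open>The centre of the cube lies in no proper face, so it can belong to the image
    cube and to \<open>cube g \<sigma>\<close> only if their initial vertices agree.\<close>
  define m where "m = (\<lambda>x. if x \<in> \<sigma> then 1/2 else 0 :: real)"
  have m: "m \<in> unit_cube \<sigma>" by (auto simp: unit_cube_def m_def)
  have cmm: "cm h m = (h, m)" if "h \<in> AL" for h using that by (auto simp: cm_def ones_def m_def)
  have "cm ?g m \<in> cube ?g \<sigma>" using m by (auto simp: cube_def)
  then have "cm ?g m \<in> cube g \<sigma>" using stab ext_cube[OF a f g(1,2)] g(3) by simp
  then obtain s where s: "s \<in> unit_cube \<sigma>" "cm ?g m = cm g s" by (auto simp: cube_def)
  have sn: "s x \<noteq> 1" for x
  proof
    assume "s x = 1"
    then have "x \<in> \<sigma>" using unit_cubeD(3)[OF s(1), of x] by auto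
    moreover have "m = (\<lambda>x. if s x = 1 then 0 else s x)" using s(2) cmm[OF gA] by (simp add: cm_def[of g s])
    then have "m x = 0" using \<open>s x = 1\<close> by simp
    ultimately show False by (simp add: m_def)
  qed
  have "cm g s = (g, s)" using sn g by (simp add: cm_def ones_def)
  then have gg: "?g = g" using s(2) cmm[OF gA] by simp
  have "?D = {}"
  proof (rule ccontr)
    assume "?D \<noteq> {}"
    then obtain b where b: "b \<in> ?D" by blast
    then have bB: "b \<in> B" "b \<in> \<sigma>" "\<not> eps a (\<phi> g) b" by (auto simp: flips_def eps_def)
    have "x = b" if "x \<in> ?D" for x
    proof -
      have "x \<in> B" "x \<in> \<sigma>" using that by (auto simp: flips_def eps_def)
      then show ?thesis using B_not_adjacent[OF _ bB(1)] edge_simplex[OF g(2) _ bB(2)] by blast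
    qed
    then have "?D = {b}" using b by blast
    then have "f g \<cdot> ainv (gen b) = g" using gg bB B_subset by (metis sp_single subsetD)
    moreover have bV: "b \<in> V" using bB B_subset by blast
    ultimately have "f g \<cdot> ainv (gen b) \<cdot> gen b = g \<cdot> gen b" by simp
    then have "f g = g \<cdot> gen b" using fg bV by (simp add: A.m_assoc)
    then have "a (\<phi> g) = \<phi> g \<bullet> fgen b"
      using vliftD(2)[OF f g(1)] g(1) bB B_subset by (auto simp: phi_mult phi_gen)
    moreover have "a (\<phi> g \<bullet> fgen b) = a (\<phi> g) \<bullet> fpow b False"
      using lpa_step1[OF a phi_closed[OF g(1)] bB(1)] bB by simp
    ultimately have "a (\<phi> g \<bullet> fgen b) = \<phi> g" "a (\<phi> g) = \<phi> g \<bullet> fgen b"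
      using g(1) bB by (simp_all add: fpow_def F.m_assoc)
    moreover have "tree_edge B b (\<phi> g) (\<phi> g \<bullet> fgen b)" using g(1) bB by (simp add: tree_edge_def)
    ultimately show False using ni unfolding no_inversion_def by blast
  qed
  moreover obtain t where "t \<in> unit_cube \<sigma>" "p = cm g t" using p g(3) by (auto simp: cube_def)
  ultimately show ?thesis
    using ext_cm[OF a f g(1,2), of t] gg by (simp add: flip_def)
qed

end

section \<open>The group of lifts\<close>

context flag_free
begin

lemma pi_def: "p \<in> CP \<Longrightarrow> \<pi> p = {trans n p | n. n \<in> N}"
  by (cases p) (simp add: cover_proj_def trans_def)

lemma N_one [simp]: "\<one>\<^sub>L \<in> N"
  by (simp add: N_iff)

lemma N_closed: "n \<in> N \<Longrightarrow> n \<in> AL"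
  by (simp add: N_iff)

lemma N_mult: "n \<in> N \<Longrightarrow> m \<in> N \<Longrightarrow> n \<cdot> m \<in> N"
  by (simp add: N_iff phi_mult)

lemma N_inv: "n \<in> N \<Longrightarrow> ainv n \<in> N"
  by (simp add: N_iff phi_inv)

lemma pi_eq_iff:
  assumes "p \<in> CP" "q \<in> CP" shows "\<pi> p = \<pi> q \<longleftrightarrow> (\<exists>n\<in>N. q = trans n p)"
proof
  assume "\<pi> p = \<pi> q"
  moreover have "trans \<one>\<^sub>L q \<in> \<pi> q" unfolding pi_def[OF assms(2)] using N_one by blast
  ultimately have "q \<in> \<pi> p" using assms by simp
  then show "\<exists>n\<in>N. q = trans n p" unfolding pi_def[OF assms(1)] by blast
next
  assume "\<exists>n\<in>N. q = trans n p"
  then obtain n where n: "n \<in> N" "q = trans n p" by blast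
  have "trans m q = trans (m \<cdot> n) p" if "m \<in> N" for m using that n assms by (simp add: trans_trans N_closed)
  moreover have "trans m p = trans (m \<cdot> ainv n) q" if "m \<in> N" for m
    using that n assms by (simp add: trans_trans N_closed A.m_assoc)
  ultimately show "\<pi> p = \<pi> q"
    unfolding pi_def[OF assms(1)] pi_def[OF assms(2)] using n(1) N_mult N_inv by blast
qed

lemma pi_vertex: assumes "g \<in> AL" "h \<in> AL" shows "\<pi> (g, \<lambda>_. 0) = \<pi> (h, \<lambda>_. 0) \<longleftrightarrow> \<phi> g = \<phi> h"
proof -
  have "\<pi> (g, \<lambda>_. 0) = \<pi> (h, \<lambda>_. 0) \<longleftrightarrow> (\<exists>n\<in>N. h = n \<cdot> g)"
    using assms by (subst pi_eq_iff) (auto simp: trans_def)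
  also have "\<dots> \<longleftrightarrow> \<phi> g = \<phi> h"
  proof
    assume "\<phi> g = \<phi> h"
    then show "\<exists>n\<in>N. h = n \<cdot> g" using same_phi[OF assms] by metis
  next
    assume "\<exists>n\<in>N. h = n \<cdot> g"
    then obtain n where "n \<in> AL" "\<phi> n = \<one>\<^sub>F" "h = n \<cdot> g" using N_iff by blast
    then show "\<phi> g = \<phi> h" using assms(1) phi_closed[OF assms(1)] by (simp only: phi_mult F.l_one)
  qed
  finally show ?thesis .
qed

lemma pi_cm:
  assumes "g \<in> AL" "h \<in> AL" "\<phi> g = \<phi> h" "\<sigma> \<in> L" "s \<in> unit_cube \<sigma>"
  shows "\<pi> (cm g s) = \<pi> (cm h s)"
proof -
  obtain n where n: "n \<in> N" "h = n \<cdot> g" using same_phi[OF assms(1-3)] .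
  have "cm h s = trans n (cm g s)" using trans_cm[OF N_closed[OF n(1)] assms(1,4,5)] n(2) by simp
  then show ?thesis using pi_eq_iff[OF cm_in_CP[OF assms(1,4,5)] cm_in_CP[OF assms(2,4,5)]] n(1) by blast
qed

lemma pi_snd: "p \<in> CP \<Longrightarrow> q \<in> CP \<Longrightarrow> \<pi> p = \<pi> q \<Longrightarrow> snd p = snd q"
  unfolding pi_eq_iff by (auto simp: trans_def)

section \<open>Descent of extended lifts to the intermediate cover\<close>

lemma ext_left:
  assumes a: "lpa a" and f: "vlift a f" and n: "n \<in> N" and p: "p \<in> CP"
  shows "ext a (\<lambda>g. n \<cdot> f g) p = trans n (ext a f p)"
proof -
  obtain g \<sigma> s where *: "g \<in> AL" "\<sigma> \<in> L" "s \<in> unit_cube \<sigma>" "p = cm g s" using point_in_some_cube[OF p] .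
  show ?thesis
    unfolding *(4) ext_cm[OF a f *(1-3)] ext_cm[OF a vlift_N[OF f n] *(1-3)]
      trans_cm[OF N_closed[OF n] ext_base[OF a f *(1,2)] *(2) flip_unit_cube[OF flips_simplex(2) *(3)]]
    using N_closed[OF n] vliftD(1)[OF f *(1)] flips_simplex(1)[OF *(2)] by (simp add: A.m_assoc)
qed

text \<open>Precomposing \<open>f\<close> with a kernel translation changes neither
  \<open>\<phi>\<close> nor the signs, so the result is another lift of \<open>a\<close> and differs
  from \<open>f\<close> by a kernel translation on the left. Hence orbits of the kernel go to
  orbits.\<close>

lemma ext_right:
  assumes a: "lpa a" and f: "vlift a f" and n: "n \<in> N"
  shows "\<exists>n'\<in>N. \<forall>p\<in>CP. ext a f (trans n p) = trans n' (ext a f p)"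
proof -
  have phn: "\<phi> (n \<cdot> g) = \<phi> g" if "g \<in> AL" for g using that n by (simp add: N_iff phi_mult)
  have "vlift a (\<lambda>g. f (n \<cdot> g))"
    unfolding vlift_def
  proof (intro conjI ballI)
    fix g assume g: "g \<in> AL"
    then have ng: "n \<cdot> g \<in> AL" using N_closed[OF n] by simp
    show "f (n \<cdot> g) \<in> AL" "\<phi> (f (n \<cdot> g)) = a (\<phi> g)" using vliftD[OF f ng] phn[OF g] by auto
    fix x assume x: "x \<in> V"
    have "f (n \<cdot> g \<cdot> gen x) = f (n \<cdot> g) \<cdot> apow x (eps a (\<phi> (n \<cdot> g)) x)"
      using f ng x unfolding vlift_def by blast
    then show "f (n \<cdot> (g \<cdot> gen x)) = f (n \<cdot> g) \<cdot> apow x (eps a (\<phi> g) x)"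
      using phn[OF g] g x N_closed[OF n] by (simp add: A.m_assoc)
  qed
  from vlift_same[OF a f this] obtain m where m: "m \<in> N" "\<And>g. g \<in> AL \<Longrightarrow> f (n \<cdot> g) = m \<cdot> f g" by blast
  have "ext a f (trans n p) = trans m (ext a f p)" if p: "p \<in> CP" for p
  proof -
    obtain g \<sigma> s where *: "g \<in> AL" "\<sigma> \<in> L" "s \<in> unit_cube \<sigma>" "p = cm g s" using point_in_some_cube[OF p] .
    have ng: "n \<cdot> g \<in> AL" using N_closed[OF n] *(1) by simp
    have fl: "flips a (n \<cdot> g) \<sigma> = flips a g \<sigma>" using phn[OF *(1)] by (simp add: flips_def)
    show ?thesis
      unfolding *(4) trans_cm[OF N_closed[OF n] *(1-3)] ext_cm[OF a f *(1-3)] ext_cm[OF a f ng *(2,3)] fl m(2)[OF *(1)]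
        trans_cm[OF N_closed[OF m(1)] ext_base[OF a f *(1,2)] *(2) flip_unit_cube[OF flips_simplex(2) *(3)]]
      using N_closed[OF m(1)] vliftD(1)[OF f *(1)] flips_simplex(1)[OF *(2)] by (simp add: A.m_assoc)
  qed
  then show ?thesis using m(1) by blast
qed

lemma ext_CP: "lpa a \<Longrightarrow> vlift a f \<Longrightarrow> p \<in> CP \<Longrightarrow> ext a f p \<in> CP"
  by (rule Bij_mem[OF cauts_Bij[OF ext_cauts]])

definition descend :: "('v word set \<Rightarrow> 'v word set) \<Rightarrow> ('v word set \<Rightarrow> 'v word set) \<Rightarrow> 'v cover_point set \<Rightarrow> 'v cover_point set" where
  "descend a f y = \<pi> (ext a f (SOME p. p \<in> CP \<and> \<pi> p = y))"

lemma descend_pi: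
  assumes a: "lpa a" and f: "vlift a f" and p: "p \<in> CP" shows "descend a f (\<pi> p) = \<pi> (ext a f p)"
proof -
  define q where "q = (SOME q. q \<in> CP \<and> \<pi> q = \<pi> p)"
  have q: "q \<in> CP \<and> \<pi> q = \<pi> p" unfolding q_def by (rule someI[of _ p]) (use p in simp)
  then obtain n where n: "n \<in> N" "q = trans n p" using pi_eq_iff[of p q] p by metis
  obtain m where "m \<in> N" "ext a f q = trans m (ext a f p)" using ext_right[OF a f n(1)] p n(2) by blast
  then show ?thesis
    unfolding descend_def q_def[symmetric] using pi_eq_iff[OF ext_CP[OF a f p] ext_CP[OF a f conjunct1[OF q]]] by blast
qed

lemma phi_ext_base:
  assumes a: "lpa a" and f: "vlift a f" and g: "g \<in> AL" and x: "x \<in> V"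
    and r: "r \<in> {0..1}"
  shows "ext a f (cm g (edge_point x r)) = (if eps a (\<phi> g) x then cm (f g) (edge_point x r)
     else cm (f g \<cdot> ainv (gen x)) (edge_point x (1 - r)))"
proof -
  have ep: "edge_point x r \<in> unit_cube {x}" using cm_edge(1)[OF g x] r by simp
  have fl: "flips a g {x} = (if eps a (\<phi> g) x then {} else {x})" by (auto simp: flips_def)
  have "flip {} (edge_point x r) = edge_point x r" "flip {x} (edge_point x r) = edge_point x (1 - r)"
    by (auto simp: flip_def edge_point_def)
  then show ?thesis
    using ext_cm[OF a f g vertex_simplex[OF x] ep] vliftD(1)[OF f g] x fl by simp
qed

lemma extends_iff:
  "extends_to_intermediate L B a \<Phi> \<longleftrightarrow> bij_betw \<Phi> (\<pi> ` CP) (\<pi> ` CP) \<and>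
      (\<forall>g\<in>AL. \<forall>g'\<in>AL. \<phi> g' = a (\<phi> g) \<longrightarrow> \<Phi> (\<pi> (g, \<lambda>_. 0)) = \<pi> (g', \<lambda>_. 0)) \<and>
      (\<forall>g\<in>AL. \<forall>g'\<in>AL. \<forall>b\<in>B. \<forall>r\<in>{0..1}.
         (\<phi> g' = a (\<phi> g) \<and> a (\<phi> g \<bullet> fgen b) = \<phi> g' \<bullet> fgen b \<longrightarrow>
            \<Phi> (\<pi> (cm g (edge_point b r))) = \<pi> (cm g' (edge_point b r))) \<and>
         (\<phi> g' = a (\<phi> g \<bullet> fgen b) \<and> a (\<phi> g) = \<phi> g' \<bullet> fgen b \<longrightarrow>
            \<Phi> (\<pi> (cm g (edge_point b r))) = \<pi> (cm g' (edge_point b (1 - r))))) \<and>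
      (\<forall>g\<in>AL. \<forall>g'\<in>AL. \<forall>x\<in>V - B. \<forall>r\<in>{0..1}. \<phi> g' = a (\<phi> g) \<longrightarrow>
         \<Phi> (\<pi> (cm g (edge_point x r))) = \<pi> (cm g' (edge_point x r))) \<and>
      (\<forall>g\<in>AL. \<forall>\<sigma>\<in>L. \<exists>g'\<in>AL. \<exists>\<sigma>'\<in>L. \<exists>\<theta>.
         bij_betw \<theta> (unit_cube \<sigma>) (unit_cube \<sigma>') \<and>
         (\<forall>s\<in>unit_cube \<sigma>. \<forall>t\<in>unit_cube \<sigma>. cube_dist L (\<theta> s) (\<theta> t) = cube_dist L s t) \<and>
         (\<forall>s\<in>unit_cube \<sigma>. \<Phi> (\<pi> (cm g s)) = \<pi> (cm g' (\<theta> s))))"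
  unfolding extends_to_intermediate_def Let_def intermediate_cover_def Union_L ..

lemma descend_extends:
  assumes a: "lpa a" and f: "vlift a f" shows "extends_to_intermediate L B a (descend a f)"
  unfolding extends_iff
proof (intro conjI ballI impI)
  let ?i = "restrict (inv_into FB a) FB"
  note i = lpa_inverse[OF a]
  obtain f' where f': "vlift ?i f'" "\<And>g. g \<in> AL \<Longrightarrow> f' (f g) = g" "\<And>g. g \<in> AL \<Longrightarrow> f (f' g) = g"
    by (rule vlift_inverse[OF a f]) blast
  have 1: "ext a f (ext ?i f' p) = p" if "p \<in> CP" for p
    by (rule cubical_identity[OF cubical_comp[OF cubical_ext[OF a f] cubical_ext[OF i f'(1)]] _ that])
      (use f' ext_vertex[OF f] ext_vertex[OF f'(1)] vliftD(1)[OF f'(1)] in simp)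
  have 2: "ext ?i f' (ext a f p) = p" if "p \<in> CP" for p
    by (rule cubical_identity[OF cubical_comp[OF cubical_ext[OF i f'(1)] cubical_ext[OF a f]] _ that])
      (use f' ext_vertex[OF f] ext_vertex[OF f'(1)] vliftD(1)[OF f] in simp)
  show "bij_betw (descend a f) (\<pi> ` CP) (\<pi> ` CP)"
    by (rule bij_betwI[where g = "descend ?i f'"])
      (auto simp: descend_pi[OF a f] descend_pi[OF i f'(1)] 1 2 ext_CP[OF a f] ext_CP[OF i f'(1)])
next
  fix g g' assume g: "g \<in> AL" "g' \<in> AL" "\<phi> g' = a (\<phi> g)"
  then show "descend a f (\<pi> (g, \<lambda>_. 0)) = \<pi> (g', \<lambda>_. 0)"
    using vliftD[OF f g(1)] by (simp add: descend_pi[OF a f] ext_vertex[OF f] pi_vertex)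
next
  fix g g' b r assume *: "g \<in> AL" "g' \<in> AL" "b \<in> B" "r \<in> {0..1::real}"
    "\<phi> g' = a (\<phi> g) \<and> a (\<phi> g \<bullet> fgen b) = \<phi> g' \<bullet> fgen b"
  then have bV: "b \<in> V" using B_subset by blast
  have ep: "edge_point b r \<in> unit_cube {b}" using cm_edge(1)[OF *(1) bV] *(4) by simp
  have "eps a (\<phi> g) b" using * by (simp add: eps_def)
  then show "descend a f (\<pi> (cm g (edge_point b r))) = \<pi> (cm g' (edge_point b r))"
    unfolding descend_pi[OF a f cm_in_CP[OF *(1) vertex_simplex[OF bV] ep]] phi_ext_base[OF a f *(1) bV *(4)]
    using pi_cm[OF vliftD(1)[OF f *(1)] *(2) _ vertex_simplex[OF bV] ep] *(5) vliftD(2)[OF f *(1)] by simp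
next
  fix g g' b r assume *: "g \<in> AL" "g' \<in> AL" "b \<in> B" "r \<in> {0..1::real}"
    "\<phi> g' = a (\<phi> g \<bullet> fgen b) \<and> a (\<phi> g) = \<phi> g' \<bullet> fgen b"
  then have bV: "b \<in> V" using B_subset by blast
  have ep: "edge_point b r \<in> unit_cube {b}" using cm_edge(1)[OF *(1) bV] *(4) by simp
  have ep': "edge_point b (1 - r) \<in> unit_cube {b}" using cm_edge(1)[OF *(1) bV, of "1 - r"] *(4) by simp
  have eq: "\<phi> g' = a (\<phi> g) \<bullet> fpow b (eps a (\<phi> g) b)" using lpa_step1[OF a phi_closed[OF *(1)] *(3)] *(5) by simp
  have "a (\<phi> g) \<bullet> fpow b False = \<phi> g' \<bullet> fpow b True \<bullet> fpow b (\<not> True)"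
    using *(3,5) by (simp add: fpow_def)
  then have eq2: "\<phi> g' = a (\<phi> g) \<bullet> fpow b False" using phi_closed[OF *(2)] by (simp only: fpow_cancel)
  have ne: "\<not> eps a (\<phi> g) b" using eq eq2 fpow_inj[OF *(3), of "a (\<phi> g)"] a *(1) by simp
  have "\<phi> (f g \<cdot> ainv (gen b)) = \<phi> g'"
    using eq2 vliftD[OF f *(1)] bV *(3) by (simp add: phi_mult phi_inv phi_gen fpow_def)
  then show "descend a f (\<pi> (cm g (edge_point b r))) = \<pi> (cm g' (edge_point b (1 - r)))"
    unfolding descend_pi[OF a f cm_in_CP[OF *(1) vertex_simplex[OF bV] ep]] phi_ext_base[OF a f *(1) bV *(4)]
    using pi_cm[OF _ *(2) _ vertex_simplex[OF bV] ep', of "f g \<cdot> ainv (gen b)"] ne vliftD(1)[OF f *(1)] bV by simp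
next
  fix g g' x r assume *: "g \<in> AL" "g' \<in> AL" "x \<in> V - B" "r \<in> {0..1::real}" "\<phi> g' = a (\<phi> g)"
  then have xV: "x \<in> V" "eps a (\<phi> g) x" by (auto simp: eps_def)
  have ep: "edge_point x r \<in> unit_cube {x}" using cm_edge(1)[OF *(1) xV(1)] *(4) by simp
  show "descend a f (\<pi> (cm g (edge_point x r))) = \<pi> (cm g' (edge_point x r))"
    unfolding descend_pi[OF a f cm_in_CP[OF *(1) vertex_simplex[OF xV(1)] ep]] phi_ext_base[OF a f *(1) xV(1) *(4)]
    using pi_cm[OF vliftD(1)[OF f *(1)] *(2) _ vertex_simplex[OF xV(1)] ep] *(5) xV vliftD(2)[OF f *(1)] by simp
next
  fix g \<sigma> assume *: "g \<in> AL" "\<sigma> \<in> L"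
  have "bij_betw (flip (flips a g \<sigma>)) (unit_cube \<sigma>) (unit_cube \<sigma>)"
    by (rule bij_betwI[where g = "flip (flips a g \<sigma>)"]) (auto intro: flip_unit_cube[OF flips_simplex(2)])
  moreover have "descend a f (\<pi> (cm g s)) = \<pi> (cm (f g \<cdot> ainv (sp (flips a g \<sigma>))) (flip (flips a g \<sigma>) s))"
    if "s \<in> unit_cube \<sigma>" for s
    unfolding descend_pi[OF a f cm_in_CP[OF * that]] ext_cm[OF a f * that] ..
  ultimately show "\<exists>g'\<in>AL. \<exists>\<sigma>'\<in>L. \<exists>\<theta>. bij_betw \<theta> (unit_cube \<sigma>) (unit_cube \<sigma>') \<and>
         (\<forall>s\<in>unit_cube \<sigma>. \<forall>t\<in>unit_cube \<sigma>. cube_dist L (\<theta> s) (\<theta> t) = cube_dist L s t) \<and>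
         (\<forall>s\<in>unit_cube \<sigma>. descend a f (\<pi> (cm g s)) = \<pi> (cm g' (\<theta> s)))"
    using ext_base[OF a f *] *(2) cube_dist_flip by blast
qed

lemma extends_edge:
  assumes a: "lpa a" and f: "vlift a f" and E: "extends_to_intermediate L B a \<Phi>"
    and g: "g \<in> AL" and x: "x \<in> V" and r: "r \<in> {0..1}"
  shows "\<Phi> (\<pi> (cm g (edge_point x r))) = \<pi> (ext a f (cm g (edge_point x r)))"
proof (cases "x \<in> B")
  case False
  then have "eps a (\<phi> g) x" by (simp add: eps_def)
  then show ?thesis
    using E g x r False vliftD[OF f g] unfolding extends_iff phi_ext_base[OF a f g x r] by simp
next
  case True
  show ?thesis
  proof (cases "eps a (\<phi> g) x")
    case e: True
    then have "a (\<phi> g \<bullet> fgen x) = \<phi> (f g) \<bullet> fgen x" using True vliftD[OF f g] by (simp add: eps_def)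
    then show ?thesis
      using E g x r True vliftD[OF f g] e unfolding extends_iff phi_ext_base[OF a f g x r] by simp
  next
    case e: False
    let ?h = "f g \<cdot> ainv (gen x)"
    have h: "?h \<in> AL" using vliftD[OF f g] x by simp
    have 1: "\<phi> ?h = a (\<phi> g \<bullet> fgen x)"
      using lpa_step1[OF a phi_closed[OF g] True] e vliftD[OF f g] x True by (simp add: phi_mult phi_inv phi_gen fpow_def)
    have 2: "a (\<phi> g) = \<phi> ?h \<bullet> fgen x"
      using vliftD[OF f g] x True a g by (simp add: phi_mult phi_inv phi_gen F.m_assoc)
    from E have "\<forall>g\<in>AL. \<forall>g'\<in>AL. \<forall>b\<in>B. \<forall>r\<in>{0..1}. \<phi> g' = a (\<phi> g \<bullet> fgen b) \<and> a (\<phi> g) = \<phi> g' \<bullet> fgen b \<longrightarrow>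
            \<Phi> (\<pi> (cm g (edge_point b r))) = \<pi> (cm g' (edge_point b (1 - r)))"
      unfolding extends_iff by simp
    with g h True r 1 2 have "\<Phi> (\<pi> (cm g (edge_point x r))) = \<pi> (cm ?h (edge_point x (1 - r)))" by blast
    then show ?thesis using e unfolding phi_ext_base[OF a f g x r] by simp
  qed
qed

text \<open>The clauses prescribe \<open>\<Phi>\<close> on vertices and edges; on larger cubes they
  only provide some isometry onto a cube. Its behaviour near the initial corner is read off the
  edges, and then \<open>isometry_unit_cube\<close> leaves one possibility.\<close>

lemma extends_unique:
  assumes a: "lpa a" and f: "vlift a f" and E: "extends_to_intermediate L B a \<Phi>" and p: "p \<in> CP"
  shows "\<Phi> (\<pi> p) = \<pi> (ext a f p)"
proof -
  obtain g \<sigma> s where g: "g \<in> AL" and \<sigma>: "\<sigma> \<in> L" and s: "s \<in> unit_cube \<sigma>" and ps: "p = cm g s"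
    using point_in_some_cube[OF p] .
  have "\<exists>g'\<in>AL. \<exists>\<sigma>'\<in>L. \<exists>\<theta>. bij_betw \<theta> (unit_cube \<sigma>) (unit_cube \<sigma>') \<and>
         (\<forall>s\<in>unit_cube \<sigma>. \<forall>t\<in>unit_cube \<sigma>. cube_dist L (\<theta> s) (\<theta> t) = cube_dist L s t) \<and>
         (\<forall>s\<in>unit_cube \<sigma>. \<Phi> (\<pi> (cm g s)) = \<pi> (cm g' (\<theta> s)))"
    using E g \<sigma> unfolding extends_iff by simp
  then obtain g' \<sigma>' \<theta> where g': "g' \<in> AL" and \<sigma>': "\<sigma>' \<in> L" and bij: "bij_betw \<theta> (unit_cube \<sigma>) (unit_cube \<sigma>')"
     and iso0: "\<forall>s\<in>unit_cube \<sigma>. \<forall>t\<in>unit_cube \<sigma>. cube_dist L (\<theta> s) (\<theta> t) = cube_dist L s t"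
     and \<Phi>0: "\<forall>s\<in>unit_cube \<sigma>. \<Phi> (\<pi> (cm g s)) = \<pi> (cm g' (\<theta> s))" by (elim bexE exE conjE)
  have \<theta>: "\<theta> s \<in> unit_cube \<sigma>'" if "s \<in> unit_cube \<sigma>" for s using bij_betw_apply[OF bij that] .
  have iso: "cube_dist L (\<theta> s) (\<theta> t) = cube_dist L s t" if "s \<in> unit_cube \<sigma>" "t \<in> unit_cube \<sigma>" for s t
    using iso0 that by blast
  have \<Phi>: "\<Phi> (\<pi> (cm g s)) = \<pi> (cm g' (\<theta> s))" if "s \<in> unit_cube \<sigma>" for s using \<Phi>0 that by blast
  define c where "c = \<theta> (\<lambda>_. 0)"
  have cU: "c \<in> unit_cube \<sigma>'" using \<theta> by (simp add: c_def)
  have fg: "f g \<in> AL" "\<phi> (f g) = a (\<phi> g)" using vliftD[OF f g] by auto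
  have "\<Phi> (\<pi> (g, \<lambda>_. 0)) = \<pi> (f g, \<lambda>_. 0)" using E g fg unfolding extends_iff by simp
  then have v0: "\<pi> (cm g' c) = \<pi> (f g, \<lambda>_. 0)" using \<Phi>[OF zero_unit_cube] g by (simp add: c_def)
  have "snd (cm g' c) = (\<lambda>_. 0)" using pi_snd[OF cm_in_CP[OF g' \<sigma>' cU] _ v0] fg by simp
  then have c01: "c y = 0 \<or> c y = 1" for y by (auto simp: cm_def fun_eq_iff split: if_splits)
  let ?D = "flips a g \<sigma>"
  have sV: "\<sigma> \<subseteq> V" using \<sigma> simplex_subset_V by auto
  have edge: "(\<forall>y. y \<noteq> x \<longrightarrow> \<theta> (edge_point x (1/3)) y = c y) \<and> (c x = 1 \<longleftrightarrow> x \<in> ?D)" if x: "x \<in> \<sigma>" for x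
  proof -
    \<comment> \<open>1/3 is an interior point that differs from its mirror image 2/3, so its torus
      coordinates show which edge it lies on and in which direction that edge is travelled.\<close>
    let ?e = "edge_point x (1/3)"
    have xV: "x \<in> V" and r: "1/3 \<in> {0..1::real}" using x sV by auto
    have eU: "?e \<in> unit_cube \<sigma>" using x by (auto simp: unit_cube_def edge_point_def)
    have "\<pi> (cm g' (\<theta> ?e)) = \<pi> (ext a f (cm g ?e))"
      using \<Phi>[OF eU] extends_edge[OF a f E g xV r] by simp
    then have "snd (cm g' (\<theta> ?e)) = snd (ext a f (cm g ?e))"
      using pi_snd cm_in_CP[OF g' \<sigma>' \<theta>[OF eU]] ext_CP[OF a f cm_in_CP[OF g \<sigma> eU]] by blast
    moreover have "snd (ext a f (cm g ?e)) = edge_point x (if x \<in> ?D then 2/3 else 1/3)"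
      using x unfolding phi_ext_base[OF a f g xV r] by (auto simp: cm_def edge_point_def flips_def)
    ultimately have fr: "(if \<theta> ?e y = 1 then 0 else \<theta> ?e y) = edge_point x (if x \<in> ?D then 2/3 else 1/3) y" for y
      by (simp add: cm_def fun_eq_iff)
    have "cube_dist L ?e (\<lambda>_. 0) = 1/3"
    proof -
      have "(\<Sum>y\<in>V. (?e y - 0)\<^sup>2) = (\<Sum>y\<in>V. if y = x then (1/3)\<^sup>2 else 0)"
        by (intro sum.cong) (auto simp: edge_point_def)
      then show ?thesis using xV finite_V by (simp add: cube_dist_def Union_L real_sqrt_divide)
    qed
    then have "cube_dist L (\<theta> ?e) c = 1/3" using iso[OF eU zero_unit_cube] by (simp add: c_def)
    then have d: "\<bar>\<theta> ?e y - c y\<bar> \<le> 1/3" if "y \<in> V" for y using cube_dist_component[OF that, of "\<theta> ?e" c] by simp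
    have "\<theta> ?e y = c y" if "y \<noteq> x" for y
    proof (cases "y \<in> V")
      case True
      then show ?thesis using fr[of y] that d[OF True] c01[of y] by (auto simp: edge_point_def split: if_splits)
    next
      case False
      then have "y \<notin> \<sigma>'" using simplex_subset_V[OF \<sigma>'] by blast
      then show ?thesis using unit_cubeD(3)[OF \<theta>[OF eU]] unit_cubeD(3)[OF cU] by simp
    qed
    moreover have "c x = 1 \<longleftrightarrow> x \<in> ?D"
      using fr[of x] d[OF xV] c01[of x] by (auto simp: edge_point_def split: if_splits)
    ultimately show ?thesis by blast
  qed
  have th: "\<theta> t = (\<lambda>y. if y \<in> \<sigma> then flip ?D t y else c y)" if t: "t \<in> unit_cube \<sigma>" for t
  proof -
    have "\<theta> t = (\<lambda>y. if y \<in> \<sigma> then (if c y = 1 then 1 - t y else t y) else c y)"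
      by (rule isometry_unit_cube[where r = "1/3", OF \<sigma> \<sigma>' \<theta> iso c_def[symmetric] c01]) (use edge t in auto)
    then show ?thesis using edge by (auto simp: flip_def)
  qed
  \<comment> \<open>Coordinates outside \<open>\<sigma>\<close> at which \<open>c\<close> is 1 are
    constant over the cube and can be absorbed into its initial vertex.\<close>
  let ?C = "ones c - \<sigma>"
  have CL: "?C \<in> L" using ones_simplex[OF cU \<sigma>'] by (rule simplex_subset) auto
  let ?G = "g' \<cdot> sp ?C"
  have GA: "?G \<in> AL" using g' CL by simp
  have cmG: "cm g' (\<theta> t) = cm ?G (flip ?D t)" if t: "t \<in> unit_cube \<sigma>" for t
  proof -
    have fU: "flip ?D t \<in> unit_cube \<sigma>" by (rule flip_unit_cube[OF flips_simplex(2) t])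
    have o: "ones (\<theta> t) = ?C \<union> ones (flip ?D t)" "?C \<inter> ones (flip ?D t) = {}"
      using ones_subset[OF fU] by (auto simp: ones_def th[OF t])
    have "sp (ones (\<theta> t)) = sp ?C \<cdot> sp (ones (flip ?D t))"
      by (rule sp_partition[OF ones_simplex[OF \<theta>[OF t] \<sigma>'] o])
    then have "g' \<cdot> sp (ones (\<theta> t)) = ?G \<cdot> sp (ones (flip ?D t))"
      using g' CL ones_simplex[OF fU \<sigma>] by (simp add: A.m_assoc)
    moreover have "(if \<theta> t y = 1 then 0 else \<theta> t y) = (if flip ?D t y = 1 then 0 else flip ?D t y)" for y
      using c01[of y] unit_cubeD(3)[OF fU, of y] by (auto simp: th[OF t])
    ultimately show ?thesis by (simp add: cm_def)
  qed
  have DL: "?D \<in> L" by (rule flips_simplex(1)[OF \<sigma>])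
  have "flip ?D (\<lambda>_. 0) = indic ?D" by (auto simp: flip_def indic_def)
  then have "cm g' c = (?G \<cdot> sp ?D, \<lambda>_. 0)" using cmG[OF zero_unit_cube] by (simp add: c_def cm_indic)
  then have "\<phi> (?G \<cdot> sp ?D) = \<phi> (f g)" using v0 GA DL fg by (simp add: pi_vertex)
  then have "\<phi> (?G \<cdot> sp ?D \<cdot> ainv (sp ?D)) = \<phi> (f g \<cdot> ainv (sp ?D))" using GA DL fg by (simp only: phi_mult A.m_closed A.inv_closed sp_closed)
  then have "\<phi> ?G = \<phi> (f g \<cdot> ainv (sp ?D))" using g' DL CL by (simp add: A.m_assoc)
  then have "\<pi> (cm ?G (flip ?D s)) = \<pi> (cm (f g \<cdot> ainv (sp ?D)) (flip ?D s))"
    by (intro pi_cm[OF GA ext_base[OF a f g \<sigma>] _ \<sigma> flip_unit_cube[OF flips_simplex(2) s]])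
  then show ?thesis
    unfolding ps \<Phi>[OF s] ext_cm[OF a f g \<sigma> s] cmG[OF s] .
qed

section \<open>Uniqueness of continuous lifts\<close>

lemma continuous_SC:
  "continuous_map (mtopology_of SC) (mtopology_of SC) h \<longleftrightarrow> h ` CP \<subseteq> CP \<and>
    (\<forall>a\<in>CP. \<forall>e>0. \<exists>d>0. \<forall>x. x \<in> CP \<and> mdist SC a x < d \<longrightarrow> mdist SC (h a) (h x) < e)"
  using Metric_space.metric_continuous_map[OF Metric_space_mspace_mdist Metric_space_mspace_mdist, of SC SC h]
  by (simp add: mtopology_of_def)

lemma cauts_homeo: assumes "h \<in> cauts" shows "h \<in> cover_homeos L"
proof -
  have hB: "h \<in> Bij CP" by (rule cauts_Bij[OF assms])
  have "Metric_space12 CP (mdist SC) CP (mdist SC)"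
    using Metric_space_mspace_mdist[of SC] by (simp add: Metric_space12_def)
  then have "homeomorphic_map (Metric_space.mtopology CP (mdist SC)) (Metric_space.mtopology CP (mdist SC)) h"
    by (rule Metric_space12.isometry_imp_homeomorphic_map)
      (use hB assms in \<open>auto simp: Bij_def bij_betw_def cauts_def isometries_def\<close>)
  then show ?thesis using hB by (simp add: cover_homeos_def mtopology_of_def)
qed

text \<open>Two lifts of the same map differ by a locally constant element of the kernel, because the
  kernel acts with uniformly discrete orbits.\<close>

lemma lift_unique:
  assumes a: "lpa a" and E: "extends_to_intermediate L B a \<Phi>"
    and h: "h \<in> cover_homeos L" and lft: "\<And>p. p \<in> CP \<Longrightarrow> \<pi> (h p) = \<Phi> (\<pi> p)"
  shows "h \<in> cauts" "vlift a (act h)"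
proof -
  have hB: "h \<in> Bij CP" using h by (simp add: cover_homeos_def)
  obtain g1 where "g1 \<in> AL" "\<phi> g1 = a \<one>\<^sub>F" using phi_surj[OF lpa_closed[OF a F.one_closed]] .
  then obtain f where f: "vlift a f" using vlift_exists[OF a] by metis
  let ?e = "ext a f"
  note eA = ext_cauts[OF a f]
  have eCP: "?e p \<in> CP" if "p \<in> CP" for p by (rule ext_CP[OF a f that])
  have hCP: "h p \<in> CP" if "p \<in> CP" for p by (rule Bij_mem[OF hB that])
  have "\<exists>n. n \<in> N \<and> h p = trans n (?e p)" if "p \<in> CP" for p
    using pi_eq_iff[OF eCP[OF that] hCP[OF that]] lft[OF that] extends_unique[OF a f E that] by auto
  then obtain n where n: "\<And>p. p \<in> CP \<Longrightarrow> n p \<in> N \<and> h p = trans (n p) (?e p)" by metis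
  have nA: "n p \<in> AL" if "p \<in> CP" for p using n[OF that] N_closed by blast
  have eiso: "cdist (?e p) (?e q) = cdist p q" if "p \<in> CP" "q \<in> CP" for p q
    using eA that eCP by (simp add: cauts_def isometries_def mdist_SC)
  \<comment> \<open>Continuity of \<open>h\<close> contributes 1/4 and the isometry
    \<open>?e\<close> another 1/4; their sum is the separation constant of
    \<open>trans_separated\<close>.\<close>
  have locconst: "\<exists>d>0. \<forall>q\<in>CP. cdist p q < d \<longrightarrow> n p = n q" if p: "p \<in> CP" for p
  proof -
    have "continuous_map (mtopology_of SC) (mtopology_of SC) h"
      using h by (simp add: cover_homeos_def homeomorphic_eq_everything_map)
    then obtain d where d: "d > 0" "\<And>q. q \<in> CP \<Longrightarrow> mdist SC p q < d \<Longrightarrow> mdist SC (h p) (h q) < 1/4"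
      unfolding continuous_SC using p by (metis zero_less_divide_1_iff zero_less_numeral)
    show ?thesis
    proof (intro exI conjI ballI impI)
      show "min d (1/4) > 0" using d by simp
      fix q assume q: "q \<in> CP" "cdist p q < min d (1/4)"
      have 1: "cdist (h p) (h q) < 1/4" using d(2)[OF q(1)] q p by (simp add: mdist_SC hCP)
      let ?m = "ainv (n p) \<cdot> n q"
      have m: "?m \<in> AL" using nA p q by simp
      have "cdist (trans (n p) (?e p)) (trans (n q) (?e p)) \<le> cdist (h p) (h q) + cdist (h q) (trans (n q) (?e p))"
        using cdist_triangle[of "h p" "h q" "trans (n q) (?e p)"] n[OF p] hCP p q nA eCP by simp
      also have "cdist (h q) (trans (n q) (?e p)) = cdist q p"
        using n[OF q(1)] cdist_trans[OF nA[OF q(1)] eCP[OF q(1)] eCP[OF p]] eiso[OF q(1) p] by simp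
      finally have "cdist (trans (n p) (?e p)) (trans (n q) (?e p)) < 1/2"
        using 1 q(2) cdist_sym[of q p] by simp
      moreover have "trans (n q) (?e p) = trans (n p) (trans ?m (?e p))"
        using nA p q eCP m by (simp add: trans_trans flip: A.m_assoc)
      ultimately have "cdist (?e p) (trans ?m (?e p)) < 1/2"
        using cdist_trans[OF nA[OF p] eCP[OF p] trans_CP[OF m eCP[OF p]]] by simp
      then have "?m = \<one>\<^sub>L" using trans_separated[OF m eCP[OF p]] by blast
      then have "n p \<cdot> ?m = n p \<cdot> \<one>\<^sub>L" by simp
      then show "n p = n q" using nA p q by (simp flip: A.m_assoc)
    qed
  qed
  \<comment> \<open>The segment \<open>r * s\<close> with \<open>r\<close> from 0 to 1 joins the
    initial vertex to the point \<open>s\<close> of the cube, and a locally constant function on the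
    unit interval is constant.\<close>
  have cubeconst: "n (cm g s) = n (g, \<lambda>_. 0)" if *: "g \<in> AL" "\<sigma> \<in> L" "s \<in> unit_cube \<sigma>" for g \<sigma> s
  proof -
    let ?\<gamma> = "\<lambda>r x. r * s x"
    have U: "?\<gamma> r \<in> unit_cube \<sigma>" if "r \<in> {0..1}" for r
      using that *(3) by (auto simp: unit_cube_def mult_le_one)
    have D: "cube_dist L (?\<gamma> r) (?\<gamma> r') = \<bar>r - r'\<bar> * cube_dist L s (\<lambda>_. 0)" for r r'
    proof -
      have "(\<Sum>x\<in>V. (r * s x - r' * s x)\<^sup>2) = (r - r')\<^sup>2 * (\<Sum>x\<in>V. (s x - 0)\<^sup>2)"
        unfolding sum_distrib_left by (intro sum.cong) (auto simp: power2_eq_square algebra_simps)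
      then show ?thesis by (simp add: cube_dist_def Union_L real_sqrt_mult)
    qed
    define M where "M = cube_dist L s (\<lambda>_. 0) + 1"
    have M: "M > 0" using cube_dist_nonneg[of s "\<lambda>_. 0"] unfolding M_def by linarith
    have "n (cm g (?\<gamma> 1)) = n (cm g (?\<gamma> 0))"
    proof (rule connected_local_const[where A = "{0..1::real}" and f = "\<lambda>r. n (cm g (?\<gamma> r))"])
      show "\<forall>r\<in>{0..1}. \<forall>\<^sub>F r' in at r within {0..1}. n (cm g (?\<gamma> r)) = n (cm g (?\<gamma> r'))"
      proof
        fix r :: real assume r: "r \<in> {0..1}"
        obtain d where d: "d > 0" "\<And>q. q \<in> CP \<Longrightarrow> cdist (cm g (?\<gamma> r)) q < d \<Longrightarrow> n (cm g (?\<gamma> r)) = n q"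
          using locconst[OF cm_in_CP[OF *(1,2) U[OF r]]] by blast
        show "\<forall>\<^sub>F r' in at r within {0..1}. n (cm g (?\<gamma> r)) = n (cm g (?\<gamma> r'))"
          unfolding eventually_at
        proof (intro exI conjI ballI impI)
          show "d / M > 0" using d M by simp
          fix r' assume r': "r' \<in> {0..1::real}" "r' \<noteq> r \<and> dist r' r < d / M"
          have "cdist (cm g (?\<gamma> r)) (cm g (?\<gamma> r')) = \<bar>r - r'\<bar> * cube_dist L s (\<lambda>_. 0)"
            using cdist_cube[OF *(1,2) U[OF r] U[OF r'(1)]] D by simp
          also have "\<dots> \<le> \<bar>r - r'\<bar> * M" by (rule mult_left_mono) (auto simp: M_def)
          also have "\<dots> < d" using r'(2) M by (simp add: dist_real_def abs_minus_commute field_simps)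
          finally show "n (cm g (?\<gamma> r)) = n (cm g (?\<gamma> r'))"
            using d(2)[OF cm_in_CP[OF *(1,2) U[OF r'(1)]]] by blast
        qed
      qed
    qed auto
    then show ?thesis using *(1) by simp
  qed
  have edgeconst: "n (g \<cdot> gen x, \<lambda>_. 0) = n (g, \<lambda>_. 0)" if "g \<in> AL" "x \<in> V" for g x
    using cubeconst[OF that(1) vertex_simplex[OF that(2)], of "edge_point x 1"] cm_edge[OF that] by simp
  have vertconst: "n (g, \<lambda>_. 0) = n (\<one>\<^sub>L, \<lambda>_. 0)" if "g \<in> AL" for g
    using that
  proof (induction rule: raag_induct)
    case (mult g x)
    then show ?case using edgeconst Union_L by simp
  next
    case (inv_mult g x)
    then have "g \<cdot> ainv (gen x) \<in> AL" "x \<in> V" "g \<cdot> ainv (gen x) \<cdot> gen x = g"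
      using Union_L by (auto simp: A.m_assoc)
    then show ?case using edgeconst[of "g \<cdot> ainv (gen x)" x] inv_mult by simp
  qed simp
  let ?n = "n (\<one>\<^sub>L, \<lambda>_. 0)"
  have n1: "?n \<in> N" using n[of "(\<one>\<^sub>L, \<lambda>_. 0)"] by simp
  let ?f = "\<lambda>g. ?n \<cdot> f g"
  have vf: "vlift a ?f" by (rule vlift_N[OF f n1])
  have "h = ext a ?f"
  proof (rule Bij_eqI[OF hB cauts_Bij[OF ext_cauts[OF a vf]]])
    fix p assume p: "p \<in> CP"
    obtain g \<sigma> s where *: "g \<in> AL" "\<sigma> \<in> L" "s \<in> unit_cube \<sigma>" "p = cm g s" using point_in_some_cube[OF p] .
    have "n p = ?n" using cubeconst[OF *(1-3)] vertconst[OF *(1)] *(4) by simp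
    then show "h p = ext a ?f p" using n[OF p] ext_left[OF a f n1 p] by simp
  qed
  then show "h \<in> cauts" "vlift a (act h)"
    using ext_cauts[OF a vf] vlift_cong[of ?f "act h" a] act_ext[OF vf] vf by auto
qed

text \<open>Any lift of \<open>a\<close> can be corrected by the kernel element that joins its value
  at \<open>g\<close> to \<open>g'\<close>.\<close>

lemma vlift_through:
  assumes a: "lpa a" and g: "g \<in> AL" "g' \<in> AL" "\<phi> g' = a (\<phi> g)"
  obtains f where "vlift a f" "f g = g'"
proof -
  obtain g1 where "g1 \<in> AL" "\<phi> g1 = a \<one>\<^sub>F" using phi_surj[OF lpa_closed[OF a F.one_closed]] .
  then obtain f where f: "vlift a f" using vlift_exists[OF a] by metis
  obtain n where n: "n \<in> N" "g' = n \<cdot> f g" using same_phi[of "f g" g'] vliftD[OF f g(1)] g by metis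
  show ?thesis by (rule that[OF vlift_N[OF f n(1)]]) (simp add: n(2))
qed

end

section \<open>The group of lifts as an extension by the deck group\<close>

locale lift_action = flag_free L V B for L :: "'v set set" and V :: "'v set" and B :: "'v set" +
  fixes \<Gamma> :: "'g monoid" and \<rho> :: "'g \<Rightarrow> 'v word set \<Rightarrow> 'v word set"
  assumes lp: "label_preserving_action B \<Gamma> \<rho>"
begin

sublocale G: group \<Gamma>
  using lp by (simp add: label_preserving_action_def)

abbreviation LG :: "('g \<times> ('v cover_point \<Rightarrow> 'v cover_point)) monoid" where
  "LG \<equiv> lift_group L B \<Gamma> \<rho>"

lemma rho_hom: "\<rho> \<in> hom \<Gamma> (tree_aut B)"
  using lp by (simp add: label_preserving_action_def)

lemma rho_lpa: "\<gamma> \<in> carrier \<Gamma> \<Longrightarrow> lpa (\<rho> \<gamma>)"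
  using lp hom_in_carrier[OF rho_hom] by (simp add: label_preserving_action_def lpa_def)

lemma rho_no_inversion: "\<gamma> \<in> carrier \<Gamma> \<Longrightarrow> no_inversion B (\<rho> \<gamma>)"
  using lp by (simp add: label_preserving_action_def)

lemma rho_one: "\<rho> \<one>\<^bsub>\<Gamma>\<^esub> = (\<lambda>x\<in>FB. x)"
  using hom_one[OF rho_hom G.group_axioms group_tree_aut] by (simp add: tree_aut_one)

lemma rho_mult: "\<gamma> \<in> carrier \<Gamma> \<Longrightarrow> \<delta> \<in> carrier \<Gamma> \<Longrightarrow> \<rho> (\<gamma> \<otimes>\<^bsub>\<Gamma>\<^esub> \<delta>) = compose FB (\<rho> \<gamma>) (\<rho> \<delta>)"
  using hom_mult[OF rho_hom] tree_aut_mult lpa_tauts rho_lpa by metis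

lemma rho_inv: assumes "\<gamma> \<in> carrier \<Gamma>" shows "\<rho> (inv\<^bsub>\<Gamma>\<^esub> \<gamma>) = restrict (inv_into FB (\<rho> \<gamma>)) FB"
proof -
  have "\<rho> (inv\<^bsub>\<Gamma>\<^esub> \<gamma>) = inv\<^bsub>tree_aut B\<^esub> \<rho> \<gamma>"
    using group_hom.hom_inv[of \<Gamma> "tree_aut B" \<rho> \<gamma>] rho_hom assms
    by (simp add: group_hom_def group_hom_axioms_def G.group_axioms group_tree_aut)
  also have "\<dots> = inv\<^bsub>BijGroup FB\<^esub> \<rho> \<gamma>"
    unfolding tree_aut_eq
    by (rule group.m_inv_consistent[OF group_BijGroup subgroup_tauts lpa_tauts[OF rho_lpa[OF assms]]])
  finally show ?thesis using BijGroup_inv[OF lpa_Bij[OF rho_lpa[OF assms]]] by simp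
qed

text \<open>By definition a lift is a homeomorphism covering some automorphism of the intermediate
  cover. Uniqueness of lifts turns this into a condition on vertices in which the map downstairs no
  longer appears; all later work uses this form.\<close>

lemma LG_carrier: "(\<gamma>, h) \<in> carrier LG \<longleftrightarrow> \<gamma> \<in> carrier \<Gamma> \<and> h \<in> cauts \<and> vlift (\<rho> \<gamma>) (act h)"
proof
  assume "(\<gamma>, h) \<in> carrier LG"
  then obtain \<Phi> where "\<gamma> \<in> carrier \<Gamma>" "h \<in> cover_homeos L" "extends_to_intermediate L B (\<rho> \<gamma>) \<Phi>"
    "\<And>x. x \<in> CP \<Longrightarrow> \<pi> (h x) = \<Phi> (\<pi> x)" by (auto simp: lift_group_def)
  then show "\<gamma> \<in> carrier \<Gamma> \<and> h \<in> cauts \<and> vlift (\<rho> \<gamma>) (act h)"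
    using lift_unique[OF rho_lpa] by blast
next
  assume *: "\<gamma> \<in> carrier \<Gamma> \<and> h \<in> cauts \<and> vlift (\<rho> \<gamma>) (act h)"
  then have "h = ext (\<rho> \<gamma>) (act h)" using cauts_ext rho_lpa by blast
  moreover have "extends_to_intermediate L B (\<rho> \<gamma>) (descend (\<rho> \<gamma>) (act h))"
    using descend_extends rho_lpa * by blast
  moreover have "\<pi> (ext (\<rho> \<gamma>) (act h) x) = descend (\<rho> \<gamma>) (act h) (\<pi> x)" if "x \<in> CP" for x
    using descend_pi[OF rho_lpa _ that] * by simp
  ultimately show "(\<gamma>, h) \<in> carrier LG"
    using * cauts_homeo by (auto simp: lift_group_def)
qed

lemma LG_eq: "LG = (\<Gamma> \<times>\<times> BijGroup CP)\<lparr>carrier := carrier LG\<rparr>"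
  by (simp add: lift_group_def)

lemma subgroup_LG: "subgroup (carrier LG) (\<Gamma> \<times>\<times> BijGroup CP)"
proof (rule group.subgroupI[OF DirProd_group[OF G.group_axioms group_BijGroup]])
  show "carrier LG \<subseteq> carrier (\<Gamma> \<times>\<times> BijGroup CP)"
    using LG_carrier cauts_Bij by auto
  have "vlift (\<lambda>x\<in>FB. x) (\<lambda>g. \<one>\<^sub>L \<cdot> g)" by (rule vlift_trans[OF N_one])
  then have "vlift (\<lambda>x\<in>FB. x) (act (\<lambda>x\<in>CP. x))" by (rule vlift_cong[rotated]) (simp add: act_one)
  then have "(\<one>\<^bsub>\<Gamma>\<^esub>, \<lambda>x\<in>CP. x) \<in> carrier LG"
    using subgroup.one_closed[OF subgroup_cauts] by (simp add: LG_carrier rho_one)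
  then show "carrier LG \<noteq> {}" by blast
next
  fix x assume x: "x \<in> carrier LG"
  obtain \<gamma> h where xe: "x = (\<gamma>, h)" by (cases x)
  have *: "\<gamma> \<in> carrier \<Gamma>" "h \<in> cauts" "vlift (\<rho> \<gamma>) (act h)" using x by (simp_all add: xe LG_carrier)
  let ?i = "restrict (inv_into CP h) CP"
  have hi: "inv\<^bsub>BijGroup CP\<^esub> h = ?i" by (rule BijGroup_inv[OF cauts_Bij[OF *(2)]])
  have iA: "?i \<in> cauts" using subgroup.m_inv_closed[OF subgroup_cauts *(2)] hi by simp
  obtain f' where f': "vlift (\<rho> (inv\<^bsub>\<Gamma>\<^esub> \<gamma>)) f'" "\<And>g. g \<in> AL \<Longrightarrow> f' (act h g) = g"
    unfolding rho_inv[OF *(1)] by (rule vlift_inverse[OF rho_lpa[OF *(1)] *(3)]) blast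
  have "f' g = act ?i g" if g: "g \<in> AL" for g
  proof -
    have "compose CP h ?i = (\<lambda>x\<in>CP. x)"
      using inv_into_Bij[OF cauts_Bij[OF *(2)]] by (auto simp: compose_def restrict_def fun_eq_iff)
    then have "act h (act ?i g) = g" using act_compose[OF *(2) iA g] act_one[OF g] by simp
    then show ?thesis using f'(2)[OF cauts_vertex(2)[OF iA g]] by simp
  qed
  then have "vlift (\<rho> (inv\<^bsub>\<Gamma>\<^esub> \<gamma>)) (act ?i)" using vlift_cong f'(1) by blast
  then show "inv\<^bsub>\<Gamma> \<times>\<times> BijGroup CP\<^esub> x \<in> carrier LG"
    using * iA cauts_Bij by (simp add: xe inv_DirProd[OF G.group_axioms group_BijGroup] hi LG_carrier)
  fix y assume y: "y \<in> carrier LG"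
  obtain \<delta> k where ye: "y = (\<delta>, k)" by (cases y)
  have **: "\<delta> \<in> carrier \<Gamma>" "k \<in> cauts" "vlift (\<rho> \<delta>) (act k)" using y by (simp_all add: ye LG_carrier)
  have "vlift (\<rho> (\<gamma> \<otimes>\<^bsub>\<Gamma>\<^esub> \<delta>)) (\<lambda>g. act h (act k g))"
    unfolding rho_mult[OF *(1) **(1)] by (rule vlift_compose[OF rho_lpa[OF *(1)] rho_lpa[OF **(1)] *(3) **(3)])
  then have "vlift (\<rho> (\<gamma> \<otimes>\<^bsub>\<Gamma>\<^esub> \<delta>)) (act (compose CP h k))"
    by (rule vlift_cong[rotated]) (simp add: act_compose[OF *(2) **(2)])
  moreover have "compose CP h k \<in> cauts"
    using subgroup.m_closed[OF subgroup_cauts *(2) **(2)] * ** cauts_Bij by simp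
  ultimately show "x \<otimes>\<^bsub>\<Gamma> \<times>\<times> BijGroup CP\<^esub> y \<in> carrier LG"
    using * ** cauts_Bij by (simp add: xe ye LG_carrier)
qed

lemma group_LG: "group LG"
  by (subst LG_eq, rule subgroup.subgroup_is_group[OF subgroup_LG DirProd_group[OF G.group_axioms group_BijGroup]])

lemma LG_mult:
  "(\<gamma>, h) \<in> carrier LG \<Longrightarrow> (\<delta>, k) \<in> carrier LG \<Longrightarrow> (\<gamma>, h) \<otimes>\<^bsub>LG\<^esub> (\<delta>, k) = (\<gamma> \<otimes>\<^bsub>\<Gamma>\<^esub> \<delta>, compose CP h k)"
  by (subst LG_eq) (simp add: LG_carrier cauts_Bij)

lemma LG_through:
  assumes "\<gamma> \<in> carrier \<Gamma>" "g \<in> AL" "g' \<in> AL" "\<phi> g' = \<rho> \<gamma> (\<phi> g)"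
  obtains h where "(\<gamma>, h) \<in> carrier LG" "act h g = g'"
proof -
  obtain f where f: "vlift (\<rho> \<gamma>) f" "f g = g'" using vlift_through[OF rho_lpa[OF assms(1)] assms(2-4)] .
  let ?h = "ext (\<rho> \<gamma>) f"
  have "vlift (\<rho> \<gamma>) (act ?h)" by (rule vlift_cong[OF _ f(1)]) (simp add: act_ext[OF f(1)])
  then have "(\<gamma>, ?h) \<in> carrier LG"
    using assms(1) ext_cauts[OF rho_lpa[OF assms(1)] f(1)] by (simp add: LG_carrier)
  then show ?thesis using that act_ext[OF f(1) assms(2)] f(2) by blast
qed

lemma fst_epi: "fst \<in> epi LG \<Gamma>"
  unfolding epi_iff_subset
proof
  show "fst \<in> hom LG \<Gamma>"
    by (rule homI) (auto simp: LG_carrier LG_mult)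
  show "carrier \<Gamma> \<subseteq> fst ` carrier LG"
  proof
    fix \<gamma> assume \<gamma>: "\<gamma> \<in> carrier \<Gamma>"
    obtain g1 where g1: "g1 \<in> AL" "\<phi> g1 = \<rho> \<gamma> \<one>\<^sub>F" using phi_surj[OF lpa_closed[OF rho_lpa[OF \<gamma>] F.one_closed]] .
    have "\<phi> g1 = \<rho> \<gamma> (\<phi> \<one>\<^sub>L)" using g1(2) by simp
    from LG_through[OF \<gamma> A.one_closed g1(1) this] obtain h where "(\<gamma>, h) \<in> carrier LG" by blast
    then show "\<gamma> \<in> fst ` carrier LG" by force
  qed
qed

text \<open>Over the identity of the tree the automorphism downstairs is the identity, so covering
  it means preserving the fibres of \<open>\<pi>\<close>.\<close>

lemma kernel_fst: "kernel LG \<Gamma> fst = {\<one>\<^bsub>\<Gamma>\<^esub>} \<times> deck_group L B"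
proof -
  have vid: "vlift (\<lambda>x\<in>FB. x) (\<lambda>g. \<one>\<^sub>L \<cdot> g)" by (rule vlift_trans[OF N_one])
  have eid: "ext (\<lambda>x\<in>FB. x) (\<lambda>g. \<one>\<^sub>L \<cdot> g) p = p" if "p \<in> CP" for p
    by (rule cubical_identity[OF cubical_ext[OF lpa_id vid] _ that]) (simp add: ext_vertex[OF vid])
  have "(\<gamma>, h) \<in> kernel LG \<Gamma> fst \<longleftrightarrow> \<gamma> = \<one>\<^bsub>\<Gamma>\<^esub> \<and> h \<in> deck_group L B" for \<gamma> h
  proof
    assume "(\<gamma>, h) \<in> kernel LG \<Gamma> fst"
    then have 1: "\<gamma> = \<one>\<^bsub>\<Gamma>\<^esub>" "(\<one>\<^bsub>\<Gamma>\<^esub>, h) \<in> carrier LG" by (auto simp: kernel_def)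
    from 1(2) obtain \<Phi> where "h \<in> cover_homeos L" "extends_to_intermediate L B (\<lambda>x\<in>FB. x) \<Phi>"
      "\<And>x. x \<in> CP \<Longrightarrow> \<pi> (h x) = \<Phi> (\<pi> x)" by (auto simp: lift_group_def rho_one)
    then show "\<gamma> = \<one>\<^bsub>\<Gamma>\<^esub> \<and> h \<in> deck_group L B"
      using 1(1) extends_unique[OF lpa_id vid] eid by (simp add: deck_group_def)
  next
    assume *: "\<gamma> = \<one>\<^bsub>\<Gamma>\<^esub> \<and> h \<in> deck_group L B"
    have "extends_to_intermediate L B (\<rho> \<gamma>) (descend (\<lambda>x\<in>FB. x) (\<lambda>g. \<one>\<^sub>L \<cdot> g))"
      using descend_extends[OF lpa_id vid] * by (simp add: rho_one)
    moreover have "\<pi> (h x) = descend (\<lambda>x\<in>FB. x) (\<lambda>g. \<one>\<^sub>L \<cdot> g) (\<pi> x)" if "x \<in> CP" for x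
      using descend_pi[OF lpa_id vid that] eid[OF that] * that by (simp add: deck_group_def)
    ultimately have "(\<gamma>, h) \<in> carrier LG" using * by (auto simp: lift_group_def deck_group_def)
    then show "(\<gamma>, h) \<in> kernel LG \<Gamma> fst" using * by (simp add: kernel_def)
  qed
  then show ?thesis by auto
qed

lemma snd_hom: "snd \<in> hom LG (isom_group SC)"
proof (rule homI)
  fix x y assume "x \<in> carrier LG" "y \<in> carrier LG"
  then show "snd (x \<otimes>\<^bsub>LG\<^esub> y) = snd x \<otimes>\<^bsub>isom_group SC\<^esub> snd y"
    by (cases x; cases y) (simp add: LG_mult, simp add: LG_carrier isom_group_eq cauts_Bij)
next
  fix x assume "x \<in> carrier LG"
  then show "snd x \<in> carrier (isom_group SC)" by (cases x) (simp add: LG_carrier cauts_def)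
qed

lemma admissible: "admissible_on (snd ` carrier LG) (cover_cubes L)"
  unfolding admissible_on_def
proof (intro ballI conjI impI)
  fix h C assume "h \<in> snd ` carrier LG" and C: "C \<in> cover_cubes L"
  then obtain \<gamma> where *: "\<gamma> \<in> carrier \<Gamma>" "h \<in> cauts" "vlift (\<rho> \<gamma>) (act h)" by (auto simp: LG_carrier)
  show "h ` C \<in> cover_cubes L" using *(2) C by (auto simp: cauts_def)
  fix x assume st: "h ` C = C" and x: "x \<in> C"
  have he: "h = ext (\<rho> \<gamma>) (act h)" by (rule cauts_ext[OF rho_lpa[OF *(1)] *(2,3)])
  have "ext (\<rho> \<gamma>) (act h) x = x"
    by (rule ext_admissible[OF rho_lpa[OF *(1)] rho_no_inversion[OF *(1)] *(3) C _ x]) (use st he in metis)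
  then show "h x = x" using he by metis
qed

lemma lift_conclusions:
  "group LG \<and> fst \<in> epi LG \<Gamma> \<and> kernel LG \<Gamma> fst = {\<one>\<^bsub>\<Gamma>\<^esub>} \<times> deck_group L B \<and>
   snd \<in> hom LG (isom_group (salvetti_cover L)) \<and> admissible_on (snd ` carrier LG) (cover_cubes L) \<and>
   (\<forall>(\<gamma>, f)\<in>carrier LG. \<forall>g\<in>carrier (raag L). \<exists>g'\<in>carrier (raag L). f (g, \<lambda>_. 0) = (g', \<lambda>_. 0) \<and>
      raag_to_free L B g' = \<rho> \<gamma> (raag_to_free L B g))"
proof (intro conjI group_LG fst_epi kernel_fst snd_hom admissible ballI)
  fix x assume x: "x \<in> carrier LG"
  obtain \<gamma> f where xe: "x = (\<gamma>, f)" by (cases x)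
  then have *: "f \<in> cauts" "vlift (\<rho> \<gamma>) (act f)" using x by (simp_all add: LG_carrier)
  have "\<forall>g\<in>AL. \<exists>g'\<in>AL. f (g, \<lambda>_. 0) = (g', \<lambda>_. 0) \<and> \<phi> g' = \<rho> \<gamma> (\<phi> g)"
    using cauts_vertex[OF *(1)] vliftD(2)[OF *(2)] by blast
  then show "case x of (\<gamma>, f) \<Rightarrow> \<forall>g\<in>AL. \<exists>g'\<in>AL. f (g, \<lambda>_. 0) = (g', \<lambda>_. 0) \<and> \<phi> g' = \<rho> \<gamma> (\<phi> g)"
    by (simp add: xe)
qed

end

section \<open>Haar measure on a closed permutation group with a regular subgroup\<close>

text \<open>The permuted set is the carrier of \<open>P\<close>, on which \<open>P\<close> acts by
  left multiplication through \<open>reg\<close>. The sets \<open>Bn n\<close> are finite, exhaust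
  it and are preserved by the stabiliser of the identity; \<open>complete\<close> says that the
  group is closed under pointwise limits.\<close>

locale permutation_group = group A for A :: "'a monoid" (structure) +
  fixes P :: "'p monoid" and act :: "'a \<Rightarrow> 'p \<Rightarrow> 'p" and reg :: "'p \<Rightarrow> 'a" and Bn :: "nat \<Rightarrow> 'p set"
  assumes P: "group P" and countable_P: "countable (carrier P)"
    and act_closed: "f \<in> carrier A \<Longrightarrow> v \<in> carrier P \<Longrightarrow> act f v \<in> carrier P"
    and act_mult: "f \<in> carrier A \<Longrightarrow> g \<in> carrier A \<Longrightarrow> v \<in> carrier P \<Longrightarrow> act (f \<otimes> g) v = act f (act g v)"
    and act_one: "v \<in> carrier P \<Longrightarrow> act \<one> v = v"
    and faithful: "f \<in> carrier A \<Longrightarrow> g \<in> carrier A \<Longrightarrow> (\<And>v. v \<in> carrier P \<Longrightarrow> act f v = act g v) \<Longrightarrow> f = g"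
    and reg_closed: "a \<in> carrier P \<Longrightarrow> reg a \<in> carrier A"
    and act_reg: "a \<in> carrier P \<Longrightarrow> v \<in> carrier P \<Longrightarrow> act (reg a) v = a \<otimes>\<^bsub>P\<^esub> v"
    and finite_Bn: "finite (Bn n)" and Bn_mono: "Bn n \<subseteq> Bn (Suc n)" and Bn_Union: "(\<Union>n. Bn n) = carrier P"
    and Bn_0: "Bn 0 = {\<one>\<^bsub>P\<^esub>}"
    and Bn_act: "f \<in> carrier A \<Longrightarrow> act f \<one>\<^bsub>P\<^esub> = \<one>\<^bsub>P\<^esub> \<Longrightarrow> v \<in> Bn n \<Longrightarrow> act f v \<in> Bn n"
    and complete: "(\<And>n. \<exists>f\<in>carrier A. \<forall>v\<in>Bn n. act f v = p v) \<Longrightarrow> \<exists>f\<in>carrier A. \<forall>v\<in>carrier P. act f v = p v"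
begin

sublocale P: group P by (rule P)

abbreviation V :: "'p set" where "V \<equiv> carrier P"
abbreviation e :: 'p where "e \<equiv> \<one>\<^bsub>P\<^esub>"

lemma Bn_le: "n \<le> m \<Longrightarrow> Bn n \<subseteq> Bn m"
  using lift_Suc_mono_le[of Bn n m] Bn_mono by blast

lemma Bn_V: "v \<in> Bn n \<Longrightarrow> v \<in> V"
  using Bn_Union by blast

lemma e_Bn: "e \<in> Bn n"
  using Bn_le[of 0 n] Bn_0 by auto

lemma finite_in_Bn: assumes "finite S" "S \<subseteq> V" obtains n where "S \<subseteq> Bn n"
proof -
  have "\<exists>n. S \<subseteq> Bn n"
    using assms
  proof (induction S rule: finite_induct)
    case (insert x S)
    then obtain n m where "S \<subseteq> Bn n" "x \<in> Bn m" using Bn_Union by blast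
    then have "insert x S \<subseteq> Bn (max n m)" using Bn_le[of n "max n m"] Bn_le[of m "max n m"] by auto
    then show ?case by blast
  qed simp
  then show ?thesis using that by blast
qed

lemma act_inv: "f \<in> carrier A \<Longrightarrow> v \<in> V \<Longrightarrow> act (inv f) (act f v) = v"
    "f \<in> carrier A \<Longrightarrow> v \<in> V \<Longrightarrow> act f (act (inv f) v) = v"
  using act_mult[of "inv f" f v] act_mult[of f "inv f" v] act_one by auto

lemma act_inj: "f \<in> carrier A \<Longrightarrow> v \<in> V \<Longrightarrow> w \<in> V \<Longrightarrow> act f v = act f w \<longleftrightarrow> v = w"
  using act_inv(1) by metis

text \<open>Left cosets of the pointwise stabilisers \<open>stab n\<close>; they are the basic open
  sets.\<close>

definition cyl :: "'a \<Rightarrow> nat \<Rightarrow> 'a set" where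
  "cyl f n = {f' \<in> carrier A. \<forall>v\<in>Bn n. act f' v = act f v}"

definition stab :: "nat \<Rightarrow> 'a set" where
  "stab n = {f \<in> carrier A. \<forall>v\<in>Bn n. act f v = v}"

lemma stabD: "f \<in> stab n \<Longrightarrow> f \<in> carrier A" "f \<in> stab n \<Longrightarrow> v \<in> Bn n \<Longrightarrow> act f v = v"
  by (auto simp: stab_def)

lemma stab_Bn: "f \<in> stab n \<Longrightarrow> v \<in> Bn m \<Longrightarrow> act f v \<in> Bn m"
  using Bn_act stabD e_Bn by metis

lemma finite_stab_restrict: "finite ((\<lambda>f. restrict (act f) (Bn m)) ` stab n)"
  by (rule finite_subset[of _ "Bn m \<rightarrow>\<^sub>E Bn m"]) (auto simp: stab_Bn finite_Bn finite_PiE)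

text \<open>A transversal of \<open>stab (Suc n)\<close> in \<open>stab n\<close>.\<close>

definition rep :: "nat \<Rightarrow> 'a \<Rightarrow> 'a" where
  "rep n f = (SOME r. r \<in> stab n \<and> restrict (act r) (Bn (Suc n)) = restrict (act f) (Bn (Suc n)))"

lemma rep: assumes "f \<in> stab n" shows "rep n f \<in> stab n" "v \<in> Bn (Suc n) \<Longrightarrow> act (rep n f) v = act f v"
proof -
  have "rep n f \<in> stab n \<and> restrict (act (rep n f)) (Bn (Suc n)) = restrict (act f) (Bn (Suc n))"
    unfolding rep_def by (rule someI[of _ f]) (use assms in simp)
  then show "rep n f \<in> stab n" "v \<in> Bn (Suc n) \<Longrightarrow> act (rep n f) v = act f v"
    by (metis restrict_apply')+
qed

lemma rep_cong: assumes "\<And>v. v \<in> Bn (Suc n) \<Longrightarrow> act f v = act g v" shows "rep n f = rep n g"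
proof -
  have "restrict (act f) (Bn (Suc n)) = restrict (act g) (Bn (Suc n))" using assms by auto
  then show ?thesis by (simp add: rep_def)
qed

definition R :: "nat \<Rightarrow> 'a set" where "R n = rep n ` stab n"

lemma one_stab: "\<one> \<in> stab n"
  using act_one Bn_V by (auto simp: stab_def)

lemma R_stab: "r \<in> R n \<Longrightarrow> r \<in> stab n"
  using rep(1) by (auto simp: R_def)

lemma finite_R: "finite (R n)"
proof -
  have "rep n f = (SOME r. r \<in> stab n \<and> restrict (act r) (Bn (Suc n)) = restrict (act f) (Bn (Suc n)))" for f
    by (simp add: rep_def)
  then have "R n = (\<lambda>h. SOME r. r \<in> stab n \<and> restrict (act r) (Bn (Suc n)) = h) `
     (\<lambda>f. restrict (act f) (Bn (Suc n))) ` stab n"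
    by (simp add: R_def image_image)
  then show ?thesis using finite_stab_restrict by simp
qed

lemma R_nonempty: "R n \<noteq> {}"
  using one_stab by (auto simp: R_def)

lemma R_eq: assumes "r \<in> R n" "f \<in> stab n" "\<And>v. v \<in> Bn (Suc n) \<Longrightarrow> act r v = act f v" shows "r = rep n f"
proof -
  obtain k where k: "k \<in> stab n" "r = rep n k" using assms(1) by (auto simp: R_def)
  have "act k v = act f v" if "v \<in> Bn (Suc n)" for v using rep(2)[OF k(1) that] assms(3)[OF that] k(2) by simp
  then show ?thesis using k(2) rep_cong by blast
qed

section \<open>Digit expansions of elements of the stabiliser\<close>

primrec xs :: "(nat \<Rightarrow> 'a) \<Rightarrow> nat \<Rightarrow> 'a" where
  "xs w 0 = \<one>"
| "xs w (Suc n) = xs w n \<otimes> w n"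

abbreviation RR :: "(nat \<Rightarrow> 'a) set" where "RR \<equiv> PiE UNIV R"

lemma RR_stab: "w \<in> RR \<Longrightarrow> w n \<in> stab n"
  using R_stab by (auto simp: PiE_iff)

lemma xs_closed: "w \<in> RR \<Longrightarrow> xs w n \<in> carrier A"
  by (induction n) (auto dest: RR_stab stabD)

lemma xs_stable: assumes w: "w \<in> RR" and "n \<le> m" and v: "v \<in> Bn n" shows "act (xs w m) v = act (xs w n) v"
  using assms(2)
proof (induction m rule: dec_induct)
  case (step m)
  have "act (w m) v = v" using stabD(2)[OF RR_stab[OF w]] Bn_le[OF step(1)] v by blast
  then show ?case using step act_mult[OF xs_closed[OF w] stabD(1)[OF RR_stab[OF w]] Bn_V[OF v]] by simp
qed simp

text \<open>The infinite product of the digits: partial products stabilise on each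
  \<open>Bn n\<close>, and \<open>complete\<close> supplies an element with the limiting
  values.\<close>

definition limw :: "(nat \<Rightarrow> 'a) \<Rightarrow> 'a" where
  "limw w = (SOME f. f \<in> carrier A \<and> (\<forall>n. \<forall>v\<in>Bn n. act f v = act (xs w n) v))"

lemma limw: assumes w: "w \<in> RR" shows "limw w \<in> carrier A" "v \<in> Bn n \<Longrightarrow> act (limw w) v = act (xs w n) v"
proof -
  define p where "p v = act (xs w (LEAST n. v \<in> Bn n)) v" for v
  have p: "p v = act (xs w n) v" if "v \<in> Bn n" for v n
    unfolding p_def by (rule xs_stable[OF w _ LeastI[of "\<lambda>n. v \<in> Bn n", OF that], symmetric]) (rule Least_le[of "\<lambda>n. v \<in> Bn n", OF that])
  have "\<exists>f\<in>carrier A. \<forall>v\<in>V. act f v = p v"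
  proof (rule complete)
    show "\<exists>f\<in>carrier A. \<forall>v\<in>Bn n. act f v = p v" for n
      by (rule bexI[OF _ xs_closed[OF w, of n]]) (simp add: p)
  qed
  then obtain f where f: "f \<in> carrier A" "\<forall>v\<in>V. act f v = p v" by blast
  then have "\<forall>n. \<forall>v\<in>Bn n. act f v = act (xs w n) v" using p Bn_V by simp
  then have "limw w \<in> carrier A \<and> (\<forall>n. \<forall>v\<in>Bn n. act (limw w) v = act (xs w n) v)"
    unfolding limw_def
    by (rule someI[of "\<lambda>f. f \<in> carrier A \<and> (\<forall>n. \<forall>v\<in>Bn n. act f v = act (xs w n) v)", OF conjI[OF f(1)]])
  then show "limw w \<in> carrier A" "v \<in> Bn n \<Longrightarrow> act (limw w) v = act (xs w n) v" by auto
qed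

text \<open>Greedy digits. The first component is the product of the digits found so far, the second
  the representative of the remainder at the current level; both are carried because each digit
  depends on all earlier ones.\<close>

primrec code :: "'a \<Rightarrow> nat \<Rightarrow> 'a \<times> 'a" where
  "code f 0 = (\<one>, rep 0 f)"
| "code f (Suc n) = (let y = fst (code f n) \<otimes> snd (code f n) in (y, rep (Suc n) (inv y \<otimes> f)))"

definition digit :: "'a \<Rightarrow> nat \<Rightarrow> 'a" where "digit f n = snd (code f n)"

lemma code_fst: "fst (code f n) = xs (digit f) n"
  by (induction n) (auto simp: digit_def Let_def)

lemma digit_rep: "f \<in> carrier A \<Longrightarrow> digit f n = rep n (inv (xs (digit f) n) \<otimes> f)"
  by (cases n) (auto simp: digit_def Let_def simp flip: code_fst)

lemma digit:
  assumes f: "f \<in> stab 0"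
  shows "digit f n \<in> R n \<and> xs (digit f) n \<in> carrier A \<and> (\<forall>v\<in>Bn n. act (xs (digit f) n) v = act f v)"
proof (induction n)
  have step: "inv (xs (digit f) n) \<otimes> f \<in> stab n"
    if "xs (digit f) n \<in> carrier A" "\<forall>v\<in>Bn n. act (xs (digit f) n) v = act f v" for n
    unfolding stab_def using that stabD(1)[OF f] act_inv(1) Bn_V by (auto simp: act_mult) metis
  case 0
  then show ?case using stabD(1)[OF f] digit_rep[of f 0] f one_stab stabD(2)[OF f]
    by (auto simp: R_def act_one Bn_V)
next
  have step: "inv (xs (digit f) n) \<otimes> f \<in> stab n"
    if "xs (digit f) n \<in> carrier A" "\<forall>v\<in>Bn n. act (xs (digit f) n) v = act f v" for n
    unfolding stab_def using that stabD(1)[OF f] act_inv(1) Bn_V by (auto simp: act_mult) metis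
  case (Suc n)
  let ?x = "xs (digit f) n" and ?d = "digit f n"
  have fA: "f \<in> carrier A" by (rule stabD(1)[OF f])
  have s: "inv ?x \<otimes> f \<in> stab n" using step Suc by blast
  have dA: "?d \<in> carrier A" using Suc R_stab stabD(1) by blast
  have 1: "xs (digit f) (Suc n) \<in> carrier A" using Suc dA by simp
  have 2: "act (xs (digit f) (Suc n)) v = act f v" if v: "v \<in> Bn (Suc n)" for v
  proof -
    have "act ?d v = act (inv ?x \<otimes> f) v" using rep(2)[OF s v] digit_rep[OF fA, of n] by simp
    then show ?thesis
      using Suc dA fA Bn_V[OF v] act_closed[OF fA Bn_V[OF v]] by (simp add: act_mult act_inv)
  qed
  then have "inv (xs (digit f) (Suc n)) \<otimes> f \<in> stab (Suc n)" using step 1 by blast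
  then have "digit f (Suc n) \<in> R (Suc n)" using digit_rep[OF fA, of "Suc n"] by (simp add: R_def)
  then show ?case using 1 2 by blast
qed

lemma digit_RR: "f \<in> stab 0 \<Longrightarrow> digit f \<in> RR"
  using digit by (auto simp: PiE_iff extensional_def)

lemma lim_digit: assumes "f \<in> stab 0" shows "limw (digit f) = f"
proof (rule faithful)
  fix v assume "v \<in> V"
  then obtain n where "v \<in> Bn n" using Bn_Union by blast
  then show "act (limw (digit f)) v = act f v" using limw(2)[OF digit_RR[OF assms]] digit[OF assms] by simp
qed (use limw(1)[OF digit_RR[OF assms]] stabD(1)[OF assms] in auto)

lemma lim_stab: "w \<in> RR \<Longrightarrow> limw w \<in> stab 0"
  using limw[of w] limw(2)[of w _ 0] by (auto simp: stab_def act_one Bn_V)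

text \<open>Cylinders correspond to prefixes of digit sequences. In the product of the uniform
  measures a cylinder with centre in \<open>stab 0\<close> therefore has a mass that depends on its
  level only.\<close>

lemma lim_cyl_iff:
  assumes w: "w \<in> RR" and f: "f \<in> stab 0"
  shows "limw w \<in> cyl f n \<longleftrightarrow> (\<forall>i<n. w i = digit f i)"
proof -
  have "limw w \<in> cyl f n \<longleftrightarrow> (\<forall>v\<in>Bn n. act (xs w n) v = act f v)"
    using limw[OF w] by (auto simp: cyl_def)
  also have "\<dots> \<longleftrightarrow> (\<forall>i<n. w i = digit f i)"
  proof
    assume "\<forall>i<n. w i = digit f i"
    then have "xs w n = xs (digit f) n" by (induction n) auto
    then show "\<forall>v\<in>Bn n. act (xs w n) v = act f v" using digit[OF f] by simp
  next
    assume eq: "\<forall>v\<in>Bn n. act (xs w n) v = act f v"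
    have "j \<le> n \<Longrightarrow> \<forall>i<j. w i = digit f i" for j
    proof (induction j)
      case (Suc j)
      then have IH: "\<forall>i<j. w i = digit f i" by simp
      then have x: "xs w j = xs (digit f) j" by (induction j) auto
      let ?x = "xs (digit f) j"
      have xA: "?x \<in> carrier A" and fA: "f \<in> carrier A" using digit[OF f] stabD(1)[OF f] by auto
      have wA: "w j \<in> carrier A" using RR_stab[OF w] stabD(1) by blast
      have "act (w j) v = act (inv ?x \<otimes> f) v" if v: "v \<in> Bn (Suc j)" for v
      proof -
        have "act (xs w (Suc j)) v = act f v"
          using xs_stable[OF w Suc.prems v] eq Bn_le[OF Suc.prems] v by auto
        then have "act ?x (act (w j) v) = act f v" using x wA xA Bn_V[OF v] by (simp add: act_mult)
        then show ?thesis using act_inv(1)[OF xA act_closed[OF wA Bn_V[OF v]]] xA fA Bn_V[OF v] by (simp add: act_mult)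
      qed
      moreover have "inv ?x \<otimes> f \<in> stab j"
        unfolding stab_def using digit[OF f] fA act_inv(1)[OF xA] Bn_V xA by (auto simp: act_mult) metis
      ultimately have "w j = digit f j"
        using R_eq[of "w j" j "inv ?x \<otimes> f"] w digit_rep[OF fA, of j] by (auto simp: PiE_iff)
      then show ?case using IH by (auto simp: less_Suc_eq)
    qed simp
    then show "\<forall>i<n. w i = digit f i" by blast
  qed
  finally show ?thesis .
qed

section \<open>Construction of the measure and its determination by cylinders\<close>

definition cmass :: "nat \<Rightarrow> ennreal" where "cmass n = (\<Prod>i<n. ennreal (1 / real (card (R i))))"

abbreviation Lam :: "(nat \<Rightarrow> 'a) measure" where "Lam \<equiv> PiM UNIV (\<lambda>n. uniform_count_measure (R n))"

lemma prob_uniform: "prob_space (uniform_count_measure (R n))"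
  by (rule prob_space_uniform_count_measure[OF finite_R R_nonempty])

lemma prob_Lam: "prob_space Lam"
  by (rule prob_space_PiM[OF prob_uniform])

lemma space_Lam: "space Lam = RR"
  by (simp add: space_PiM space_uniform_count_measure)

lemma Lam_cyl:
  assumes f: "f \<in> stab 0"
  shows "{w \<in> RR. limw w \<in> cyl f n} \<in> sets Lam" "emeasure Lam {w \<in> RR. limw w \<in> cyl f n} = cmass n"
proof -
  interpret product_prob_space "\<lambda>n. uniform_count_measure (R n)" UNIV
    using prob_uniform by (simp add: product_prob_space_def product_prob_space_axioms_def product_sigma_finite_def prob_space_imp_sigma_finite)
  have eq: "{w \<in> RR. limw w \<in> cyl f n} = {w \<in> space Lam. \<forall>i\<in>{..<n}. w i \<in> {digit f i}}"
    by (auto simp: space_Lam lim_cyl_iff[OF _ f])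
  have dR: "{digit f i} \<in> sets (uniform_count_measure (R i))" for i
    using digit[OF f, of i] by (simp add: sets_uniform_count_measure)
  have "emeasure (uniform_count_measure (R i)) {digit f i} = ennreal (1 / real (card (R i)))" for i
    using digit[OF f, of i] finite_R[of i] by (subst emeasure_uniform_count_measure) auto
  then show "emeasure Lam {w \<in> RR. limw w \<in> cyl f n} = cmass n"
    unfolding eq by (subst emeasure_PiM_Collect) (use dR in \<open>auto simp: cmass_def\<close>)
  show "{w \<in> RR. limw w \<in> cyl f n} \<in> sets Lam"
    unfolding eq using dR by (auto intro!: sets.sets_Collect_finite_All sets_Collect_single)
qed

lemma cmass: "cmass 0 = 1" "cmass n \<noteq> 0" "cmass n \<noteq> \<infinity>"
proof -
  have eq: "cmass n = ennreal (\<Prod>i<n. 1 / real (card (R i)))" for n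
    unfolding cmass_def by (rule prod_ennreal) simp
  have "(\<Prod>i<n. 1 / real (card (R i))) > 0"
    by (rule prod_pos) (use finite_R R_nonempty in \<open>auto simp: card_gt_0_iff\<close>)
  then show "cmass n \<noteq> 0" by (simp add: eq ennreal_eq_0_iff)
  show "cmass n \<noteq> \<infinity>" by (simp add: eq)
  show "cmass 0 = 1" by (simp add: cmass_def)
qed

definition cyls :: "'a set set" where "cyls = insert {} {cyl f n | f n. f \<in> carrier A}"

text \<open>Every element is uniquely a regular translation times an element of
  \<open>stab 0\<close>. Translations are counted, and the stabiliser carries the distribution of a
  product of independent uniform digits.\<close>

definition Haar :: "'a measure" where
  "Haar = distr (count_space V \<Otimes>\<^sub>M Lam) (sigma (carrier A) cyls) (\<lambda>(a, w). reg a \<otimes> limw w)"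

lemma cyl_subset: "cyl f n \<subseteq> carrier A"
  by (auto simp: cyl_def)

lemma cyls_Pow: "cyls \<subseteq> Pow (carrier A)"
  using cyl_subset by (auto simp: cyls_def)

lemma sets_Haar: "sets Haar = sigma_sets (carrier A) cyls"
  using cyls_Pow by (simp add: Haar_def)

lemma space_Haar [simp]: "space Haar = carrier A"
  using cyls_Pow by (simp add: Haar_def space_measure_of_conv)

lemma cyl_self: "f \<in> carrier A \<Longrightarrow> f \<in> cyl f n"
  by (simp add: cyl_def)

lemma cyl_cong: "f' \<in> cyl f n \<Longrightarrow> cyl f' n = cyl f n"
  by (auto simp: cyl_def)

lemma cyl_mono: "n \<le> m \<Longrightarrow> cyl f m \<subseteq> cyl f n"
  using Bn_le by (fastforce simp: cyl_def)

lemma countable_cyls: "countable cyls"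
proof -
  have "{cyl f n | f n. f \<in> carrier A} \<subseteq> (\<Union>n. (\<lambda>q. {f' \<in> carrier A. \<forall>v\<in>Bn n. act f' v = q v}) ` (Bn n \<rightarrow>\<^sub>E V))"
  proof
    fix C assume "C \<in> {cyl f n | f n. f \<in> carrier A}"
    then obtain f n where C: "C = cyl f n" "f \<in> carrier A" by blast
    have "C = {f' \<in> carrier A. \<forall>v\<in>Bn n. act f' v = restrict (act f) (Bn n) v}" by (simp add: C cyl_def)
    moreover have "restrict (act f) (Bn n) \<in> Bn n \<rightarrow>\<^sub>E V" using C act_closed Bn_V by auto
    ultimately show "C \<in> (\<Union>n. (\<lambda>q. {f' \<in> carrier A. \<forall>v\<in>Bn n. act f' v = q v}) ` (Bn n \<rightarrow>\<^sub>E V))" by blast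
  qed
  moreover have "countable (Bn n \<rightarrow>\<^sub>E V)" for n
    by (rule countable_PiE[OF finite_Bn]) (rule countable_P)
  then have "countable (\<Union>n. (\<lambda>q. {f' \<in> carrier A. \<forall>v\<in>Bn n. act f' v = q v}) ` (Bn n \<rightarrow>\<^sub>E V))"
    by (intro countable_UN countable_image) auto
  ultimately show ?thesis unfolding cyls_def countable_insert_eq by (rule countable_subset)
qed

text \<open>A cylinder is determined by a map from a finite set to a countable one, so there are
  countably many cylinders and every union of them is measurable.\<close>

lemma Haar_open:
  assumes "U \<subseteq> carrier A" "\<And>f. f \<in> U \<Longrightarrow> \<exists>n. cyl f n \<subseteq> U" shows "U \<in> sets Haar"
proof -
  have "U = \<Union>{C \<in> cyls. C \<subseteq> U}"
  proof
    show "U \<subseteq> \<Union>{C \<in> cyls. C \<subseteq> U}"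
    proof
      fix f assume f: "f \<in> U"
      then obtain n where "cyl f n \<subseteq> U" using assms(2) by blast
      moreover have "cyl f n \<in> cyls" "f \<in> cyl f n" using f assms(1) cyl_self by (auto simp: cyls_def)
      ultimately show "f \<in> \<Union>{C \<in> cyls. C \<subseteq> U}" by blast
    qed
  qed blast
  moreover have "countable {C \<in> cyls. C \<subseteq> U}" using countable_cyls by simp
  moreover have "C \<in> sets Haar" if "C \<in> cyls" for C using that by (simp add: sets_Haar sigma_sets.Basic)
  ultimately show ?thesis using sets.countable_Union[of "{C \<in> cyls. C \<subseteq> U}" Haar] by auto
qed

lemma cyl_sets [simp]: "f \<in> carrier A \<Longrightarrow> cyl f n \<in> sets Haar"
  by (auto simp: sets_Haar cyls_def)

text \<open>The value at the identity of \<open>P\<close> determines the translation factor, and the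
  remaining factor runs through a cylinder of the same level with centre in
  \<open>stab 0\<close>.\<close>

lemma Haar_cyl: assumes f: "f \<in> carrier A" shows "emeasure Haar (cyl f n) = cmass n"
proof -
  define \<psi> where "\<psi> = (\<lambda>(a, w). reg a \<otimes> limw w)"
  have pre: "\<psi> -` cyl g m \<inter> space (count_space V \<Otimes>\<^sub>M Lam) = {act g e} \<times> {w \<in> RR. limw w \<in> cyl (inv (reg (act g e)) \<otimes> g) m}"
    and st: "inv (reg (act g e)) \<otimes> g \<in> stab 0" if g: "g \<in> carrier A" for g m
  proof -
    let ?a = "act g e"
    have aV: "?a \<in> V" "reg ?a \<in> carrier A" using act_closed g reg_closed by auto
    have "act (reg ?a) e = ?a" using act_reg[of ?a e] aV by simp
    then have "act (inv (reg ?a)) ?a = e" using act_inv(1)[of "reg ?a" e] aV by simp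
    then show "inv (reg ?a) \<otimes> g \<in> stab 0" using g aV by (simp add: stab_def Bn_0 act_mult)
    have "reg a \<otimes> limw w \<in> cyl g m \<longleftrightarrow> a = ?a \<and> limw w \<in> cyl (inv (reg ?a) \<otimes> g) m" if a: "a \<in> V" and w: "w \<in> RR" for a w
    proof -
      note l = lim_stab[OF w]
      have lA: "limw w \<in> carrier A" "reg a \<in> carrier A" using stabD(1)[OF l] reg_closed[OF a] by auto
      have "act (reg a \<otimes> limw w) e = a" using lA a act_reg[of a e] stabD(2)[OF l e_Bn] by (simp add: act_mult)
      then have "reg a \<otimes> limw w \<in> cyl g m \<Longrightarrow> a = ?a" using e_Bn[of m] by (auto simp: cyl_def)
      moreover have "reg ?a \<otimes> limw w \<in> cyl g m \<longleftrightarrow> limw w \<in> cyl (inv (reg ?a) \<otimes> g) m"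
      proof -
        have "act (reg ?a) (act (limw w) v) = act g v \<longleftrightarrow> act (limw w) v = act (inv (reg ?a)) (act g v)" if "v \<in> V" for v
          using act_inv aV lA act_closed g that by metis
        then show ?thesis using Bn_V aV lA g by (auto simp: cyl_def act_mult)
      qed
      ultimately show ?thesis by blast
    qed
    then show "\<psi> -` cyl g m \<inter> space (count_space V \<Otimes>\<^sub>M Lam) = {?a} \<times> {w \<in> RR. limw w \<in> cyl (inv (reg ?a) \<otimes> g) m}"
      using aV by (auto simp: \<psi>_def space_pair_measure space_Lam)
  qed
  have sp: "{act g e} \<times> {w \<in> RR. limw w \<in> cyl (inv (reg (act g e)) \<otimes> g) m} \<in> sets (count_space V \<Otimes>\<^sub>M Lam)"
    if g: "g \<in> carrier A" for g m
    by (rule pair_measureI) (use act_closed[OF g] Lam_cyl(1)[OF st[OF g]] in auto)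
  have meas: "\<psi> \<in> measurable (count_space V \<Otimes>\<^sub>M Lam) (sigma (carrier A) cyls)"
  proof (rule measurable_measure_of[OF cyls_Pow])
    show "\<psi> \<in> space (count_space V \<Otimes>\<^sub>M Lam) \<rightarrow> carrier A"
      using reg_closed limw(1) by (auto simp: \<psi>_def space_pair_measure space_Lam)
    fix C assume "C \<in> cyls"
    then consider "C = {}" | g m where "g \<in> carrier A" "C = cyl g m" by (auto simp: cyls_def)
    then show "\<psi> -` C \<inter> space (count_space V \<Otimes>\<^sub>M Lam) \<in> sets (count_space V \<Otimes>\<^sub>M Lam)"
      by cases (use pre sp in auto)
  qed
  interpret L: prob_space Lam by (rule prob_Lam)
  have "cyl f n \<in> sets (sigma (carrier A) cyls)" using f cyls_Pow by (auto simp: cyls_def)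
  then have "emeasure Haar (cyl f n) = emeasure (count_space V \<Otimes>\<^sub>M Lam) ({act f e} \<times> {w \<in> RR. limw w \<in> cyl (inv (reg (act f e)) \<otimes> f) n})"
    unfolding Haar_def \<psi>_def[symmetric] using emeasure_distr[OF meas] pre[OF f] by simp
  also have "\<dots> = emeasure (count_space V) {act f e} * emeasure Lam {w \<in> RR. limw w \<in> cyl (inv (reg (act f e)) \<otimes> f) n}"
    by (rule L.emeasure_pair_measure_Times) (use act_closed[OF f] Lam_cyl(1)[OF st[OF f]] in auto)
  also have "\<dots> = cmass n" using act_closed[OF f] Lam_cyl(2)[OF st[OF f]] by simp
  finally show ?thesis .
qed

lemma Int_stable_cyls: "Int_stable cyls"
proof (rule Int_stableI)
  fix C D assume C: "C \<in> cyls" and D: "D \<in> cyls"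
  have key: "cyl f n \<inter> cyl g m \<in> cyls" if "n \<le> m" "f \<in> carrier A" "g \<in> carrier A" for f g n m
  proof (cases "cyl f n \<inter> cyl g m = {}")
    case True
    then show ?thesis by (simp add: cyls_def)
  next
    case False
    then obtain h where h: "h \<in> cyl f n" "h \<in> cyl g m" by blast
    have "cyl g m \<subseteq> cyl f n" using cyl_cong[OF h(1)] cyl_cong[OF h(2)] cyl_mono[OF that(1)] by blast
    then have "cyl f n \<inter> cyl g m = cyl g m" by blast
    then show ?thesis using that by (auto simp: cyls_def)
  qed
  from C D consider "C = {} \<or> D = {}" | f n g m where "C = cyl f n" "D = cyl g m" "f \<in> carrier A" "g \<in> carrier A"
    by (auto simp: cyls_def)
  then show "C \<inter> D \<in> cyls"
  proof cases
    case 1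
    then show ?thesis by (auto simp: cyls_def)
  next
    case (2 f n g m)
    then show ?thesis using key[of n m f g] key[of m n g f] by (cases "n \<le> m") (auto simp: Int_commute)
  qed
qed

text \<open>Any two cylinders are nested or disjoint, and those of level 0 form a countable cover by
  sets of finite mass, so the masses of cylinders determine the measure.\<close>

lemma Haar_eqI:
  assumes s: "sets N = sets Haar" and c: "\<And>f n. f \<in> carrier A \<Longrightarrow> emeasure N (cyl f n) = cmass n"
  shows "N = Haar"
proof (rule measure_eqI_generator_eq_countable[OF Int_stable_cyls cyls_Pow])
  show "emeasure N X = emeasure Haar X" if "X \<in> cyls" for X
    using that c Haar_cyl by (auto simp: cyls_def)
  show "sets N = sigma_sets (carrier A) cyls" "sets Haar = sigma_sets (carrier A) cyls"
    using s sets_Haar by auto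
  show "{cyl (reg a) 0 | a. a \<in> V} \<subseteq> cyls" using reg_closed by (auto simp: cyls_def)
  show "\<Union>{cyl (reg a) 0 | a. a \<in> V} = carrier A"
  proof
    show "carrier A \<subseteq> \<Union>{cyl (reg a) 0 | a. a \<in> V}"
    proof
      fix f assume f: "f \<in> carrier A"
      then have "f \<in> cyl (reg (act f e)) 0" "act f e \<in> V"
        using act_closed act_reg[of "act f e" e] by (auto simp: cyl_def Bn_0)
      then show "f \<in> \<Union>{cyl (reg a) 0 | a. a \<in> V}" by blast
    qed
  qed (auto simp: cyl_def)
  have "{cyl (reg a) 0 | a. a \<in> V} = (\<lambda>a. cyl (reg a) 0) ` V" by blast
  then show "countable {cyl (reg a) 0 | a. a \<in> V}" using countable_P by simp
  show "emeasure N C \<noteq> \<infinity>" if "C \<in> {cyl (reg a) 0 | a. a \<in> V}" for C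
    using that c reg_closed cmass by auto
qed

text \<open>Left translation keeps the level of a cylinder, so left invariance can be read off the
  masses. Right translation does not keep it, and right invariance needs a separate
  argument.\<close>

lemma cyl_left: "g \<in> carrier A \<Longrightarrow> f \<in> carrier A \<Longrightarrow> {h \<in> carrier A. g \<otimes> h \<in> cyl f n} = cyl (inv g \<otimes> f) n"
proof -
  assume g: "g \<in> carrier A" and f: "f \<in> carrier A"
  have "act g (act h v) = act f v \<longleftrightarrow> act h v = act (inv g) (act f v)" if "v \<in> V" "h \<in> carrier A" for v h
    using act_inv g f that act_closed by metis
  then show ?thesis using g f Bn_V by (auto simp: cyl_def act_mult)
qed

lemma left_measurable: assumes g: "g \<in> carrier A" shows "(\<lambda>h. g \<otimes> h) \<in> measurable Haar Haar"
proof (rule measurable_sigma_sets[OF sets_Haar cyls_Pow])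
  fix C assume "C \<in> cyls"
  then consider "C = {}" | f n where "f \<in> carrier A" "C = cyl f n" by (auto simp: cyls_def)
  then show "(\<lambda>h. g \<otimes> h) -` C \<inter> space Haar \<in> sets Haar"
  proof cases
    case (2 f n)
    have "(\<lambda>h. g \<otimes> h) -` C \<inter> space Haar = {h \<in> carrier A. g \<otimes> h \<in> cyl f n}" using 2 by auto
    then show ?thesis using cyl_left[OF g 2(1)] g 2 by simp
  qed simp
qed (use g in auto)

lemma Haar_left:
  assumes g: "g \<in> carrier A" and E: "E \<in> sets Haar"
  shows "{h \<in> carrier A. g \<otimes> h \<in> E} \<in> sets Haar" "emeasure Haar {h \<in> carrier A. g \<otimes> h \<in> E} = emeasure Haar E"
proof -
  have pre: "(\<lambda>h. g \<otimes> h) -` E \<inter> space Haar = {h \<in> carrier A. g \<otimes> h \<in> E}" for E by auto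
  show "{h \<in> carrier A. g \<otimes> h \<in> E} \<in> sets Haar" using measurable_sets[OF left_measurable[OF g] E] pre by simp
  have "distr Haar Haar (\<lambda>h. g \<otimes> h) = Haar"
  proof (rule Haar_eqI)
    fix f n assume f: "f \<in> carrier A"
    then show "emeasure (distr Haar Haar (\<lambda>h. g \<otimes> h)) (cyl f n) = cmass n"
      using emeasure_distr[OF left_measurable[OF g] cyl_sets[OF f]] pre cyl_left[OF g f] Haar_cyl g by simp
  qed simp
  then show "emeasure Haar {h \<in> carrier A. g \<otimes> h \<in> E} = emeasure Haar E"
    using emeasure_distr[OF left_measurable[OF g] E] pre by simp
qed

text \<open>The values of \<open>h \<otimes> g\<close> on \<open>Bn n\<close> are values of
  \<open>h\<close> on the image of \<open>Bn n\<close> under \<open>g\<close>; this image is finite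
  and so lies in some larger \<open>Bn m\<close>.\<close>

lemma right_pre_open:
  assumes g: "g \<in> carrier A" and U: "U \<subseteq> carrier A" "\<And>f. f \<in> U \<Longrightarrow> \<exists>n. cyl f n \<subseteq> U" and f: "f \<in> carrier A" "f \<otimes> g \<in> U"
  shows "\<exists>n. cyl f n \<subseteq> {h \<in> carrier A. h \<otimes> g \<in> U}"
proof -
  obtain n where n: "cyl (f \<otimes> g) n \<subseteq> U" using U(2)[OF f(2)] by blast
  obtain m where m: "act g ` Bn n \<subseteq> Bn m"
    by (rule finite_in_Bn[of "act g ` Bn n"]) (use finite_Bn act_closed[OF g] Bn_V in auto)
  have "h \<otimes> g \<in> cyl (f \<otimes> g) n" if "h \<in> cyl f m" for h
    using that m g f Bn_V by (auto simp: cyl_def act_mult image_subset_iff)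
  then have "cyl f m \<subseteq> {h \<in> carrier A. h \<otimes> g \<in> U}" using n by (auto simp: cyl_def)
  then show ?thesis by blast
qed

lemma cyl_open: "h \<in> cyl f n \<Longrightarrow> \<exists>m. cyl h m \<subseteq> cyl f n"
  using cyl_cong by blast

lemma right_measurable: assumes g: "g \<in> carrier A" shows "(\<lambda>h. h \<otimes> g) \<in> measurable Haar Haar"
proof (rule measurable_sigma_sets[OF sets_Haar cyls_Pow])
  fix C assume "C \<in> cyls"
  then consider "C = {}" | f n where "f \<in> carrier A" "C = cyl f n" by (auto simp: cyls_def)
  then show "(\<lambda>h. h \<otimes> g) -` C \<inter> space Haar \<in> sets Haar"
  proof cases
    case (2 f n)
    have "(\<lambda>h. h \<otimes> g) -` C \<inter> space Haar = {h \<in> carrier A. h \<otimes> g \<in> cyl f n}" using 2 by auto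
    moreover have "{h \<in> carrier A. h \<otimes> g \<in> cyl f n} \<in> sets Haar"
      by (rule Haar_open) (use right_pre_open[OF g cyl_subset cyl_open] in auto)
    ultimately show ?thesis by simp
  qed simp
qed (use g in auto)

text \<open>Both \<open>stab 0\<close> and its right translates are fundamental domains for the left action of the
  regular subgroup, so right translation preserves the mass of \<open>stab 0\<close>.\<close>

lemma Haar_stab_right:
  assumes g: "g \<in> carrier A" shows "emeasure Haar {h \<in> carrier A. h \<otimes> g \<in> stab 0} = 1"
proof -
  have st: "stab 0 = cyl \<one> 0" by (auto simp: stab_def cyl_def act_one Bn_V)
  let ?S = "{h \<in> carrier A. h \<otimes> g \<in> stab 0}"
  let ?F = "\<lambda>a. {h \<in> carrier A. act h e = a}"
  have Fcyl: "?F a = cyl (reg a) 0" if "a \<in> V" for a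
    using that reg_closed act_reg[of a e] by (auto simp: cyl_def Bn_0)
  have FM: "?F a \<in> sets Haar" if "a \<in> V" for a using Fcyl[OF that] reg_closed[OF that] by simp
  have SM: "?S \<in> sets Haar"
    using measurable_sets[OF right_measurable[OF g], of "stab 0"] by (simp add: st vimage_def Int_def conj_commute)
  \<comment> \<open>Cut \<open>?S\<close> by the value at the identity of \<open>P\<close>. A
    regular translation moves each piece into \<open>stab 0\<close>, and the moved pieces tile
    \<open>stab 0\<close>.\<close>
  have "?S = (\<Union>a\<in>V. ?S \<inter> ?F a)" using act_closed by auto
  then have "emeasure Haar ?S = (\<integral>\<^sup>+a. emeasure Haar (?S \<inter> ?F a) \<partial>count_space V)"
    using emeasure_UN_countable[of V "\<lambda>a. ?S \<inter> ?F a" Haar] FM SM countable_P by (auto simp: disjoint_family_on_def)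
  also have "\<dots> = (\<integral>\<^sup>+a. emeasure Haar ({h \<in> carrier A. reg a \<otimes> h \<in> ?S} \<inter> stab 0) \<partial>count_space V)"
  proof (rule nn_integral_cong)
    fix a assume "a \<in> space (count_space V)"
    then have a: "a \<in> V" "reg a \<in> carrier A" using reg_closed by auto
    have "act (reg a) (act h e) = a \<longleftrightarrow> act h e = e" if "h \<in> carrier A" for h
      using act_inj[OF a(2), of "act h e" e] act_reg[OF a(1), of e] that act_closed a by auto
    moreover have "act (reg a) e = a" using act_reg[OF a(1), of e] a by simp
    ultimately have "{h \<in> carrier A. reg a \<otimes> h \<in> ?S \<inter> ?F a} = {h \<in> carrier A. reg a \<otimes> h \<in> ?S} \<inter> stab 0"
      using a by (auto simp: act_mult stab_def Bn_0)
    then show "emeasure Haar (?S \<inter> ?F a) = emeasure Haar ({h \<in> carrier A. reg a \<otimes> h \<in> ?S} \<inter> stab 0)"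
      using Haar_left(2)[OF a(2), of "?S \<inter> ?F a"] FM[OF a(1)] SM by simp
  qed
  also have "\<dots> = emeasure Haar (\<Union>a\<in>V. {h \<in> carrier A. reg a \<otimes> h \<in> ?S} \<inter> stab 0)"
  proof (rule emeasure_UN_countable[symmetric, OF _ countable_P])
    show "{h \<in> carrier A. reg a \<otimes> h \<in> ?S} \<inter> stab 0 \<in> sets Haar" if "a \<in> V" for a
      using Haar_left(1)[OF reg_closed[OF that] SM] st by auto
    have "a = b" if "a \<in> V" "b \<in> V" "h \<in> carrier A" "reg a \<otimes> h \<in> ?S" "reg b \<otimes> h \<in> ?S" for a b h
    proof -
      have "act (reg c \<otimes> h \<otimes> g) e = c \<otimes>\<^bsub>P\<^esub> act (h \<otimes> g) e" if "c \<in> V" for c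
        using that g \<open>h \<in> carrier A\<close> reg_closed[OF that] act_reg[OF that] act_closed by (simp add: act_mult m_assoc)
      then have "a \<otimes>\<^bsub>P\<^esub> act (h \<otimes> g) e = b \<otimes>\<^bsub>P\<^esub> act (h \<otimes> g) e" using that by (simp add: stab_def Bn_0)
      then show ?thesis using that g act_closed by (simp add: P.right_cancel)
    qed
    then show "disjoint_family_on (\<lambda>a. {h \<in> carrier A. reg a \<otimes> h \<in> ?S} \<inter> stab 0) V"
      unfolding disjoint_family_on_def by blast
  qed
  also have "(\<Union>a\<in>V. {h \<in> carrier A. reg a \<otimes> h \<in> ?S} \<inter> stab 0) = stab 0"
  proof
    show "stab 0 \<subseteq> (\<Union>a\<in>V. {h \<in> carrier A. reg a \<otimes> h \<in> ?S} \<inter> stab 0)"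
    proof
      fix h assume h: "h \<in> stab 0"
      have hA: "h \<in> carrier A" by (rule stabD(1)[OF h])
      let ?a = "inv\<^bsub>P\<^esub> act (h \<otimes> g) e"
      have a: "?a \<in> V" "reg ?a \<in> carrier A" "act (h \<otimes> g) e \<in> V" using reg_closed act_closed hA g by auto
      have "act (reg ?a \<otimes> h \<otimes> g) e = e"
        using act_reg[OF a(1) a(3)] a hA g by (simp add: act_mult m_assoc)
      then have "reg ?a \<otimes> h \<in> ?S" using a hA g by (simp add: stab_def Bn_0)
      then show "h \<in> (\<Union>a\<in>V. {h \<in> carrier A. reg a \<otimes> h \<in> ?S} \<inter> stab 0)" using a h hA by blast
    qed
  qed auto
  also have "emeasure Haar (stab 0) = 1" using Haar_cyl[of \<one> 0] cmass st by simp
  finally show ?thesis .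
qed

text \<open>By left invariance the mass \<open>d\<close> of the right preimage of a cylinder depends
  on the level only. \<open>stab 0\<close> is a finite disjoint union of cylinders of level
  \<open>n\<close> and its right preimage still has mass 1, so \<open>d\<close> must be
  \<open>cmass n\<close>.\<close>

lemma Haar_right:
  assumes g: "g \<in> carrier A" and E: "E \<in> sets Haar"
  shows "{h \<in> carrier A. h \<otimes> g \<in> E} \<in> sets Haar" "emeasure Haar {h \<in> carrier A. h \<otimes> g \<in> E} = emeasure Haar E"
proof -
  have pre: "(\<lambda>h. h \<otimes> g) -` E \<inter> space Haar = {h \<in> carrier A. h \<otimes> g \<in> E}" for E by auto
  have meas: "{h \<in> carrier A. h \<otimes> g \<in> E} \<in> sets Haar" if "E \<in> sets Haar" for E
    using measurable_sets[OF right_measurable[OF g] that] pre by simp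
  show "{h \<in> carrier A. h \<otimes> g \<in> E} \<in> sets Haar" by (rule meas[OF E])
  have val: "emeasure Haar {h \<in> carrier A. h \<otimes> g \<in> cyl f n} = cmass n" if f: "f \<in> carrier A" for f n
  proof -
    define d where "d = emeasure Haar {h \<in> carrier A. h \<otimes> g \<in> cyl \<one> n}"
    have d: "emeasure Haar {h \<in> carrier A. h \<otimes> g \<in> cyl k n} = d" if k: "k \<in> carrier A" for k
    proof -
      have "{h \<in> carrier A. inv k \<otimes> h \<in> cyl \<one> n} = cyl k n" using cyl_left[of "inv k" \<one> n] k by simp
      then have mem: "x \<in> cyl k n \<longleftrightarrow> inv k \<otimes> x \<in> cyl \<one> n" if "x \<in> carrier A" for x using that by blast
      then have "{h \<in> carrier A. h \<otimes> g \<in> cyl k n} = {h \<in> carrier A. inv k \<otimes> h \<in> {h \<in> carrier A. h \<otimes> g \<in> cyl \<one> n}}"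
        using k g by (intro Collect_cong conj_cong HOL.refl) (simp add: mem m_assoc)
      then show ?thesis using Haar_left(2)[OF inv_closed[OF k] meas[OF cyl_sets[OF one_closed]]] by (simp add: d_def)
    qed
    let ?D = "(\<lambda>k. cyl k n) ` stab 0"
    have "(\<lambda>k. cyl k n) ` stab 0 = (\<lambda>q. {f' \<in> carrier A. \<forall>v\<in>Bn n. act f' v = q v}) ` (\<lambda>f. restrict (act f) (Bn n)) ` stab 0"
      unfolding image_image by (rule image_cong) (auto simp: cyl_def)
    then have finD: "finite ?D" using finite_stab_restrict[of n 0] by simp
    have Dc: "\<exists>k\<in>carrier A. C = cyl k n" if C: "C \<in> ?D" for C
    proof -
      obtain k where "k \<in> stab 0" "C = cyl k n" using C by blast
      then show ?thesis using stabD(1) by blast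
    qed
    have UD: "\<Union>?D = stab 0"
    proof
      show "\<Union>?D \<subseteq> stab 0"
      proof
        fix x assume "x \<in> \<Union>?D"
        then obtain k where "k \<in> stab 0" "x \<in> cyl k n" by blast
        then show "x \<in> stab 0" using e_Bn[of n] by (auto simp: stab_def Bn_0 cyl_def)
      qed
      show "stab 0 \<subseteq> \<Union>?D"
      proof
        fix x assume "x \<in> stab 0"
        then show "x \<in> \<Union>?D" using cyl_self[OF stabD(1), of x 0 n] by blast
      qed
    qed
    have disj: "C \<inter> C' = {}" if CC: "C \<in> ?D" "C' \<in> ?D" "C \<noteq> C'" for C C'
    proof -
      obtain k k' where "C = cyl k n" "C' = cyl k' n" using CC(1,2) by blast
      then show ?thesis using CC(3) cyl_cong by blast
    qed
    have card: "of_nat (card ?D) * cmass n = 1"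
    proof -
      have "(\<Sum>C\<in>?D. emeasure Haar C) = emeasure Haar (\<Union>C\<in>?D. C)"
        by (rule sum_emeasure) (use Dc disj finD in \<open>auto simp: disjoint_family_on_def stabD(1)\<close>)
      moreover have "(\<Sum>C\<in>?D. emeasure Haar C) = (\<Sum>C\<in>?D. cmass n)"
        by (rule sum.cong[OF HOL.refl]) (metis Dc Haar_cyl)
      moreover have "stab 0 = cyl \<one> 0" by (auto simp: stab_def cyl_def act_one Bn_V)
      ultimately show ?thesis using UD Haar_cyl[of \<one> 0] cmass by simp
    qed
    have "of_nat (card ?D) * d = 1"
    proof -
      let ?T = "\<lambda>C. {h \<in> carrier A. h \<otimes> g \<in> C}"
      have "(\<Sum>C\<in>?D. emeasure Haar (?T C)) = emeasure Haar (\<Union>C\<in>?D. ?T C)"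
      proof (rule sum_emeasure[OF _ _ finD])
        show "?T ` ?D \<subseteq> sets Haar"
        proof (rule image_subsetI)
          fix C assume "C \<in> ?D"
          then obtain k where "k \<in> carrier A" "C = cyl k n" using Dc by meson
          then show "?T C \<in> sets Haar" using meas[OF cyl_sets, of k n] by simp
        qed
        show "disjoint_family_on ?T ?D"
          unfolding disjoint_family_on_def
        proof (intro ballI impI)
          fix C C' assume "C \<in> ?D" "C' \<in> ?D" "C \<noteq> C'"
          then have "C \<inter> C' = {}" by (rule disj)
          then show "?T C \<inter> ?T C' = {}" by blast
        qed
      qed
      moreover have "(\<Sum>C\<in>?D. emeasure Haar (?T C)) = (\<Sum>C\<in>?D. d)"
        by (rule sum.cong[OF HOL.refl]) (metis Dc d)
      moreover have gen: "(\<Union>C\<in>D. ?T C) = ?T (\<Union>D)" for D by blast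
      have "(\<Union>C\<in>?D. ?T C) = ?T (stab 0)" using gen[of ?D] by (subst (asm) UD)
      ultimately show ?thesis using Haar_stab_right[OF g] by simp
    qed
    then have "of_nat (card ?D) * d = of_nat (card ?D) * cmass n" using card by simp
    moreover have nz: "of_nat (card ?D) \<noteq> (0 :: ennreal)"
    proof
      assume "of_nat (card ?D) = (0 :: ennreal)"
      with card show False by (simp only: mult_zero_left zero_neq_one)
    qed
    ultimately have "d = cmass n" unfolding ennreal_mult_cancel_left by auto
    then show ?thesis using d[OF f] by simp
  qed
  have "distr Haar Haar (\<lambda>h. h \<otimes> g) = Haar"
  proof (rule Haar_eqI)
    fix f n assume f: "f \<in> carrier A"
    then show "emeasure (distr Haar Haar (\<lambda>h. h \<otimes> g)) (cyl f n) = cmass n"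
      using emeasure_distr[OF right_measurable[OF g] cyl_sets[OF f]] pre val by simp
  qed simp
  then show "emeasure Haar {h \<in> carrier A. h \<otimes> g \<in> E} = emeasure Haar E"
    using emeasure_distr[OF right_measurable[OF g] E] pre by simp
qed

lemma Haar_fibre:
  assumes "a \<in> V"
  shows "{h \<in> carrier A. act h e = a} \<in> sets Haar" "emeasure Haar {h \<in> carrier A. act h e = a} = 1"
proof -
  have "{h \<in> carrier A. act h e = a} = cyl (reg a) 0"
    using assms reg_closed act_reg[of a e] by (auto simp: cyl_def Bn_0)
  then show "{h \<in> carrier A. act h e = a} \<in> sets Haar" "emeasure Haar {h \<in> carrier A. act h e = a} = 1"
    using Haar_cyl cmass reg_closed assms by auto
qed

end

section \<open>Coset spaces of topological groups\<close>

text \<open>The family is a topology because distinct cosets are disjoint: this makes unions of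
  cosets commute with intersections of sets of cosets.\<close>

lemma openin_coset_topology:
  assumes "group G" "subgroup \<Gamma> G"
  shows "openin (coset_topology G T \<Gamma>) U \<longleftrightarrow> U \<subseteq> rcosets\<^bsub>G\<^esub> \<Gamma> \<and> openin T (\<Union>U)"
proof -
  have "istopology (\<lambda>U. U \<subseteq> rcosets\<^bsub>G\<^esub> \<Gamma> \<and> openin T (\<Union>U))"
    unfolding istopology_def
  proof (intro conjI allI impI)
    fix S U assume *: "S \<subseteq> rcosets\<^bsub>G\<^esub> \<Gamma> \<and> openin T (\<Union>S)" "U \<subseteq> rcosets\<^bsub>G\<^esub> \<Gamma> \<and> openin T (\<Union>U)"
    have "C = D" if "C \<in> rcosets\<^bsub>G\<^esub> \<Gamma>" "D \<in> rcosets\<^bsub>G\<^esub> \<Gamma>" "x \<in> C" "x \<in> D" for C D x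
      using group.rcos_disjoint[OF assms] that unfolding pairwise_def disjnt_def by blast
    then have "\<Union>(S \<inter> U) = \<Union>S \<inter> \<Union>U" using * by blast
    then show "openin T (\<Union>(S \<inter> U))" using * by auto
    show "S \<inter> U \<subseteq> rcosets\<^bsub>G\<^esub> \<Gamma>" using * by blast
  next
    fix \<K> :: "'a set set set" assume *: "\<forall>K\<in>\<K>. K \<subseteq> rcosets\<^bsub>G\<^esub> \<Gamma> \<and> openin T (\<Union>K)"
    have "\<Union>(\<Union>\<K>) = \<Union>((\<lambda>K. \<Union>K) ` \<K>)" by auto
    then show "openin T (\<Union>(\<Union>\<K>))" using * by (auto intro: openin_Union)
    show "\<Union>\<K> \<subseteq> rcosets\<^bsub>G\<^esub> \<Gamma>" using * by blast
  qed
  then show ?thesis by (simp add: coset_topology_def)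
qed

section \<open>Translations, discreteness and products of topological groups\<close>

locale top_group = group G for G :: "'a monoid" (structure) +
  fixes T :: "'a topology"
  assumes top: "topological_group G T"
begin

lemma topspace_T: "topspace T = carrier G"
  using top by (simp add: topological_group_def)

lemma continuous_right: assumes "g \<in> carrier G" shows "continuous_map T T (\<lambda>x. x \<otimes> g)"
proof -
  have "continuous_map T (prod_topology T T) (\<lambda>x. (x, g))"
    using assms by (intro continuous_map_pairedI) (auto simp: topspace_T)
  moreover have "continuous_map (prod_topology T T) T (\<lambda>(x, y). x \<otimes> y)"
    using top by (simp add: topological_group_def)
  ultimately have "continuous_map T T ((\<lambda>(x, y). x \<otimes> y) \<circ> (\<lambda>x. (x, g)))"
    by (rule continuous_map_compose)
  then show ?thesis by (simp add: comp_def)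
qed

lemma continuous_left: assumes "g \<in> carrier G" shows "continuous_map T T (\<lambda>x. g \<otimes> x)"
proof -
  have "continuous_map T (prod_topology T T) (\<lambda>x. (g, x))"
    using assms by (intro continuous_map_pairedI) (auto simp: topspace_T)
  moreover have "continuous_map (prod_topology T T) T (\<lambda>(x, y). x \<otimes> y)"
    using top by (simp add: topological_group_def)
  ultimately have "continuous_map T T ((\<lambda>(x, y). x \<otimes> y) \<circ> (\<lambda>x. (g, x)))"
    by (rule continuous_map_compose)
  then show ?thesis by (simp add: comp_def)
qed

lemma open_right: "g \<in> carrier G \<Longrightarrow> openin T U \<Longrightarrow> openin T {x \<in> carrier G. x \<otimes> g \<in> U}"
  using continuous_right[of g] by (auto simp: continuous_map_def topspace_T)

lemma open_left: "g \<in> carrier G \<Longrightarrow> openin T U \<Longrightarrow> openin T {x \<in> carrier G. g \<otimes> x \<in> U}"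
  using continuous_left[of g] by (auto simp: continuous_map_def topspace_T)

lemma discrete_inI:
  assumes \<Gamma>: "subgroup \<Gamma> G" and U: "openin T U" "\<one> \<in> U" "\<And>x. x \<in> U \<Longrightarrow> x \<in> \<Gamma> \<Longrightarrow> x = \<one>"
  shows "discrete_in T \<Gamma>"
proof -
  have sub: "\<Gamma> \<subseteq> carrier G" by (rule subgroup.subset[OF \<Gamma>])
  have "openin (subtopology T \<Gamma>) {x}" if x: "x \<in> \<Gamma>" for x
  proof -
    have xG: "x \<in> carrier G" using x sub by blast
    have "y = x" if "y \<in> \<Gamma>" "inv x \<otimes> y \<in> U" for y
    proof -
      have "inv x \<otimes> y = \<one>" using U(3)[OF that(2)] subgroup.m_closed[OF \<Gamma> subgroup.m_inv_closed[OF \<Gamma> x] that(1)] by simp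
      then show ?thesis using that(1) xG sub by (metis inv_equality inv_inv inv_closed subsetD)
    qed
    then have "{x} = {y \<in> carrier G. inv x \<otimes> y \<in> U} \<inter> \<Gamma>" using x xG U(2) by auto
    then show ?thesis using open_left[OF inv_closed[OF xG] U(1)] unfolding openin_subtopology by blast
  qed
  moreover have "topspace (subtopology T \<Gamma>) = \<Gamma>" using sub by (auto simp: topspace_T)
  ultimately have "discrete_topology \<Gamma> = subtopology T \<Gamma>" unfolding discrete_topology_unique by blast
  then show ?thesis using sub by (simp add: discrete_in_def topspace_T)
qed

lemma discrete_inD:
  assumes "discrete_in T \<Gamma>" "x \<in> \<Gamma>" obtains U where "openin T U" "U \<inter> \<Gamma> = {x}"
proof -
  have "openin (subtopology T \<Gamma>) {x}" using assms by (simp add: discrete_in_def)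
  then obtain U where "openin T U" "{x} = U \<inter> \<Gamma>" unfolding openin_subtopology by blast
  then show ?thesis using that by metis
qed

end

lemma topological_group_DirProd:
  assumes 1: "topological_group G1 T1" and 2: "topological_group G2 T2"
  shows "topological_group (G1 \<times>\<times> G2) (prod_topology T1 T2)"
proof -
  have g: "group G1" "group G2" and ts: "topspace T1 = carrier G1" "topspace T2 = carrier G2"
    and m: "continuous_map (prod_topology T1 T1) T1 (\<lambda>(x, y). x \<otimes>\<^bsub>G1\<^esub> y)"
      "continuous_map (prod_topology T2 T2) T2 (\<lambda>(x, y). x \<otimes>\<^bsub>G2\<^esub> y)"
    and i: "continuous_map T1 T1 (\<lambda>x. inv\<^bsub>G1\<^esub> x)" "continuous_map T2 T2 (\<lambda>x. inv\<^bsub>G2\<^esub> x)"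
    using assms by (auto simp: topological_group_def)
  let ?P = "prod_topology T1 T2"
  have ff: "continuous_map (prod_topology ?P ?P) T1 (\<lambda>z. fst (fst z))"
    and fs: "continuous_map (prod_topology ?P ?P) T1 (\<lambda>z. fst (snd z))"
    and sf: "continuous_map (prod_topology ?P ?P) T2 (\<lambda>z. snd (fst z))"
    and ss: "continuous_map (prod_topology ?P ?P) T2 (\<lambda>z. snd (snd z))"
    using continuous_map_compose[OF continuous_map_fst[of ?P ?P] continuous_map_fst[of T1 T2]]
      continuous_map_compose[OF continuous_map_snd[of ?P ?P] continuous_map_fst[of T1 T2]]
      continuous_map_compose[OF continuous_map_fst[of ?P ?P] continuous_map_snd[of T1 T2]]
      continuous_map_compose[OF continuous_map_snd[of ?P ?P] continuous_map_snd[of T1 T2]]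
    by (simp_all add: comp_def)
  have "continuous_map (prod_topology ?P ?P) T1 ((\<lambda>(x, y). x \<otimes>\<^bsub>G1\<^esub> y) \<circ> (\<lambda>z. (fst (fst z), fst (snd z))))"
    by (rule continuous_map_compose[OF continuous_map_pairedI[OF ff fs] m(1)])
  moreover have "continuous_map (prod_topology ?P ?P) T2 ((\<lambda>(x, y). x \<otimes>\<^bsub>G2\<^esub> y) \<circ> (\<lambda>z. (snd (fst z), snd (snd z))))"
    by (rule continuous_map_compose[OF continuous_map_pairedI[OF sf ss] m(2)])
  ultimately have "continuous_map (prod_topology ?P ?P) ?P (\<lambda>z. (((\<lambda>(x, y). x \<otimes>\<^bsub>G1\<^esub> y) \<circ> (\<lambda>z. (fst (fst z), fst (snd z)))) z,
     ((\<lambda>(x, y). x \<otimes>\<^bsub>G2\<^esub> y) \<circ> (\<lambda>z. (snd (fst z), snd (snd z)))) z))"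
    by (rule continuous_map_pairedI)
  then have "continuous_map (prod_topology ?P ?P) ?P (\<lambda>(x, y). x \<otimes>\<^bsub>G1 \<times>\<times> G2\<^esub> y)"
    by (simp add: case_prod_unfold mult_DirProd' comp_def)
  moreover have "continuous_map ?P ?P (\<lambda>x. inv\<^bsub>G1 \<times>\<times> G2\<^esub> x)"
  proof -
    have "continuous_map ?P ?P (\<lambda>z. (inv\<^bsub>G1\<^esub> (fst z), inv\<^bsub>G2\<^esub> (snd z)))"
      by (intro continuous_map_pairedI continuous_map_compose[OF continuous_map_fst i(1), unfolded comp_def]
          continuous_map_compose[OF continuous_map_snd i(2), unfolded comp_def])
    then show ?thesis
      by (rule continuous_map_eq) (auto simp: ts inv_DirProd[OF g])
  qed
  ultimately show ?thesis using g ts by (simp add: topological_group_def DirProd_group)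
qed

text \<open>Continuity of the operations on the product is part of a lattice hypothesis. Slicing at
  the identity of the second factor passes it to the first, where it can be combined with another
  second factor.\<close>

lemma topological_group_fst:
  assumes tg: "topological_group (G1 \<times>\<times> G2) (prod_topology T1 T2)" and g: "group G1" "group G2"
  shows "topological_group G1 T1" "topspace T2 = carrier G2"
proof -
  interpret G1: group G1 by (rule g(1))
  interpret G2: group G2 by (rule g(2))
  have m: "continuous_map (prod_topology (prod_topology T1 T2) (prod_topology T1 T2)) (prod_topology T1 T2) (\<lambda>(x, y). x \<otimes>\<^bsub>G1 \<times>\<times> G2\<^esub> y)"
    and i: "continuous_map (prod_topology T1 T2) (prod_topology T1 T2) (\<lambda>x. inv\<^bsub>G1 \<times>\<times> G2\<^esub> x)"
    and "topspace T1 \<times> topspace T2 = carrier G1 \<times> carrier G2"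
    using tg by (auto simp: topological_group_def)
  moreover have "carrier G1 \<noteq> {}" "carrier G2 \<noteq> {}" by auto
  ultimately have ts: "topspace T1 = carrier G1" "topspace T2 = carrier G2" by (auto simp: times_eq_iff)
  then show "topspace T2 = carrier G2" by simp
  have j: "continuous_map T1 (prod_topology T1 T2) (\<lambda>x. (x, \<one>\<^bsub>G2\<^esub>))"
    by (intro continuous_map_pairedI) (auto simp: ts)
  have "continuous_map (prod_topology T1 T1) (prod_topology (prod_topology T1 T2) (prod_topology T1 T2))
      (\<lambda>z. ((fst z, \<one>\<^bsub>G2\<^esub>), (snd z, \<one>\<^bsub>G2\<^esub>)))"
    by (intro continuous_map_pairedI continuous_map_fst continuous_map_snd) (auto simp: ts)
  from continuous_map_compose[OF continuous_map_compose[OF this m] continuous_map_fst]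
  have "continuous_map (prod_topology T1 T1) T1 (\<lambda>(x, y). x \<otimes>\<^bsub>G1\<^esub> y)"
    by (simp add: comp_def case_prod_unfold)
  moreover have "continuous_map T1 T1 (\<lambda>x. inv\<^bsub>G1\<^esub> x)"
    using continuous_map_compose[OF continuous_map_compose[OF j i] continuous_map_fst]
    by (rule continuous_map_eq) (auto simp: ts inv_DirProd[OF g])
  ultimately show "topological_group G1 T1" using g ts by (simp add: topological_group_def)
qed

section \<open>The topology of a closed permutation group\<close>

locale topological_permutation_group = permutation_group +
  fixes TA :: "'a topology"
  assumes openin_TA: "openin TA U \<longleftrightarrow> U \<subseteq> carrier A \<and> (\<forall>f\<in>U. \<exists>n. cyl f n \<subseteq> U)"
begin

lemma topspace_TA: "topspace TA = carrier A"
proof -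
  have "openin TA (carrier A)" unfolding openin_TA using cyl_subset by blast
  then have "carrier A \<subseteq> topspace TA" by (rule openin_subset)
  moreover have "openin TA (topspace TA)" by (rule openin_topspace)
  then have "topspace TA \<subseteq> carrier A" unfolding openin_TA by (rule conjunct1)
  ultimately show ?thesis by (rule antisym[rotated])
qed

lemma open_cyl: "f \<in> carrier A \<Longrightarrow> openin TA (cyl f n)"
  unfolding openin_TA using cyl_subset cyl_open by blast

lemma Haar_openin: "openin TA U \<Longrightarrow> U \<in> sets Haar"
  unfolding openin_TA by (rule Haar_open) auto

lemma topological_group_TA: "topological_group A TA"
  unfolding topological_group_def
proof (intro conjI group_axioms topspace_TA)
  show "continuous_map (prod_topology TA TA) TA (\<lambda>(x, y). x \<otimes> y)"
    unfolding continuous_map_def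
  proof (intro conjI allI impI)
    show "(\<lambda>(x, y). x \<otimes> y) \<in> topspace (prod_topology TA TA) \<rightarrow> topspace TA" by (auto simp: topspace_TA)
    fix U assume U: "openin TA U"
    show "openin (prod_topology TA TA) {x \<in> topspace (prod_topology TA TA). (case x of (x, y) \<Rightarrow> x \<otimes> y) \<in> U}"
      unfolding openin_prod_topology_alt
    proof (intro allI impI)
      fix f g assume "(f, g) \<in> {x \<in> topspace (prod_topology TA TA). (case x of (x, y) \<Rightarrow> x \<otimes> y) \<in> U}"
      then have fg: "f \<in> carrier A" "g \<in> carrier A" "f \<otimes> g \<in> U" by (auto simp: topspace_TA)
      obtain n where n: "cyl (f \<otimes> g) n \<subseteq> U" using U fg(3) openin_TA by blast
      obtain m where m: "act g ` Bn n \<subseteq> Bn m"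
        by (rule finite_in_Bn[of "act g ` Bn n"]) (use finite_Bn act_closed[OF fg(2)] Bn_V in auto)
      have "f' \<otimes> g' \<in> cyl (f \<otimes> g) n" if "f' \<in> cyl f m" "g' \<in> cyl g n" for f' g'
        using that m fg Bn_V by (auto simp: cyl_def act_mult image_subset_iff)
      then have sub: "cyl f m \<times> cyl g n \<subseteq> {x \<in> topspace (prod_topology TA TA). (case x of (x, y) \<Rightarrow> x \<otimes> y) \<in> U}"
        using n subsetD[OF cyl_subset] by (auto simp: topspace_TA)
      then show "\<exists>U' V'. openin TA U' \<and> openin TA V' \<and> f \<in> U' \<and> g \<in> V' \<and>
         U' \<times> V' \<subseteq> {x \<in> topspace (prod_topology TA TA). (case x of (x, y) \<Rightarrow> x \<otimes> y) \<in> U}"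
        by (intro exI[of _ "cyl f m"] exI[of _ "cyl g n"] conjI open_cyl cyl_self fg(1,2) sub)
    qed
  qed
  show "continuous_map TA TA (\<lambda>x. inv x)"
    unfolding continuous_map_def
  proof (intro conjI allI impI)
    show "(\<lambda>x. inv x) \<in> topspace TA \<rightarrow> topspace TA" by (auto simp: topspace_TA)
    fix U assume U: "openin TA U"
    have "\<exists>n. cyl f n \<subseteq> {x \<in> carrier A. inv x \<in> U}" if f: "f \<in> carrier A" "inv f \<in> U" for f
    proof -
      obtain n where n: "cyl (inv f) n \<subseteq> U" using U f(2) openin_TA by blast
      obtain m where m: "act (inv f) ` Bn n \<subseteq> Bn m"
        by (rule finite_in_Bn[of "act (inv f) ` Bn n"]) (use finite_Bn act_closed[OF inv_closed[OF f(1)]] Bn_V in auto)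
      have "inv g \<in> cyl (inv f) n" if g: "g \<in> cyl f m" for g
      proof -
        have gA: "g \<in> carrier A" using g by (simp add: cyl_def)
        have "act (inv g) v = act (inv f) v" if v: "v \<in> Bn n" for v
        proof -
          let ?w = "act (inv f) v"
          have w: "?w \<in> V" "?w \<in> Bn m" using act_closed[OF inv_closed[OF f(1)] Bn_V[OF v]] m v by auto
          have "act g ?w = act f ?w" using g w(2) by (simp add: cyl_def)
          also have "\<dots> = v" by (rule act_inv(2)[OF f(1) Bn_V[OF v]])
          finally show ?thesis using act_inv(1)[OF gA w(1)] by simp
        qed
        then show ?thesis using gA by (simp add: cyl_def)
      qed
      then show ?thesis using n cyl_subset by blast
    qed
    then show "openin TA {x \<in> topspace TA. inv x \<in> U}" unfolding openin_TA topspace_TA by auto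
  qed
qed

lemma Hausdorff_TA: "Hausdorff_space TA"
  unfolding Hausdorff_space_def
proof (intro allI impI)
  fix f g assume "f \<in> topspace TA \<and> g \<in> topspace TA \<and> f \<noteq> g"
  then have *: "f \<in> carrier A" "g \<in> carrier A" "f \<noteq> g" by (auto simp: topspace_TA)
  then obtain v where v: "v \<in> V" "act f v \<noteq> act g v" using faithful[OF *(1,2)] *(3) by metis
  then obtain n where "v \<in> Bn n" using Bn_Union by blast
  then have "disjnt (cyl f n) (cyl g n)" using v by (auto simp: disjnt_def cyl_def)
  then show "\<exists>U V. openin TA U \<and> openin TA V \<and> f \<in> U \<and> g \<in> V \<and> disjnt U V"
    by (intro exI[of _ "cyl f n"] exI[of _ "cyl g n"] conjI open_cyl cyl_self *(1,2))
qed

text \<open>The first \<open>n\<close> digits determine the limit on \<open>Bn n\<close>.\<close>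

lemma continuous_limw: "continuous_map (product_topology (\<lambda>n. discrete_topology (R n)) UNIV) TA limw"
  unfolding continuous_map_def
proof (intro conjI allI impI)
  have ts: "topspace (product_topology (\<lambda>n. discrete_topology (R n)) UNIV) = RR" by simp
  show "limw \<in> topspace (product_topology (\<lambda>n. discrete_topology (R n)) UNIV) \<rightarrow> topspace TA"
    unfolding ts topspace_TA using limw(1) by blast
  fix U assume U: "openin TA U"
  show "openin (product_topology (\<lambda>n. discrete_topology (R n)) UNIV)
     {x \<in> topspace (product_topology (\<lambda>n. discrete_topology (R n)) UNIV). limw x \<in> U}"
    unfolding openin_product_topology_alt ts
  proof (rule ballI)
    fix w assume "w \<in> {x \<in> RR. limw x \<in> U}"
    then have w: "w \<in> RR" "limw w \<in> U" by auto
    obtain n where n: "cyl (limw w) n \<subseteq> U" using U w(2) openin_TA by blast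
    let ?U = "\<lambda>i. if i < n then {w i} else R i"
    have inU: "limw w' \<in> U" if w': "w' \<in> RR" "\<And>i. i < n \<Longrightarrow> w' i = w i" for w'
    proof -
      have "m \<le> n \<Longrightarrow> xs w' m = xs w m" for m using w'(2) by (induction m) auto
      then have "limw w' \<in> cyl (limw w) n" using limw[OF w(1)] limw[OF w'(1)] by (simp add: cyl_def)
      then show ?thesis using n by blast
    qed
    have wR: "w i \<in> R i" for i using w(1) by (rule PiE_mem) simp
    have a4: "PiE UNIV ?U \<subseteq> {x \<in> RR. limw x \<in> U}"
    proof
      fix w' assume "w' \<in> PiE UNIV ?U"
      then have u: "w' i \<in> ?U i" for i by (rule PiE_mem) simp
      have "w' i \<in> R i" for i using u[of i] wR[of i] by (cases "i < n") auto
      then have "w' \<in> RR" by (simp add: PiE_iff)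
      moreover have "w' i = w i" if "i < n" for i using u[of i] that by simp
      ultimately show "w' \<in> {x \<in> RR. limw x \<in> U}" using inU by blast
    qed
    have a1: "finite {i \<in> UNIV. ?U i \<noteq> topspace (discrete_topology (R i))}"
      by (rule finite_subset[of _ "{..<n}"]) (auto split: if_splits)
    have a2: "\<forall>i\<in>UNIV. openin (discrete_topology (R i)) (?U i)" using wR by simp
    have a3: "w \<in> PiE UNIV ?U" using wR by (simp add: PiE_iff)
    show "\<exists>U'. finite {i \<in> UNIV. U' i \<noteq> topspace (discrete_topology (R i))} \<and>
       (\<forall>i\<in>UNIV. openin (discrete_topology (R i)) (U' i)) \<and> w \<in> PiE UNIV U' \<and> PiE UNIV U' \<subseteq> {x \<in> RR. limw x \<in> U}"
      by (intro exI[of _ ?U] conjI a1 a2 a3 a4)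
  qed
qed

text \<open>The stabiliser is the continuous image of a product of finite discrete spaces, which is
  compact by Tychonoff.\<close>

lemma compact_stab: "compactin TA (stab 0)"
proof -
  have "compact_space (product_topology (\<lambda>n. discrete_topology (R n)) UNIV)"
    by (simp add: compact_space_product_topology compact_space_discrete_topology finite_R)
  then have "compactin TA (limw ` RR)"
    using image_compactin[OF _ continuous_limw] by (simp add: compact_space_def)
  moreover have "limw ` RR = stab 0"
  proof
    show "limw ` RR \<subseteq> stab 0" using lim_stab by blast
    show "stab 0 \<subseteq> limw ` RR"
    proof
      fix f assume "f \<in> stab 0"
      then have "f = limw (digit f)" "digit f \<in> RR" by (simp_all only: lim_digit digit_RR)
      then show "f \<in> limw ` RR" by (rule image_eqI)
    qed
  qed
  ultimately show ?thesis by simp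
qed

lemma compact_cyl0: assumes f: "f \<in> carrier A" shows "compactin TA (cyl f 0)"
proof -
  interpret TG: top_group A TA by unfold_locales (rule topological_group_TA)
  have "(\<lambda>x. f \<otimes> x) ` stab 0 = cyl f 0"
  proof
    show "(\<lambda>x. f \<otimes> x) ` stab 0 \<subseteq> cyl f 0" using f by (auto simp: stab_def cyl_def act_mult Bn_0)
    show "cyl f 0 \<subseteq> (\<lambda>x. f \<otimes> x) ` stab 0"
    proof
      fix x assume x: "x \<in> cyl f 0"
      then have xA: "x \<in> carrier A" by (simp add: cyl_def)
      have "inv f \<otimes> x \<in> stab 0" using x xA f act_inv(1)[OF f, of e] by (simp add: stab_def cyl_def Bn_0 act_mult)
      moreover have "x = f \<otimes> (inv f \<otimes> x)" using f xA by (simp flip: m_assoc)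
      ultimately show "x \<in> (\<lambda>x. f \<otimes> x) ` stab 0" by blast
    qed
  qed
  then show ?thesis using image_compactin[OF compact_stab TG.continuous_left[OF f]] by simp
qed

lemma locally_compact_TA: "locally_compact_space TA"
  unfolding locally_compact_space_def
proof
  fix f assume "f \<in> topspace TA"
  then have f: "f \<in> carrier A" by (simp add: topspace_TA)
  show "\<exists>U K. openin TA U \<and> compactin TA K \<and> f \<in> U \<and> U \<subseteq> K"
    by (intro exI[of _ "cyl f 0"] conjI open_cyl compact_cyl0 cyl_self f subset_refl)
qed

end

section \<open>Invariant measures on coset spaces\<close>

abbreviation coset_sigma :: "'a monoid \<Rightarrow> 'a topology \<Rightarrow> 'a set \<Rightarrow> 'a set measure" where
  "coset_sigma G T \<Gamma> \<equiv> sigma (rcosets\<^bsub>G\<^esub> \<Gamma>) {U. openin (coset_topology G T \<Gamma>) U}"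

locale coset_space = top_group G T for G :: "'a monoid" (structure) and T :: "'a topology" +
  fixes \<Gamma> :: "'a set"
  assumes sub: "subgroup \<Gamma> G"
begin

abbreviation X :: "'a set set" where "X \<equiv> rcosets \<Gamma>"
abbreviation S :: "'a set set set" where "S \<equiv> sigma_sets X {U. openin (coset_topology G T \<Gamma>) U}"

lemmas openin_coset = openin_coset_topology[OF is_group sub, of T]

lemma open_coset_Pow: "{U. openin (coset_topology G T \<Gamma>) U} \<subseteq> Pow X"
  unfolding openin_coset by blast

lemma coset_carrier: "C \<in> X \<Longrightarrow> x \<in> C \<Longrightarrow> x \<in> carrier G"
  using rcosets_subset_PowG[OF sub] by blast

lemma coset_eq: "C \<in> X \<Longrightarrow> x \<in> C \<Longrightarrow> C = \<Gamma> #> x"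
proof -
  assume C: "C \<in> X" "x \<in> C"
  then obtain y where "y \<in> carrier G" "C = \<Gamma> #> y" by (auto simp: RCOSETS_def)
  then show ?thesis using repr_independence[of x \<Gamma> y] C(2) sub by simp
qed

lemma coset_in [simp]: "x \<in> carrier G \<Longrightarrow> \<Gamma> #> x \<in> X"
  by (auto simp: RCOSETS_def)

lemma self_coset: "x \<in> carrier G \<Longrightarrow> x \<in> \<Gamma> #> x"
  by (rule rcos_self[OF _ sub])

lemma coset_mem_iff: "E \<subseteq> X \<Longrightarrow> x \<in> carrier G \<Longrightarrow> \<Gamma> #> x \<in> E \<longleftrightarrow> x \<in> \<Union>E"
  using self_coset coset_eq by blast

lemma \<Gamma>_carrier: "\<gamma> \<in> \<Gamma> \<Longrightarrow> \<gamma> \<in> carrier G"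
  using subgroup.subset[OF sub] by blast

lemma coset_left: assumes "\<gamma> \<in> \<Gamma>" "x \<in> carrier G" shows "\<Gamma> #> (\<gamma> \<otimes> x) = \<Gamma> #> x"
proof -
  have "\<gamma> \<otimes> x \<in> \<Gamma> #> x" using assms by (auto simp: r_coset_def)
  then show ?thesis using coset_eq[OF coset_in[OF assms(2)]] by simp
qed

lemma coset_left_Union: assumes "E \<subseteq> X" "\<gamma> \<in> \<Gamma>" "x \<in> carrier G" shows "\<gamma> \<otimes> x \<in> \<Union>E \<longleftrightarrow> x \<in> \<Union>E"
  using coset_mem_iff[OF assms(1)] coset_left[OF assms(2,3)] assms \<Gamma>_carrier by (metis m_closed)

lemma coset_memE: assumes "y \<in> \<Gamma> #> x" obtains \<gamma> where "\<gamma> \<in> \<Gamma>" "y = \<gamma> \<otimes> x"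
  using assms by (auto simp: r_coset_def)

lemma some_coset:
  assumes "x \<in> carrier G" obtains \<gamma> where "\<gamma> \<in> \<Gamma>" "(SOME y. y \<in> \<Gamma> #> x) = \<gamma> \<otimes> x"
  using someI[of "\<lambda>y. y \<in> \<Gamma> #> x", OF self_coset[OF assms]] coset_memE by metis

lemma openin_quotient_image:
  assumes W: "openin T W" "\<And>\<gamma> x. \<gamma> \<in> \<Gamma> \<Longrightarrow> x \<in> W \<Longrightarrow> \<gamma> \<otimes> x \<in> W"
  shows "openin (coset_topology G T \<Gamma>) {C \<in> X. C \<subseteq> W}" "\<Union>{C \<in> X. C \<subseteq> W} = W"
proof -
  have WG: "W \<subseteq> carrier G" using openin_subset[OF W(1)] topspace_T by simp
  show eq: "\<Union>{C \<in> X. C \<subseteq> W} = W"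
  proof
    show "W \<subseteq> \<Union>{C \<in> X. C \<subseteq> W}"
    proof
      fix x assume x: "x \<in> W"
      then have xG: "x \<in> carrier G" using WG by blast
      have "\<Gamma> #> x \<subseteq> W" using W(2)[OF _ x] by (auto elim: coset_memE)
      then show "x \<in> \<Union>{C \<in> X. C \<subseteq> W}" using self_coset[OF xG] coset_in[OF xG] by blast
    qed
  qed blast
  show "openin (coset_topology G T \<Gamma>) {C \<in> X. C \<subseteq> W}" unfolding openin_coset eq using W(1) by blast
qed

text \<open>Lower semicontinuity replaces measurability: superlevel sets stay open in the quotient, so
  no product \<open>\<sigma>\<close>-algebra is needed.\<close>

lemma descend_function:
  fixes u :: "'a \<Rightarrow> ennreal"
  assumes inv: "\<And>\<gamma> x. \<gamma> \<in> \<Gamma> \<Longrightarrow> x \<in> carrier G \<Longrightarrow> u (\<gamma> \<otimes> x) = u x"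
    and lsc: "\<And>y. openin T {x \<in> carrier G. y < u x}"
    and s: "sets \<mu> = S" "space \<mu> = X"
  shows "(\<lambda>C. u (SOME x. x \<in> C)) \<in> borel_measurable \<mu>"
    "x \<in> carrier G \<Longrightarrow> u (SOME y. y \<in> \<Gamma> #> x) = u x"
proof -
  show val: "u (SOME y. y \<in> \<Gamma> #> x) = u x" if "x \<in> carrier G" for x
    using some_coset[OF that] inv that by metis
  show "(\<lambda>C. u (SOME x. x \<in> C)) \<in> borel_measurable \<mu>"
  proof (rule borel_measurableI_greater)
    fix y
    have "{C \<in> space \<mu>. y < u (SOME x. x \<in> C)} = {C \<in> X. C \<subseteq> {x \<in> carrier G. y < u x}}"
    proof (intro Collect_cong conj_cong)
      fix C
      show "(C \<in> space \<mu>) = (C \<in> X)" using s by simp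
      assume "C \<in> X"
      then obtain x where x: "x \<in> carrier G" "C = \<Gamma> #> x" by (auto simp: RCOSETS_def)
      have 1: "u z = u x" if z: "z \<in> C" for z
      proof -
        obtain \<gamma> where "\<gamma> \<in> \<Gamma>" "z = \<gamma> \<otimes> x" using z unfolding x(2) by (rule coset_memE)
        then show ?thesis using inv x(1) by simp
      qed
      have 2: "z \<in> carrier G" if "z \<in> C" for z using coset_carrier[OF \<open>C \<in> X\<close> that] .
      have 3: "x \<in> C" using self_coset x by simp
      have 4: "u (SOME x. x \<in> C) = u x" unfolding x(2) by (rule val[OF x(1)])
      show "(y < u (SOME x. x \<in> C)) = (C \<subseteq> {x \<in> carrier G. y < u x})"
      proof
        assume "y < u (SOME x. x \<in> C)"
        then show "C \<subseteq> {x \<in> carrier G. y < u x}" using 1 2 4 by (intro subsetI CollectI conjI) simp_all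
      next
        assume "C \<subseteq> {x \<in> carrier G. y < u x}"
        then have "x \<in> {x \<in> carrier G. y < u x}" using 3 by (rule subsetD)
        then show "y < u (SOME x. x \<in> C)" using 4 by simp
      qed
    qed
    moreover have "openin (coset_topology G T \<Gamma>) {C \<in> X. C \<subseteq> {x \<in> carrier G. y < u x}}"
      by (rule openin_quotient_image(1)[OF lsc]) (use inv \<Gamma>_carrier in auto)
    ultimately show "{C \<in> space \<mu>. y < u (SOME x. x \<in> C)} \<in> sets \<mu>"
      using s by (auto intro: sigma_sets.Basic)
  qed
qed

lemma shift_in: assumes "g \<in> carrier G" "C \<in> X" shows "C #> g \<in> X"
proof -
  obtain y where "y \<in> carrier G" "C = \<Gamma> #> y" using assms(2) by (auto simp: RCOSETS_def)
  then show ?thesis using coset_mult_assoc[of \<Gamma> y g] assms(1) subgroup.subset[OF sub] by simp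
qed

lemma shift_coset: "x \<in> carrier G \<Longrightarrow> g \<in> carrier G \<Longrightarrow> (\<Gamma> #> x) #> g = \<Gamma> #> (x \<otimes> g)"
  by (rule coset_mult_assoc[OF subgroup.subset[OF sub]])

lemma shift_preimage:
  assumes g: "g \<in> carrier G" and E: "E \<subseteq> X"
  shows "\<Union>{C \<in> X. C #> g \<in> E} = {x \<in> carrier G. x \<otimes> g \<in> \<Union>E}"
proof
  show "\<Union>{C \<in> X. C #> g \<in> E} \<subseteq> {x \<in> carrier G. x \<otimes> g \<in> \<Union>E}"
  proof
    fix x assume "x \<in> \<Union>{C \<in> X. C #> g \<in> E}"
    then obtain C where C: "C \<in> X" "C #> g \<in> E" "x \<in> C" by blast
    then have "x \<otimes> g \<in> C #> g" by (auto simp: r_coset_def)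
    then show "x \<in> {x \<in> carrier G. x \<otimes> g \<in> \<Union>E}" using C coset_carrier by blast
  qed
  show "{x \<in> carrier G. x \<otimes> g \<in> \<Union>E} \<subseteq> \<Union>{C \<in> X. C #> g \<in> E}"
  proof
    fix x assume "x \<in> {x \<in> carrier G. x \<otimes> g \<in> \<Union>E}"
    then have x: "x \<in> carrier G" "x \<otimes> g \<in> \<Union>E" by auto
    then have "(\<Gamma> #> x) #> g \<in> E" using coset_mem_iff[OF E, of "x \<otimes> g"] g by (simp add: shift_coset)
    then show "x \<in> \<Union>{C \<in> X. C #> g \<in> E}" using x(1) self_coset[OF x(1)] coset_in[OF x(1)] by blast
  qed
qed

lemma shift_open:
  assumes g: "g \<in> carrier G" and E: "openin (coset_topology G T \<Gamma>) E"
  shows "openin (coset_topology G T \<Gamma>) {C \<in> X. C #> g \<in> E}"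
proof -
  have "E \<subseteq> X" "openin T (\<Union>E)" using E by (auto simp: openin_coset)
  show ?thesis unfolding openin_coset shift_preimage[OF g \<open>E \<subseteq> X\<close>]
    by (intro conjI open_right[OF g \<open>openin T (\<Union>E)\<close>]) blast
qed

lemma shift_measurable:
  assumes g: "g \<in> carrier G" and s: "sets \<mu> = S" "space \<mu> = X"
  shows "(\<lambda>C. C #> g) \<in> measurable \<mu> \<mu>"
proof (rule measurable_sigma_sets[OF s(1) open_coset_Pow])
  show "(\<lambda>C. C #> g) \<in> space \<mu> \<rightarrow> X" using shift_in[OF g] s by auto
  fix E assume "E \<in> {U. openin (coset_topology G T \<Gamma>) U}"
  then have "openin (coset_topology G T \<Gamma>) {C \<in> X. C #> g \<in> E}" using shift_open[OF g] by blast
  moreover have "(\<lambda>C. C #> g) -` E \<inter> space \<mu> = {C \<in> X. C #> g \<in> E}" using s by auto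
  ultimately show "(\<lambda>C. C #> g) -` E \<inter> space \<mu> \<in> sets \<mu>" using s by (auto intro: sigma_sets.Basic)
qed

lemma shift_image:
  assumes g: "g \<in> carrier G" and E: "E \<subseteq> X"
  shows "(\<lambda>C. C #> g) ` E = {C \<in> X. C #> inv g \<in> E}"
proof -
  have inv1: "(C #> g) #> inv g = C" "(C #> inv g) #> g = C" if "C \<in> X" for C
    using that g by (auto simp: RCOSETS_def shift_coset m_assoc)
  show ?thesis
  proof
    show "(\<lambda>C. C #> g) ` E \<subseteq> {C \<in> X. C #> inv g \<in> E}" using inv1 E shift_in[OF g] by auto
    show "{C \<in> X. C #> inv g \<in> E} \<subseteq> (\<lambda>C. C #> g) ` E" using inv1 by force
  qed
qed

text \<open>A function on cosets is written through an arbitrary representative. Invariance of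
  \<open>u\<close> under \<open>\<Gamma>\<close> makes the choice harmless, and invariance of
  \<open>\<mu>\<close> gives the change of variables.\<close>

lemma shift_integral:
  fixes u :: "'a \<Rightarrow> ennreal"
  assumes inv: "\<And>\<gamma> x. \<gamma> \<in> \<Gamma> \<Longrightarrow> x \<in> carrier G \<Longrightarrow> u (\<gamma> \<otimes> x) = u x"
    and lsc: "\<And>y. openin T {x \<in> carrier G. y < u x}"
    and s: "sets \<mu> = S" "space \<mu> = X"
    and m: "\<And>h A. h \<in> carrier G \<Longrightarrow> A \<in> sets \<mu> \<Longrightarrow> emeasure \<mu> ((\<lambda>C. C #> h) ` A) = emeasure \<mu> A"
    and g: "g \<in> carrier G"
  shows "(\<integral>\<^sup>+C. u ((SOME x. x \<in> C) \<otimes> g) \<partial>\<mu>) = (\<integral>\<^sup>+C. u (SOME x. x \<in> C) \<partial>\<mu>)"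
proof -
  note meas = shift_measurable[OF g s]
  have "distr \<mu> \<mu> (\<lambda>C. C #> g) = \<mu>"
  proof (rule measure_eqI)
    fix E assume "E \<in> sets (distr \<mu> \<mu> (\<lambda>C. C #> g))"
    then have E: "E \<in> sets \<mu>" "E \<subseteq> X" using sets.sets_into_space[of E \<mu>] s by auto
    have "(\<lambda>C. C #> g) -` E \<inter> space \<mu> = (\<lambda>C. C #> inv g) ` E"
      using shift_image[OF inv_closed[OF g] E(2)] g s by auto
    then show "emeasure (distr \<mu> \<mu> (\<lambda>C. C #> g)) E = emeasure \<mu> E"
      using emeasure_distr[OF meas E(1)] m[OF inv_closed[OF g] E(1)] by simp
  qed simp
  then have "(\<integral>\<^sup>+C. u (SOME x. x \<in> C) \<partial>\<mu>) = (\<integral>\<^sup>+C. u (SOME x. x \<in> C) \<partial>distr \<mu> \<mu> (\<lambda>C. C #> g))" by simp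
  also have "\<dots> = (\<integral>\<^sup>+C. u (SOME x. x \<in> C #> g) \<partial>\<mu>)"
    by (rule nn_integral_distr[OF meas descend_function(1)[OF inv lsc]]) (use s in auto)
  also have "\<dots> = (\<integral>\<^sup>+C. u ((SOME x. x \<in> C) \<otimes> g) \<partial>\<mu>)"
  proof (rule nn_integral_cong)
    fix C assume "C \<in> space \<mu>"
    then obtain x where x: "x \<in> carrier G" "C = \<Gamma> #> x" using s by (auto simp: RCOSETS_def)
    obtain \<gamma> where \<gamma>: "\<gamma> \<in> \<Gamma>" "(SOME y. y \<in> \<Gamma> #> x) = \<gamma> \<otimes> x" using some_coset[OF x(1)] .
    have "u (SOME y. y \<in> C #> g) = u (x \<otimes> g)"
      unfolding x(2) shift_coset[OF x(1) g] by (rule descend_function(2)[OF inv lsc s]) (use x g in auto)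
    also have "\<dots> = u (\<gamma> \<otimes> (x \<otimes> g))" using inv[OF \<gamma>(1)] x g by simp
    also have "\<dots> = u ((SOME x. x \<in> C) \<otimes> g)" using \<gamma> x g \<Gamma>_carrier by (simp add: m_assoc)
    finally show "u (SOME x. x \<in> C #> g) = u ((SOME x. x \<in> C) \<otimes> g)" .
  qed
  finally show ?thesis ..
qed

lemma continuous_quotient: "continuous_map T (coset_topology G T \<Gamma>) (\<lambda>x. \<Gamma> #> x)"
  unfolding continuous_map_def
proof (intro conjI allI impI)
  have "openin (coset_topology G T \<Gamma>) {C \<in> X. C \<subseteq> carrier G}"
    by (rule openin_quotient_image(1)) (use topspace_T openin_topspace[of T] \<Gamma>_carrier in auto)
  then have "{C \<in> X. C \<subseteq> carrier G} \<subseteq> topspace (coset_topology G T \<Gamma>)" by (rule openin_subset)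
  moreover have "\<Gamma> #> x \<in> {C \<in> X. C \<subseteq> carrier G}" if "x \<in> carrier G" for x
    using coset_carrier[OF coset_in[OF that]] coset_in[OF that] by blast
  ultimately show "(\<lambda>x. \<Gamma> #> x) \<in> topspace T \<rightarrow> topspace (coset_topology G T \<Gamma>)"
    unfolding topspace_T by blast
  fix E assume "openin (coset_topology G T \<Gamma>) E"
  then have E: "E \<subseteq> X" "openin T (\<Union>E)" by (auto simp: openin_coset)
  have "{x \<in> topspace T. \<Gamma> #> x \<in> E} = \<Union>E"
    using coset_mem_iff[OF E(1)] coset_carrier E(1) by (auto simp: topspace_T)
  then show "openin T {x \<in> topspace T. \<Gamma> #> x \<in> E}" using E(2) by simp
qed

lemma topspace_coset: "topspace (coset_topology G T \<Gamma>) = X"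
proof
  show "topspace (coset_topology G T \<Gamma>) \<subseteq> X"
    using openin_topspace[of "coset_topology G T \<Gamma>"] unfolding openin_coset by blast
  show "X \<subseteq> topspace (coset_topology G T \<Gamma>)"
    using continuous_quotient by (auto simp: continuous_map_def RCOSETS_def topspace_T)
qed

lemma shift_invariant_lsc:
  fixes u :: "'a \<Rightarrow> ennreal"
  assumes inv: "\<And>\<gamma> x. \<gamma> \<in> \<Gamma> \<Longrightarrow> x \<in> carrier G \<Longrightarrow> u (\<gamma> \<otimes> x) = u x"
    and lsc: "\<And>y. openin T {x \<in> carrier G. y < u x}" and g: "g \<in> carrier G"
  shows "\<And>\<gamma> x. \<gamma> \<in> \<Gamma> \<Longrightarrow> x \<in> carrier G \<Longrightarrow> u (\<gamma> \<otimes> x \<otimes> g) = u (x \<otimes> g)"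
    "\<And>y. openin T {x \<in> carrier G. y < u (x \<otimes> g)}"
proof -
  show "u (\<gamma> \<otimes> x \<otimes> g) = u (x \<otimes> g)" if "\<gamma> \<in> \<Gamma>" "x \<in> carrier G" for \<gamma> x
    using inv[OF that(1), of "x \<otimes> g"] that g \<Gamma>_carrier by (simp add: m_assoc)
  show "openin T {x \<in> carrier G. y < u (x \<otimes> g)}" for y
    using open_right[OF g lsc[of y]] g by (simp cong: conj_cong)
qed

end

section \<open>Transfer of lattices\<close>

text \<open>The situation freed of its geometry: \<open>A\<close> permutes \<open>P\<close>,
  \<open>Tg\<close> permutes \<open>F\<close>, and \<open>lt\<close> gives the left translations of
  \<open>F\<close>. The last four assumptions express that \<open>\<Gamma>'\<close> is the group of
  lifts of \<open>\<Gamma>\<close>; \<open>over\<close> is the existence of a lift through any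
  compatible pair of points.\<close>

locale lattice_transfer = topological_permutation_group A P act reg Bn TA
  for A :: "'a monoid" (structure) and P :: "'p monoid" and act reg Bn TA +
  fixes H :: "'h monoid" and TH :: "'h topology" and Tg :: "'t monoid" and TT :: "'t topology"
    and F :: "'q monoid" and tact :: "'t \<Rightarrow> 'q \<Rightarrow> 'q" and lt :: "'q \<Rightarrow> 't" and \<phi> :: "'p \<Rightarrow> 'q"
    and \<Gamma> :: "('h \<times> 't) set" and \<Gamma>' :: "('h \<times> 'a) set"
  assumes gH: "group H" and gT: "group Tg" and gF: "group F"
    and tg1: "topological_group (H \<times>\<times> Tg) (prod_topology TH TT)"
    and tact_closed: "t \<in> carrier Tg \<Longrightarrow> v \<in> carrier F \<Longrightarrow> tact t v \<in> carrier F"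
    and tact_mult: "t \<in> carrier Tg \<Longrightarrow> t' \<in> carrier Tg \<Longrightarrow> v \<in> carrier F \<Longrightarrow>
      tact (t \<otimes>\<^bsub>Tg\<^esub> t') v = tact t (tact t' v)"
    and tact_one: "v \<in> carrier F \<Longrightarrow> tact \<one>\<^bsub>Tg\<^esub> v = v"
    and lt_closed: "w \<in> carrier F \<Longrightarrow> lt w \<in> carrier Tg"
    and tact_lt: "w \<in> carrier F \<Longrightarrow> v \<in> carrier F \<Longrightarrow> tact (lt w) v = w \<otimes>\<^bsub>F\<^esub> v"
    and open_tact: "v \<in> carrier F \<Longrightarrow> w \<in> carrier F \<Longrightarrow> openin TT {t \<in> carrier Tg. tact t v = w}"
    and open_TT: "openin TT U \<Longrightarrow> t \<in> U \<Longrightarrow> \<exists>S. finite S \<and> S \<subseteq> carrier F \<and>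
      (\<forall>t'\<in>carrier Tg. (\<forall>v\<in>S. tact t' v = tact t v) \<longrightarrow> t' \<in> U)"
    and phi_hom: "\<phi> \<in> hom P F" and phi_surj: "\<phi> ` carrier P = carrier F"
    and sub1: "subgroup \<Gamma> (H \<times>\<times> Tg)" and sub2: "subgroup \<Gamma>' (H \<times>\<times> A)"
    and under: "(h, f) \<in> \<Gamma>' \<Longrightarrow> \<exists>t. (h, t) \<in> \<Gamma> \<and> (\<forall>a\<in>carrier P. \<phi> (act f a) = tact t (\<phi> a))"
    and over: "(h, t) \<in> \<Gamma> \<Longrightarrow> a \<in> carrier P \<Longrightarrow> b \<in> carrier P \<Longrightarrow> tact t (\<phi> a) = \<phi> b \<Longrightarrow>
      \<exists>f. (h, f) \<in> \<Gamma>' \<and> act f a = b \<and> (\<forall>c\<in>carrier P. \<phi> (act f c) = tact t (\<phi> c))"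
    and ker: "a \<in> carrier P \<Longrightarrow> \<phi> a = \<one>\<^bsub>F\<^esub> \<Longrightarrow> (\<one>\<^bsub>H\<^esub>, reg a) \<in> \<Gamma>'"
    and rigid: "(\<one>\<^bsub>H\<^esub>, f) \<in> \<Gamma>' \<Longrightarrow> (\<forall>a\<in>carrier P. \<phi> (act f a) = \<phi> a) \<Longrightarrow> act f \<one>\<^bsub>P\<^esub> = \<one>\<^bsub>P\<^esub> \<Longrightarrow> f = \<one>"
begin

sublocale H: group H by (rule gH)
sublocale T: group Tg by (rule gT)
sublocale F: group F by (rule gF)

abbreviation T1 where "T1 \<equiv> prod_topology TH TT"
abbreviation T2 where "T2 \<equiv> prod_topology TH TA"
abbreviation G1 where "G1 \<equiv> H \<times>\<times> Tg"
abbreviation G2 where "G2 \<equiv> H \<times>\<times> A"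
abbreviation Q1 where "Q1 \<equiv> coset_topology G1 T1 \<Gamma>"
abbreviation Q2 where "Q2 \<equiv> coset_topology G2 T2 \<Gamma>'"

lemma tgH: "topological_group H TH" and topspace_TT: "topspace TT = carrier Tg"
  using topological_group_fst[OF tg1 gH gT] by auto

lemma topspace_TH: "topspace TH = carrier H"
  using tgH by (simp add: topological_group_def)

lemma tg2: "topological_group G2 T2"
  by (rule topological_group_DirProd[OF tgH topological_group_TA])

sublocale C1: coset_space G1 T1 \<Gamma>
  using DirProd_group[OF gH gT] tg1 sub1 by (simp add: coset_space_def coset_space_axioms_def top_group_def top_group_axioms_def)

sublocale C2: coset_space G2 T2 \<Gamma>'
  using DirProd_group[OF gH is_group] tg2 sub2 by (simp add: coset_space_def coset_space_axioms_def top_group_def top_group_axioms_def)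

abbreviation eF where "eF \<equiv> \<one>\<^bsub>F\<^esub>"

lemma phi_closed: "v \<in> V \<Longrightarrow> \<phi> v \<in> carrier F"
  using phi_hom by (rule hom_in_carrier)

lemma phi_mult: "v \<in> V \<Longrightarrow> w \<in> V \<Longrightarrow> \<phi> (v \<otimes>\<^bsub>P\<^esub> w) = \<phi> v \<otimes>\<^bsub>F\<^esub> \<phi> w"
  using phi_hom by (rule hom_mult)

lemma phi_inv: "v \<in> V \<Longrightarrow> \<phi> (inv\<^bsub>P\<^esub> v) = inv\<^bsub>F\<^esub> \<phi> v"
  using group_hom.hom_inv[of P F \<phi> v] phi_hom by (simp add: group_hom_def group_hom_axioms_def P gF)

text \<open>A choice of preimages, with no compatibility with products; it selects one evaluation
  fibre of \<open>A\<close> for each point of \<open>F\<close>.\<close>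

definition sec :: "'q \<Rightarrow> 'p" where "sec w = (SOME v. v \<in> V \<and> \<phi> v = w)"

lemma sec: assumes "w \<in> carrier F" shows "sec w \<in> V" "\<phi> (sec w) = w"
proof -
  have "w \<in> \<phi> ` V" using phi_surj assms by simp
  then have "\<exists>v. v \<in> V \<and> \<phi> v = w" by blast
  then have "sec w \<in> V \<and> \<phi> (sec w) = w" unfolding sec_def by (rule someI_ex)
  then show "sec w \<in> V" "\<phi> (sec w) = w" by auto
qed

lemma tact_inj: assumes "t \<in> carrier Tg" "v \<in> carrier F" "w \<in> carrier F" shows "tact t v = tact t w \<longleftrightarrow> v = w"
proof -
  have "tact (inv\<^bsub>Tg\<^esub> t) (tact t u) = u" if "u \<in> carrier F" for u
    using tact_mult[of "inv\<^bsub>Tg\<^esub> t" t u] tact_one that assms(1) by simp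
  from this[OF assms(2)] this[OF assms(3)] show ?thesis by metis
qed

lemma tact_bij: assumes "t \<in> carrier Tg" shows "bij_betw (tact t) (carrier F) (carrier F)"
proof (rule bij_betwI[where g = "tact (inv\<^bsub>Tg\<^esub> t)"])
  show "tact (inv\<^bsub>Tg\<^esub> t) (tact t x) = x" if "x \<in> carrier F" for x
    using tact_mult[of "inv\<^bsub>Tg\<^esub> t" t x] tact_one that assms by simp
  show "tact t (tact (inv\<^bsub>Tg\<^esub> t) x) = x" if "x \<in> carrier F" for x
    using tact_mult[of t "inv\<^bsub>Tg\<^esub> t" x] tact_one that assms by simp
qed (use assms tact_closed in auto)

lemma countable_F: "countable (carrier F)"
  using countable_P phi_surj by (metis countable_image)

section \<open>Slices of open sets and semicontinuity of their masses\<close>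

lemma slice_open:
  assumes U: "openin T2 U" and hf: "(h, f) \<in> U" shows "\<exists>W n. openin TH W \<and> h \<in> W \<and> f \<in> carrier A \<and> W \<times> cyl f n \<subseteq> U"
proof -
  have "\<exists>W O'. openin TH W \<and> openin TA O' \<and> h \<in> W \<and> f \<in> O' \<and> W \<times> O' \<subseteq> U"
    using U hf unfolding openin_prod_topology_alt by simp
  then obtain W O' where *: "openin TH W" "openin TA O'" "h \<in> W" "f \<in> O'" "W \<times> O' \<subseteq> U"
    by (elim exE conjE)
  have O': "O' \<subseteq> carrier A" "\<exists>n. cyl f n \<subseteq> O'" using *(2,4) unfolding openin_TA by auto
  then obtain n where n: "cyl f n \<subseteq> O'" by blast
  have "W \<times> cyl f n \<subseteq> U" using Sigma_mono[OF subset_refl n, of W] *(5) by (rule subset_trans)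
  moreover have "f \<in> carrier A" using O'(1) *(4) by (rule subsetD)
  ultimately show ?thesis using *(1,3) by (intro exI[of _ W] exI[of _ n] conjI)
qed

lemma slice_sets: assumes U: "openin T2 U" shows "{f \<in> carrier A. (h, f) \<in> U} \<in> sets Haar"
proof (rule Haar_open)
  fix f assume "f \<in> {f \<in> carrier A. (h, f) \<in> U}"
  then obtain W n where "openin TH W" "h \<in> W" "W \<times> cyl f n \<subseteq> U" using slice_open[OF U, of h f] by auto
  then have "cyl f n \<subseteq> {f \<in> carrier A. (h, f) \<in> U}" using cyl_subset by blast
  then show "\<exists>n. cyl f n \<subseteq> {f \<in> carrier A. (h, f) \<in> U}" ..
qed blast

text \<open>The slice at \<open>h\<close> is a countable union of cylinders that remain in
  \<open>U\<close> over a neighbourhood of \<open>h\<close>. Finitely many of them already have mass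
  above \<open>y\<close>, and over the intersection of their neighbourhoods the bound
  persists.\<close>

lemma slice_lsc:
  assumes U: "openin T2 U" shows "openin TH {h \<in> carrier H. y < emeasure Haar {f \<in> carrier A. (h, f) \<in> U}}"
proof (subst openin_subopen, rule ballI)
  fix h assume "h \<in> {h \<in> carrier H. y < emeasure Haar {f \<in> carrier A. (h, f) \<in> U}}"
  then have h: "h \<in> carrier H" and y: "y < emeasure Haar {f \<in> carrier A. (h, f) \<in> U}" by auto
  define \<C> where "\<C> = {C \<in> cyls. \<exists>W. openin TH W \<and> h \<in> W \<and> W \<times> C \<subseteq> U}"
  have "openin TH (carrier H)" using openin_topspace[of TH] by (simp add: topspace_TH)
  then have ne: "{} \<in> \<C>" using h by (auto simp: \<C>_def cyls_def)
  have cnt: "countable \<C>" unfolding \<C>_def using countable_cyls by (rule countable_subset[rotated]) blast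
  have "{f \<in> carrier A. (h, f) \<in> U} = \<Union>\<C>"
  proof
    show "{f \<in> carrier A. (h, f) \<in> U} \<subseteq> \<Union>\<C>"
    proof
      fix f assume "f \<in> {f \<in> carrier A. (h, f) \<in> U}"
      then obtain W n where *: "openin TH W" "h \<in> W" "f \<in> carrier A" "W \<times> cyl f n \<subseteq> U" using slice_open[OF U, of h f] by blast
      then have "cyl f n \<in> \<C>" unfolding \<C>_def cyls_def by blast
      then show "f \<in> \<Union>\<C>" using cyl_self[OF *(3)] by blast
    qed
    show "\<Union>\<C> \<subseteq> {f \<in> carrier A. (h, f) \<in> U}" using cyls_Pow unfolding \<C>_def by blast
  qed
  moreover define C where "C = from_nat_into \<C>"
  have rC: "range C = \<C>" unfolding C_def using ne cnt by (intro range_from_nat_into) auto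
  define D where "D k = (\<Union>i\<le>k. C i)" for k
  have "\<Union>\<C> = (\<Union>k. D k)" unfolding D_def rC[symmetric] by auto
  moreover have "C i \<in> sets Haar" for i
  proof -
    have "C i \<in> cyls" using rC unfolding \<C>_def by blast
    then show ?thesis by (simp add: sets_Haar sigma_sets.Basic)
  qed
  then have "range D \<subseteq> sets Haar" unfolding D_def by auto
  moreover have "incseq D" unfolding D_def incseq_def by (intro allI impI UN_mono) auto
  ultimately have "y < (SUP k. emeasure Haar (D k))" using y SUP_emeasure_incseq[of D Haar] by simp
  then obtain k where k: "y < emeasure Haar (D k)" unfolding less_SUP_iff by blast
  have "\<forall>i. \<exists>W. openin TH W \<and> h \<in> W \<and> W \<times> C i \<subseteq> U" using rC unfolding \<C>_def by blast
  then obtain W where W: "\<And>i. openin TH (W i) \<and> h \<in> W i \<and> W i \<times> C i \<subseteq> U" by metis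
  let ?W = "\<Inter>i\<in>{..k}. W i"
  have "openin TH ?W" using W by (intro openin_Inter) auto
  moreover have "h \<in> ?W" using W by blast
  moreover have "?W \<subseteq> {h \<in> carrier H. y < emeasure Haar {f \<in> carrier A. (h, f) \<in> U}}"
  proof
    fix h' assume h': "h' \<in> ?W"
    then have "h' \<in> carrier H" using openin_subset[of TH "W 0"] W topspace_TH by auto
    have "D k \<subseteq> {f \<in> carrier A. (h', f) \<in> U}"
    proof
      fix f assume "f \<in> D k"
      then obtain i where i: "i \<le> k" "f \<in> C i" by (auto simp: D_def)
      then have "(h', f) \<in> U" using W[of i] h' by blast
      moreover have "f \<in> carrier A" using i rC cyls_Pow unfolding \<C>_def by blast
      ultimately show "f \<in> {f \<in> carrier A. (h', f) \<in> U}" by simp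
    qed
    then have "emeasure Haar (D k) \<le> emeasure Haar {f \<in> carrier A. (h', f) \<in> U}"
      by (rule emeasure_mono) (rule slice_sets[OF U])
    then show "h' \<in> {h \<in> carrier H. y < emeasure Haar {f \<in> carrier A. (h, f) \<in> U}}"
      using k \<open>h' \<in> carrier H\<close> by auto
  qed
  ultimately show "\<exists>W. openin TH W \<and> h \<in> W \<and> W \<subseteq> {h \<in> carrier H. y < emeasure Haar {f \<in> carrier A. (h, f) \<in> U}}" by blast
qed

text \<open>The values of \<open>t\<close> at \<open>v0\<close> and \<open>w0\<close> are locally
  constant in \<open>t\<close>, so the superlevel set is a union of products of open sets.\<close>

lemma open_fibres:
  fixes u :: "'q \<Rightarrow> 'q \<Rightarrow> 'h \<Rightarrow> ennreal"
  assumes u: "\<And>v w y. v \<in> carrier F \<Longrightarrow> w \<in> carrier F \<Longrightarrow> openin TH {h \<in> carrier H. y < u v w h}"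
    and vw: "v0 \<in> carrier F" "w0 \<in> carrier F"
  shows "openin T1 {x \<in> carrier G1. y < (case x of (h, t) \<Rightarrow> u (tact t v0) (tact t w0) h)}"
proof -
  have "{x \<in> carrier G1. y < (case x of (h, t) \<Rightarrow> u (tact t v0) (tact t w0) h)} =
    (\<Union>(v, w)\<in>carrier F \<times> carrier F. {h \<in> carrier H. y < u v w h} \<times> ({t \<in> carrier Tg. tact t v0 = v} \<inter> {t \<in> carrier Tg. tact t w0 = w}))"
    using vw tact_closed by auto
  moreover have "openin T1 ({h \<in> carrier H. y < u v w h} \<times> ({t \<in> carrier Tg. tact t v0 = v} \<inter> {t \<in> carrier Tg. tact t w0 = w}))"
    if "v \<in> carrier F" "w \<in> carrier F" for v w
    using u[OF that] open_tact vw that by (intro openin_prod_Times_iff[THEN iffD2] disjI2 conjI openin_Int) auto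
  ultimately show ?thesis by (auto intro!: openin_Union)
qed

lemma open_act: "v \<in> V \<Longrightarrow> openin TA {f \<in> carrier A. Q (act f v)}"
  unfolding openin_TA
proof (intro conjI ballI)
  assume v: "v \<in> V"
  fix f assume "f \<in> {f \<in> carrier A. Q (act f v)}"
  moreover obtain n where "v \<in> Bn n" using Bn_Union v by blast
  ultimately have "cyl f n \<subseteq> {f \<in> carrier A. Q (act f v)}" by (auto simp: cyl_def)
  then show "\<exists>n. cyl f n \<subseteq> {f \<in> carrier A. Q (act f v)}" ..
qed blast

lemma open_restrict: assumes W: "openin T2 W" and O': "openin TA O'" shows "openin T2 {(h, f). (h, f) \<in> W \<and> f \<in> O'}"
proof -
  have "{(h, f). (h, f) \<in> W \<and> f \<in> O'} = W \<inter> (carrier H \<times> O')"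
    using openin_subset[OF W] by (auto simp: topspace_TH)
  moreover have "openin T2 (carrier H \<times> O')"
    using O' openin_topspace[of TH] topspace_TH by (simp add: openin_prod_Times_iff)
  ultimately show ?thesis using W by auto
qed

lemma Gamma_carrier: "(h, t) \<in> \<Gamma> \<Longrightarrow> h \<in> carrier H \<and> t \<in> carrier Tg"
  using C1.\<Gamma>_carrier by auto

lemma Gamma'_carrier: "(h, f) \<in> \<Gamma>' \<Longrightarrow> h \<in> carrier H \<and> f \<in> carrier A"
  using C2.\<Gamma>_carrier by auto

lemma invariant_Union:
  assumes "E \<subseteq> C2.X" "(k, f0) \<in> \<Gamma>'" "h \<in> carrier H" "f \<in> carrier A"
  shows "(k \<otimes>\<^bsub>H\<^esub> h, f0 \<otimes> f) \<in> \<Union>E \<longleftrightarrow> (h, f) \<in> \<Union>E"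
  using C2.coset_left_Union[OF assms(1,2), of "(h, f)"] assms by simp

lemma fibre_measurable: "v \<in> V \<Longrightarrow> {f \<in> carrier A. Q (act f v)} \<in> sets Haar"
  using Haar_openin open_act by blast

lemma act_e: "f \<in> carrier A \<Longrightarrow> act f e \<in> V"
  by (rule act_closed) simp_all

lemma act_reg_mult: "n \<in> V \<Longrightarrow> f \<in> carrier A \<Longrightarrow> v \<in> V \<Longrightarrow> act (reg n \<otimes> f) v = n \<otimes>\<^bsub>P\<^esub> act f v"
  using act_mult[of "reg n" f v] act_reg reg_closed act_closed by simp

lemma sum_over_fibres:
  assumes D: "D \<in> sets Haar" and g: "g \<in> carrier A"
  shows "emeasure Haar D = (\<integral>\<^sup>+w. emeasure Haar {f \<in> D. \<phi> (act (f \<otimes> g) e) = w} \<partial>count_space (carrier F))"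
proof -
  have DA: "D \<subseteq> carrier A" using sets.sets_into_space[OF D] by simp
  have eq: "{f \<in> D. \<phi> (act (f \<otimes> g) e) = w} = D \<inter> {f \<in> carrier A. \<phi> (act f (act g e)) = w}" for w
    using DA g by (auto simp: act_mult subset_iff)
  have "{f \<in> D. \<phi> (act (f \<otimes> g) e) = w} \<in> sets Haar" for w
    unfolding eq using D fibre_measurable[OF act_e[OF g], of "\<lambda>a. \<phi> a = w"] by auto
  moreover have "D = (\<Union>w\<in>carrier F. {f \<in> D. \<phi> (act (f \<otimes> g) e) = w})"
    using DA g phi_closed act_e by (auto simp: subset_iff)
  ultimately show ?thesis
    using emeasure_UN_countable[of "carrier F" "\<lambda>w. {f \<in> D. \<phi> (act (f \<otimes> g) e) = w}" Haar] countable_F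
    by (auto simp: disjoint_family_on_def)
qed

text \<open>Both sides decompose over the kernel of \<open>\<phi>\<close>, whose elements lie in \<open>\<Gamma>'\<close>; left
  translation by such an element matches the summands.\<close>

lemma fibre_exchange:
  assumes E: "E \<subseteq> C2.X" and m: "{f \<in> carrier A. (h, f) \<in> \<Union>E} \<in> sets Haar"
    and h: "h \<in> carrier H" and c: "c \<in> carrier A" and ab: "a \<in> V" "b \<in> V"
  shows "emeasure Haar {f \<in> carrier A. (h, f) \<in> \<Union>E \<and> act (f \<otimes> c) e = a \<and> \<phi> (act f e) = \<phi> b} =
    emeasure Haar {f \<in> carrier A. (h, f) \<in> \<Union>E \<and> \<phi> (act (f \<otimes> c) e) = \<phi> a \<and> act f e = b}"
proof -
  define N0 where "N0 = {n \<in> V. \<phi> n = eF}"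
  let ?L = "\<lambda>n. {f \<in> carrier A. (h, f) \<in> \<Union>E \<and> act (f \<otimes> c) e = a \<and> act f e = n \<otimes>\<^bsub>P\<^esub> b}"
  let ?R = "\<lambda>n. {f \<in> carrier A. (h, f) \<in> \<Union>E \<and> n \<otimes>\<^bsub>P\<^esub> act (f \<otimes> c) e = a \<and> act f e = b}"
  have cN: "countable N0" unfolding N0_def using countable_P by (rule countable_subset[rotated]) blast
  have meas: "{f \<in> carrier A. (h, f) \<in> \<Union>E \<and> Q (act (f \<otimes> c) e) \<and> Q' (act f e)} \<in> sets Haar" for Q Q'
  proof -
    have "{f \<in> carrier A. (h, f) \<in> \<Union>E \<and> Q (act (f \<otimes> c) e) \<and> Q' (act f e)} =
      {f \<in> carrier A. (h, f) \<in> \<Union>E} \<inter> {f \<in> carrier A. Q (act f (act c e))} \<inter> {f \<in> carrier A. Q' (act f e)}"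
      using c by (auto simp: act_mult)
    then show ?thesis
      using m fibre_measurable[OF act_e[OF c], of Q] fibre_measurable[of e Q'] by auto
  qed
  have shift: "{f \<in> carrier A. reg n \<otimes> f \<in> ?L n} = ?R n" if n: "n \<in> N0" for n
  proof (rule Collect_cong)
    fix f
    have nV: "n \<in> V" "\<phi> n = eF" using n by (auto simp: N0_def)
    show "(f \<in> carrier A \<and> reg n \<otimes> f \<in> ?L n) = (f \<in> carrier A \<and> (h, f) \<in> \<Union>E \<and> n \<otimes>\<^bsub>P\<^esub> act (f \<otimes> c) e = a \<and> act f e = b)"
    proof (cases "f \<in> carrier A")
      case True
      have "(h, reg n \<otimes> f) \<in> \<Union>E \<longleftrightarrow> (h, f) \<in> \<Union>E"
        using invariant_Union[OF E ker[OF nV] h True] h by simp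
      moreover have "act (reg n \<otimes> f \<otimes> c) e = n \<otimes>\<^bsub>P\<^esub> act (f \<otimes> c) e"
        using act_reg_mult[OF nV(1), of "f \<otimes> c" e] True c reg_closed[OF nV(1)] by (simp add: m_assoc)
      moreover have "act (reg n \<otimes> f) e = n \<otimes>\<^bsub>P\<^esub> b \<longleftrightarrow> act f e = b"
        using act_reg_mult[OF nV(1) True, of e] act_e[OF True] nV ab by simp
      ultimately show ?thesis using True reg_closed[OF nV(1)] by simp
    qed simp
  qed
  have "{f \<in> carrier A. (h, f) \<in> \<Union>E \<and> act (f \<otimes> c) e = a \<and> \<phi> (act f e) = \<phi> b} = (\<Union>n\<in>N0. ?L n)"
  proof
    show "{f \<in> carrier A. (h, f) \<in> \<Union>E \<and> act (f \<otimes> c) e = a \<and> \<phi> (act f e) = \<phi> b} \<subseteq> (\<Union>n\<in>N0. ?L n)"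
    proof
      fix f assume f: "f \<in> {f \<in> carrier A. (h, f) \<in> \<Union>E \<and> act (f \<otimes> c) e = a \<and> \<phi> (act f e) = \<phi> b}"
      let ?n = "act f e \<otimes>\<^bsub>P\<^esub> inv\<^bsub>P\<^esub> b"
      have fe: "act f e \<in> V" using act_e f by simp
      then have "?n \<in> N0" using f ab phi_closed[OF ab(2)] by (simp add: N0_def phi_mult phi_inv)
      moreover have "act f e = ?n \<otimes>\<^bsub>P\<^esub> b" using fe ab by (simp add: P.m_assoc)
      ultimately show "f \<in> (\<Union>n\<in>N0. ?L n)" using f by blast
    qed
    have "\<phi> (n \<otimes>\<^bsub>P\<^esub> b) = \<phi> b" if "n \<in> N0" for n
      using that ab phi_closed[OF ab(2)] by (simp add: N0_def phi_mult)
    then show "(\<Union>n\<in>N0. ?L n) \<subseteq> {f \<in> carrier A. (h, f) \<in> \<Union>E \<and> act (f \<otimes> c) e = a \<and> \<phi> (act f e) = \<phi> b}" by auto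
  qed
  then have "emeasure Haar {f \<in> carrier A. (h, f) \<in> \<Union>E \<and> act (f \<otimes> c) e = a \<and> \<phi> (act f e) = \<phi> b}
    = emeasure Haar (\<Union>n\<in>N0. ?L n)" by simp
  also have "\<dots> = (\<integral>\<^sup>+n. emeasure Haar (?L n) \<partial>count_space N0)"
  proof (rule emeasure_UN_countable[OF _ cN])
    show "?L n \<in> sets Haar" for n using meas[of "\<lambda>x. x = a" "\<lambda>x. x = n \<otimes>\<^bsub>P\<^esub> b"] by simp
    have "n = n'" if "n \<in> N0" "n' \<in> N0" "n \<otimes>\<^bsub>P\<^esub> b = n' \<otimes>\<^bsub>P\<^esub> b" for n n'
      using that ab by (simp add: N0_def)
    then show "disjoint_family_on ?L N0" unfolding disjoint_family_on_def by auto
  qed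
  also have "\<dots> = (\<integral>\<^sup>+n. emeasure Haar (?R n) \<partial>count_space N0)"
  proof (rule nn_integral_cong)
    fix n assume "n \<in> space (count_space N0)"
    then have n: "n \<in> N0" "n \<in> V" by (auto simp: N0_def)
    have "?L n \<in> sets Haar" using meas[of "\<lambda>x. x = a" "\<lambda>x. x = n \<otimes>\<^bsub>P\<^esub> b"] by simp
    from Haar_left(2)[OF reg_closed[OF n(2)] this] show "emeasure Haar (?L n) = emeasure Haar (?R n)"
      unfolding shift[OF n(1)] by simp
  qed
  also have "\<dots> = emeasure Haar (\<Union>n\<in>N0. ?R n)"
  proof (rule emeasure_UN_countable[symmetric, OF _ cN])
    show "?R n \<in> sets Haar" for n using meas[of "\<lambda>x. n \<otimes>\<^bsub>P\<^esub> x = a" "\<lambda>x. x = b"] by simp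
    have "n = n'" if "n \<in> N0" "n' \<in> N0" "f \<in> carrier A" "n \<otimes>\<^bsub>P\<^esub> act (f \<otimes> c) e = n' \<otimes>\<^bsub>P\<^esub> act (f \<otimes> c) e" for n n' f
      using that act_e[of "f \<otimes> c"] c by (simp add: N0_def)
    then show "disjoint_family_on ?R N0" unfolding disjoint_family_on_def by blast
  qed
  also have "(\<Union>n\<in>N0. ?R n) = {f \<in> carrier A. (h, f) \<in> \<Union>E \<and> \<phi> (act (f \<otimes> c) e) = \<phi> a \<and> act f e = b}"
  proof
    show "{f \<in> carrier A. (h, f) \<in> \<Union>E \<and> \<phi> (act (f \<otimes> c) e) = \<phi> a \<and> act f e = b} \<subseteq> (\<Union>n\<in>N0. ?R n)"
    proof
      fix f assume f: "f \<in> {f \<in> carrier A. (h, f) \<in> \<Union>E \<and> \<phi> (act (f \<otimes> c) e) = \<phi> a \<and> act f e = b}"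
      let ?x = "act (f \<otimes> c) e"
      let ?n = "a \<otimes>\<^bsub>P\<^esub> inv\<^bsub>P\<^esub> ?x"
      have x: "?x \<in> V" using act_e f c by simp
      then have "?n \<in> N0" using f ab phi_closed[OF ab(1)] by (simp add: N0_def phi_mult phi_inv)
      moreover have "?n \<otimes>\<^bsub>P\<^esub> ?x = a" using x ab by (simp add: P.m_assoc)
      ultimately show "f \<in> (\<Union>n\<in>N0. ?R n)" using f by blast
    qed
    have "\<phi> x = \<phi> (n \<otimes>\<^bsub>P\<^esub> x)" if "n \<in> N0" "x \<in> V" for n x
      using that phi_closed[OF that(2)] by (simp add: N0_def phi_mult)
    then show "(\<Union>n\<in>N0. ?R n) \<subseteq> {f \<in> carrier A. (h, f) \<in> \<Union>E \<and> \<phi> (act (f \<otimes> c) e) = \<phi> a \<and> act f e = b}"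
      using act_e c by auto
  qed
  finally show ?thesis .
qed

section \<open>Fibre measures on the cosets of the group of lifts\<close>

abbreviation N2 where "N2 \<equiv> coset_sigma G2 T2 \<Gamma>'"

lemma sets_N2: "sets N2 = C2.S" and space_N2: "space N2 = C2.X"
  using C2.open_coset_Pow by auto

lemma q_measurable: assumes h: "h \<in> carrier H" shows "(\<lambda>f. \<Gamma>' #>\<^bsub>G2\<^esub> (h, f)) \<in> measurable Haar N2"
proof (rule measurable_measure_of[OF C2.open_coset_Pow])
  show "(\<lambda>f. \<Gamma>' #>\<^bsub>G2\<^esub> (h, f)) \<in> space Haar \<rightarrow> C2.X" using h by auto
  fix E assume "E \<in> {U. openin Q2 U}"
  then have E: "E \<subseteq> C2.X" "openin T2 (\<Union>E)" by (auto simp: C2.openin_coset)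
  have "(\<lambda>f. \<Gamma>' #>\<^bsub>G2\<^esub> (h, f)) -` E \<inter> space Haar = {f \<in> carrier A. (h, f) \<in> \<Union>E}"
    using C2.coset_mem_iff[OF E(1)] h by auto
  then show "(\<lambda>f. \<Gamma>' #>\<^bsub>G2\<^esub> (h, f)) -` E \<inter> space Haar \<in> sets Haar"
    using slice_sets[OF E(2)] by simp
qed

lemma slice_sets_N2:
  assumes h: "h \<in> carrier H" and E: "E \<in> C2.S" shows "{f \<in> carrier A. (h, f) \<in> \<Union>E} \<in> sets Haar"
proof -
  have EX: "E \<subseteq> C2.X" using E sigma_sets_into_sp[OF C2.open_coset_Pow] by blast
  have "(\<lambda>f. \<Gamma>' #>\<^bsub>G2\<^esub> (h, f)) -` E \<inter> space Haar = {f \<in> carrier A. (h, f) \<in> \<Union>E}"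
    using C2.coset_mem_iff[OF EX] h by auto
  then show ?thesis using measurable_sets[OF q_measurable[OF h], of E] E sets_N2 by simp
qed

text \<open>One evaluation fibre stands for all fibres over \<open>v\<close>: translations by kernel
  elements lie in \<open>\<Gamma>'\<close>, permute these fibres, and preserve the Haar measure and
  the union of a set of cosets.\<close>

definition kap :: "('h \<times> 'a) set set \<Rightarrow> 'h \<Rightarrow> 'q \<Rightarrow> ennreal" where
  "kap E h v = emeasure Haar {f \<in> carrier A. (h, f) \<in> \<Union>E \<and> act f e = sec v}"

text \<open>The elements \<open>f\<close> of a slice that send the base point over \<open>w\<close>
  while \<open>f \<otimes> c\<close> sends it to the chosen point over \<open>v\<close>; these are
  the amounts of mass to be transported.\<close>

definition zeta :: "('h \<times> 'a) set set \<Rightarrow> 'a \<Rightarrow> 'h \<Rightarrow> 'q \<Rightarrow> 'q \<Rightarrow> ennreal" where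
  "zeta E c h v w = emeasure Haar {f \<in> carrier A. (h, f) \<in> \<Union>E \<and> act (f \<otimes> c) e = sec v \<and> \<phi> (act f e) = w}"

text \<open>By \<open>over\<close> some lift of \<open>(k, t)\<close> takes \<open>sec v\<close> to
  \<open>sec (tact t v)\<close>. Left translation by it preserves the Haar measure and, since the
  lift lies in \<open>\<Gamma>'\<close>, membership in the union of \<open>E\<close>.\<close>

lemma zeta_invariant:
  assumes E: "E \<in> C2.S" and c: "c \<in> carrier A" and g: "(k, t) \<in> \<Gamma>" and h: "h \<in> carrier H"
    and vw: "v \<in> carrier F" "w \<in> carrier F"
  shows "zeta E c (k \<otimes>\<^bsub>H\<^esub> h) (tact t v) (tact t w) = zeta E c h v w"
    "kap E (k \<otimes>\<^bsub>H\<^esub> h) (tact t v) = kap E h v"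
proof -
  have EX: "E \<subseteq> C2.X" using E sigma_sets_into_sp[OF C2.open_coset_Pow] by blast
  have kt: "k \<in> carrier H" "t \<in> carrier Tg" using Gamma_carrier[OF g] by auto
  have tv: "tact t v \<in> carrier F" by (rule tact_closed[OF kt(2) vw(1)])
  obtain f0 where f0: "(k, f0) \<in> \<Gamma>'" "act f0 (sec v) = sec (tact t v)" "\<forall>u\<in>V. \<phi> (act f0 u) = tact t (\<phi> u)"
    using over[OF g, of "sec v" "sec (tact t v)"] sec[OF vw(1)] sec[OF tv] by auto
  have f0A: "f0 \<in> carrier A" using Gamma'_carrier[OF f0(1)] by simp
  have m: "{f \<in> carrier A. (k \<otimes>\<^bsub>H\<^esub> h, f) \<in> \<Union>E} \<in> sets Haar" by (rule slice_sets_N2[OF _ E]) (use kt h in simp)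
  have in1: "act (f0 \<otimes> f) u = sec (tact t v) \<longleftrightarrow> act f u = sec v" if "f \<in> carrier A" "u \<in> V" for f u
    using act_inj[OF f0A act_closed[OF that] sec(1)[OF vw(1)]] f0(2) act_mult[OF f0A that] by simp
  have in2: "\<phi> (act (f0 \<otimes> f) e) = tact t w \<longleftrightarrow> \<phi> (act f e) = w" if "f \<in> carrier A" for f
    using tact_inj[OF kt(2) phi_closed[OF act_e[OF that]] vw(2)] f0(3) act_e[OF that] act_mult[OF f0A that] by simp
  have in3: "(k \<otimes>\<^bsub>H\<^esub> h, f0 \<otimes> f) \<in> \<Union>E \<longleftrightarrow> (h, f) \<in> \<Union>E" if "f \<in> carrier A" for f
    by (rule invariant_Union[OF EX f0(1) h that])
  let ?Z = "{f \<in> carrier A. (k \<otimes>\<^bsub>H\<^esub> h, f) \<in> \<Union>E \<and> act (f \<otimes> c) e = sec (tact t v) \<and> \<phi> (act f e) = tact t w}"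
  have "?Z = {f \<in> carrier A. (k \<otimes>\<^bsub>H\<^esub> h, f) \<in> \<Union>E} \<inter> {f \<in> carrier A. act f (act c e) = sec (tact t v)} \<inter> {f \<in> carrier A. \<phi> (act f e) = tact t w}"
    using c by (auto simp: act_mult)
  then have "?Z \<in> sets Haar"
    using m fibre_measurable[OF act_e[OF c], of "\<lambda>x. x = sec (tact t v)"] fibre_measurable[of e "\<lambda>x. \<phi> x = tact t w"] by auto
  from Haar_left(2)[OF f0A this]
  have "emeasure Haar ?Z = emeasure Haar {f \<in> carrier A. f0 \<otimes> f \<in> ?Z}" by simp
  also have "{f \<in> carrier A. f0 \<otimes> f \<in> ?Z} = {f \<in> carrier A. (h, f) \<in> \<Union>E \<and> act (f \<otimes> c) e = sec v \<and> \<phi> (act f e) = w}"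
  proof (intro Collect_cong conj_cong HOL.refl)
    fix f assume f: "f \<in> carrier A"
    have "act (f0 \<otimes> f \<otimes> c) e = sec (tact t v) \<longleftrightarrow> act (f \<otimes> c) e = sec v"
      using in1[of "f \<otimes> c" e] f f0A c by (simp add: m_assoc)
    then show "(f0 \<otimes> f \<in> ?Z) = ((h, f) \<in> \<Union>E \<and> act (f \<otimes> c) e = sec v \<and> \<phi> (act f e) = w)"
      using in2[OF f] in3[OF f] m_closed[OF f0A f] by (simp only: mem_Collect_eq simp_thms)
  qed
  finally show "zeta E c (k \<otimes>\<^bsub>H\<^esub> h) (tact t v) (tact t w) = zeta E c h v w" by (simp add: zeta_def)
  let ?K = "{f \<in> carrier A. (k \<otimes>\<^bsub>H\<^esub> h, f) \<in> \<Union>E \<and> act f e = sec (tact t v)}"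
  have "?K = {f \<in> carrier A. (k \<otimes>\<^bsub>H\<^esub> h, f) \<in> \<Union>E} \<inter> {f \<in> carrier A. act f e = sec (tact t v)}" by auto
  then have "?K \<in> sets Haar" using m fibre_measurable[of e "\<lambda>x. x = sec (tact t v)"] by auto
  from Haar_left(2)[OF f0A this]
  have "emeasure Haar ?K = emeasure Haar {f \<in> carrier A. f0 \<otimes> f \<in> ?K}" by simp
  also have "{f \<in> carrier A. f0 \<otimes> f \<in> ?K} = {f \<in> carrier A. (h, f) \<in> \<Union>E \<and> act f e = sec v}"
  proof (intro Collect_cong conj_cong HOL.refl)
    fix f assume f: "f \<in> carrier A"
    show "(f0 \<otimes> f \<in> ?K) = ((h, f) \<in> \<Union>E \<and> act f e = sec v)"
      using in1[of f e] f in3[OF f] m_closed[OF f0A f] by simp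
  qed
  finally show "kap E (k \<otimes>\<^bsub>H\<^esub> h) (tact t v) = kap E h v" by (simp add: kap_def)
qed

lemma zeta_lsc:
  assumes E: "openin Q2 E" and c: "c \<in> carrier A"
  shows "openin TH {h \<in> carrier H. y < zeta E c h v w}" "openin TH {h \<in> carrier H. y < kap E h v}"
proof -
  have W: "openin T2 (\<Union>E)" using E by (simp add: C2.openin_coset)
  have "openin TA ({f \<in> carrier A. act f (act c e) = sec v} \<inter> {f \<in> carrier A. \<phi> (act f e) = w})"
    using open_act[OF act_e[OF c], of "\<lambda>x. x = sec v"] open_act[of e "\<lambda>x. \<phi> x = w"] by auto
  from slice_lsc[OF open_restrict[OF W this], of y]
  show "openin TH {h \<in> carrier H. y < zeta E c h v w}"
    unfolding zeta_def using c by (simp add: act_mult conj_ac cong: conj_cong)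
  have "openin TA {f \<in> carrier A. act f e = sec v}" using open_act[of e "\<lambda>x. x = sec v"] by auto
  from slice_lsc[OF open_restrict[OF W this], of y]
  show "openin TH {h \<in> carrier H. y < kap E h v}"
    unfolding kap_def by (simp add: conj_ac cong: conj_cong)
qed

text \<open>The fibre over the image of the base point, pushed to the cosets of
  \<open>\<Gamma>'\<close>. It is a probability measure on cosets in \<open>C1.X\<close> because an
  evaluation fibre has Haar mass 1, and the invariance of \<open>kap\<close> makes it independent of
  the representative.\<close>

definition kernel_measure :: "('h \<times> 't) set \<Rightarrow> ('h \<times> 'a) set measure" where
  "kernel_measure C = (let x = (SOME x. x \<in> C) in
     distr (restrict_space Haar {f \<in> carrier A. act f e = sec (tact (snd x) eF)}) N2 (\<lambda>f. \<Gamma>' #>\<^bsub>G2\<^esub> (fst x, f)))"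

lemma some_in: assumes "C \<in> C1.X" shows "(SOME x. x \<in> C) \<in> carrier G1"
proof -
  obtain y where y: "y \<in> carrier G1" "C = \<Gamma> #>\<^bsub>G1\<^esub> y" using assms by (auto simp: RCOSETS_def)
  have "(SOME x. x \<in> C) \<in> C" by (rule someI[of _ y]) (use C1.self_coset[OF y(1)] y(2) in simp)
  then show ?thesis using C1.coset_carrier[OF assms] by blast
qed

lemma kernel_measure:
  assumes C: "C \<in> C1.X" and E: "E \<in> C2.S"
  shows "emeasure (kernel_measure C) E = kap E (fst (SOME x. x \<in> C)) (tact (snd (SOME x. x \<in> C)) eF)"
proof -
  obtain h t where x: "(SOME x. x \<in> C) = (h, t)" by (cases "SOME x. x \<in> C")
  have ht: "h \<in> carrier H" "t \<in> carrier Tg" using some_in[OF C] x by auto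
  let ?Om = "{f \<in> carrier A. act f e = sec (tact t eF)}"
  have Om: "?Om \<in> sets Haar" using fibre_measurable[of e "\<lambda>x. x = sec (tact t eF)"] by simp
  have EX: "E \<subseteq> C2.X" using E sigma_sets_into_sp[OF C2.open_coset_Pow] by blast
  have q: "(\<lambda>f. \<Gamma>' #>\<^bsub>G2\<^esub> (h, f)) \<in> measurable (restrict_space Haar ?Om) N2"
    by (rule measurable_restrict_space1[OF q_measurable[OF ht(1)]])
  have "emeasure (kernel_measure C) E = emeasure (restrict_space Haar ?Om) ((\<lambda>f. \<Gamma>' #>\<^bsub>G2\<^esub> (h, f)) -` E \<inter> space (restrict_space Haar ?Om))"
    unfolding kernel_measure_def x Let_def using emeasure_distr[OF q] E sets_N2 by simp
  also have "(\<lambda>f. \<Gamma>' #>\<^bsub>G2\<^esub> (h, f)) -` E \<inter> space (restrict_space Haar ?Om) = {f \<in> carrier A. (h, f) \<in> \<Union>E \<and> act f e = sec (tact t eF)}"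
    using C2.coset_mem_iff[OF EX] ht by (auto simp: space_restrict_space)
  also have "emeasure (restrict_space Haar ?Om) \<dots> = kap E h (tact t eF)"
    unfolding kap_def by (rule emeasure_restrict_space[OF sets.Int[OF Om sets.top]]) auto
  finally show ?thesis by (simp add: x)
qed

lemma kap_all: assumes "h \<in> carrier H" "v \<in> carrier F" shows "kap C2.X h v = 1"
proof -
  have "(h, f) \<in> \<Union>C2.X" if "f \<in> carrier A" for f
  proof (rule UnionI)
    show "\<Gamma>' #>\<^bsub>G2\<^esub> (h, f) \<in> C2.X" using assms that by (intro C2.coset_in) simp
    show "(h, f) \<in> \<Gamma>' #>\<^bsub>G2\<^esub> (h, f)" using assms that by (intro C2.self_coset) simp
  qed
  then have "{f \<in> carrier A. (h, f) \<in> \<Union>C2.X \<and> act f e = sec v} = {f \<in> carrier A. act f e = sec v}" by (intro Collect_cong) (simp only: simp_thms cong: conj_cong)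
  then show ?thesis using Haar_fibre(2)[OF sec(1)[OF assms(2)]] by (simp add: kap_def)
qed

lemma X2_open: "openin Q2 C2.X"
  using openin_topspace[of "Q2"] C2.topspace_coset by simp

lemma X2_S: "C2.X \<in> C2.S"
  using X2_open by (auto intro: sigma_sets.Basic)

definition Zfun :: "('h \<times> 'a) set set \<Rightarrow> 'a \<Rightarrow> 'q \<Rightarrow> 'h \<times> 't \<Rightarrow> ennreal" where
  "Zfun E c w x = zeta E c (fst x) (tact (snd x) eF) (tact (snd x) w)"

definition Ufun :: "('h \<times> 'a) set set \<Rightarrow> 'h \<times> 't \<Rightarrow> ennreal" where
  "Ufun E x = kap E (fst x) (tact (snd x) eF)"

lemma Zfun:
  assumes E: "openin Q2 E" and c: "c \<in> carrier A" and w: "w \<in> carrier F"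
  shows "\<And>\<gamma> x. \<gamma> \<in> \<Gamma> \<Longrightarrow> x \<in> carrier G1 \<Longrightarrow> Zfun E c w (\<gamma> \<otimes>\<^bsub>G1\<^esub> x) = Zfun E c w x"
    "\<And>y. openin T1 {x \<in> carrier G1. y < Zfun E c w x}"
    "\<And>\<gamma> x. \<gamma> \<in> \<Gamma> \<Longrightarrow> x \<in> carrier G1 \<Longrightarrow> Ufun E (\<gamma> \<otimes>\<^bsub>G1\<^esub> x) = Ufun E x"
    "\<And>y. openin T1 {x \<in> carrier G1. y < Ufun E x}"
proof -
  have ES: "E \<in> C2.S" using E by (auto intro: sigma_sets.Basic)
  fix \<gamma> x assume g: "\<gamma> \<in> \<Gamma>" and x: "x \<in> carrier G1"
  obtain k s where ge: "\<gamma> = (k, s)" by (cases \<gamma>)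
  obtain h t where xe: "x = (h, t)" by (cases x)
  have *: "(k, s) \<in> \<Gamma>" "h \<in> carrier H" "t \<in> carrier Tg" "k \<in> carrier H" "s \<in> carrier Tg"
    using g x Gamma_carrier by (auto simp: ge xe)
  have tt: "tact t eF \<in> carrier F" "tact t w \<in> carrier F" using tact_closed[OF *(3)] w by auto
  show "Zfun E c w (\<gamma> \<otimes>\<^bsub>G1\<^esub> x) = Zfun E c w x"
    using zeta_invariant(1)[OF ES c *(1,2) tt] * w by (simp add: Zfun_def ge xe tact_mult)
  show "Ufun E (\<gamma> \<otimes>\<^bsub>G1\<^esub> x) = Ufun E x"
    using zeta_invariant(2)[OF ES c *(1,2) tt] * by (simp add: Ufun_def ge xe tact_mult)
next
  fix y
  have "{x \<in> carrier G1. y < Zfun E c w x} =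
    {x \<in> carrier G1. y < (case x of (h, t) \<Rightarrow> zeta E c h (tact t eF) (tact t w))}"
    by (auto simp: Zfun_def)
  then show "openin T1 {x \<in> carrier G1. y < Zfun E c w x}"
    using open_fibres[of "\<lambda>v w h. zeta E c h v w" eF w y] zeta_lsc(1)[OF E c] w by simp
  have "{x \<in> carrier G1. y < Ufun E x} =
    {x \<in> carrier G1. y < (case x of (h, t) \<Rightarrow> (\<lambda>v w h. kap E h v) (tact t eF) (tact t eF) h)}"
    by (auto simp: Ufun_def)
  then show "openin T1 {x \<in> carrier G1. y < Ufun E x}"
    using open_fibres[of "\<lambda>v w h. kap E h v" eF eF y] zeta_lsc(2)[OF E c] by simp
qed

text \<open>It is enough to treat open sets, which are stable under intersection and generate the
  sigma-algebra; there measurability is the lower semicontinuity of \<open>Ufun\<close>.\<close>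

lemma kernel_measurable:
  assumes s: "sets \<mu> = C1.S" "space \<mu> = C1.X" shows "kernel_measure \<in> measurable \<mu> (subprob_algebra N2)"
proof (rule measurable_subprob_algebra_generated[OF sets_N2 _ C2.open_coset_Pow])
  show "Int_stable {U. openin Q2 U}" by (auto intro!: Int_stableI)
  have sK: "sets (kernel_measure C) = sets N2" for C by (simp add: kernel_measure_def Let_def)
  then show "sets (kernel_measure C) = sets N2" for C by simp
  have basic: "(\<lambda>C. emeasure (kernel_measure C) E) \<in> borel_measurable \<mu>" if E: "openin Q2 E" for E
  proof -
    have "E \<in> C2.S" using E by (auto intro: sigma_sets.Basic)
    then have "emeasure (kernel_measure C) E = Ufun E (SOME x. x \<in> C)" if "C \<in> space \<mu>" for C
      using kernel_measure[of C E] that s by (simp add: Ufun_def)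
    moreover have "(\<lambda>C. Ufun E (SOME x. x \<in> C)) \<in> borel_measurable \<mu>"
      by (rule C1.descend_function(1)[OF Zfun(3,4)[OF E one_closed F.one_closed] s])
    ultimately show ?thesis by (subst measurable_cong)
  qed
  then show "(\<lambda>C. emeasure (kernel_measure C) E) \<in> borel_measurable \<mu>"
    if "E \<in> {U. openin Q2 U}" for E using that by simp
  show "(\<lambda>C. emeasure (kernel_measure C) C2.X) \<in> borel_measurable \<mu>" by (rule basic[OF X2_open])
  fix C assume "C \<in> space \<mu>"
  then have C: "C \<in> C1.X" using s by simp
  have sp: "space (kernel_measure C) = C2.X" using sets_eq_imp_space_eq[OF sK[of C]] space_N2 by simp
  have "emeasure (kernel_measure C) C2.X = 1"
    using kernel_measure[OF C X2_S] kap_all some_in[OF C] tact_closed by (simp add: mem_Times_iff)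
  then show "subprob_space (kernel_measure C)"
    using C2.coset_in[of "\<one>\<^bsub>G2\<^esub>"] sp by (intro subprob_spaceI) auto
qed

text \<open>Right invariance of the Haar measure moves the translation by \<open>b\<close> from the
  set \<open>E\<close> to the condition at the base point. The mass is then sorted by the point of
  \<open>F\<close> over which \<open>f\<close> sends the base point, and \<open>tact t\<close>
  reindexes the sum.\<close>

lemma Ufun_shift:
  assumes E: "openin Q2 E" and k: "k \<in> carrier H" and b: "b \<in> carrier A"
    and x: "x \<in> carrier G1"
  shows "Ufun {C \<in> C2.X. C #>\<^bsub>G2\<^esub> (k, b) \<in> E} x =
    (\<integral>\<^sup>+w. Zfun E (inv b) w (x \<otimes>\<^bsub>G1\<^esub> (k, \<one>\<^bsub>Tg\<^esub>)) \<partial>count_space (carrier F))"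
proof -
  obtain h t where xe: "x = (h, t)" by (cases x)
  have ht: "h \<in> carrier H" "t \<in> carrier Tg" using x by (auto simp: xe)
  have ES: "E \<in> C2.S" using E by (auto intro: sigma_sets.Basic)
  have EX: "E \<subseteq> C2.X" using E by (simp add: C2.openin_coset)
  have te: "tact t eF \<in> carrier F" by (rule tact_closed[OF ht(2) F.one_closed])
  have kb: "(k, b) \<in> carrier G2" using k b by simp
  have hk: "h \<otimes>\<^bsub>H\<^esub> k \<in> carrier H" using ht k by simp
  let ?D = "{f \<in> carrier A. (h \<otimes>\<^bsub>H\<^esub> k, f) \<in> \<Union>E \<and> act (f \<otimes> inv b) e = sec (tact t eF)}"
  have "?D = {f \<in> carrier A. (h \<otimes>\<^bsub>H\<^esub> k, f) \<in> \<Union>E} \<inter> {f \<in> carrier A. act f (act (inv b) e) = sec (tact t eF)}"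
    using b by (auto simp: act_mult)
  then have D: "?D \<in> sets Haar"
    using slice_sets_N2[OF hk ES] fibre_measurable[OF act_e[OF inv_closed[OF b]], of "\<lambda>x. x = sec (tact t eF)"] by auto
  have "Ufun {C \<in> C2.X. C #>\<^bsub>G2\<^esub> (k, b) \<in> E} x =
    emeasure Haar {f \<in> carrier A. (h, f) \<in> {x \<in> carrier G2. x \<otimes>\<^bsub>G2\<^esub> (k, b) \<in> \<Union>E} \<and> act f e = sec (tact t eF)}"
    unfolding Ufun_def kap_def C2.shift_preimage[OF kb EX] by (simp add: xe)
  also have "{f \<in> carrier A. (h, f) \<in> {x \<in> carrier G2. x \<otimes>\<^bsub>G2\<^esub> (k, b) \<in> \<Union>E} \<and> act f e = sec (tact t eF)} = {f \<in> carrier A. f \<otimes> b \<in> ?D}"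
    using b ht by (intro Collect_cong conj_cong HOL.refl) (simp add: m_assoc)
  also have "emeasure Haar \<dots> = emeasure Haar ?D" by (rule Haar_right(2)[OF b D])
  also have "\<dots> = (\<integral>\<^sup>+w. zeta E (inv b) (h \<otimes>\<^bsub>H\<^esub> k) (tact t eF) w \<partial>count_space (carrier F))"
    unfolding sum_over_fibres[OF D one_closed]
  proof (rule nn_integral_cong)
    fix w
    have "{f \<in> ?D. \<phi> (act (f \<otimes> \<one>) e) = w} = {f \<in> carrier A. (h \<otimes>\<^bsub>H\<^esub> k, f) \<in> \<Union>E \<and> act (f \<otimes> inv b) e = sec (tact t eF) \<and> \<phi> (act f e) = w}"
      by (simp add: conj_assoc cong: conj_cong)
    then show "emeasure Haar {f \<in> ?D. \<phi> (act (f \<otimes> \<one>) e) = w} = zeta E (inv b) (h \<otimes>\<^bsub>H\<^esub> k) (tact t eF) w"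
      by (simp only: zeta_def)
  qed
  also have "\<dots> = (\<integral>\<^sup>+w. zeta E (inv b) (h \<otimes>\<^bsub>H\<^esub> k) (tact t eF) (tact t w) \<partial>count_space (carrier F))"
    by (rule nn_integral_bij_count_space[OF tact_bij[OF ht(2)], symmetric])
  also have "\<dots> = (\<integral>\<^sup>+w. Zfun E (inv b) w (x \<otimes>\<^bsub>G1\<^esub> (k, \<one>\<^bsub>Tg\<^esub>)) \<partial>count_space (carrier F))"
    using ht by (intro nn_integral_cong) (simp add: Zfun_def xe)
  finally show ?thesis .
qed

text \<open>Here the mass is sorted by the point over which \<open>f \<otimes> c\<close> sends the
  base point, and \<open>fibre_exchange\<close> swaps the point prescribed exactly with the one
  prescribed only up to the kernel. The translation by the inverse of \<open>w\<close> sends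
  \<open>w\<close> to the base point and the base point to that inverse, which produces the
  right-hand factor.\<close>

lemma Ufun_exchange:
  assumes E: "openin Q2 E" and c: "c \<in> carrier A"
    and x: "x \<in> carrier G1"
  shows "Ufun E x =
    (\<integral>\<^sup>+w. Zfun E c w (x \<otimes>\<^bsub>G1\<^esub> (\<one>\<^bsub>H\<^esub>, lt (inv\<^bsub>F\<^esub> w))) \<partial>count_space (carrier F))"
proof -
  obtain h t where xe: "x = (h, t)" by (cases x)
  have ht: "h \<in> carrier H" "t \<in> carrier Tg" using x by (auto simp: xe)
  have ES: "E \<in> C2.S" using E by (auto intro: sigma_sets.Basic)
  have EX: "E \<subseteq> C2.X" using E by (simp add: C2.openin_coset)
  have te: "tact t eF \<in> carrier F" by (rule tact_closed[OF ht(2) F.one_closed])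
  have m: "{f \<in> carrier A. (h, f) \<in> \<Union>E} \<in> sets Haar" by (rule slice_sets_N2[OF ht(1) ES])
  let ?D = "{f \<in> carrier A. (h, f) \<in> \<Union>E \<and> act f e = sec (tact t eF)}"
  have "?D = {f \<in> carrier A. (h, f) \<in> \<Union>E} \<inter> {f \<in> carrier A. act f e = sec (tact t eF)}" by auto
  then have D: "?D \<in> sets Haar" using m fibre_measurable[of e "\<lambda>x. x = sec (tact t eF)"] by auto
  have bij: "bij_betw (\<lambda>w. tact t (inv\<^bsub>F\<^esub> w)) (carrier F) (carrier F)"
  proof -
    have "bij_betw (m_inv F) (carrier F) (carrier F)"
      by (rule bij_betwI[where g = "m_inv F"]) auto
    from bij_betw_trans[OF this tact_bij[OF ht(2)]] show ?thesis by (simp add: o_def)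
  qed
  have "Ufun E x = emeasure Haar ?D" by (simp add: Ufun_def kap_def xe)
  also have "\<dots> = (\<integral>\<^sup>+v. zeta E c h v (tact t eF) \<partial>count_space (carrier F))"
    unfolding sum_over_fibres[OF D c]
  proof (rule nn_integral_cong)
    fix v assume "v \<in> space (count_space (carrier F))"
    then have v: "v \<in> carrier F" by simp
    have "{f \<in> ?D. \<phi> (act (f \<otimes> c) e) = v} = {f \<in> carrier A. (h, f) \<in> \<Union>E \<and> \<phi> (act (f \<otimes> c) e) = \<phi> (sec v) \<and> act f e = sec (tact t eF)}"
      unfolding sec(2)[OF v] by (intro Collect_cong) (simp only: mem_Collect_eq conj_ac)
    then show "emeasure Haar {f \<in> ?D. \<phi> (act (f \<otimes> c) e) = v} = zeta E c h v (tact t eF)"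
      using fibre_exchange[OF EX m ht(1) c sec(1)[OF v] sec(1)[OF te]] by (simp only: zeta_def sec(2)[OF te])
  qed
  also have "\<dots> = (\<integral>\<^sup>+w. zeta E c h (tact t (inv\<^bsub>F\<^esub> w)) (tact t eF) \<partial>count_space (carrier F))"
    by (rule nn_integral_bij_count_space[OF bij, symmetric])
  also have "\<dots> = (\<integral>\<^sup>+w. Zfun E c w (x \<otimes>\<^bsub>G1\<^esub> (\<one>\<^bsub>H\<^esub>, lt (inv\<^bsub>F\<^esub> w))) \<partial>count_space (carrier F))"
  proof (rule nn_integral_cong)
    fix w assume "w \<in> space (count_space (carrier F))"
    then have w: "w \<in> carrier F" "inv\<^bsub>F\<^esub> w \<in> carrier F" by auto
    have "tact (t \<otimes>\<^bsub>Tg\<^esub> lt (inv\<^bsub>F\<^esub> w)) eF = tact t (inv\<^bsub>F\<^esub> w)" "tact (t \<otimes>\<^bsub>Tg\<^esub> lt (inv\<^bsub>F\<^esub> w)) w = tact t eF"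
      using tact_mult[OF ht(2) lt_closed[OF w(2)]] tact_lt[OF w(2)] w by simp_all
    then show "zeta E c h (tact t (inv\<^bsub>F\<^esub> w)) (tact t eF) = Zfun E c w (x \<otimes>\<^bsub>G1\<^esub> (\<one>\<^bsub>H\<^esub>, lt (inv\<^bsub>F\<^esub> w)))"
      using ht by (simp add: Zfun_def xe)
  qed
  finally show ?thesis .
qed

text \<open>A mass transport argument: \<open>Zfun E c w\<close> is integrated over the cosets once for each
  \<open>w\<close>, and the invariance of \<open>\<mu>\<close> under \<open>H\<close> and under the translations \<open>lt w\<close> moves mass from
  the fibre over \<open>w\<close> to the fibre over \<open>\<one>\<close>.\<close>

lemma finite_covolume_transfer:
  assumes "finite_covolume G1 T1 \<Gamma>"
  shows "finite_covolume G2 T2 \<Gamma>'"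
proof -
  obtain \<mu> :: "('h \<times> 't) set measure" where sp: "space \<mu> = C1.X" and st: "sets \<mu> = C1.S"
    and pos: "0 < emeasure \<mu> (space \<mu>)" and fin: "emeasure \<mu> (space \<mu>) < \<infinity>"
    and invm: "\<And>g E. g \<in> carrier G1 \<Longrightarrow> E \<in> sets \<mu> \<Longrightarrow> emeasure \<mu> ((\<lambda>C. C #>\<^bsub>G1\<^esub> g) ` E) = emeasure \<mu> E"
    using assms unfolding finite_covolume_def by (elim exE conjE) blast
  have ne: "space \<mu> \<noteq> {}" using C1.coset_in[OF C1.one_closed] unfolding sp by blast
  note km = kernel_measurable[OF st sp]
  \<comment> \<open>The average of the fibre measures over the cosets of \<open>\<Gamma>\<close>;
    since each has mass 1, the total mass is that of \<open>\<mu>\<close>.\<close>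
  define \<nu> where "\<nu> = \<mu> \<bind> kernel_measure"
  have s\<nu>: "sets \<nu> = C2.S" unfolding \<nu>_def using sets_bind[OF _ ne, of kernel_measure N2] sets_N2
    by (simp add: kernel_measure_def Let_def)
  have sp\<nu>: "space \<nu> = C2.X" using sets_eq_imp_space_eq[of \<nu> N2] s\<nu> sets_N2 space_N2 by simp
  have val: "emeasure \<nu> E = (\<integral>\<^sup>+C. Ufun E (SOME x. x \<in> C) \<partial>\<mu>)" if "E \<in> C2.S" for E
  proof -
    have "emeasure \<nu> E = (\<integral>\<^sup>+C. emeasure (kernel_measure C) E \<partial>\<mu>)"
      unfolding \<nu>_def by (rule emeasure_bind[OF ne km]) (simp only: sets_N2 that)
    also have "\<dots> = (\<integral>\<^sup>+C. Ufun E (SOME x. x \<in> C) \<partial>\<mu>)"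
      by (rule nn_integral_cong) (simp add: sp kernel_measure[OF _ that] Ufun_def)
    finally show ?thesis .
  qed
  have total: "emeasure \<nu> C2.X = emeasure \<mu> (space \<mu>)"
  proof -
    have "emeasure \<nu> C2.X = (\<integral>\<^sup>+C. 1 \<partial>\<mu>)" unfolding val[OF X2_S]
    proof (rule nn_integral_cong)
      fix C assume "C \<in> space \<mu>"
      then have "(SOME x. x \<in> C) \<in> carrier G1" using some_in sp by simp
      then show "Ufun C2.X (SOME x. x \<in> C) = 1"
        unfolding Ufun_def by (intro kap_all tact_closed) (simp_all add: mem_Times_iff)
    qed
    then show ?thesis by simp
  qed
  have key: "emeasure \<nu> {C \<in> C2.X. C #>\<^bsub>G2\<^esub> (k, b) \<in> E} = emeasure \<nu> E"
    if E: "openin Q2 E" and kb: "k \<in> carrier H" "b \<in> carrier A" for k b E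
  proof -
    let ?E' = "{C \<in> C2.X. C #>\<^bsub>G2\<^esub> (k, b) \<in> E}"
    let ?c = "inv b"
    have c: "?c \<in> carrier A" using kb by simp
    have E': "openin Q2 ?E'" by (rule C2.shift_open[OF _ E]) (use kb in simp)
    have k1: "(k, \<one>\<^bsub>Tg\<^esub>) \<in> carrier G1" using kb by simp
    have l1: "(\<one>\<^bsub>H\<^esub>, lt (inv\<^bsub>F\<^esub> w)) \<in> carrier G1" if "w \<in> carrier F" for w
      using lt_closed[of "inv\<^bsub>F\<^esub> w"] that by simp
    have meas: "(\<lambda>C. Zfun E ?c w ((SOME x. x \<in> C) \<otimes>\<^bsub>G1\<^esub> g)) \<in> borel_measurable \<mu>"
      if "w \<in> carrier F" "g \<in> carrier G1" for w g
      by (rule C1.descend_function(1)[OF C1.shift_invariant_lsc[OF Zfun(1,2)[OF E c that(1)] that(2)] st sp])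
    have "emeasure \<nu> ?E' = (\<integral>\<^sup>+C. Ufun ?E' (SOME x. x \<in> C) \<partial>\<mu>)"
      by (rule val) (use E' in \<open>auto intro: sigma_sets.Basic\<close>)
    also have "\<dots> = (\<integral>\<^sup>+C. (\<integral>\<^sup>+w. Zfun E ?c w ((SOME x. x \<in> C) \<otimes>\<^bsub>G1\<^esub> (k, \<one>\<^bsub>Tg\<^esub>)) \<partial>count_space (carrier F)) \<partial>\<mu>)"
      by (rule nn_integral_cong, rule Ufun_shift[OF E kb some_in]) (simp add: sp)
    also have "\<dots> = (\<integral>\<^sup>+w. (\<integral>\<^sup>+C. Zfun E ?c w ((SOME x. x \<in> C) \<otimes>\<^bsub>G1\<^esub> (k, \<one>\<^bsub>Tg\<^esub>)) \<partial>\<mu>) \<partial>count_space (carrier F))"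
      by (rule nn_integral_count_space_nn_integral[OF countable_F meas[OF _ k1]])
    \<comment> \<open>For each \<open>w\<close> both inner integrals equal the one without
      translation, because \<open>\<mu>\<close> is invariant. The translation may vary with
      \<open>w\<close>; this is the transport.\<close>
    also have "\<dots> = (\<integral>\<^sup>+w. (\<integral>\<^sup>+C. Zfun E ?c w ((SOME x. x \<in> C) \<otimes>\<^bsub>G1\<^esub> (\<one>\<^bsub>H\<^esub>, lt (inv\<^bsub>F\<^esub> w))) \<partial>\<mu>) \<partial>count_space (carrier F))"
    proof (rule nn_integral_cong)
      fix w assume "w \<in> space (count_space (carrier F))"
      then have w: "w \<in> carrier F" by simp
      have si: "(\<integral>\<^sup>+C. Zfun E ?c w ((SOME x. x \<in> C) \<otimes>\<^bsub>G1\<^esub> g) \<partial>\<mu>) = (\<integral>\<^sup>+C. Zfun E ?c w (SOME x. x \<in> C) \<partial>\<mu>)"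
        if "g \<in> carrier G1" for g
        by (rule C1.shift_integral[OF Zfun(1,2)[OF E c w] st sp invm]) (assumption | rule that)+
      show "(\<integral>\<^sup>+C. Zfun E ?c w ((SOME x. x \<in> C) \<otimes>\<^bsub>G1\<^esub> (k, \<one>\<^bsub>Tg\<^esub>)) \<partial>\<mu>) =
        (\<integral>\<^sup>+C. Zfun E ?c w ((SOME x. x \<in> C) \<otimes>\<^bsub>G1\<^esub> (\<one>\<^bsub>H\<^esub>, lt (inv\<^bsub>F\<^esub> w))) \<partial>\<mu>)"
        by (rule HOL.trans[OF si[OF k1] si[OF l1[OF w], symmetric]])
    qed
    also have "\<dots> = (\<integral>\<^sup>+C. (\<integral>\<^sup>+w. Zfun E ?c w ((SOME x. x \<in> C) \<otimes>\<^bsub>G1\<^esub> (\<one>\<^bsub>H\<^esub>, lt (inv\<^bsub>F\<^esub> w))) \<partial>count_space (carrier F)) \<partial>\<mu>)"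
      by (rule nn_integral_count_space_nn_integral[OF countable_F, symmetric]) (use meas l1 in simp)
    also have "\<dots> = (\<integral>\<^sup>+C. Ufun E (SOME x. x \<in> C) \<partial>\<mu>)"
      by (rule nn_integral_cong, rule Ufun_exchange[OF E c some_in, symmetric]) (simp add: sp)
    also have "\<dots> = emeasure \<nu> E" by (rule val[symmetric]) (use E in \<open>auto intro: sigma_sets.Basic\<close>)
    finally show ?thesis .
  qed
  have invn: "emeasure \<nu> ((\<lambda>C. C #>\<^bsub>G2\<^esub> g) ` E) = emeasure \<nu> E"
    if g: "g \<in> carrier G2" and E: "E \<in> sets \<nu>" for g E
  proof -
    let ?g = "inv\<^bsub>G2\<^esub> g"
    obtain k b where kb: "?g = (k, b)" "k \<in> carrier H" "b \<in> carrier A"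
      using C2.inv_closed[OF g] by (cases "?g") auto
    have g': "?g \<in> carrier G2" by (rule C2.inv_closed[OF g])
    note sm = C2.shift_measurable[OF g' s\<nu> sp\<nu>]
    have dv: "emeasure (distr \<nu> \<nu> (\<lambda>C. C #>\<^bsub>G2\<^esub> ?g)) E = emeasure \<nu> {C \<in> C2.X. C #>\<^bsub>G2\<^esub> ?g \<in> E}"
      if "E \<in> C2.S" for E
    proof -
      have "(\<lambda>C. C #>\<^bsub>G2\<^esub> ?g) -` E \<inter> space \<nu> = {C \<in> C2.X. C #>\<^bsub>G2\<^esub> ?g \<in> E}" using sp\<nu> by auto
      then show ?thesis using emeasure_distr[OF sm, of E] that s\<nu> by simp
    qed
    \<comment> \<open>Open sets are stable under intersection and generate, and the whole space is
      open and of finite mass, so agreement on open sets suffices.\<close>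
    have "\<nu> = distr \<nu> \<nu> (\<lambda>C. C #>\<^bsub>G2\<^esub> ?g)"
    proof (rule measure_eqI_generator_eq[where A = "\<lambda>i::nat. C2.X" and \<Omega> = C2.X])
      show "Int_stable {U. openin Q2 U}" by (auto intro!: Int_stableI)
      show "{U. openin Q2 U} \<subseteq> Pow C2.X" by (rule C2.open_coset_Pow)
      show "sets \<nu> = C2.S" "sets (distr \<nu> \<nu> (\<lambda>C. C #>\<^bsub>G2\<^esub> ?g)) = C2.S" using s\<nu> by simp_all
      show "range (\<lambda>i::nat. C2.X) \<subseteq> {U. openin Q2 U}" using X2_open by simp
      show "emeasure \<nu> C2.X \<noteq> \<infinity>" using total fin by auto
      fix E assume "E \<in> {U. openin Q2 U}"
      then have o: "openin Q2 E" by simp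
      then have "E \<in> C2.S" by (auto intro: sigma_sets.Basic)
      then show "emeasure \<nu> E = emeasure (distr \<nu> \<nu> (\<lambda>C. C #>\<^bsub>G2\<^esub> ?g)) E"
        using dv key[OF o kb(2,3)] kb(1) by simp
    qed simp
    then have "emeasure \<nu> E = emeasure (distr \<nu> \<nu> (\<lambda>C. C #>\<^bsub>G2\<^esub> ?g)) E" by (rule arg_cong)
    also have "\<dots> = emeasure \<nu> {C \<in> C2.X. C #>\<^bsub>G2\<^esub> ?g \<in> E}" using dv E s\<nu> by simp
    also have "{C \<in> C2.X. C #>\<^bsub>G2\<^esub> ?g \<in> E} = (\<lambda>C. C #>\<^bsub>G2\<^esub> g) ` E"
      using C2.shift_image[OF g, of E] sets.sets_into_space[OF E] sp\<nu> by simp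
    finally show ?thesis by simp
  qed
  show ?thesis unfolding finite_covolume_def
    using s\<nu> sp\<nu> total pos fin invn by (intro exI[of _ \<nu>] conjI ballI) simp_all
qed

text \<open>A neighbourhood in \<open>H\<close> together with a prescribed value at
  \<open>eF\<close> gives an open set of cosets of \<open>\<Gamma>\<close>, and finitely many of
  these cover. For each of them a compact set in \<open>H\<close> times one cylinder of level 0 has
  compact image among the cosets of \<open>\<Gamma>'\<close>, and \<open>over\<close> moves every
  coset representative into one of these products.\<close>

lemma compact_transfer:
  assumes c: "compact_space Q1" and lc: "locally_compact_space TH"
  shows "compact_space Q2"
proof -
  have "\<forall>h\<in>carrier H. \<exists>U K. openin TH U \<and> compactin TH K \<and> h \<in> U \<and> U \<subseteq> K"
    using lc unfolding locally_compact_space_def topspace_TH .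
  then obtain U K where UK: "\<And>h. h \<in> carrier H \<Longrightarrow> openin TH (U h) \<and> compactin TH (K h) \<and> h \<in> U h \<and> U h \<subseteq> K h"
    by metis
  define W where "W i = U (fst i) \<times> {t \<in> carrier Tg. tact t eF = snd i}" for i
  define W' where "W' i = {x \<in> carrier G1. \<exists>\<gamma>\<in>\<Gamma>. \<gamma> \<otimes>\<^bsub>G1\<^esub> x \<in> W i}" for i
  define \<O> where "\<O> i = {C \<in> C1.X. C \<subseteq> W' i}" for i
  let ?I = "carrier H \<times> carrier F"
  have openO: "openin Q1 (\<O> i)" and UO: "\<Union>(\<O> i) = W' i" if i: "i \<in> ?I" for i
  proof -
    have oW: "openin T1 (W i)"
      using UK[of "fst i"] open_tact[of eF "snd i"] i unfolding W_def by (simp add: openin_prod_Times_iff mem_Times_iff)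
    have "W' i = (\<Union>\<gamma>\<in>\<Gamma>. {x \<in> carrier G1. \<gamma> \<otimes>\<^bsub>G1\<^esub> x \<in> W i})" unfolding W'_def by blast
    moreover have "openin T1 \<dots>"
      by (rule openin_Union) (use C1.open_left[OF C1.\<Gamma>_carrier oW] in blast)
    ultimately have o: "openin T1 (W' i)" by simp
    have inv: "\<gamma> \<otimes>\<^bsub>G1\<^esub> x \<in> W' i" if g: "\<gamma> \<in> \<Gamma>" and x: "x \<in> W' i" for \<gamma> x
    proof -
      obtain \<delta> where d: "x \<in> carrier G1" "\<delta> \<in> \<Gamma>" "\<delta> \<otimes>\<^bsub>G1\<^esub> x \<in> W i" using x unfolding W'_def by blast
      note gc = C1.\<Gamma>_carrier[OF g] C1.\<Gamma>_carrier[OF d(2)]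
      let ?\<epsilon> = "\<delta> \<otimes>\<^bsub>G1\<^esub> inv\<^bsub>G1\<^esub> \<gamma>"
      have 1: "?\<epsilon> \<in> \<Gamma>" by (intro subgroup.m_closed[OF sub1] subgroup.m_inv_closed[OF sub1] g d(2))
      have "?\<epsilon> \<otimes>\<^bsub>G1\<^esub> (\<gamma> \<otimes>\<^bsub>G1\<^esub> x) = \<delta> \<otimes>\<^bsub>G1\<^esub> (inv\<^bsub>G1\<^esub> \<gamma> \<otimes>\<^bsub>G1\<^esub> (\<gamma> \<otimes>\<^bsub>G1\<^esub> x))"
        by (rule C1.m_assoc[OF gc(2) C1.inv_closed[OF gc(1)] C1.m_closed[OF gc(1) d(1)]])
      also have "\<dots> = \<delta> \<otimes>\<^bsub>G1\<^esub> x" by (simp only: C1.inv_solve_left' C1.m_assoc[symmetric] C1.l_inv C1.l_one gc d(1) C1.inv_closed)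
      finally show ?thesis unfolding W'_def using 1 d(3) C1.m_closed[OF gc(1) d(1)]
        by (intro CollectI conjI bexI[of _ ?\<epsilon>]) simp_all
    qed
    show "openin Q1 (\<O> i)" "\<Union>(\<O> i) = W' i"
      unfolding \<O>_def using C1.openin_quotient_image[OF o inv] by simp_all
  qed
  have "C1.X \<subseteq> \<Union>(\<O> ` ?I)"
  proof
    fix C assume C: "C \<in> C1.X"
    then obtain x where x: "x \<in> carrier G1" "C = \<Gamma> #>\<^bsub>G1\<^esub> x" by (auto simp: RCOSETS_def)
    obtain h t where xe: "x = (h, t)" by (cases x)
    have ht: "h \<in> carrier H" "t \<in> carrier Tg" using x by (auto simp: xe)
    let ?i = "(h, tact t eF)"
    have i: "?i \<in> ?I" using ht tact_closed[OF ht(2) F.one_closed] by simp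
    have "\<one>\<^bsub>G1\<^esub> \<otimes>\<^bsub>G1\<^esub> x \<in> W ?i" using UK[OF ht(1)] ht C1.l_one[OF x(1)] by (simp add: W_def xe)
    then have "x \<in> W' ?i" unfolding W'_def using x(1) subgroup.one_closed[OF sub1] by blast
    then obtain D where D: "D \<in> \<O> ?i" "x \<in> D" using UO[OF i] by blast
    then have "D = C" using C1.coset_eq[of D x] x(2) by (simp add: \<O>_def)
    then show "C \<in> \<Union>(\<O> ` ?I)" using D i by blast
  qed
  moreover have "compactin Q1 C1.X" using c unfolding compact_space_def C1.topspace_coset .
  ultimately have "\<exists>\<F>. finite \<F> \<and> \<F> \<subseteq> \<O> ` ?I \<and> C1.X \<subseteq> \<Union>\<F>"
    by (intro compactinD) (use openO in auto)
  then obtain \<F> where F: "finite \<F>" "\<F> \<subseteq> \<O> ` ?I" "C1.X \<subseteq> \<Union>\<F>" by (elim exE conjE)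
  obtain J where J': "J \<subseteq> ?I" "finite J" "\<F> = \<O> ` J" using finite_subset_image[OF F(1,2)] by (elim exE conjE)
  then have J: "finite J" "J \<subseteq> ?I" "C1.X \<subseteq> \<Union>(\<O> ` J)" using F(3) by simp_all
  define Q where "Q i = (\<lambda>x. \<Gamma>' #>\<^bsub>G2\<^esub> x) ` (K (fst i) \<times> cyl (reg (sec (snd i))) 0)" for i
  have cQ: "compactin Q2 (Q i)" if "i \<in> J" for i
  proof -
    have i: "fst i \<in> carrier H" "snd i \<in> carrier F" using that J(2) by (auto simp: mem_Times_iff)
    show ?thesis unfolding Q_def
      by (rule image_compactin[OF _ C2.continuous_quotient])
        (use UK[OF i(1)] compact_cyl0[OF reg_closed[OF sec(1)[OF i(2)]]] in \<open>simp add: compactin_Times\<close>)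
  qed
  have "compactin Q2 (\<Union>(Q ` J))"
    by (rule compactin_Union) (use J(1) cQ in auto)
  moreover have "\<Union>(Q ` J) = C2.X"
  proof
    show "\<Union>(Q ` J) \<subseteq> C2.X" using cQ compactin_subset_topspace unfolding C2.topspace_coset[symmetric] by blast
    show "C2.X \<subseteq> \<Union>(Q ` J)"
    proof
      fix C assume "C \<in> C2.X"
      then obtain h f where hf: "h \<in> carrier H" "f \<in> carrier A" "C = \<Gamma>' #>\<^bsub>G2\<^esub> (h, f)" by (auto simp: RCOSETS_def)
      have fe: "act f e \<in> V" by (rule act_e[OF hf(2)])
      \<comment> \<open>\<open>f\<close> itself has no image in \<open>Tg\<close>. The translation
        \<open>lt v\<close>, which takes the same value over the base point, stands in for it, and
        membership in \<open>W i\<close> depends on that value only.\<close>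
      define v where "v = \<phi> (act f e)"
      have v: "v \<in> carrier F" unfolding v_def by (rule phi_closed[OF fe])
      have x: "(h, lt v) \<in> carrier G1" using hf lt_closed[OF v] by simp
      obtain i where i: "i \<in> J" "\<Gamma> #>\<^bsub>G1\<^esub> (h, lt v) \<in> \<O> i" using J(3) C1.coset_in[OF x] by blast
      have i': "fst i \<in> carrier H" "snd i \<in> carrier F" using i J(2) by (auto simp: mem_Times_iff)
      have "(h, lt v) \<in> W' i" using i(2) C1.self_coset[OF x] by (auto simp: \<O>_def)
      then obtain k s where g: "(k, s) \<in> \<Gamma>" "(k, s) \<otimes>\<^bsub>G1\<^esub> (h, lt v) \<in> W i" unfolding W'_def by auto
      have ks: "k \<in> carrier H" "s \<in> carrier Tg" using Gamma_carrier[OF g(1)] by auto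
      have U: "k \<otimes>\<^bsub>H\<^esub> h \<in> U (fst i)" and "tact (s \<otimes>\<^bsub>Tg\<^esub> lt v) eF = snd i" using g(2) by (auto simp: W_def)
      then have sv: "tact s (\<phi> (act f e)) = \<phi> (sec (snd i))"
        using tact_mult[OF ks(2) lt_closed[OF v] F.one_closed] tact_lt[OF v F.one_closed] v sec(2)[OF i'(2)] by (simp add: v_def)
      obtain f0 where f0: "(k, f0) \<in> \<Gamma>'" "act f0 (act f e) = sec (snd i)"
        using over[OF g(1) fe sec(1)[OF i'(2)] sv] by blast
      have f0A: "f0 \<in> carrier A" using Gamma'_carrier[OF f0(1)] by simp
      have "f0 \<otimes> f \<in> cyl (reg (sec (snd i))) 0"
        using f0(2) f0A hf(2) act_mult[OF f0A hf(2), of e] act_reg[of "sec (snd i)" e] sec(1)[OF i'(2)] by (simp add: cyl_def Bn_0)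
      moreover have "k \<otimes>\<^bsub>H\<^esub> h \<in> K (fst i)" using U UK[OF i'(1)] by blast
      ultimately have "\<Gamma>' #>\<^bsub>G2\<^esub> (k \<otimes>\<^bsub>H\<^esub> h, f0 \<otimes> f) \<in> Q i" unfolding Q_def by (intro imageI SigmaI)
      moreover have "\<Gamma>' #>\<^bsub>G2\<^esub> (k \<otimes>\<^bsub>H\<^esub> h, f0 \<otimes> f) = C"
        using C2.coset_left[OF f0(1), of "(h, f)"] hf by simp
      ultimately show "C \<in> \<Union>(Q ` J)" using i(1) by blast
    qed
  qed
  ultimately show ?thesis unfolding compact_space_def C2.topspace_coset by simp
qed

text \<open>The neighbourhood asks that the part in \<open>H\<close> is near the identity, that the
  base point is fixed, and that finitely many points of \<open>F\<close> are fixed below. A lift in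
  it covers an element of \<open>\<Gamma>\<close> near the identity, hence the identity, and is
  trivial by \<open>rigid\<close>.\<close>

lemma discrete_transfer:
  assumes "discrete_in T1 \<Gamma>" shows "discrete_in T2 \<Gamma>'"
proof -
  obtain U where U: "openin T1 U" "U \<inter> \<Gamma> = {\<one>\<^bsub>G1\<^esub>}"
    using C1.discrete_inD[OF assms subgroup.one_closed[OF sub1]] .
  have "(\<one>\<^bsub>H\<^esub>, \<one>\<^bsub>Tg\<^esub>) \<in> U" using U(2) by auto
  then have "\<exists>W O'. openin TH W \<and> openin TT O' \<and> \<one>\<^bsub>H\<^esub> \<in> W \<and> \<one>\<^bsub>Tg\<^esub> \<in> O' \<and> W \<times> O' \<subseteq> U"
    using U(1) unfolding openin_prod_topology_alt by simp
  then obtain W O' where W: "openin TH W" "openin TT O'" "\<one>\<^bsub>H\<^esub> \<in> W" "\<one>\<^bsub>Tg\<^esub> \<in> O'" "W \<times> O' \<subseteq> U" by (elim exE conjE)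
  obtain S where S: "finite S" "S \<subseteq> carrier F"
    "\<forall>t'\<in>carrier Tg. (\<forall>v\<in>S. tact t' v = tact \<one>\<^bsub>Tg\<^esub> v) \<longrightarrow> t' \<in> O'"
    using open_TT[OF W(2,4)] by (elim exE conjE)
  let ?O = "{f \<in> carrier A. act f e = e} \<inter> (\<Inter>v\<in>S. {f \<in> carrier A. \<phi> (act f (sec v)) = v}) \<inter> topspace TA"
  have "openin TA (\<Inter>v\<in>S. {f \<in> carrier A. \<phi> (act f (sec v)) = v})" if "S \<noteq> {}"
    by (rule openin_Inter) (use S that open_act[of "sec v" "\<lambda>x. \<phi> x = v" for v] sec(1) in auto)
  then have oO: "openin TA ?O" using open_act[of e "\<lambda>x. x = e"] by (cases "S = {}") auto
  show ?thesis
  proof (rule C2.discrete_inI[OF sub2, of "W \<times> ?O"])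
    show "openin T2 (W \<times> ?O)" using W(1) oO by (simp only: openin_prod_Times_iff simp_thms)
    have "act \<one> v = v" if "v \<in> V" for v using act_one that by simp
    then show "\<one>\<^bsub>G2\<^esub> \<in> W \<times> ?O" using W(3) S(2) sec by (auto simp: topspace_TA subset_iff)
    fix x assume x: "x \<in> W \<times> ?O" "x \<in> \<Gamma>'"
    obtain h f where xe: "x = (h, f)" by (cases x)
    have hf: "h \<in> W" "f \<in> carrier A" "act f e = e" "\<forall>v\<in>S. \<phi> (act f (sec v)) = v" using x(1) by (auto simp: xe)
    obtain t where t: "(h, t) \<in> \<Gamma>" "\<forall>a\<in>V. \<phi> (act f a) = tact t (\<phi> a)" using under[of h f] x(2) unfolding xe by meson
    have tT: "t \<in> carrier Tg" using Gamma_carrier[OF t(1)] by simp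
    have "tact t v = tact \<one>\<^bsub>Tg\<^esub> v" if "v \<in> S" for v
    proof -
      have v: "v \<in> carrier F" using that S(2) by blast
      have "tact t (\<phi> (sec v)) = \<phi> (act f (sec v))" using t(2) sec(1)[OF v] by simp
      then show ?thesis using hf(4) that sec(2)[OF v] tact_one[OF v] by simp
    qed
    then have "t \<in> O'" using S(3) tT by blast
    then have "(h, t) \<in> U \<inter> \<Gamma>" using W(5) hf(1) t(1) by blast
    then have "h = \<one>\<^bsub>H\<^esub>" "t = \<one>\<^bsub>Tg\<^esub>" using U(2) by auto
    moreover have "f = \<one>"
    proof (rule rigid)
      show "(\<one>\<^bsub>H\<^esub>, f) \<in> \<Gamma>'" using x(2) xe \<open>h = \<one>\<^bsub>H\<^esub>\<close> by simp
      show "\<forall>a\<in>V. \<phi> (act f a) = \<phi> a" using t(2) \<open>t = \<one>\<^bsub>Tg\<^esub>\<close> tact_one phi_closed by simp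
    qed (rule hf(3))
    ultimately show "x = \<one>\<^bsub>G2\<^esub>" by (simp add: xe)
  qed
qed

lemma locally_compact_factor:
  assumes "locally_compact_group G1 T1"
  shows "locally_compact_space TH" "Hausdorff_space TH"
proof -
  have ne: "\<one>\<^bsub>H\<^esub> \<in> topspace TH" "\<one>\<^bsub>Tg\<^esub> \<in> topspace TT" by (simp_all add: topspace_TH topspace_TT)
  then have "T1 \<noteq> trivial_topology" by auto
  then show "locally_compact_space TH" "Hausdorff_space TH"
    using assms ne unfolding locally_compact_group_def
    by (auto simp: locally_compact_space_prod_topology Hausdorff_space_prod_topology)
qed

lemma locally_compact_transfer:
  assumes "locally_compact_group G1 T1"
  shows "locally_compact_group G2 T2"
  using locally_compact_factor[OF assms] tg2 Hausdorff_TA locally_compact_TA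
  by (simp add: locally_compact_group_def locally_compact_space_prod_topology Hausdorff_space_prod_topology)

lemma lattice_transfer:
  assumes "lattice_in G1 T1 \<Gamma>" shows "lattice_in G2 T2 \<Gamma>'"
  using assms locally_compact_transfer discrete_transfer finite_covolume_transfer sub2 by (simp add: lattice_in_def)

lemma uniform_lattice_transfer:
  assumes "uniform_lattice_in G1 T1 \<Gamma>" shows "uniform_lattice_in G2 T2 \<Gamma>'"
  using assms lattice_transfer compact_transfer locally_compact_factor(1)
  by (auto simp: uniform_lattice_in_def lattice_in_def)

end

section \<open>The automorphism group of the universal cover as a permutation group\<close>

context flag
begin

lemma cauts_inverse: assumes "f \<in> cauts"
  shows "restrict (inv_into CP f) CP \<in> cauts"
    "p \<in> CP \<Longrightarrow> restrict (inv_into CP f) CP (f p) = p" "p \<in> CP \<Longrightarrow> f (restrict (inv_into CP f) CP p) = p"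
proof -
  note B = cauts_Bij[OF assms]
  show "restrict (inv_into CP f) CP \<in> cauts"
    using subgroup.m_inv_closed[OF subgroup_cauts assms] by (simp add: BijGroup_inv B)
  show "p \<in> CP \<Longrightarrow> restrict (inv_into CP f) CP (f p) = p" by (rule Bij_inv_left[OF B])
  show "p \<in> CP \<Longrightarrow> f (restrict (inv_into CP f) CP p) = p" using inv_into_Bij[OF B] by simp
qed

text \<open>Apply \<open>cubical_fix_vertices\<close> to one automorphism followed by the inverse of
  the other.\<close>

lemma agree_cube:
  assumes f: "f \<in> cauts" and h: "h \<in> cauts" and g: "g \<in> AL" and \<sigma>: "\<sigma> \<in> L"
    and eq: "\<And>\<tau>. \<tau> \<subseteq> \<sigma> \<Longrightarrow> act f (g \<cdot> sp \<tau>) = act h (g \<cdot> sp \<tau>)" and s: "s \<in> unit_cube \<sigma>"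
  shows "f (cm g s) = h (cm g s)"
proof -
  let ?i = "restrict (inv_into CP h) CP"
  have "?i (f (cm g s)) = cm g s"
  proof (rule cubical_fix_vertices[OF cubical_comp[OF cauts_cubical[OF cauts_inverse(1)[OF h]] cauts_cubical[OF f]] g \<sigma> _ s])
    fix \<tau> assume t: "\<tau> \<subseteq> \<sigma>"
    then have v: "g \<cdot> sp \<tau> \<in> AL" using g \<sigma> simplex_subset by (intro A.m_closed sp_closed)
    have "f (g \<cdot> sp \<tau>, \<lambda>_. 0) = h (g \<cdot> sp \<tau>, \<lambda>_. 0)" using cauts_vertex(1)[OF f v] cauts_vertex(1)[OF h v] eq[OF t] by simp
    then show "?i (f (g \<cdot> sp \<tau>, \<lambda>_. 0)) = (g \<cdot> sp \<tau>, \<lambda>_. 0)" using cauts_inverse(2)[OF h, of "(g \<cdot> sp \<tau>, \<lambda>_. 0)"] v by simp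
  qed
  then have "h (?i (f (cm g s))) = h (cm g s)" by (rule arg_cong)
  moreover have "f (cm g s) \<in> CP" by (rule Bij_mem[OF cauts_Bij[OF f] cm_in_CP[OF g \<sigma> s]])
  ultimately show ?thesis using cauts_inverse(3)[OF h] by simp
qed

definition regular :: "'v word set \<Rightarrow> 'v cover_point \<Rightarrow> 'v cover_point" where
  "regular a = restrict (trans a) CP"

lemma cubical_trans: assumes "a \<in> AL" shows "cubical (regular a)"
  unfolding cubical_def
proof (intro ballI)
  fix g \<sigma> assume *: "g \<in> AL" "\<sigma> \<in> L"
  show "\<exists>g'\<in>AL. \<exists>\<sigma>'\<in>L. \<exists>\<theta>. (\<forall>s\<in>unit_cube \<sigma>. \<theta> s \<in> unit_cube \<sigma>') \<and>
     (\<forall>s\<in>unit_cube \<sigma>. \<forall>t\<in>unit_cube \<sigma>. cube_dist L (\<theta> s) (\<theta> t) = cube_dist L s t) \<and>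
     (\<forall>s\<in>unit_cube \<sigma>. regular a (cm g s) = cm g' (\<theta> s))"
    by (rule bexI[of _ "a \<cdot> g"], rule bexI[of _ \<sigma>], rule exI[of _ "\<lambda>s. s"])
      (use * assms in \<open>simp_all add: regular_def cm_in_CP trans_cm\<close>)
qed

lemma regular_cube: assumes "a \<in> AL" "C \<in> cover_cubes L" shows "regular a ` C \<in> cover_cubes L"
proof -
  obtain g \<sigma> where C: "g \<in> AL" "\<sigma> \<in> L" "C = cube g \<sigma>" using assms(2) unfolding cover_cubes_eq by blast
  have "regular a ` C = cube (a \<cdot> g) \<sigma>"
    unfolding C(3) cube_def image_image
    by (rule image_cong) (use C assms(1) in \<open>simp_all add: regular_def cm_in_CP trans_cm\<close>)
  then show ?thesis using assms(1) C(1,2) A.m_closed unfolding cover_cubes_eq by blast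
qed

lemma regular_inverse: "a \<in> AL \<Longrightarrow> p \<in> CP \<Longrightarrow> regular a (regular (ainv a) p) = p"
  by (simp add: regular_def trans_trans)

lemma regular_cauts: assumes a: "a \<in> AL" shows "regular a \<in> cauts"
proof (rule cautsI[where h = "regular (ainv a)"])
  have i: "ainv a \<in> AL" using a by simp
  show "regular a \<in> extensional CP" by (simp add: regular_def)
  show "\<And>p. p \<in> CP \<Longrightarrow> regular a (regular (ainv a) p) = p" by (rule regular_inverse[OF a])
  show "\<And>p. p \<in> CP \<Longrightarrow> regular (ainv a) (regular a p) = p" using regular_inverse[OF i] a by simp
  show "cubical (regular a)" "cubical (regular (ainv a))" using cubical_trans a i by auto
  show "\<And>C. C \<in> cover_cubes L \<Longrightarrow> regular a ` C \<in> cover_cubes L" by (rule regular_cube[OF a])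
  show "\<And>C. C \<in> cover_cubes L \<Longrightarrow> regular (ainv a) ` C \<in> cover_cubes L" by (rule regular_cube[OF i])
qed

lemma act_regular: "a \<in> AL \<Longrightarrow> v \<in> AL \<Longrightarrow> act (regular a) v = a \<cdot> v"
  by (simp add: act_def regular_def trans_def)

section \<open>Finite balls of vertices\<close>

definition nbhd :: "'v word set \<Rightarrow> 'v word set set" where
  "nbhd v = {w \<in> AL. \<exists>C\<in>cover_cubes L. (v, \<lambda>_. 0) \<in> C \<and> (w, \<lambda>_. 0) \<in> C}"

lemma vertex_in_cube: assumes "g \<in> AL" "\<sigma> \<in> L"
  shows "(v, \<lambda>_. 0) \<in> cube g \<sigma> \<longleftrightarrow> (\<exists>\<tau>\<subseteq>\<sigma>. v = g \<cdot> sp \<tau>)"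
proof
  assume "(v, \<lambda>_. 0) \<in> cube g \<sigma>"
  then obtain s where "s \<in> unit_cube \<sigma>" "(v, \<lambda>_. 0) = cm g s" unfolding cube_def by blast
  then show "\<exists>\<tau>\<subseteq>\<sigma>. v = g \<cdot> sp \<tau>" using ones_subset[of s \<sigma>] unfolding cm_def by (intro exI[of _ "ones s"]) simp
next
  assume "\<exists>\<tau>\<subseteq>\<sigma>. v = g \<cdot> sp \<tau>"
  then obtain \<tau> where "\<tau> \<subseteq> \<sigma>" "v = g \<cdot> sp \<tau>" by blast
  then show "(v, \<lambda>_. 0) \<in> cube g \<sigma>" unfolding cube_def
    by (intro image_eqI[OF _ indic_unit_cube[of \<tau> \<sigma>]]) (simp_all add: cm_indic)
qed

text \<open>Two vertices of one cube are related by going back along one simplex to the initial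
  vertex and forward along another, and \<open>L\<close> is finite.\<close>

lemma finite_nbhd: assumes v: "v \<in> AL" shows "finite (nbhd v)"
proof (rule finite_subset)
  show "nbhd v \<subseteq> (\<lambda>(\<tau>, \<tau>'). v \<cdot> ainv (sp \<tau>) \<cdot> sp \<tau>') ` (L \<times> L)"
  proof
    fix w assume "w \<in> nbhd v"
    then obtain g \<sigma> where *: "g \<in> AL" "\<sigma> \<in> L" "(v, \<lambda>_. 0) \<in> cube g \<sigma>" "(w, \<lambda>_. 0) \<in> cube g \<sigma>"
      unfolding nbhd_def cover_cubes_eq by blast
    obtain \<tau> where t: "\<tau> \<subseteq> \<sigma>" "v = g \<cdot> sp \<tau>" using *(3) unfolding vertex_in_cube[OF *(1,2)] by blast
    obtain \<tau>' where t': "\<tau>' \<subseteq> \<sigma>" "w = g \<cdot> sp \<tau>'" using *(4) unfolding vertex_in_cube[OF *(1,2)] by blast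
    have tL: "\<tau> \<in> L" "\<tau>' \<in> L" using t(1) t'(1) *(2) simplex_subset by auto
    then have "w = v \<cdot> ainv (sp \<tau>) \<cdot> sp \<tau>'" using t(2) t'(2) *(1) by (simp add: A.m_assoc)
    then show "w \<in> (\<lambda>(\<tau>, \<tau>'). v \<cdot> ainv (sp \<tau>) \<cdot> sp \<tau>') ` (L \<times> L)" using tL by (intro image_eqI[of _ _ "(\<tau>, \<tau>')"]) simp_all
  qed
  show "finite ((\<lambda>(\<tau>, \<tau>'). v \<cdot> ainv (sp \<tau>) \<cdot> sp \<tau>') ` (L \<times> L))" using finite_L by simp
qed

lemma nbhd_act: assumes f: "f \<in> cauts" and v: "v \<in> AL" and w: "w \<in> nbhd v" shows "act f w \<in> nbhd (act f v)"
proof -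
  obtain C where C: "w \<in> AL" "C \<in> cover_cubes L" "(v, \<lambda>_. 0) \<in> C" "(w, \<lambda>_. 0) \<in> C" using w unfolding nbhd_def by blast
  have "f ` C \<in> (\<lambda>C. f ` C) ` cover_cubes L" using C(2) by (rule imageI)
  then have 1: "f ` C \<in> cover_cubes L" using f unfolding cauts_def by simp
  have 2: "(act f v, \<lambda>_. 0) \<in> f ` C" by (rule image_eqI[OF _ C(3)]) (rule cauts_vertex(1)[OF f v, symmetric])
  have 3: "(act f w, \<lambda>_. 0) \<in> f ` C" by (rule image_eqI[OF _ C(4)]) (rule cauts_vertex(1)[OF f C(1), symmetric])
  show ?thesis unfolding nbhd_def by (rule CollectI, rule conjI[OF cauts_vertex(2)[OF f C(1)]], rule bexI[of _ "f ` C"], rule conjI[OF 2 3], rule 1)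
qed

lemma nbhd_gen: assumes "v \<in> AL" "x \<in> V" shows "v \<cdot> gen x \<in> nbhd v" "v \<in> nbhd (v \<cdot> gen x)"
proof -
  have 1: "(v, \<lambda>_. 0) \<in> cube v {x}"
    unfolding vertex_in_cube[OF assms(1) vertex_simplex[OF assms(2)]] by (rule exI[of _ "{}"]) (simp add: assms)
  have 2: "(v \<cdot> gen x, \<lambda>_. 0) \<in> cube v {x}"
    unfolding vertex_in_cube[OF assms(1) vertex_simplex[OF assms(2)]] by (rule exI[of _ "{x}"]) (simp add: assms)
  have 3: "cube v {x} \<in> cover_cubes L"
    unfolding cover_cubes_eq by (rule CollectI, rule exI[of _ v], rule exI[of _ "{x}"]) (simp add: assms vertex_simplex)
  show "v \<cdot> gen x \<in> nbhd v" "v \<in> nbhd (v \<cdot> gen x)" unfolding nbhd_def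
    by (rule CollectI, rule conjI, use assms in simp, rule bexI[of _ "cube v {x}"], rule conjI[OF 1 2], rule 3)
      (rule CollectI, rule conjI, use assms in simp, rule bexI[of _ "cube v {x}"], rule conjI[OF 2 1], rule 3)
qed

text \<open>Balls for the relation of lying in a common cube. Automorphisms permute cubes and so
  respect this relation; it contains all edges, so the balls exhaust the vertices.\<close>

primrec vball :: "nat \<Rightarrow> 'v word set set" where
  "vball 0 = {\<one>\<^sub>L}"
| "vball (Suc n) = vball n \<union> (\<Union>v\<in>vball n. nbhd v)"

lemma vball_AL: "vball n \<subseteq> AL"
  by (induction n) (auto simp: nbhd_def)

lemma finite_vball: "finite (vball n)"
  by (induction n) (use vball_AL in \<open>auto intro!: finite_nbhd\<close>)

lemma vball_act: assumes f: "f \<in> cauts" "act f \<one>\<^sub>L = \<one>\<^sub>L" shows "v \<in> vball n \<Longrightarrow> act f v \<in> vball n"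
proof (induction n arbitrary: v)
  case (Suc n)
  show ?case
  proof (cases "v \<in> vball n")
    case False
    then obtain u where u: "u \<in> vball n" "v \<in> nbhd u" using Suc.prems by auto
    have "act f v \<in> nbhd (act f u)" using nbhd_act[OF f(1) _ u(2)] u(1) vball_AL by blast
    then show ?thesis using Suc.IH[OF u(1)] by auto
  qed (use Suc.IH in simp)
qed (use f in simp)

lemma vball_Union: "(\<Union>n. vball n) = AL"
proof
  show "(\<Union>n. vball n) \<subseteq> AL" using vball_AL by blast
  show "AL \<subseteq> (\<Union>n. vball n)"
  proof
    fix g assume "g \<in> AL"
    then have "\<exists>n. g \<in> vball n"
    proof (induction g rule: raag_induct)
      case one
      show ?case by (rule exI[of _ 0]) simp
    next
      case (mult g x)
      then obtain n where "g \<in> vball n" by blast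
      then have "g \<cdot> gen x \<in> vball (Suc n)" using nbhd_gen(1)[of g x] mult Union_L by auto
      then show ?case ..
    next
      case (inv_mult g x)
      then obtain n where n: "g \<in> vball n" by blast
      have x: "x \<in> V" using inv_mult Union_L by simp
      have "g \<cdot> ainv (gen x) \<in> nbhd (g \<cdot> ainv (gen x) \<cdot> gen x)" by (rule nbhd_gen(2)) (use x inv_mult in simp_all)
      moreover have "g \<cdot> ainv (gen x) \<cdot> gen x = g" using x inv_mult by (simp add: A.m_assoc)
      ultimately have "g \<cdot> ainv (gen x) \<in> vball (Suc n)" using n by auto
      then show ?case ..
    qed
    then show "g \<in> (\<Union>n. vball n)" by blast
  qed
qed

lemma vball_le: "n \<le> m \<Longrightarrow> vball n \<subseteq> vball m"
  by (rule lift_Suc_mono_le[of vball]) auto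

lemma finite_in_vball: assumes "finite S" "S \<subseteq> AL" shows "\<exists>n. S \<subseteq> vball n"
  using assms
proof induction
  case (insert v S)
  then obtain n where "S \<subseteq> vball n" by auto
  have "v \<in> (\<Union>n. vball n)" using insert.prems vball_Union by simp
  then obtain m where "v \<in> vball m" by blast
  note \<open>S \<subseteq> vball n\<close> this
  then have "insert v S \<subseteq> vball (max n m)" using vball_le[of n "max n m"] vball_le[of m "max n m"] by auto
  then show ?case ..
qed simp

section \<open>Pointwise limits of automorphisms\<close>

lemma eventually_on_cube:
  fixes f :: "nat \<Rightarrow> 'v cover_point \<Rightarrow> 'v cover_point"
  assumes f: "\<forall>n. f n \<in> cauts" and ev: "\<forall>v\<in>AL. \<forall>\<^sub>F n in sequentially. act (f n) v = p v"
    and g: "g \<in> AL" and \<sigma>: "\<sigma> \<in> L"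
  shows "\<exists>N. \<forall>n\<ge>N. \<forall>s\<in>unit_cube \<sigma>. f n (cm g s) = f N (cm g s)"
proof -
  have "\<forall>\<^sub>F n in sequentially. \<forall>\<tau>\<in>Pow \<sigma>. act (f n) (g \<cdot> sp \<tau>) = p (g \<cdot> sp \<tau>)"
    using finite_simplex[OF \<sigma>] g \<sigma> simplex_subset by (intro eventually_ball_finite ballI ev[rule_format]) auto
  then obtain N where "\<forall>n\<ge>N. \<forall>\<tau>\<in>Pow \<sigma>. act (f n) (g \<cdot> sp \<tau>) = p (g \<cdot> sp \<tau>)"
    unfolding eventually_sequentially ..
  then have N: "\<And>n \<tau>. n \<ge> N \<Longrightarrow> \<tau> \<subseteq> \<sigma> \<Longrightarrow> act (f n) (g \<cdot> sp \<tau>) = p (g \<cdot> sp \<tau>)" by simp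
  show ?thesis
  proof (intro exI[of _ N] allI ballI impI)
    fix n s assume *: "n \<ge> N" "s \<in> unit_cube \<sigma>"
    show "f n (cm g s) = f N (cm g s)"
      by (rule agree_cube[OF f[rule_format] f[rule_format] g \<sigma> _ *(2)]) (use N[OF *(1)] N[of N] in simp)
  qed
qed

text \<open>The eventual value rather than a metric limit: a cube has finitely many corners, so the
  approximants agree on the whole cube from some index on.\<close>

definition evlim :: "(nat \<Rightarrow> 'v cover_point \<Rightarrow> 'v cover_point) \<Rightarrow> 'v cover_point \<Rightarrow> 'v cover_point" where
  "evlim f q = (THE y. \<forall>\<^sub>F n in sequentially. f n q = y)"

lemma evlim_eq: assumes "\<forall>\<^sub>F n in sequentially. f n q = y" shows "evlim f q = y"
  unfolding evlim_def
proof (rule the_equality[where P = "\<lambda>y. \<forall>\<^sub>F n in sequentially. f n q = y", OF assms])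
  fix z assume "\<forall>\<^sub>F n in sequentially. f n q = z"
  then have "\<forall>\<^sub>F n in sequentially. z = y" using assms by eventually_elim simp
  then show "z = y" by simp
qed

lemma evlim:
  assumes f: "\<forall>n. f n \<in> cauts" and ev: "\<forall>v\<in>AL. \<forall>\<^sub>F n in sequentially. act (f n) v = p v"
  shows "\<And>q. q \<in> CP \<Longrightarrow> \<forall>\<^sub>F n in sequentially. f n q = evlim f q" "cubical (evlim f)"
    "\<And>C. C \<in> cover_cubes L \<Longrightarrow> evlim f ` C \<in> cover_cubes L" "\<And>v. v \<in> AL \<Longrightarrow> act (evlim f) v = p v"
proof -
  have on_cube: "\<exists>N. \<forall>s\<in>unit_cube \<sigma>. evlim f (cm g s) = f N (cm g s) \<and> (\<forall>\<^sub>F n in sequentially. f n (cm g s) = evlim f (cm g s))"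
    if gs: "g \<in> AL" "\<sigma> \<in> L" for g \<sigma>
  proof -
    obtain N where N: "\<forall>n\<ge>N. \<forall>s\<in>unit_cube \<sigma>. f n (cm g s) = f N (cm g s)"
      using eventually_on_cube[OF f ev gs] ..
    have "evlim f (cm g s) = f N (cm g s) \<and> (\<forall>\<^sub>F n in sequentially. f n (cm g s) = evlim f (cm g s))" if "s \<in> unit_cube \<sigma>" for s
    proof -
      have e: "\<forall>\<^sub>F n in sequentially. f n (cm g s) = f N (cm g s)"
        unfolding eventually_sequentially by (rule exI[of _ N]) (use N that in blast)
      show ?thesis unfolding evlim_eq[of f, OF e] by (rule conjI[OF HOL.refl e])
    qed
    then show ?thesis by blast
  qed
  show "\<forall>\<^sub>F n in sequentially. f n q = evlim f q" if q: "q \<in> CP" for q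
  proof -
    obtain g \<sigma> s where *: "g \<in> AL" "\<sigma> \<in> L" "s \<in> unit_cube \<sigma>" "q = cm g s" using point_in_some_cube[OF q] .
    show ?thesis using on_cube[OF *(1,2)] *(3) unfolding *(4) by blast
  qed
  show "cubical (evlim f)"
    unfolding cubical_def
  proof (intro ballI)
    fix g \<sigma> assume *: "g \<in> AL" "\<sigma> \<in> L"
    obtain N where N: "\<forall>s\<in>unit_cube \<sigma>. evlim f (cm g s) = f N (cm g s)" using on_cube[OF *] by blast
    show "\<exists>g'\<in>AL. \<exists>\<sigma>'\<in>L. \<exists>\<theta>. (\<forall>s\<in>unit_cube \<sigma>. \<theta> s \<in> unit_cube \<sigma>') \<and>
       (\<forall>s\<in>unit_cube \<sigma>. \<forall>t\<in>unit_cube \<sigma>. cube_dist L (\<theta> s) (\<theta> t) = cube_dist L s t) \<and>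
       (\<forall>s\<in>unit_cube \<sigma>. evlim f (cm g s) = cm g' (\<theta> s))"
      using cauts_cubical[OF spec[OF f, of N], unfolded cubical_def] * N by simp
  qed
  show "evlim f ` C \<in> cover_cubes L" if "C \<in> cover_cubes L" for C
  proof -
    obtain g \<sigma> where *: "g \<in> AL" "\<sigma> \<in> L" "C = cube g \<sigma>" using \<open>C \<in> cover_cubes L\<close> unfolding cover_cubes_eq by blast
    obtain N where N: "\<forall>s\<in>unit_cube \<sigma>. evlim f (cm g s) = f N (cm g s)" using on_cube[OF *(1,2)] by blast
    have "evlim f ` C = f N ` C" unfolding *(3) cube_def image_image using N by (intro image_cong) simp_all
    then show ?thesis using spec[OF f, of N] that unfolding cauts_def by auto
  qed
  show "act (evlim f) v = p v" if "v \<in> AL" for v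
  proof -
    have "\<forall>\<^sub>F n in sequentially. f n (v, \<lambda>_. 0) = (p v, \<lambda>_. 0)"
      using bspec[OF ev that] by eventually_elim (simp add: cauts_vertex(1)[OF spec[OF f] that])
    from evlim_eq[of f, OF this] show ?thesis by (simp add: act_def)
  qed
qed

lemma act_inverse: assumes "f \<in> cauts" "v \<in> AL"
  shows "act (restrict (inv_into CP f) CP) (act f v) = v" "act f (act (restrict (inv_into CP f) CP) v) = v"
proof -
  note i = cauts_inverse[OF assms(1)]
  have v: "(v, \<lambda>_. 0) \<in> CP" using assms(2) by simp
  have "restrict (inv_into CP f) CP (act f v, \<lambda>_. 0) = (v, \<lambda>_. 0)"
    using i(2)[OF v] cauts_vertex(1)[OF assms] by simp
  then show "act (restrict (inv_into CP f) CP) (act f v) = v" by (simp add: act_def[of "restrict (inv_into CP f) CP"])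
  have "f (act (restrict (inv_into CP f) CP) v, \<lambda>_. 0) = (v, \<lambda>_. 0)"
    using i(3)[OF v] cauts_vertex(1)[OF i(1) assms(2)] by simp
  then show "act f (act (restrict (inv_into CP f) CP) v) = v" by (simp add: act_def[of f])
qed

text \<open>A pointwise limit is onto because, after a translation, the approximants permute every
  finite ball.\<close>

lemma cauts_complete:
  assumes "\<And>n. \<exists>f\<in>cauts. \<forall>v\<in>vball n. act f v = p v"
  shows "\<exists>f\<in>cauts. \<forall>v\<in>AL. act f v = p v"
proof -
  obtain f where f: "\<And>n. f n \<in> cauts" and fp: "\<And>n v. v \<in> vball n \<Longrightarrow> act (f n) v = p v" using assms by metis
  define k where "k n = restrict (inv_into CP (f n)) CP" for n
  have k: "k n \<in> cauts" for n unfolding k_def by (rule cauts_inverse(1)[OF f])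
  have ev: "\<forall>\<^sub>F n in sequentially. act (f n) v = p v" if v: "v \<in> AL" for v
  proof -
    obtain N where "v \<in> vball N" using v vball_Union by blast
    then have "\<forall>n\<ge>N. act (f n) v = p v" using fp vball_le by blast
    then show ?thesis unfolding eventually_sequentially ..
  qed
  have surj: "\<exists>N. \<exists>u\<in>vball N. p u = v" if v: "v \<in> AL" for v
  proof -
    define c where "c = p \<one>\<^sub>L"
    have fc: "act (f n) \<one>\<^sub>L = c" for n using fp[of "\<one>\<^sub>L" n] vball_le[of 0 n] by (simp add: c_def)
    have c: "c \<in> AL" using cauts_vertex(2)[OF f[of 0], of "\<one>\<^sub>L"] fc by simp
    obtain N where N: "ainv c \<cdot> v \<in> vball N" using vball_Union A.m_closed[OF A.inv_closed[OF c] v] by blast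
    \<comment> \<open>Dividing by \<open>c\<close>, the common image of the base vertex, gives an
      automorphism that fixes the base vertex. It maps the finite ball into itself injectively,
      hence onto itself.\<close>
    let ?h = "\<lambda>u. ainv c \<cdot> act (f N) u"
    have hv: "?h u \<in> vball N" if u: "u \<in> vball N" for u
    proof -
      have uA: "u \<in> AL" using u vball_AL by blast
      let ?g = "compose CP (regular (ainv c)) (f N)"
      have g: "?g \<in> cauts" using subgroup.m_closed[OF subgroup_cauts regular_cauts[OF A.inv_closed[OF c]] f[of N]]
          regular_cauts[OF A.inv_closed[OF c]] f[of N] cauts_Bij by simp
      have ga: "act ?g w = ?h w" if "w \<in> AL" for w
        using act_compose[OF regular_cauts[OF A.inv_closed[OF c]] f that] act_regular[OF A.inv_closed[OF c] cauts_vertex(2)[OF f that]] by simp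
      have "act ?g \<one>\<^sub>L = \<one>\<^sub>L" using ga[of "\<one>\<^sub>L"] fc c by simp
      from vball_act[OF g this u] show ?thesis using ga[OF uA] by simp
    qed
    have "inj_on ?h (vball N)"
    proof (rule inj_onI)
      fix u w assume uw: "u \<in> vball N" "w \<in> vball N" "?h u = ?h w"
      then have AL: "u \<in> AL" "w \<in> AL" using vball_AL by auto
      then have "act (f N) u = act (f N) w" using uw(3) c cauts_vertex(2)[OF f] A.Units_l_cancel[of "ainv c"] by simp
      then show "u = w" using act_inverse(1)[OF f AL(1)] act_inverse(1)[OF f AL(2)] by metis
    qed
    then have "?h ` vball N = vball N" using hv by (intro endo_inj_surj[OF finite_vball]) auto
    then have "ainv c \<cdot> v \<in> ?h ` vball N" using N by simp
    then obtain u where u: "u \<in> vball N" "ainv c \<cdot> v = ainv c \<cdot> act (f N) u" by blast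
    have "u \<in> AL" using u(1) vball_AL by blast
    then have "act (f N) u = v" using u(2) c v cauts_vertex(2)[OF f] A.Units_l_cancel[of "ainv c" v] by simp
    then show ?thesis using fp[OF u(1)] u(1) by metis
  qed
  \<comment> \<open>A pointwise right inverse of \<open>p\<close>. The inverse automorphisms
    converge to it on vertices, and their limit is inverse to the limit of \<open>f\<close>.\<close>
  then obtain q where q: "\<And>v. v \<in> AL \<Longrightarrow> \<exists>N. q v \<in> vball N \<and> p (q v) = v" by metis
  have evk: "\<forall>\<^sub>F n in sequentially. act (k n) v = q v" if v: "v \<in> AL" for v
  proof -
    obtain N where N: "q v \<in> vball N" "p (q v) = v" using q[OF v] by blast
    then have qA: "q v \<in> AL" using vball_AL by blast
    show ?thesis using ev[OF qA]
    proof eventually_elim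
      case (elim n)
      then show ?case using act_inverse(1)[OF f qA, of n] N(2) by (simp add: k_def)
    qed
  qed
  have "\<forall>n. f n \<in> cauts" "\<forall>v\<in>AL. \<forall>\<^sub>F n in sequentially. act (f n) v = p v" using f ev by simp_all
  note F = evlim[OF this]
  have "\<forall>n. k n \<in> cauts" "\<forall>v\<in>AL. \<forall>\<^sub>F n in sequentially. act (k n) v = q v" using k evk by simp_all
  note K = evlim[OF this]
  have FK: "evlim f (evlim k x) = x" if x: "x \<in> CP" for x
  proof (rule evlim_eq)
    show "\<forall>\<^sub>F n in sequentially. f n (evlim k x) = x" using K(1)[OF x]
    proof eventually_elim
      case (elim n)
      then show ?case using cauts_inverse(3)[OF f x, of n, folded k_def] by simp
    qed
  qed
  have KF: "evlim k (evlim f x) = x" if x: "x \<in> CP" for x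
  proof (rule evlim_eq)
    show "\<forall>\<^sub>F n in sequentially. k n (evlim f x) = x" using F(1)[OF x]
    proof eventually_elim
      case (elim n)
      then show ?case using cauts_inverse(2)[OF f x, of n, folded k_def] by simp
    qed
  qed
  have cubr: "cubical (restrict G CP)" if "cubical G" for G
    using that cm_in_CP unfolding cubical_def by simp
  have imr: "restrict G CP ` C = G ` C" if "C \<in> cover_cubes L" for G and C
    using cubes_subset[OF that] by (intro image_cong) auto
  have "restrict (evlim f) CP \<in> cauts"
  proof (rule cautsI[where h = "restrict (evlim k) CP"])
    show "\<And>C. C \<in> cover_cubes L \<Longrightarrow> restrict (evlim f) CP ` C \<in> cover_cubes L" unfolding imr by (rule F(3))
    show "\<And>C. C \<in> cover_cubes L \<Longrightarrow> restrict (evlim k) CP ` C \<in> cover_cubes L" unfolding imr by (rule K(3))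
  qed (use FK KF cubical_CP[OF F(2)] cubical_CP[OF K(2)] in \<open>simp_all add: cubr F(2) K(2)\<close>)
  moreover have "act (restrict (evlim f) CP) v = p v" if "v \<in> AL" for v
    using F(4)[OF that] that by (simp add: act_def)
  ultimately show ?thesis by blast
qed

sublocale PG: permutation_group CA "raag L" act regular vball
proof (intro permutation_group.intro permutation_group_axioms.intro)
  show "group CA" "group (raag L)" by (rule group_CA, rule A.group_axioms)
  show "countable AL" unfolding raag_def Union_L by (rule countable_presented_group) (simp add: finite_V countable_finite)
  show "\<And>f v. f \<in> carrier CA \<Longrightarrow> v \<in> AL \<Longrightarrow> act f v \<in> AL" by (simp add: cauts_vertex(2))
  show "\<And>f g v. f \<in> carrier CA \<Longrightarrow> g \<in> carrier CA \<Longrightarrow> v \<in> AL \<Longrightarrow> act (f \<otimes>\<^bsub>CA\<^esub> g) v = act f (act g v)"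
    by (simp add: CA_mult act_compose)
  show "\<And>v. v \<in> AL \<Longrightarrow> act \<one>\<^bsub>CA\<^esub> v = v" by (simp add: CA_one act_one)
  show "\<And>f g. f \<in> carrier CA \<Longrightarrow> g \<in> carrier CA \<Longrightarrow> (\<And>v. v \<in> AL \<Longrightarrow> act f v = act g v) \<Longrightarrow> f = g"
    by (simp add: cauts_eqI)
  show "\<And>a. a \<in> AL \<Longrightarrow> regular a \<in> carrier CA" by (simp add: regular_cauts)
  show "\<And>a v. a \<in> AL \<Longrightarrow> v \<in> AL \<Longrightarrow> act (regular a) v = a \<cdot> v" by (rule act_regular)
  show "\<And>n. finite (vball n)" by (rule finite_vball)
  show "\<And>n. vball n \<subseteq> vball (Suc n)" by simp
  show "(\<Union>n. vball n) = AL" by (rule vball_Union)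
  show "vball 0 = {\<one>\<^sub>L}" by simp
  show "\<And>f v n. f \<in> carrier CA \<Longrightarrow> act f \<one>\<^sub>L = \<one>\<^sub>L \<Longrightarrow> v \<in> vball n \<Longrightarrow> act f v \<in> vball n"
    by (rule vball_act) simp_all
  show "\<And>p. (\<And>n. \<exists>f\<in>carrier CA. \<forall>v\<in>vball n. act f v = p v) \<Longrightarrow> \<exists>f\<in>carrier CA. \<forall>v\<in>AL. act f v = p v"
    unfolding carrier_CA by (rule cauts_complete)
qed

section \<open>Cylinders generate the topology of pointwise convergence\<close>

abbreviation PT where "PT \<equiv> product_topology (\<lambda>_. mtopology_of SC) CP"

lemma cover_aut_topology_eq: "cover_aut_topology L = subtopology PT cauts"
proof -
  have "isometries SC \<inter> cauts = cauts" by (auto simp: cauts_def)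
  then show ?thesis by (simp add: cover_aut_topology_def isom_topology_def subtopology_subtopology)
qed

text \<open>Distinct vertices are at distance at least 1/2, so prescribing the image of a vertex
  amounts to the open condition of lying in a ball of radius 1/2.\<close>

lemma cyl_open_in_product: "\<exists>W. openin PT W \<and> PG.cyl f n = cauts \<inter> W" if f: "f \<in> cauts"
proof -
  define B where "B v = mball_of SC (act f v, \<lambda>_. 0) (1/2)" for v :: "'v word set"
  have tB: "topspace (mtopology_of SC) = CP" by simp
  define W where "W = (\<Inter>v\<in>vball n. {h \<in> topspace PT. h (v, \<lambda>_. 0) \<in> B v}) \<inter> topspace PT"
  have "openin PT {h \<in> topspace PT. h (v, \<lambda>_. 0) \<in> B v}" if "v \<in> vball n" for v
  proof -
    have "(v, \<lambda>_. 0) \<in> CP" using that vball_AL by auto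
    then have "continuous_map PT (mtopology_of SC) (\<lambda>h. h (v, \<lambda>_. 0))" by (rule continuous_map_product_projection)
    moreover have "openin (mtopology_of SC) (B v)" unfolding B_def mball_of_def mtopology_of_def by (rule Metric_space.openin_mball[OF Metric_space_mspace_mdist])
    ultimately show ?thesis by (rule openin_continuous_map_preimage)
  qed
  then have "openin PT (\<Inter>v\<in>vball n. {h \<in> topspace PT. h (v, \<lambda>_. 0) \<in> B v})"
    using finite_vball[of n] vball_le[of 0 n] by (intro openin_Inter) auto
  then have "openin PT W" unfolding W_def by (rule openin_Int) (rule openin_topspace)
  moreover have "PG.cyl f n = cauts \<inter> W"
  proof (rule Set.set_eqI)
    fix h
    have "h \<in> PG.cyl f n \<longleftrightarrow> (\<forall>v\<in>vball n. h (v, \<lambda>_. 0) \<in> B v)" if h: "h \<in> cauts"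
    proof -
      have "act h v = act f v \<longleftrightarrow> h (v, \<lambda>_. 0) \<in> B v" if "v \<in> vball n" for v
      proof -
        have v: "v \<in> AL" using that vball_AL by blast
        note hv = cauts_vertex[OF h v] and fv = cauts_vertex[OF f v]
        have "h (v, \<lambda>_. 0) \<in> B v \<longleftrightarrow> cdist (act f v, \<lambda>_. 0) (act h v, \<lambda>_. 0) < 1/2"
          using hv fv by (simp add: B_def in_mball_of mdist_SC)
        also have "\<dots> \<longleftrightarrow> act h v = act f v"
          using vertices_separated[OF fv(2) hv(2)] cdist_refl[of "(act f v, \<lambda>_. 0)"] fv(2) by (metis half_gt_zero vertex_in_CP zero_less_one)
        finally show ?thesis by simp
      qed
      then show ?thesis using h by (simp add: PG.cyl_def)
    qed
    moreover have "h \<in> topspace PT" if "h \<in> cauts"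
      using cauts_Bij[OF that] Bij_imp_funcset[of h CP] Bij_imp_extensional[of h CP] by (simp add: PiE_def)
    moreover have "h \<in> cauts" if "h \<in> PG.cyl f n" using that by (simp add: PG.cyl_def)
    ultimately show "h \<in> PG.cyl f n \<longleftrightarrow> h \<in> cauts \<inter> W" unfolding W_def by blast
  qed
  ultimately show ?thesis by blast
qed

text \<open>The image of a point is determined by the images of the finitely many corners of a cube
  containing it, so agreement on a large enough ball of vertices forces agreement at finitely many
  given points.\<close>

lemma cyl_fixes_points: assumes "finite Q" "Q \<subseteq> CP" "f \<in> cauts" shows "\<exists>n. \<forall>h\<in>PG.cyl f n. \<forall>q\<in>Q. h q = f q"
proof -
  have "\<exists>S. finite S \<and> S \<subseteq> AL \<and> (\<forall>h\<in>cauts. (\<forall>v\<in>S. act h v = act f v) \<longrightarrow> h q = f q)" if "q \<in> CP" for q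
  proof -
    obtain g \<sigma> s where *: "g \<in> AL" "\<sigma> \<in> L" "s \<in> unit_cube \<sigma>" "q = cm g s" using point_in_some_cube[OF \<open>q \<in> CP\<close>] .
    let ?S = "(\<lambda>\<tau>. g \<cdot> sp \<tau>) ` Pow \<sigma>"
    have "finite ?S" "?S \<subseteq> AL" using finite_simplex[OF *(2)] *(1,2) simplex_subset by auto
    moreover have "h q = f q" if "h \<in> cauts" "\<forall>v\<in>?S. act h v = act f v" for h
      unfolding *(4) by (rule agree_cube[OF that(1) assms(3) *(1,2) _ *(3)]) (use that(2) in simp)
    ultimately show ?thesis by (intro exI[of _ ?S]) simp
  qed
  then obtain S where S: "\<And>q. q \<in> CP \<Longrightarrow> finite (S q) \<and> S q \<subseteq> AL \<and> (\<forall>h\<in>cauts. (\<forall>v\<in>S q. act h v = act f v) \<longrightarrow> h q = f q)"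
    by metis
  have "finite (\<Union>q\<in>Q. S q)" "(\<Union>q\<in>Q. S q) \<subseteq> AL" using S assms(1,2) by auto
  from finite_in_vball[OF this] obtain n where n: "(\<Union>q\<in>Q. S q) \<subseteq> vball n" ..
  show ?thesis
  proof (intro exI[of _ n] ballI)
    fix h q assume h: "h \<in> PG.cyl f n" and q: "q \<in> Q"
    then have "h \<in> cauts" "\<forall>v\<in>S q. act h v = act f v" using n by (auto simp: PG.cyl_def)
    then show "h q = f q" using S q assms(2) by blast
  qed
qed

sublocale PG: topological_permutation_group CA "raag L" act regular vball "cover_aut_topology L"
proof unfold_locales
  fix U
  show "openin (cover_aut_topology L) U \<longleftrightarrow> U \<subseteq> carrier CA \<and> (\<forall>f\<in>U. \<exists>n. PG.cyl f n \<subseteq> U)"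
  proof
    assume "openin (cover_aut_topology L) U"
    then obtain W where W: "openin PT W" "U = W \<inter> cauts" unfolding cover_aut_topology_eq openin_subtopology by blast
    have "\<exists>n. PG.cyl f n \<subseteq> U" if "f \<in> U" for f
    proof -
      have f: "f \<in> W" "f \<in> cauts" using that W(2) by auto
      obtain Y where Y: "finite {i \<in> CP. Y i \<noteq> topspace (mtopology_of SC)}" "f \<in> PiE CP Y" "PiE CP Y \<subseteq> W"
        using W(1)[unfolded openin_product_topology_alt] f(1) by meson
      obtain n where n: "\<forall>h\<in>PG.cyl f n. \<forall>q\<in>{i \<in> CP. Y i \<noteq> topspace (mtopology_of SC)}. h q = f q"
        using cyl_fixes_points[OF Y(1) _ f(2)] by blast
      have "h \<in> U" if h: "h \<in> PG.cyl f n" for h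
      proof -
        have hc: "h \<in> cauts" using h by (simp add: PG.cyl_def)
        have "h q \<in> Y q" if q: "q \<in> CP" for q
        proof (cases "Y q = topspace (mtopology_of SC)")
          case True
          then show ?thesis using Bij_mem[OF cauts_Bij[OF hc] q] by simp
        next
          case False
          then have "h q = f q" using n h q by blast
          then show ?thesis using Y(2) q by auto
        qed
        then have "h \<in> PiE CP Y" using Bij_imp_extensional[OF cauts_Bij[OF hc]] by (simp add: PiE_iff)
        then show ?thesis using Y(3) hc W(2) by blast
      qed
      then show ?thesis by blast
    qed
    then show "U \<subseteq> carrier CA \<and> (\<forall>f\<in>U. \<exists>n. PG.cyl f n \<subseteq> U)" using W(2) by simp
  next
    assume U: "U \<subseteq> carrier CA \<and> (\<forall>f\<in>U. \<exists>n. PG.cyl f n \<subseteq> U)"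
    show "openin (cover_aut_topology L) U"
    proof (subst openin_subopen, rule ballI)
      fix f assume "f \<in> U"
      have n1: "f \<in> cauts" using subsetD[OF conjunct1[OF U] \<open>f \<in> U\<close>] unfolding carrier_CA .
      have "\<exists>n. PG.cyl f n \<subseteq> U" by (rule bspec[OF conjunct2[OF U] \<open>f \<in> U\<close>])
      then obtain n where n: "PG.cyl f n \<subseteq> U" ..
      obtain W where W: "openin PT W" "PG.cyl f n = cauts \<inter> W" using cyl_open_in_product[OF n1, of n] by (elim exE conjE)
      have "openin (cover_aut_topology L) (PG.cyl f n)" unfolding cover_aut_topology_eq openin_subtopology
        by (rule exI[of _ W]) (simp add: W Int_commute)
      moreover have "f \<in> PG.cyl f n" using n1 by (simp add: PG.cyl_def)
      ultimately show "\<exists>T. openin (cover_aut_topology L) T \<and> f \<in> T \<and> T \<subseteq> U" using n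
        by (intro exI[of _ "PG.cyl f n"] conjI)
    qed
  qed
qed

end

section \<open>Lattices in the product with the tree\<close>

context flag_free
begin

section \<open>The topology of the tree group and its left translations\<close>

lemma tree_aut_topology_eq: "tree_aut_topology B = subtopology (product_topology (\<lambda>_. discrete_topology FB) FB) tauts"
  by (simp add: tree_aut_topology_def)

lemma tauts_mem: "t \<in> tauts \<Longrightarrow> v \<in> FB \<Longrightarrow> t v \<in> FB"
  by (rule Bij_mem[OF tauts_Bij])

lemma tauts_eqI: "t \<in> tauts \<Longrightarrow> s \<in> tauts \<Longrightarrow> (\<And>v. v \<in> FB \<Longrightarrow> t v = s v) \<Longrightarrow> t = s"
  by (rule Bij_eqI[OF tauts_Bij tauts_Bij])

lemma tauts_extensional: "t \<in> tauts \<Longrightarrow> t \<in> extensional FB"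
  by (rule Bij_imp_extensional[OF tauts_Bij])

lemma topspace_tree_aut: "topspace (tree_aut_topology B) = tauts"
proof -
  have "tauts \<subseteq> FB \<rightarrow>\<^sub>E FB" using tauts_mem tauts_extensional by (intro subsetI) (simp add: PiE_iff)
  then show ?thesis unfolding tree_aut_topology_eq by (simp add: Int_absorb1)
qed

lemma open_tree_value: assumes "v \<in> FB" shows "openin (tree_aut_topology B) {t \<in> tauts. t v = w}"
proof -
  let ?P = "product_topology (\<lambda>_. discrete_topology FB) FB"
  have "openin ?P {t \<in> topspace ?P. t v \<in> {w} \<inter> FB}"
    by (rule openin_continuous_map_preimage[OF continuous_map_product_projection[OF assms]]) simp
  moreover have "{t \<in> tauts. t v = w} = {t \<in> topspace ?P. t v \<in> {w} \<inter> FB} \<inter> tauts"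
    using tauts_mem tauts_extensional assms by (auto simp only: topspace_product_topology topspace_discrete_topology PiE_iff)
  ultimately show ?thesis unfolding tree_aut_topology_eq openin_subtopology by blast
qed

lemma open_tree_finite:
  assumes "openin (tree_aut_topology B) U" "t \<in> U"
  shows "\<exists>S. finite S \<and> S \<subseteq> FB \<and> (\<forall>s\<in>tauts. (\<forall>v\<in>S. s v = t v) \<longrightarrow> s \<in> U)"
proof -
  let ?P = "product_topology (\<lambda>_. discrete_topology FB) FB"
  obtain W where W: "openin ?P W" "U = W \<inter> tauts" using assms(1) unfolding tree_aut_topology_eq openin_subtopology by blast
  have t: "t \<in> W" "t \<in> tauts" using assms(2) W(2) by auto
  obtain Y where Y: "finite {i \<in> FB. Y i \<noteq> topspace (discrete_topology FB)}" "t \<in> PiE FB Y" "PiE FB Y \<subseteq> W"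
    using W(1)[unfolded openin_product_topology_alt] t(1) by meson
  let ?S = "{i \<in> FB. Y i \<noteq> topspace (discrete_topology FB)}"
  have "s \<in> U" if s: "s \<in> tauts" "\<forall>v\<in>?S. s v = t v" for s
  proof -
    have "s v \<in> Y v" if v: "v \<in> FB" for v
    proof (cases "Y v = topspace (discrete_topology FB)")
      case True
      then show ?thesis using tauts_mem[OF s(1) v] by simp
    next
      case False
      then have "s v = t v" using s(2) v by simp
      then show ?thesis using Y(2) v by (simp add: PiE_iff)
    qed
    then have "s \<in> PiE FB Y" using tauts_extensional[OF s(1)] by (simp add: PiE_iff)
    then show ?thesis using Y(3) s(1) W(2) by blast
  qed
  then show ?thesis using Y(1) by (intro exI[of _ ?S] conjI) simp_all
qed

definition left_translation :: "'v word set \<Rightarrow> 'v word set \<Rightarrow> 'v word set" where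
  "left_translation w = (\<lambda>x\<in>FB. w \<bullet> x)"

lemma left_translation_tauts: assumes w: "w \<in> FB" shows "left_translation w \<in> tauts"
proof -
  let ?i = "inv\<^bsub>free_group_on B\<^esub> w"
  have "left_translation w \<in> Bij FB"
    by (rule BijI[where g = "\<lambda>x. ?i \<bullet> x"]) (use w in \<open>simp_all add: left_translation_def F.m_assoc[symmetric]\<close>)
  moreover have "tree_edge B b (w \<bullet> x) (w \<bullet> y) \<longleftrightarrow> tree_edge B b x y" if xy: "x \<in> FB" "y \<in> FB" for b x y
  proof -
    have "w \<bullet> x = w \<bullet> y \<bullet> fgen b \<longleftrightarrow> x = y \<bullet> fgen b" if "b \<in> B" "x \<in> FB" "y \<in> FB" for x y
      using F.Units_l_cancel[of w x "y \<bullet> fgen b"] that w by (simp add: F.m_assoc)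
    then show ?thesis using xy w unfolding tree_edge_def by (intro conj_cong HOL.refl) auto
  qed
  ultimately show ?thesis by (simp add: tauts_def edge_def left_translation_def)
qed

text \<open>Collect the tree vertices under a path from the base vertex to \<open>v\<close>. If
  \<open>a\<close> fixes them, all signs along the path are positive, and a lift that fixes the base
  vertex follows the path unchanged.\<close>

lemma fixed_by_lift:
  assumes "v \<in> AL"
  shows "\<exists>S. finite S \<and> S \<subseteq> FB \<and> (\<forall>a f. lpa a \<longrightarrow> vlift a f \<longrightarrow> f \<one>\<^sub>L = \<one>\<^sub>L \<longrightarrow> (\<forall>s\<in>S. a s = s) \<longrightarrow> f v = v)"
  using assms
proof (induction v rule: raag_induct)
  case one
  show ?case by (rule exI[of _ "{}"]) simp
next
  case (mult g x)
  then obtain S where S: "finite S" "S \<subseteq> FB"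
    "\<And>a f. lpa a \<Longrightarrow> vlift a f \<Longrightarrow> f \<one>\<^sub>L = \<one>\<^sub>L \<Longrightarrow> \<forall>s\<in>S. a s = s \<Longrightarrow> f g = g" by (elim exE conjE) simp
  have x: "x \<in> V" using mult(2) Union_L by simp
  show ?case
  proof (intro exI[of _ "S \<union> {\<phi> g, \<phi> (g \<cdot> gen x)}"] conjI allI impI)
    fix a f assume *: "lpa a" "vlift a f" "f \<one>\<^sub>L = \<one>\<^sub>L" "\<forall>s\<in>S \<union> {\<phi> g, \<phi> (g \<cdot> gen x)}. a s = s"
    have "eps a (\<phi> g) x" using *(4) mult(1) x by (cases "x \<in> B") (simp_all add: eps_def phi_mult phi_gen)
    then show "f (g \<cdot> gen x) = g \<cdot> gen x"
      using *(2) S(3)[OF *(1-3)] *(4) mult(1) x by (simp add: vlift_def apow_def)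
  qed (use S(1,2) mult(1) x in simp_all)
next
  case (inv_mult g x)
  then obtain S where S: "finite S" "S \<subseteq> FB"
    "\<And>a f. lpa a \<Longrightarrow> vlift a f \<Longrightarrow> f \<one>\<^sub>L = \<one>\<^sub>L \<Longrightarrow> \<forall>s\<in>S. a s = s \<Longrightarrow> f g = g" by (elim exE conjE) simp
  have x: "x \<in> V" using inv_mult(2) Union_L by simp
  let ?g = "g \<cdot> ainv (gen x)"
  have g: "?g \<in> AL" "?g \<cdot> gen x = g" using inv_mult(1) x by (simp_all add: A.m_assoc)
  show ?case
  proof (intro exI[of _ "S \<union> {\<phi> g, \<phi> ?g}"] conjI allI impI)
    fix a f assume *: "lpa a" "vlift a f" "f \<one>\<^sub>L = \<one>\<^sub>L" "\<forall>s\<in>S \<union> {\<phi> g, \<phi> ?g}. a s = s"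
    have "\<phi> ?g \<bullet> fgen x = \<phi> g" if "x \<in> B" using phi_mult[OF g(1) gen_closed[OF x]] that x unfolding g(2) by (simp add: phi_gen)
    then have "eps a (\<phi> ?g) x" using *(4) by (simp add: eps_def)
    then have "f (?g \<cdot> gen x) = f ?g \<cdot> gen x" using *(2) g(1) x by (simp add: vlift_def apow_def)
    then have "g = f ?g \<cdot> gen x" using S(3)[OF *(1-3)] *(4) unfolding g(2) by simp
    moreover have "f ?g \<in> AL" by (rule vliftD(1)[OF *(2) g(1)])
    ultimately show "f ?g = ?g" using x A.right_cancel[of "gen x" "f ?g" ?g] g inv_mult(1) by simp
  qed (use S(1,2) inv_mult(1) x in simp_all)
qed

end

section \<open>Subgroups of the product with the tree group and their groups of lifts\<close>

locale product_subgroup = flag_free L V B for L :: "'v set set" and V :: "'v set" and B :: "'v set" +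
  fixes X :: "'x metric" and H :: "('x \<Rightarrow> 'x) set"
    and \<Gamma> :: "(('x \<Rightarrow> 'x) \<times> ('v word set \<Rightarrow> 'v word set)) set"
  assumes H: "subgroup H (isom_group X)"
    and sub: "subgroup \<Gamma> (subgroup_with_tree H X B)"
    and lab: "label_preserving_action B ((subgroup_with_tree H X B)\<lparr>carrier := \<Gamma>\<rparr>) snd"
begin

sublocale lift_action L V B "(subgroup_with_tree H X B)\<lparr>carrier := \<Gamma>\<rparr>" snd
  by unfold_locales (rule lab)

abbreviation HG where "HG \<equiv> (isom_group X)\<lparr>carrier := H\<rparr>"
abbreviation HT where "HT \<equiv> subtopology (isom_topology X) H"
abbreviation \<Gamma>' where "\<Gamma>' \<equiv> lift_group_map ` carrier (lattice_lift_group H X L B \<Gamma>)"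

lemma lattice_LG: "lattice_lift_group H X L B \<Gamma> = LG"
  by (simp add: lattice_lift_group_def)

lemma group_HG: "group HG"
  by (rule subgroup.subgroup_is_group[OF H group_isom_group])

lemma group_product: "group (HG \<times>\<times> tree_aut B)" "group (HG \<times>\<times> CA)"
  using DirProd_group[OF group_HG group_tree_aut] DirProd_group[OF group_HG group_CA] .

lemma Gamma_mem: "(h, t) \<in> \<Gamma> \<Longrightarrow> h \<in> H \<and> t \<in> tauts"
  using subgroup.subset[OF sub] by (auto simp: subgroup_with_tree_def)

lemma Gamma_lpa: "(h, t) \<in> \<Gamma> \<Longrightarrow> lpa t"
  using rho_lpa[of "(h, t)"] by simp

lemma Gamma_one: "(\<one>\<^bsub>HG\<^esub>, \<lambda>x\<in>FB. x) \<in> \<Gamma>"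
  using subgroup.one_closed[OF sub] by (simp add: subgroup_with_tree_def tree_aut_one)

lemma Gamma'_mem: "(h, f) \<in> \<Gamma>' \<longleftrightarrow> (\<exists>t. (h, t) \<in> \<Gamma> \<and> f \<in> cauts \<and> vlift t (act f))"
proof
  assume "(h, f) \<in> \<Gamma>'"
  then obtain x where x: "x \<in> carrier LG" "(h, f) = lift_group_map x" unfolding lattice_LG by blast
  obtain h' t f' where xe: "x = ((h', t), f')" by (cases x) auto
  have "h' = h" "f' = f" using x(2) by (simp_all add: xe lift_group_map_def)
  then show "\<exists>t. (h, t) \<in> \<Gamma> \<and> f \<in> cauts \<and> vlift t (act f)"
    using x(1) unfolding xe LG_carrier by (intro exI[of _ t]) simp
next
  assume "\<exists>t. (h, t) \<in> \<Gamma> \<and> f \<in> cauts \<and> vlift t (act f)"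
  then obtain t where "(h, t) \<in> \<Gamma>" "f \<in> cauts" "vlift t (act f)" by blast
  then have "((h, t), f) \<in> carrier LG" unfolding LG_carrier by simp
  then show "(h, f) \<in> \<Gamma>'" unfolding lattice_LG by (intro image_eqI[of _ _ "((h, t), f)"]) (simp_all add: lift_group_map_def)
qed

text \<open>A lift remembers its tree automorphism because \<open>\<phi>\<close> is onto. This is
  why \<open>lift_group_map\<close> may forget the component in the tree group and still be
  injective.\<close>

lemma vlift_determines:
  assumes "t \<in> tauts" "s \<in> tauts" "vlift t f" "vlift s f" shows "t = s"
proof (rule tauts_eqI[OF assms(1,2)])
  fix u assume "u \<in> FB"
  then obtain g where g: "g \<in> AL" "\<phi> g = u" by (rule phi_surj)
  show "t u = s u" using vliftD(2)[OF assms(3) g(1)] vliftD(2)[OF assms(4) g(1)] g(2) by simp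
qed

lemma lift_through:
  assumes "(h, t) \<in> \<Gamma>" "a \<in> AL" "b \<in> AL" "t (\<phi> a) = \<phi> b"
  shows "\<exists>f. f \<in> cauts \<and> vlift t (act f) \<and> act f a = b"
proof -
  have "(h, t) \<in> carrier ((subgroup_with_tree H X B)\<lparr>carrier := \<Gamma>\<rparr>)" "\<phi> b = snd (h, t) (\<phi> a)" using assms by simp_all
  then obtain f where "((h, t), f) \<in> carrier LG" "act f a = b" using LG_through[OF _ assms(2,3)] by blast
  then show ?thesis unfolding LG_carrier by (intro exI[of _ f]) simp
qed

lemma lift_group_map_mon: "lift_group_map \<in> mon (lattice_lift_group H X L B \<Gamma>) (subgroup_with_cover H X L)"
  unfolding lattice_LG mon_def subgroup_with_cover_def
proof (intro CollectI conjI homI inj_onI)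
  fix x assume x: "x \<in> carrier LG"
  obtain h t f where xe: "x = ((h, t), f)" by (cases x) auto
  have *: "(h, t) \<in> \<Gamma>" "f \<in> cauts" "vlift t (act f)" using x unfolding xe LG_carrier by simp_all
  show "lift_group_map x \<in> carrier (HG \<times>\<times> CA)" using *(2) Gamma_mem[OF *(1)] by (simp add: xe lift_group_map_def)
  fix y assume y: "y \<in> carrier LG"
  obtain h' t' f' where ye: "y = ((h', t'), f')" by (cases y) auto
  have **: "(h', t') \<in> \<Gamma>" "f' \<in> cauts" "vlift t' (act f')" using y unfolding ye LG_carrier by simp_all
  show "lift_group_map (x \<otimes>\<^bsub>LG\<^esub> y) = lift_group_map x \<otimes>\<^bsub>HG \<times>\<times> CA\<^esub> lift_group_map y"
    using LG_mult[OF x[unfolded xe] y[unfolded ye]] *(2) **(2)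
    by (simp add: xe ye lift_group_map_def subgroup_with_tree_def CA_mult)
  assume "lift_group_map x = lift_group_map y"
  then have e: "h = h'" "f = f'" by (simp_all add: xe ye lift_group_map_def)
  then have "t = t'" using vlift_determines[of t t' "act f"] * ** Gamma_mem by blast
  then show "x = y" using e by (simp add: xe ye)
qed

lemma subgroup_Gamma': "subgroup \<Gamma>' (HG \<times>\<times> CA)"
proof -
  have "lift_group_map \<in> hom LG (HG \<times>\<times> CA)"
    using lift_group_map_mon by (simp add: lattice_LG mon_def subgroup_with_cover_def)
  then have "group_hom LG (HG \<times>\<times> CA) lift_group_map"
    using group_LG group_product(2) by (simp add: group_hom_def group_hom_axioms_def)
  from group_hom.img_is_subgroup[OF this] show ?thesis unfolding lattice_LG .
qed

text \<open>Kernel translations are lifts of the identity, and conversely every lift of the identity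
  is a kernel translation on vertices, so it is trivial as soon as it fixes the base vertex.\<close>

lemma transfer:
  assumes "topological_group (HG \<times>\<times> tree_aut B) (prod_topology HT (tree_aut_topology B))"
  shows "lattice_transfer CA (raag L) act regular vball (cover_aut_topology L) HG HT (tree_aut B) (tree_aut_topology B)
    (free_group_on B) (\<lambda>t v. t v) left_translation \<phi> \<Gamma> \<Gamma>'"
proof (intro lattice_transfer.intro lattice_transfer_axioms.intro PG.topological_permutation_group_axioms)
  show "group HG" "group (tree_aut B)" "group (free_group_on B)" by (rule group_HG, rule group_tree_aut, rule F.group_axioms)
  show "topological_group (HG \<times>\<times> tree_aut B) (prod_topology HT (tree_aut_topology B))" by (rule assms)
  show "\<And>t v. t \<in> carrier (tree_aut B) \<Longrightarrow> v \<in> FB \<Longrightarrow> t v \<in> FB" by (simp add: tauts_mem)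
  show "\<And>t t' v. t \<in> carrier (tree_aut B) \<Longrightarrow> t' \<in> carrier (tree_aut B) \<Longrightarrow> v \<in> FB \<Longrightarrow> (t \<otimes>\<^bsub>tree_aut B\<^esub> t') v = t (t' v)"
    by (simp add: tree_aut_mult compose_eq)
  show "\<And>v. v \<in> FB \<Longrightarrow> \<one>\<^bsub>tree_aut B\<^esub> v = v" by (simp add: tree_aut_one)
  show "\<And>w. w \<in> FB \<Longrightarrow> left_translation w \<in> carrier (tree_aut B)" by (simp add: left_translation_tauts)
  show "\<And>w v. w \<in> FB \<Longrightarrow> v \<in> FB \<Longrightarrow> left_translation w v = w \<bullet> v" by (simp add: left_translation_def)
  show "\<And>v w. v \<in> FB \<Longrightarrow> w \<in> FB \<Longrightarrow> openin (tree_aut_topology B) {t \<in> carrier (tree_aut B). t v = w}"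
    by (simp add: open_tree_value)
  show "\<And>U t. openin (tree_aut_topology B) U \<Longrightarrow> t \<in> U \<Longrightarrow>
    \<exists>S. finite S \<and> S \<subseteq> FB \<and> (\<forall>t'\<in>carrier (tree_aut B). (\<forall>v\<in>S. t' v = t v) \<longrightarrow> t' \<in> U)"
    unfolding carrier_tree_aut by (rule open_tree_finite)
  show "\<phi> \<in> hom (raag L) (free_group_on B)" by (rule phi_hom)
  show "\<phi> ` AL = FB"
  proof
    show "\<phi> ` AL \<subseteq> FB" by (intro image_subsetI) simp
    show "FB \<subseteq> \<phi> ` AL" by (rule subsetI, erule phi_surj) (rule image_eqI, simp_all)
  qed
  show "subgroup \<Gamma> (HG \<times>\<times> tree_aut B)" using sub by (simp add: subgroup_with_tree_def)
  show "subgroup \<Gamma>' (HG \<times>\<times> CA)" by (rule subgroup_Gamma')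
  show "\<exists>t. (h, t) \<in> \<Gamma> \<and> (\<forall>a\<in>AL. \<phi> (act f a) = t (\<phi> a))" if hf: "(h, f) \<in> \<Gamma>'" for h f
  proof -
    obtain t where "(h, t) \<in> \<Gamma>" "f \<in> cauts" "vlift t (act f)" using hf unfolding Gamma'_mem by (elim exE conjE)
    then show ?thesis using vliftD(2) by (intro exI[of _ t]) simp
  qed
  show "\<exists>f. (h, f) \<in> \<Gamma>' \<and> act f a = b \<and> (\<forall>c\<in>AL. \<phi> (act f c) = t (\<phi> c))"
    if ht: "(h, t) \<in> \<Gamma>" "a \<in> AL" "b \<in> AL" "t (\<phi> a) = \<phi> b" for h t a b
  proof -
    obtain f where f: "f \<in> cauts" "vlift t (act f)" "act f a = b" using lift_through[OF ht] by (elim exE conjE)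
    have "(h, f) \<in> \<Gamma>'" unfolding Gamma'_mem using ht(1) f(1,2) by (intro exI[of _ t]) simp
    then show ?thesis using f(3) vliftD(2)[OF f(2)] by (intro exI[of _ f]) simp
  qed
  show "(\<one>\<^bsub>HG\<^esub>, regular a) \<in> \<Gamma>'" if a: "a \<in> AL" "\<phi> a = \<one>\<^sub>F" for a
  proof -
    have "vlift (\<lambda>x\<in>FB. x) (\<lambda>g. a \<cdot> g)" by (rule vlift_trans) (simp add: N_iff a)
    then have "vlift (\<lambda>x\<in>FB. x) (act (regular a))" by (rule vlift_cong[rotated]) (simp add: act_regular a(1))
    then show ?thesis unfolding Gamma'_mem using Gamma_one regular_cauts[OF a(1)] by (intro exI[of _ "\<lambda>x\<in>FB. x"]) simp
  qed
  show "f = \<one>\<^bsub>CA\<^esub>" if hf: "(\<one>\<^bsub>HG\<^esub>, f) \<in> \<Gamma>'" and ff: "\<forall>a\<in>AL. \<phi> (act f a) = \<phi> a" and f1: "act f \<one>\<^sub>L = \<one>\<^sub>L" for f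
  proof -
    obtain t where t: "(\<one>\<^bsub>HG\<^esub>, t) \<in> \<Gamma>" "f \<in> cauts" "vlift t (act f)" using hf unfolding Gamma'_mem by (elim exE conjE)
    have "t = (\<lambda>x\<in>FB. x)"
    proof (rule tauts_eqI)
      show "t \<in> tauts" using Gamma_mem[OF t(1)] by simp
      show "(\<lambda>x\<in>FB. x) \<in> tauts" by (rule lpa_tauts[OF lpa_id])
      fix u assume u: "u \<in> FB"
      obtain g where g: "g \<in> AL" "\<phi> g = u" using u by (rule phi_surj)
      show "t u = (\<lambda>x\<in>FB. x) u" using vliftD(2)[OF t(3) g(1)] ff g u by simp
    qed
    then have "vlift (\<lambda>x\<in>FB. x) (act f)" using t(3) by simp
    then obtain n where n: "n \<in> N" "\<And>g. g \<in> AL \<Longrightarrow> act f g = n \<cdot> g" by (rule vlift_idD) blast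
    have "n = \<one>\<^sub>L" using n(2)[OF A.one_closed] f1 n(1) by (simp add: N_iff)
    then have "act f g = act (\<lambda>x\<in>CP. x) g" if "g \<in> AL" for g using n(2)[OF that] that by (simp add: act_one)
    then show ?thesis unfolding CA_one by (intro cauts_eqI[OF t(2)]) (use group.is_monoid[OF group_CA, THEN monoid.one_closed] in \<open>simp_all add: CA_one\<close>)
  qed
qed

text \<open>The assumption of \<open>transfer\<close> on the topology of the product is contained in
  the lattice hypothesis.\<close>

lemma lattice_lift:
  assumes "lattice_in (subgroup_with_tree H X B) (subgroup_with_tree_topology H X B) \<Gamma>"
  shows "lattice_in (subgroup_with_cover H X L) (subgroup_with_cover_topology H X L) \<Gamma>'"
  using lattice_transfer.lattice_transfer[OF transfer] assms
  by (simp add: subgroup_with_cover_def subgroup_with_cover_topology_def subgroup_with_tree_def subgroup_with_tree_topology_def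
      lattice_in_def locally_compact_group_def)

lemma uniform_lattice_lift:
  assumes "uniform_lattice_in (subgroup_with_tree H X B) (subgroup_with_tree_topology H X B) \<Gamma>"
  shows "uniform_lattice_in (subgroup_with_cover H X L) (subgroup_with_cover_topology H X L) \<Gamma>'"
  using lattice_transfer.uniform_lattice_transfer[OF transfer] assms
  by (simp add: subgroup_with_cover_def subgroup_with_cover_topology_def subgroup_with_tree_def subgroup_with_tree_topology_def
      uniform_lattice_in_def lattice_in_def locally_compact_group_def)

text \<open>Every element of \<open>\<Gamma>\<close> has a lift with the same component in
  \<open>H\<close>, so the projection to \<open>H\<close> is unchanged as a set.\<close>

lemma fst_Gamma': "fst ` \<Gamma>' = fst ` \<Gamma>"
proof
  show "fst ` \<Gamma>' \<subseteq> fst ` \<Gamma>"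
  proof
    fix h assume "h \<in> fst ` \<Gamma>'"
    then obtain x where "x \<in> \<Gamma>'" "h = fst x" by (rule imageE)
    then have "(h, snd x) \<in> \<Gamma>'" by simp
    then obtain t where "(h, t) \<in> \<Gamma>" unfolding Gamma'_mem by (elim exE conjE)
    then show "h \<in> fst ` \<Gamma>" by (rule image_eqI[rotated]) simp
  qed
  show "fst ` \<Gamma> \<subseteq> fst ` \<Gamma>'"
  proof
    fix h assume "h \<in> fst ` \<Gamma>"
    then obtain x where "x \<in> \<Gamma>" "h = fst x" by (rule imageE)
    then obtain t where t: "(h, t) \<in> \<Gamma>" by (cases x) simp
    obtain b where b: "b \<in> AL" "\<phi> b = t (\<phi> \<one>\<^sub>L)" using phi_surj[of "t (\<phi> \<one>\<^sub>L)"] tauts_mem[of t "\<phi> \<one>\<^sub>L"] Gamma_mem[OF t] by auto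
    obtain f where "f \<in> cauts" "vlift t (act f)" using lift_through[OF t A.one_closed b(1) b(2)[symmetric]] by (elim exE conjE)
    then have "(h, f) \<in> \<Gamma>'" unfolding Gamma'_mem using t by (intro exI[of _ t]) simp
    then show "h \<in> fst ` \<Gamma>'" by (rule image_eqI[rotated]) simp
  qed
qed

text \<open>Non-discreteness is passed on in contrapositive form. A cylinder isolates the identity
  among the lifts, and by \<open>fixed_by_lift\<close> finitely many tree vertices control it: an
  element of the projection fixing them has a lift in the cylinder, so the lift and with it the
  element are trivial.\<close>

lemma tree_discrete:
  assumes d: "discrete_in (cover_aut_topology L) (snd ` \<Gamma>')" shows "discrete_in (tree_aut_topology B) (snd ` \<Gamma>)"
proof -
  interpret TG: top_group CA "cover_aut_topology L" by unfold_locales (rule PG.topological_group_TA)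
  interpret TA: group "tree_aut B" by (rule group_tree_aut)
  have one': "\<one>\<^bsub>CA\<^esub> \<in> snd ` \<Gamma>'"
    using subgroup.one_closed[OF subgroup_Gamma'] by (rule image_eqI[rotated]) simp
  obtain U where U: "openin (cover_aut_topology L) U" "U \<inter> snd ` \<Gamma>' = {\<one>\<^bsub>CA\<^esub>}"
    using TG.discrete_inD[OF d one'] .
  then obtain n where n: "PG.cyl \<one>\<^bsub>CA\<^esub> n \<subseteq> U" unfolding PG.openin_TA by blast
  have "\<exists>S. \<forall>v\<in>vball n. finite (S v) \<and> S v \<subseteq> FB \<and>
      (\<forall>a f. lpa a \<longrightarrow> vlift a f \<longrightarrow> f \<one>\<^sub>L = \<one>\<^sub>L \<longrightarrow> (\<forall>s\<in>S v. a s = s) \<longrightarrow> f v = v)"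
    by (rule bchoice, rule ballI, rule fixed_by_lift, erule subsetD[OF vball_AL])
  then obtain S where S: "\<forall>v\<in>vball n. finite (S v) \<and> S v \<subseteq> FB \<and>
      (\<forall>a f. lpa a \<longrightarrow> vlift a f \<longrightarrow> f \<one>\<^sub>L = \<one>\<^sub>L \<longrightarrow> (\<forall>s\<in>S v. a s = s) \<longrightarrow> f v = v)" ..
  \<comment> \<open>The base vertex of the tree is included so that an element fixing
    \<open>Q\<close> has a lift through the base vertex of the cover.\<close>
  define Q where "Q = insert \<one>\<^sub>F (\<Union>v\<in>vball n. S v)"
  have Q: "finite Q" "Q \<subseteq> FB" unfolding Q_def using S finite_vball by auto
  have rigid: "t = \<one>\<^bsub>tree_aut B\<^esub>" if t: "t \<in> snd ` \<Gamma>" "\<forall>s\<in>Q. t s = s" for t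
  proof -
    obtain x where "x \<in> \<Gamma>" "t = snd x" using t(1) by (rule imageE)
    then obtain h where h: "(h, t) \<in> \<Gamma>" by (cases x) simp
    obtain f where f: "f \<in> cauts" "vlift t (act f)" "act f \<one>\<^sub>L = \<one>\<^sub>L"
      using lift_through[OF h A.one_closed A.one_closed] t(2) by (auto simp: Q_def)
    have "act f v = v" if v: "v \<in> vball n" for v
    proof -
      have "\<forall>s\<in>S v. t s = s" using t(2) v by (auto simp: Q_def)
      then show ?thesis using S[THEN bspec, OF v] Gamma_lpa[OF h] f(2,3) by blast
    qed
    then have "f \<in> PG.cyl \<one>\<^bsub>CA\<^esub> n" using f(1) vball_AL by (simp add: PG.cyl_def CA_one act_one subset_iff)
    moreover have "(h, f) \<in> \<Gamma>'" unfolding Gamma'_mem using h f by (intro exI[of _ t]) simp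
    then have "f \<in> snd ` \<Gamma>'" by (rule image_eqI[rotated]) simp
    ultimately have "f = \<one>\<^bsub>CA\<^esub>" using n U(2) by blast
    then have "act f g = g" if "g \<in> AL" for g using that by (simp add: CA_one act_one)
    then have "vlift (\<lambda>x\<in>FB. x) (act f)"
      using vlift_cong[of "\<lambda>g. \<one>\<^sub>L \<cdot> g" "act f"] vlift_trans[of "\<one>\<^sub>L"] by (simp add: N_iff)
    then show ?thesis unfolding tree_aut_one
      using vlift_determines[of t "\<lambda>x\<in>FB. x" "act f"] f(2) Gamma_mem[OF h] lpa_tauts[OF lpa_id] by simp
  qed
  have subT: "subgroup (snd ` \<Gamma>) (tree_aut B)"
    using group_hom.img_is_subgroup[of "(subgroup_with_tree H X B)\<lparr>carrier := \<Gamma>\<rparr>" "tree_aut B" snd] rho_hom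
    by (simp add: group_hom_def group_hom_axioms_def G.group_axioms group_tree_aut)
  have sT: "snd ` \<Gamma> \<subseteq> tauts" using subgroup.subset[OF subT] by simp
  have "openin (subtopology (tree_aut_topology B) (snd ` \<Gamma>)) {t}" if t: "t \<in> snd ` \<Gamma>" for t
  proof -
    have tT: "t \<in> tauts" using t sT by blast
    define W where "W = (\<Inter>s\<in>Q. {t' \<in> tauts. t' s = t s})"
    have "openin (tree_aut_topology B) W" unfolding W_def
      using Q by (intro openin_Inter) (auto simp: Q_def intro!: open_tree_value)
    moreover have "t' = t" if t': "t' \<in> W" "t' \<in> snd ` \<Gamma>" for t'
    proof -
      have t'T: "t' \<in> tauts" using t'(2) sT by blast
      let ?i = "inv\<^bsub>tree_aut B\<^esub> t"
      have iT: "?i \<in> tauts" using TA.inv_closed[of t] tT by simp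
      have "?i \<otimes>\<^bsub>tree_aut B\<^esub> t' \<in> snd ` \<Gamma>" by (intro subgroup.m_closed[OF subT] subgroup.m_inv_closed[OF subT] t t'(2))
      moreover have "(?i \<otimes>\<^bsub>tree_aut B\<^esub> t') s = s" if s: "s \<in> Q" for s
      proof -
        have sF: "s \<in> FB" using s Q(2) by blast
        have "(?i \<otimes>\<^bsub>tree_aut B\<^esub> t') s = ?i (t s)" using t'(1) s sF iT t'T by (simp add: tree_aut_mult compose_eq W_def)
        also have "\<dots> = (?i \<otimes>\<^bsub>tree_aut B\<^esub> t) s" using sF iT tT by (simp add: tree_aut_mult compose_eq)
        also have "\<dots> = s" using TA.l_inv[of t] tT sF by (simp add: tree_aut_one)
        finally show ?thesis .
      qed
      ultimately have "?i \<otimes>\<^bsub>tree_aut B\<^esub> t' = \<one>\<^bsub>tree_aut B\<^esub>" using rigid by blast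
      then have "t \<otimes>\<^bsub>tree_aut B\<^esub> (?i \<otimes>\<^bsub>tree_aut B\<^esub> t') = t" using tT by simp
      then show ?thesis using tT t'T iT TA.m_assoc[of t ?i t', symmetric] by simp
    qed
    then have "W \<inter> snd ` \<Gamma> = {t}" using t tT by (auto simp: W_def)
    ultimately show ?thesis unfolding openin_subtopology by blast
  qed
  then have "discrete_topology (snd ` \<Gamma>) = subtopology (tree_aut_topology B) (snd ` \<Gamma>)"
    unfolding discrete_topology_unique using sT topspace_tree_aut by auto
  then show ?thesis unfolding discrete_in_def topspace_tree_aut using sT by simp
qed

end

theorem theorem7p4:
  fixes L :: "'v set set" and v :: "nat \<Rightarrow> 'v" and m k :: nat
    and X :: "'x metric" and H :: "('x \<Rightarrow> 'x) set"
  assumes inj: "inj_on v {1..m}"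
    and flag: "flag_complex (v ` {1..m}) L"
    and k: "k \<le> m"
    and free: "freely_generates L (v ` {1..k})"
    and cat0: "CAT0_space X" and proper: "proper_metric X"
    and tits: "finite_dim_tits_boundary X"
    and H: "subgroup H (isom_group X)"
    and cocompact: "acts_cocompactly H X" and minimal: "acts_minimally H X"
  defines "B \<equiv> v ` {1..k}"
  shows
    "(\<forall>(\<Gamma> :: 'g monoid) \<rho>. label_preserving_action B \<Gamma> \<rho> \<longrightarrow>
        group (lift_group L B \<Gamma> \<rho>) \<and>
        fst \<in> epi (lift_group L B \<Gamma> \<rho>) \<Gamma> \<and>
        kernel (lift_group L B \<Gamma> \<rho>) \<Gamma> fst = {\<one>\<^bsub>\<Gamma>\<^esub>} \<times> deck_group L B \<and>
        snd \<in> hom (lift_group L B \<Gamma> \<rho>) (isom_group (salvetti_cover L)) \<and>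
        admissible_on (snd ` carrier (lift_group L B \<Gamma> \<rho>)) (cover_cubes L) \<and>
        (\<forall>(\<gamma>, f)\<in>carrier (lift_group L B \<Gamma> \<rho>). \<forall>g\<in>carrier (raag L).
           \<exists>g'\<in>carrier (raag L). f (g, \<lambda>_. 0) = (g', \<lambda>_. 0) \<and>
             raag_to_free L B g' = \<rho> \<gamma> (raag_to_free L B g)))
     \<and>
     (\<forall>\<Gamma>. label_preserving_action B ((subgroup_with_tree H X B)\<lparr>carrier := \<Gamma>\<rparr>) snd \<longrightarrow>
        uniform_lattice_in (subgroup_with_tree H X B) (subgroup_with_tree_topology H X B) \<Gamma> \<longrightarrow>
        lift_group_map \<in> mon (lattice_lift_group H X L B \<Gamma>) (subgroup_with_cover H X L) \<and>
        uniform_lattice_in (subgroup_with_cover H X L) (subgroup_with_cover_topology H X L)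
          (lift_group_map ` carrier (lattice_lift_group H X L B \<Gamma>)))
     \<and>
     (\<forall>\<kappa> \<C> \<Gamma>. polyhedral_structure \<kappa> X \<C> \<longrightarrow> admissible_on H \<C> \<longrightarrow>
        label_preserving_action B ((subgroup_with_tree H X B)\<lparr>carrier := \<Gamma>\<rparr>) snd \<longrightarrow>
        lattice_in (subgroup_with_tree H X B) (subgroup_with_tree_topology H X B) \<Gamma> \<longrightarrow>
        lift_group_map \<in> mon (lattice_lift_group H X L B \<Gamma>) (subgroup_with_cover H X L) \<and>
        lattice_in (subgroup_with_cover H X L) (subgroup_with_cover_topology H X L)
          (lift_group_map ` carrier (lattice_lift_group H X L B \<Gamma>)))
     \<and>
     (\<forall>\<Gamma>. subgroup \<Gamma> (subgroup_with_tree H X B) \<longrightarrow>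
        label_preserving_action B ((subgroup_with_tree H X B)\<lparr>carrier := \<Gamma>\<rparr>) snd \<longrightarrow>
        (\<not> discrete_in (subtopology (isom_topology X) H) (fst ` \<Gamma>) \<longrightarrow>
         \<not> discrete_in (subtopology (isom_topology X) H)
             (fst ` lift_group_map ` carrier (lattice_lift_group H X L B \<Gamma>))) \<and>
        (\<not> discrete_in (tree_aut_topology B) (snd ` \<Gamma>) \<longrightarrow>
         \<not> discrete_in (cover_aut_topology L)
             (snd ` lift_group_map ` carrier (lattice_lift_group H X L B \<Gamma>))))"
proof -
  have "B \<subseteq> v ` {1..m}" "freely_generates L B" using k free by (auto simp: B_def)
  then interpret flag_free L "v ` {1..m}" B using flag by unfold_locales
  have ps: "product_subgroup L (v ` {1..m}) B X H \<Gamma>"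
    if "subgroup \<Gamma> (subgroup_with_tree H X B)" "label_preserving_action B ((subgroup_with_tree H X B)\<lparr>carrier := \<Gamma>\<rparr>) snd" for \<Gamma>
    by (intro product_subgroup.intro product_subgroup_axioms.intro flag_free_axioms H that)
  show ?thesis
  proof ((rule conjI[OF _ conjI[OF _ conjI]]; intro allI impI), goal_cases)
    case (1 \<Gamma> \<rho>)
    then interpret lift_action L "v ` {1..m}" B \<Gamma> \<rho> by unfold_locales
    show ?case by (rule lift_conclusions)
  next
    case (2 \<Gamma>)
    then have "subgroup \<Gamma> (subgroup_with_tree H X B)" by (simp add: uniform_lattice_in_def lattice_in_def)
    note ps = ps[OF this 2(1)]
    show ?case using product_subgroup.lift_group_map_mon[OF ps] product_subgroup.uniform_lattice_lift[OF ps 2(2)] ..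
  next
    case (3 \<kappa> \<C> \<Gamma>)
    then have "subgroup \<Gamma> (subgroup_with_tree H X B)" by (simp add: lattice_in_def)
    note ps = ps[OF this 3(3)]
    show ?case using product_subgroup.lift_group_map_mon[OF ps] product_subgroup.lattice_lift[OF ps 3(4)] ..
  next
    case (4 \<Gamma>)
    note ps = ps[OF this]
    \<comment> \<open>The two projections to \<open>H\<close> are the same set; on the tree side,
      discreteness among the lifts implies discreteness in the tree group.\<close>
    show ?case using product_subgroup.tree_discrete[OF ps] unfolding product_subgroup.fst_Gamma'[OF ps] by blast
  qed
qed

end
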